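(* Let $R$ be a commutative ring in which $2$ is invertible and $Q$ a finite quiver with double $\overline{Q}$. Then $(S\mathcal{N}_{\mathrm{gr}},\Delta^-_{\mathrm{gr}})$ and $(S\mathcal{N}_{\mathrm{gr}},\Delta^+_{\mathrm{gr}})$ are BV algebras (over $R$), where $\Delta^\pm_{\mathrm{gr}}=\mathrm{br}^\pm_{\mathrm{gr}}+\delta^\pm_{\mathrm{gr}}$.
   Context: The double $\overline{Q}$ of $Q=(s,t:Q_1\to Q_0)$ has the same vertices and arrows $Q_1\sqcup\{\overline{a}\mid a\in Q_1\}$, with $s(\overline{a})=t(a)$, $t(\overline{a})=s(a)$. For arrows $a,b$ of $\overline{Q}$, $\langle a,b\rangle_{\mathrm{gr}}=1$ if $a=\overline{b}$ or $b=\overline{a}$, and $0$ otherwise. Paths are words $a_1\cdots a_n$ of arrows with $t(a_k)=s(a_{k+1})$, together with constant paths $e_i$. $(R\overline{Q})_{\mathrm{gr}}$ is the path algebra with $\mathbb{Z}/2$-grading $|a|=0$, $|\overline{a}|=1$ for $a\in Q_1$, $|e_i|=0$. $\mathcal{N}_{\mathrm{gr}}$ is the quotient supermodule of $(R\overline{Q})_{\mathrm{gr}}$ by the span of graded commutators (so $a_1\cdots a_n=(-1)^{|a_1||a_2\cdots a_n|}a_2\cdots a_na_1$ for closed paths, and non-closed paths vanish). With cyclic indices (here $a_{i+1}\cdots a_{i-1}$ is the rotation of the word with $a_i$ removed, and $a_{i+1}\cdots a_{j-1}$ the cyclic subword strictly between positions $i$ and $j$), and zero on constant paths, define odd maps $\mathrm{br}^\pm_{\mathrm{gr}}:\mathcal{N}_{\mathrm{gr}}\otimes\mathcal{N}_{\mathrm{gr}}\to\mathcal{N}_{\mathrm{gr}}$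 and $\delta^\pm_{\mathrm{gr}}:\mathcal{N}_{\mathrm{gr}}\to\mathcal{N}_{\mathrm{gr}}\otimes\mathcal{N}_{\mathrm{gr}}$ by: $\mathrm{br}^-_{\mathrm{gr}}(a_1\cdots a_m\otimes b_1\cdots b_n)=\sum_{i,j}(-1)^{\varepsilon}\langle a_i,b_j\rangle_{\mathrm{gr}}e_{t(a_i)}a_{i+1}\cdots a_{i-1}b_{j+1}\cdots b_{j-1}$, $\varepsilon=|a_1\cdots a_{i-1}||a_i\cdots a_m|+|b_1\cdots b_{j-1}||b_j\cdots b_n|+|a_{i+1}\cdots a_{i-1}||b_j|$; $\delta^-_{\mathrm{gr}}(a_1\cdots a_n)=\frac12\sum_{i,j}(-1)^{\varepsilon}\langle a_i,a_j\rangle_{\mathrm{gr}}e_{t(a_i)}a_{i+1}\cdots a_{j-1}\otimes e_{t(a_j)}a_{j+1}\cdots a_{i-1}$, $\varepsilon=|a_1\cdots a_{i-1}||a_i\cdots a_n|+|a_{i+1}\cdots a_{j-1}||a_j|$; $\mathrm{br}^+_{\mathrm{gr}}(a_1\cdots a_m\otimes b_1\cdots b_n)=\sum_{i,j}(-1)^{\varepsilon}\langle a_i,b_j\rangle_{\mathrm{gr}}a_ia_{i+1}\cdots a_{i-1}a_ib_jb_{j+1}\cdots b_{j-1}b_j$, $\varepsilon=|a_1\cdots a_{i-1}||a_i\cdots a_m|+|b_1\cdots b_{j-1}||b_j\cdots b_n|+|a_{i+1}\cdots a_{i-1}|+|b_{j+1}\cdots b_{j-1}||b_j|$; $\delta^+_{\mathrm{gr}}(a_1\cdots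 a_n)=\frac12\sum_{i,j}(-1)^{\varepsilon}\langle a_i,a_j\rangle_{\mathrm{gr}}a_ia_{i+1}\cdots a_{j-1}a_j\otimes a_ja_{j+1}\cdots a_{i-1}a_i$, $\varepsilon=|a_1\cdots a_{i-1}||a_i\cdots a_n|+|a_{i+1}\cdots a_{j-1}|+|a_{j+1}\cdots a_{i-1}||a_i|+|a_j|$. These are well defined and symmetric ($\mathrm{br}\circ\sigma=\mathrm{br}$, $\sigma\circ\delta=\delta$ with $\sigma$ the Koszul symmetry). $S\mathcal{N}_{\mathrm{gr}}$ is the free supercommutative $R$-superalgebra on $\mathcal{N}_{\mathrm{gr}}$. In $\Delta^\pm_{\mathrm{gr}}=\mathrm{br}^\pm_{\mathrm{gr}}+\delta^\pm_{\mathrm{gr}}$, the bracket is extended to the unique odd differential operator of order $\le2$ on $S\mathcal{N}_{\mathrm{gr}}$ that vanishes on $S^{\le1}\mathcal{N}_{\mathrm{gr}}$ and sends $x\cdot y\in S^2$ to $\mathrm{br}^\pm_{\mathrm{gr}}(x\otimes y)$, and the cobracket, composed with $\mathcal{N}_{\mathrm{gr}}^{\otimes2}\to S^2\mathcal{N}_{\mathrm{gr}}$, is extended to an odd derivation. A BV algebra over $R$ is a supercommutative $R$-superalgebra with an odd differential operator $\Delta$ of order $\le2$ satisfying $\Delta^2=0$ and $\Delta(1)=0$. *)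

theory Defs
  imports
    "HOL-Algebra.QuotRing"
    "HOL-Algebra.Module"
    "HOL-Library.Poly_Mapping"
    "HOL-Library.Z2"
    "Graph_Theory.Arc_Walk"
begin

section \<open>Supermodules and superalgebras\<close>

text \<open>
  The ground ring is a type of sort \<open>{comm_ring, comm_monoid_mult}\<close>, i.e. a commutative ring
  with unit. Unlike \<open>comm_ring_1\<close> this sort does not demand \<open>0 \<noteq> 1\<close>, so that the zero ring is
  included; every \<open>comm_ring_1\<close> type belongs to it.
\<close>

definition scalars :: "'r :: {comm_ring, comm_monoid_mult} ring" where
  "scalars = \<lparr>carrier = UNIV, monoid.mult = (*), one = 1, zero = 0, add = (+)\<rparr>"

definition half :: "'r :: {comm_ring, comm_monoid_mult}" where
  "half = (THE h. (1 + 1) * h = 1)"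

text \<open>
  As for \<open>module\<close> in HOL-Algebra, the fields \<open>mult\<close> and \<open>one\<close> carry no meaning when the record is
  regarded as a mere supermodule. \<open>grade M p\<close> is the set of homogeneous elements of parity \<open>p\<close>
  (together with zero).
\<close>

record ('r, 'm) supermod = "('r, 'm) module" +
  grade :: "bit \<Rightarrow> 'm set"

definition ksgn :: "('m, 'b) ring_scheme \<Rightarrow> bit \<Rightarrow> 'm \<Rightarrow> 'm" where
  "ksgn M \<epsilon> x = (if \<epsilon> = 0 then x else \<ominus>\<^bsub>M\<^esub> x)"

locale supermodule =
  Module.module "scalars :: 'r ring" M
  for M :: "('r :: {comm_ring, comm_monoid_mult}, 'm) supermod" (structure) +
  assumes grade_submodule: "submodule (grade M p) scalars M"
    and grade_disjoint: "grade M 0 \<inter> grade M 1 = {\<zero>}"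
    and grade_sum: "carrier M = grade M 0 <+> grade M 1"

locale superalgebra = supermodule A + ring A
  for A :: "('r :: {comm_ring, comm_monoid_mult}, 'm) supermod" (structure) +
  assumes smult_mult_left:
      "\<lbrakk>x \<in> carrier A; y \<in> carrier A\<rbrakk> \<Longrightarrow> (r \<odot> x) \<otimes> y = r \<odot> (x \<otimes> y)"
    and smult_mult_right:
      "\<lbrakk>x \<in> carrier A; y \<in> carrier A\<rbrakk> \<Longrightarrow> x \<otimes> (r \<odot> y) = r \<odot> (x \<otimes> y)"
    and grade_one: "\<one> \<in> grade A 0"
    and grade_mult: "\<lbrakk>x \<in> grade A p; y \<in> grade A q\<rbrakk> \<Longrightarrow> x \<otimes> y \<in> grade A (p + q)"

locale supercommutative_superalgebra = superalgebra +
  assumes supercomm: "\<lbrakk>x \<in> grade A p; y \<in> grade A q\<rbrakk> \<Longrightarrow> x \<otimes> y = ksgn A (p * q) (y \<otimes> x)"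

definition linear_maps ::
    "('r, 'm) supermod \<Rightarrow> ('r, 'n) supermod \<Rightarrow> ('m \<Rightarrow> 'n) set" where
  "linear_maps M N =
    {f \<in> carrier M \<rightarrow> carrier N.
      (\<forall>x\<in>carrier M. \<forall>y\<in>carrier M. f (x \<oplus>\<^bsub>M\<^esub> y) = f x \<oplus>\<^bsub>N\<^esub> f y) \<and>
      (\<forall>r. \<forall>x\<in>carrier M. f (r \<odot>\<^bsub>M\<^esub> x) = r \<odot>\<^bsub>N\<^esub> f x)}"

definition hom_ends :: "('r, 'm) supermod \<Rightarrow> bit \<Rightarrow> ('m \<Rightarrow> 'm) set" where
  "hom_ends M d = {f \<in> linear_maps M M. \<forall>p. \<forall>x\<in>grade M p. f x \<in> grade M (d + p)}"

text \<open>
  Differential operators in the sense of Grothendieck: an operator \<open>D\<close> of parity \<open>d\<close> has order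
  \<open>\<le> 0\<close> if it supercommutes with all (left) multiplications, and order \<open>\<le> n + 1\<close> if its
  supercommutator with the multiplication by any homogeneous element has order \<open>\<le> n\<close>.
\<close>

definition mult_commutator ::
    "('r, 'm) supermod \<Rightarrow> bit \<Rightarrow> ('m \<Rightarrow> 'm) \<Rightarrow> bit \<Rightarrow> 'm \<Rightarrow> 'm \<Rightarrow> 'm" where
  "mult_commutator A d D e a = (\<lambda>x. D (a \<otimes>\<^bsub>A\<^esub> x) \<ominus>\<^bsub>A\<^esub> ksgn A (d * e) (a \<otimes>\<^bsub>A\<^esub> D x))"

primrec diff_op :: "('r, 'm) supermod \<Rightarrow> nat \<Rightarrow> bit \<Rightarrow> ('m \<Rightarrow> 'm) \<Rightarrow> bool" where
  "diff_op A 0 d D \<longleftrightarrow> D \<in> hom_ends A d \<and>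
    (\<forall>e. \<forall>a\<in>grade A e. \<forall>x\<in>carrier A. mult_commutator A d D e a x = \<zero>\<^bsub>A\<^esub>)"
| "diff_op A (Suc n) d D \<longleftrightarrow> D \<in> hom_ends A d \<and>
    (\<forall>e. \<forall>a\<in>grade A e. diff_op A n (d + e) (mult_commutator A d D e a))"

definition derivation :: "('r, 'm) supermod \<Rightarrow> bit \<Rightarrow> ('m \<Rightarrow> 'm) \<Rightarrow> bool" where
  "derivation A d D \<longleftrightarrow> D \<in> hom_ends A d \<and>
    (\<forall>p. \<forall>x\<in>grade A p. \<forall>y\<in>carrier A.
      D (x \<otimes>\<^bsub>A\<^esub> y) = D x \<otimes>\<^bsub>A\<^esub> y \<oplus>\<^bsub>A\<^esub> ksgn A (d * p) (x \<otimes>\<^bsub>A\<^esub> D y))"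

locale bv_algebra = supercommutative_superalgebra +
  fixes \<Delta>
  assumes Delta_diff_op: "diff_op A 2 1 \<Delta>"
    and Delta_square: "x \<in> carrier A \<Longrightarrow> \<Delta> (\<Delta> x) = \<zero>"
    and Delta_one: "\<Delta> \<one> = \<zero>"


section \<open>Quotients\<close>

definition mspan :: "('r :: {comm_ring, comm_monoid_mult}, 'm) supermod \<Rightarrow> 'm set \<Rightarrow> 'm set" where
  "mspan M X = \<Inter> {H. submodule H scalars M \<and> X \<subseteq> H}"

definition graded_commutators :: "('r, 'm) supermod \<Rightarrow> 'm set" where
  "graded_commutators A =
    {x \<otimes>\<^bsub>A\<^esub> y \<ominus>\<^bsub>A\<^esub> ksgn A (p * q) (y \<otimes>\<^bsub>A\<^esub> x) | x y p q. x \<in> grade A p \<and> y \<in> grade A q}"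

text \<open>
  The quotient by a submodule \<open>H\<close>, realised on cosets. The product and the unit are meaningful
  only if \<open>H\<close> is a two-sided ideal of a superalgebra.
\<close>

definition quot :: "('r, 'm) supermod \<Rightarrow> 'm set \<Rightarrow> ('r, 'm set) supermod" where
  "quot M H =
    \<lparr>carrier = carrier (M Quot H),
     monoid.mult = monoid.mult (M Quot H),
     one = one (M Quot H),
     zero = zero (M Quot H),
     add = add (M Quot H),
     smult = (\<lambda>r X. H <+>\<^bsub>M\<^esub> (smult M r ` X)),
     grade = (\<lambda>p. (\<lambda>x. H +>\<^bsub>M\<^esub> x) ` grade M p)\<rparr>"


section \<open>Tensor algebra and free supercommutative superalgebra of a supermodule\<close>

text \<open>Lists under concatenation, so that \<open>'m list \<Rightarrow>\<^sub>0 'r\<close> is the free associative algebra.\<close>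

instantiation list :: (type) monoid_add
begin

definition zero_list :: "'a list" where "zero_list = []"
definition plus_list :: "'a list \<Rightarrow> 'a list \<Rightarrow> 'a list" where "plus_list = (@)"

instance by standard (simp_all add: zero_list_def plus_list_def)

end

text \<open>
  The free associative algebra on the set of elements of \<open>M\<close>. Only the image of \<open>grade\<close> in the
  tensor algebra is a grading: a letter that is not homogeneous becomes a sum of homogeneous
  elements after imposing linearity.
\<close>

definition free_alg :: "('r :: {comm_ring, comm_monoid_mult}, 'm) supermod
    \<Rightarrow> ('r, 'm list \<Rightarrow>\<^sub>0 'r) supermod" where
  "free_alg M =
    \<lparr>carrier = {f. Poly_Mapping.keys f \<subseteq> lists (carrier M)},
     monoid.mult = (*),
     one = Poly_Mapping.single [] 1,
     zero = 0,
     add = (+),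
     smult = (\<lambda>r. Poly_Mapping.map ((*) r)),
     grade = (\<lambda>p. {f. Poly_Mapping.keys f \<subseteq>
       {w. \<exists>ps. list_all2 (\<lambda>x q. x \<in> grade M q) w ps \<and> sum_list ps = p}})\<rparr>"

definition linearity_ideal ::
    "('r :: {comm_ring, comm_monoid_mult}, 'm) supermod \<Rightarrow> ('m list \<Rightarrow>\<^sub>0 'r) set" where
  "linearity_ideal M = Idl\<^bsub>free_alg M\<^esub>
    ({Poly_Mapping.single [x \<oplus>\<^bsub>M\<^esub> y] 1 - Poly_Mapping.single [x] 1 - Poly_Mapping.single [y] 1
        | x y. x \<in> carrier M \<and> y \<in> carrier M} \<union>
     {Poly_Mapping.single [r \<odot>\<^bsub>M\<^esub> x] 1 - Poly_Mapping.single [x] r | r x. x \<in> carrier M})"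

type_synonym ('r, 'm) tens = "('m list \<Rightarrow>\<^sub>0 'r) set"
type_synonym ('r, 'm) symm = "('r, 'm) tens set"

definition tensor_alg :: "('r :: {comm_ring, comm_monoid_mult}, 'm) supermod
    \<Rightarrow> ('r, ('r, 'm) tens) supermod" where
  "tensor_alg M = quot (free_alg M) (linearity_ideal M)"

definition tensor_class :: "('r :: {comm_ring, comm_monoid_mult}, 'm) supermod
    \<Rightarrow> ('m list \<Rightarrow>\<^sub>0 'r) \<Rightarrow> ('r, 'm) tens" where
  "tensor_class M f = linearity_ideal M +>\<^bsub>free_alg M\<^esub> f"

definition tensor_gen :: "('r :: {comm_ring, comm_monoid_mult}, 'm) supermod
    \<Rightarrow> 'm \<Rightarrow> ('r, 'm) tens" where
  "tensor_gen M x = tensor_class M (Poly_Mapping.single [x] 1)"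

text \<open>\<open>M \<otimes> M\<close>, as the part of tensor degree 2 of the tensor algebra.\<close>

definition tensor_square :: "('r :: {comm_ring, comm_monoid_mult}, 'm) supermod
    \<Rightarrow> ('r, ('r, 'm) tens) supermod" where
  "tensor_square M =
    (let T2 = tensor_class M `
          {f. Poly_Mapping.keys f \<subseteq> {w \<in> lists (carrier M). length w = 2}}
     in (tensor_alg M)\<lparr>carrier := T2, grade := (\<lambda>p. T2 \<inter> grade (tensor_alg M) p)\<rparr>)"

definition supercomm_ideal :: "('r :: {comm_ring, comm_monoid_mult}, 'm) supermod
    \<Rightarrow> ('r, 'm) tens set" where
  "supercomm_ideal M = Idl\<^bsub>tensor_alg M\<^esub> (graded_commutators (tensor_alg M))"

definition sym_alg :: "('r :: {comm_ring, comm_monoid_mult}, 'm) supermod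
    \<Rightarrow> ('r, ('r, 'm) symm) supermod" where
  "sym_alg M = quot (tensor_alg M) (supercomm_ideal M)"

definition sym_class :: "('r :: {comm_ring, comm_monoid_mult}, 'm) supermod
    \<Rightarrow> ('r, 'm) tens \<Rightarrow> ('r, 'm) symm" where
  "sym_class M t = supercomm_ideal M +>\<^bsub>tensor_alg M\<^esub> t"

definition sym_gen :: "('r :: {comm_ring, comm_monoid_mult}, 'm) supermod
    \<Rightarrow> 'm \<Rightarrow> ('r, 'm) symm" where
  "sym_gen M x = sym_class M (tensor_gen M x)"

definition sym_upto :: "('r :: {comm_ring, comm_monoid_mult}, 'm) supermod
    \<Rightarrow> nat \<Rightarrow> ('r, 'm) symm set" where
  "sym_upto M k = (\<lambda>f. sym_class M (tensor_class M f)) `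
    {f. Poly_Mapping.keys f \<subseteq> {w \<in> lists (carrier M). length w \<le> k}}"

text \<open>
  Extension of a bracket \<open>b\<close> and of a cobracket \<open>c\<close> on \<open>M\<close> to odd operators on \<open>sym_alg M\<close>.
  Operators are normalised to be \<open>undefined\<close> outside the carrier, as otherwise they would not be
  unique.
\<close>

definition extend_bracket :: "('r :: {comm_ring, comm_monoid_mult}, 'm) supermod
    \<Rightarrow> ('m \<times> 'm \<Rightarrow> 'm) \<Rightarrow> ('r, 'm) symm \<Rightarrow> ('r, 'm) symm" where
  "extend_bracket M b = (THE D. D \<in> extensional (carrier (sym_alg M)) \<and>
     diff_op (sym_alg M) 2 1 D \<and>
     (\<forall>z\<in>sym_upto M 1. D z = \<zero>\<^bsub>sym_alg M\<^esub>) \<and>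
     (\<forall>x\<in>carrier M. \<forall>y\<in>carrier M.
        D (sym_gen M x \<otimes>\<^bsub>sym_alg M\<^esub> sym_gen M y) = sym_gen M (b (x, y))))"

definition extend_cobracket :: "('r :: {comm_ring, comm_monoid_mult}, 'm) supermod
    \<Rightarrow> ('m \<Rightarrow> ('r, 'm) tens) \<Rightarrow> ('r, 'm) symm \<Rightarrow> ('r, 'm) symm" where
  "extend_cobracket M c = (THE D. D \<in> extensional (carrier (sym_alg M)) \<and>
     derivation (sym_alg M) 1 D \<and>
     (\<forall>x\<in>carrier M. D (sym_gen M x) = sym_class M (c x)))"


section \<open>The graded path algebra of the double and its cyclic quotient\<close>

text \<open>
  A quiver is a \<open>pre_digraph\<close> with \<open>tail\<close> and \<open>head\<close> as source and target maps; \<open>fin_digraph\<close>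
  allows loops and multiple arrows.
\<close>

datatype 'e darrow = Orig 'e | Bar 'e

primrec parity :: "'e darrow \<Rightarrow> bit" where
  "parity (Orig a) = 0"
| "parity (Bar a) = 1"

definition double :: "('v, 'e) pre_digraph \<Rightarrow> ('v, 'e darrow) pre_digraph" where
  "double Q =
    \<lparr>verts = verts Q,
     arcs = Orig ` arcs Q \<union> Bar ` arcs Q,
     tail = (\<lambda>x. case x of Orig a \<Rightarrow> tail Q a | Bar a \<Rightarrow> head Q a),
     head = (\<lambda>x. case x of Orig a \<Rightarrow> head Q a | Bar a \<Rightarrow> tail Q a)\<rparr>"

definition paired :: "'e darrow \<Rightarrow> 'e darrow \<Rightarrow> bool" where
  "paired x y \<longleftrightarrow> (\<exists>a. (x = Orig a \<and> y = Bar a) \<or> (x = Bar a \<and> y = Orig a))"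

definition wpar :: "'e darrow list \<Rightarrow> bit" where
  "wpar w = sum_list (map parity w)"

text \<open>
  A path is a pair of its starting vertex and its word of arrows; \<open>(i, [])\<close> is the constant path
  \<open>e\<^sub>i\<close>.
\<close>

type_synonym ('v, 'e) qpath = "'v \<times> 'e darrow list"

definition paths :: "('v, 'e) pre_digraph \<Rightarrow> ('v, 'e) qpath set" where
  "paths Q = {(u, w). \<exists>v. pre_digraph.awalk (double Q) u w v}"

definition closed_paths :: "('v, 'e) pre_digraph \<Rightarrow> ('v, 'e) qpath set" where
  "closed_paths Q = {(u, w). pre_digraph.awalk (double Q) u w u}"

definition path_mult :: "('v, 'e) pre_digraph
    \<Rightarrow> (('v, 'e) qpath \<Rightarrow>\<^sub>0 'r :: {comm_ring, comm_monoid_mult})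
    \<Rightarrow> (('v, 'e) qpath \<Rightarrow>\<^sub>0 'r) \<Rightarrow> (('v, 'e) qpath \<Rightarrow>\<^sub>0 'r)" where
  "path_mult Q f g =
    (\<Sum>(u, p)\<in>Poly_Mapping.keys f. \<Sum>(v, q)\<in>Poly_Mapping.keys g.
       if pre_digraph.awlast (double Q) u p = v
       then Poly_Mapping.single (u, p @ q)
              (Poly_Mapping.lookup f (u, p) * Poly_Mapping.lookup g (v, q))
       else 0)"

definition path_alg :: "('v, 'e) pre_digraph
    \<Rightarrow> ('r :: {comm_ring, comm_monoid_mult}, ('v, 'e) qpath \<Rightarrow>\<^sub>0 'r) supermod" where
  "path_alg Q =
    \<lparr>carrier = {f. Poly_Mapping.keys f \<subseteq> paths Q},
     monoid.mult = path_mult Q,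
     one = (\<Sum>i\<in>verts Q. Poly_Mapping.single (i, []) 1),
     zero = 0,
     add = (+),
     smult = (\<lambda>r. Poly_Mapping.map ((*) r)),
     grade = (\<lambda>p. {f. Poly_Mapping.keys f \<subseteq> {x \<in> paths Q. wpar (snd x) = p}})\<rparr>"

type_synonym ('r, 'v, 'e) cyc = "(('v, 'e) qpath \<Rightarrow>\<^sub>0 'r) set"

definition N_gr :: "('v, 'e) pre_digraph
    \<Rightarrow> ('r :: {comm_ring, comm_monoid_mult}, ('r, 'v, 'e) cyc) supermod" where
  "N_gr Q = quot (path_alg Q) (mspan (path_alg Q) (graded_commutators (path_alg Q)))"

definition cyc_class :: "('v, 'e) pre_digraph \<Rightarrow> ('v, 'e) qpath
    \<Rightarrow> ('r :: {comm_ring, comm_monoid_mult}, 'v, 'e) cyc" where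
  "cyc_class Q x =
    mspan (path_alg Q) (graded_commutators (path_alg Q)) +>\<^bsub>path_alg Q\<^esub> Poly_Mapping.single x 1"


section \<open>Brackets and cobrackets\<close>

text \<open>
  \<open>cyc_sub w i j\<close> is the cyclic subword strictly between the positions \<open>i\<close> and \<open>j\<close>, with
  positions counted from 0; \<open>cyc_sub w i i\<close> is the rotation of \<open>w\<close> starting after \<open>i\<close>, with
  position \<open>i\<close> removed.
\<close>

definition cyc_sub :: "'x list \<Rightarrow> nat \<Rightarrow> nat \<Rightarrow> 'x list" where
  "cyc_sub w i j = (if i < j then drop (Suc i) (take j w) else drop (Suc i) w @ take j w)"

definition br_minus_path :: "('v, 'e) pre_digraph \<Rightarrow> ('v, 'e) qpath \<Rightarrow> ('v, 'e) qpath
    \<Rightarrow> ('r :: {comm_ring, comm_monoid_mult}, 'v, 'e) cyc" where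
  "br_minus_path Q x y = (let a = snd x; b = snd y in
     \<Oplus>\<^bsub>N_gr Q\<^esub>i\<in>{..<length a}. \<Oplus>\<^bsub>N_gr Q\<^esub>j\<in>{..<length b}.
       if paired (a ! i) (b ! j)
       then ksgn (N_gr Q)
         (wpar (take i a) * wpar (drop i a) + wpar (take j b) * wpar (drop j b)
            + wpar (cyc_sub a i i) * parity (b ! j))
         (cyc_class Q (head (double Q) (a ! i), cyc_sub a i i @ cyc_sub b j j))
       else \<zero>\<^bsub>N_gr Q\<^esub>)"

definition br_plus_path :: "('v, 'e) pre_digraph \<Rightarrow> ('v, 'e) qpath \<Rightarrow> ('v, 'e) qpath
    \<Rightarrow> ('r :: {comm_ring, comm_monoid_mult}, 'v, 'e) cyc" where
  "br_plus_path Q x y = (let a = snd x; b = snd y in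
     \<Oplus>\<^bsub>N_gr Q\<^esub>i\<in>{..<length a}. \<Oplus>\<^bsub>N_gr Q\<^esub>j\<in>{..<length b}.
       if paired (a ! i) (b ! j)
       then ksgn (N_gr Q)
         (wpar (take i a) * wpar (drop i a) + wpar (take j b) * wpar (drop j b)
            + wpar (cyc_sub a i i) + wpar (cyc_sub b j j) * parity (b ! j))
         (cyc_class Q (tail (double Q) (a ! i),
            [a ! i] @ cyc_sub a i i @ [a ! i] @ [b ! j] @ cyc_sub b j j @ [b ! j]))
       else \<zero>\<^bsub>N_gr Q\<^esub>)"

definition delta_minus_path :: "('v, 'e) pre_digraph \<Rightarrow> ('v, 'e) qpath
    \<Rightarrow> ('r :: {comm_ring, comm_monoid_mult}, ('r, 'v, 'e) cyc) tens" where
  "delta_minus_path Q x = (let a = snd x; T = tensor_alg (N_gr Q) in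
     half \<odot>\<^bsub>T\<^esub> (\<Oplus>\<^bsub>T\<^esub>i\<in>{..<length a}. \<Oplus>\<^bsub>T\<^esub>j\<in>{..<length a}.
       if paired (a ! i) (a ! j)
       then ksgn T
         (wpar (take i a) * wpar (drop i a) + wpar (cyc_sub a i j) * parity (a ! j))
         (tensor_gen (N_gr Q) (cyc_class Q (head (double Q) (a ! i), cyc_sub a i j))
            \<otimes>\<^bsub>T\<^esub> tensor_gen (N_gr Q) (cyc_class Q (head (double Q) (a ! j), cyc_sub a j i)))
       else \<zero>\<^bsub>T\<^esub>))"

definition delta_plus_path :: "('v, 'e) pre_digraph \<Rightarrow> ('v, 'e) qpath
    \<Rightarrow> ('r :: {comm_ring, comm_monoid_mult}, ('r, 'v, 'e) cyc) tens" where
  "delta_plus_path Q x = (let a = snd x; T = tensor_alg (N_gr Q) in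
     half \<odot>\<^bsub>T\<^esub> (\<Oplus>\<^bsub>T\<^esub>i\<in>{..<length a}. \<Oplus>\<^bsub>T\<^esub>j\<in>{..<length a}.
       if paired (a ! i) (a ! j)
       then ksgn T
         (wpar (take i a) * wpar (drop i a) + wpar (cyc_sub a i j)
            + wpar (cyc_sub a j i) * parity (a ! i) + parity (a ! j))
         (tensor_gen (N_gr Q)
              (cyc_class Q (tail (double Q) (a ! i), [a ! i] @ cyc_sub a i j @ [a ! j]))
            \<otimes>\<^bsub>T\<^esub> tensor_gen (N_gr Q)
              (cyc_class Q (tail (double Q) (a ! j), [a ! j] @ cyc_sub a j i @ [a ! i])))
       else \<zero>\<^bsub>T\<^esub>))"

text \<open>
  The maps on \<open>N_gr Q\<close> with prescribed values on the classes of closed paths, which span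
  \<open>N_gr Q\<close>. A bracket, as a linear map on \<open>N_gr Q \<otimes> N_gr Q\<close>, is given as a bilinear map.
\<close>

definition bracket_of :: "('v, 'e) pre_digraph
    \<Rightarrow> (('v, 'e) qpath \<Rightarrow> ('v, 'e) qpath \<Rightarrow> ('r :: {comm_ring, comm_monoid_mult}, 'v, 'e) cyc)
    \<Rightarrow> ('r, 'v, 'e) cyc \<times> ('r, 'v, 'e) cyc \<Rightarrow> ('r, 'v, 'e) cyc" where
  "bracket_of Q \<phi> = (THE b. b \<in> extensional (carrier (N_gr Q) \<times> carrier (N_gr Q)) \<and>
     (\<forall>x\<in>carrier (N_gr Q). (\<lambda>y. b (x, y)) \<in> linear_maps (N_gr Q) (N_gr Q)) \<and>
     (\<forall>y\<in>carrier (N_gr Q). (\<lambda>x. b (x, y)) \<in> linear_maps (N_gr Q) (N_gr Q)) \<and>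
     (\<forall>x\<in>closed_paths Q. \<forall>y\<in>closed_paths Q. b (cyc_class Q x, cyc_class Q y) = \<phi> x y))"

definition cobracket_of :: "('v, 'e) pre_digraph
    \<Rightarrow> (('v, 'e) qpath
          \<Rightarrow> ('r :: {comm_ring, comm_monoid_mult}, ('r, 'v, 'e) cyc) tens)
    \<Rightarrow> ('r, 'v, 'e) cyc \<Rightarrow> ('r, ('r, 'v, 'e) cyc) tens" where
  "cobracket_of Q \<phi> = (THE c. c \<in> extensional (carrier (N_gr Q)) \<and>
     c \<in> linear_maps (N_gr Q) (tensor_square (N_gr Q)) \<and>
     (\<forall>x\<in>closed_paths Q. c (cyc_class Q x) = \<phi> x))"

definition br_minus where "br_minus Q = bracket_of Q (br_minus_path Q)"
definition br_plus where "br_plus Q = bracket_of Q (br_plus_path Q)"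
definition delta_minus where "delta_minus Q = cobracket_of Q (delta_minus_path Q)"
definition delta_plus where "delta_plus Q = cobracket_of Q (delta_plus_path Q)"

type_synonym ('r, 'v, 'e) scyc = "('r, ('r, 'v, 'e) cyc) symm"

definition SN_gr :: "('v, 'e) pre_digraph
    \<Rightarrow> ('r :: {comm_ring, comm_monoid_mult}, ('r, 'v, 'e) scyc) supermod" where
  "SN_gr Q = sym_alg (N_gr Q)"

definition Delta_minus :: "('v, 'e) pre_digraph
    \<Rightarrow> ('r :: {comm_ring, comm_monoid_mult}, 'v, 'e) scyc \<Rightarrow> ('r, 'v, 'e) scyc" where
  "Delta_minus Q z =
    extend_bracket (N_gr Q) (br_minus Q) z \<oplus>\<^bsub>SN_gr Q\<^esub> extend_cobracket (N_gr Q) (delta_minus Q) z"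

definition Delta_plus :: "('v, 'e) pre_digraph
    \<Rightarrow> ('r :: {comm_ring, comm_monoid_mult}, 'v, 'e) scyc \<Rightarrow> ('r, 'v, 'e) scyc" where
  "Delta_plus Q z =
    extend_bracket (N_gr Q) (br_plus Q) z \<oplus>\<^bsub>SN_gr Q\<^esub> extend_cobracket (N_gr Q) (delta_plus Q) z"

end

theory Submission
  imports Defs "HOL-Library.Multiset"
begin

text \<open>
  The operator contracts pairs of dual letters in a product of cyclic words, the two letters lying in
  different words (bracket) or in the same word (cobracket). Both cases become one when the words are
  cut open: a list of strings, i.e. walks with labelled ends, is evaluated by gluing equal labels, and
  the operator applied to the resulting product is the signed sum of contractions over all pairs of
  letters of the strings. Cutting at every letter, one may assume that all strings have length at most
  one, so that only pairs of different strings are contracted. The square of the operator is then, up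
  to a factor 4, a signed sum over two disjoint pairs of strings, which changes sign when the two pairs
  are exchanged, since each contraction is odd. For the sign \<open>+\<close> there are in addition terms in which
  the second contraction involves a letter inserted by the first one; they cancel in pairs because the
  two strings that are contracted with the same letter can be exchanged. Finally 2 is invertible.
\<close>

section \<open>Signs\<close>

text \<open>Expanded on closed words, the vanishing of the square splits into separate identities
  (Jacobi, co-Jacobi, compatibility, involutivity), each with its own cases of coinciding words.
  Strings treat all of them at once. What permits cutting is that the combinatorial operator
  \<open>D\<close> respects both relations satisfied by \<open>E\<close>: transposing neighbours
  costs the Koszul sign, and gluing neighbours changes nothing (\<open>D_transpose\<close>,
  \<open>D_merge\<close>). Gluing turns a contraction between two strings into one inside a single
  string, so bracket and cobracket must carry matching signs; this ties \<open>eps\<close> to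
  \<open>eps'\<close>. \<open>Delta_E\<close> identifies \<open>D\<close> with the operator by
  comparing two recursions.

  Much of the remaining work shows that the objects exist. Brackets, cobrackets and their extensions
  are definite descriptions, so each requires existence and uniqueness. The quotients must be shown
  to be graded: an element of both parity parts is equal to its negative under the parity
  involution, which is a second use of the invertibility of 2.\<close>

lemma bit_add_same [simp]: "(a :: bit) + a = 0"
  by (cases a) simp_all

lemma bit_add_cancel [simp]: "(a :: bit) + (a + b) = b"
  by (cases a; cases b) simp_all

lemma bit_mult_same [simp]: "(a :: bit) * a = a"
  by (cases a) simp_all

lemma bit_mult_cancel [simp]: "(a :: bit) * (a * b) = a * b"
  by (cases a; cases b) simp_all

text \<open>Sign exponents live in \<open>bit\<close>, the field with two elements. With xor and
  conjunction kept out of the simpset, exponents remain polynomials over this field, and the rules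
  above together with commutativity and distributivity decide the sign identities below.\<close>

declare add_bit_eq_xor [simp del] mult_bit_eq_and [simp del]

lemma wpar_simps [simp]:
  "wpar [] = 0" "wpar (x # u) = parity x + wpar u" "wpar (u @ v) = wpar u + wpar v"
  by (simp_all add: wpar_def)

section \<open>Modules over the ground ring\<close>

lemma scalars_simps [simp]:
  "carrier scalars = UNIV" "monoid.mult scalars = (*)" "one scalars = 1"
  "zero scalars = 0" "add scalars = (+)"
  by (simp_all add: scalars_def)

lemma cring_scalars: "cring (scalars :: 'r :: {comm_ring, comm_monoid_mult} ring)"
proof (rule cringI)
  show "abelian_group (scalars :: 'r ring)"
  proof (rule abelian_groupI)
    show "\<exists>y\<in>carrier scalars. y \<oplus>\<^bsub>scalars\<^esub> x = \<zero>\<^bsub>scalars\<^esub>" for x :: 'r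
      by (rule bexI[of _ "- x"]) simp_all
  qed (simp_all add: add_ac)
  show "Group.comm_monoid (scalars :: 'r ring)"
    by (rule comm_monoidI) (simp_all add: mult_ac)
qed (simp add: distrib_right)

text \<open>Modules without a grading. The free algebra on the elements of a supermodule is in
  general not graded, since its inhomogeneous letters become sums of homogeneous ones only in the
  quotient; and quotients have to be modules before their grading can be discussed.\<close>

locale smod = Module.module "scalars :: 'r ring" M
  for M :: "('r :: {comm_ring, comm_monoid_mult}, 'm) supermod" (structure)
begin

lemma sm_closed [simp]: "x \<in> carrier M \<Longrightarrow> r \<odot> x \<in> carrier M"
  using smult_closed by simp

lemma sm_ladd: "x \<in> carrier M \<Longrightarrow> (r + s) \<odot> x = r \<odot> x \<oplus> s \<odot> x"
  using smult_l_distr[of r s x] by simp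

lemma sm_radd: "\<lbrakk>x \<in> carrier M; y \<in> carrier M\<rbrakk> \<Longrightarrow> r \<odot> (x \<oplus> y) = r \<odot> x \<oplus> r \<odot> y"
  using smult_r_distr[of r x y] by simp

lemma sm_assoc: "x \<in> carrier M \<Longrightarrow> (r * s) \<odot> x = r \<odot> (s \<odot> x)"
  using smult_assoc1[of r s x] by simp

lemma sm_one [simp]: "x \<in> carrier M \<Longrightarrow> 1 \<odot> x = x"
  using smult_one by simp

lemma sm_zero [simp]: "r \<odot> \<zero> = \<zero>"
  using smult_r_null by simp

lemma sm_lzero [simp]: "x \<in> carrier M \<Longrightarrow> 0 \<odot> x = \<zero>"
  using smult_l_null by simp

lemma sm_minus: "x \<in> carrier M \<Longrightarrow> r \<odot> (\<ominus> x) = \<ominus> (r \<odot> x)"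
  using smult_r_minus by simp

lemma sm_lminus: "x \<in> carrier M \<Longrightarrow> (- r) \<odot> x = \<ominus> (r \<odot> x)"
proof -
  assume x: "x \<in> carrier M"
  have "(- r) \<odot> x \<oplus> r \<odot> x = \<zero>" using sm_ladd[OF x, of "- r" r] x by simp
  with x show ?thesis by (simp add: minus_equality[symmetric])
qed

lemma minus_zero [simp]: "\<ominus> \<zero> = \<zero>"
  by (rule minus_equality) simp_all

lemma minus_zero' [simp]: "x \<in> carrier M \<Longrightarrow> x \<ominus> \<zero> = x"
  by (simp add: a_minus_def)

lemma minus_eq_zero_iff:
  assumes "x \<in> carrier M" "y \<in> carrier M"
  shows "x \<ominus> y = \<zero> \<longleftrightarrow> x = y"
proof
  assume "x \<ominus> y = \<zero>"
  then have "\<ominus> (\<ominus> y) = x" using assms by (intro minus_equality) (simp_all add: a_minus_def)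
  then show "x = y" using assms by simp
qed (use assms in \<open>simp add: a_minus_def r_neg\<close>)

lemma sg_closed [simp]: "x \<in> carrier M \<Longrightarrow> ksgn M e x \<in> carrier M"
  by (simp add: ksgn_def)

lemma sg_0 [simp]: "ksgn M 0 x = x"
  by (simp add: ksgn_def)

lemma sg_1: "ksgn M 1 x = \<ominus> x"
  by (simp add: ksgn_def)

lemma sg_zero [simp]: "ksgn M e \<zero> = \<zero>"
  by (simp add: ksgn_def)

lemma sg_add: "\<lbrakk>x \<in> carrier M; y \<in> carrier M\<rbrakk> \<Longrightarrow> ksgn M e (x \<oplus> y) = ksgn M e x \<oplus> ksgn M e y"
  by (simp add: ksgn_def minus_add)

lemma sg_sg: "x \<in> carrier M \<Longrightarrow> ksgn M d (ksgn M e x) = ksgn M (d + e) x"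
  by (cases d; cases e) (simp_all add: ksgn_def)

lemma sg_smult: "x \<in> carrier M \<Longrightarrow> ksgn M e (r \<odot> x) = r \<odot> ksgn M e x"
  by (simp add: ksgn_def sm_minus)

lemma sg_inv: "x \<in> carrier M \<Longrightarrow> ksgn M e (\<ominus> x) = \<ominus> (ksgn M e x)"
  by (simp add: ksgn_def)

text \<open>Apart from the factor in the cobracket, every use of the invertibility of 2 passes
  through this cancellation.\<close>

lemma double_eq_zero:
  assumes "(1 + 1 :: 'r) dvd 1" "x \<in> carrier M" "x \<oplus> x = \<zero>"
  shows "x = \<zero>"
proof -
  obtain h where h: "(1 :: 'r) = (1 + 1) * h" using assms(1) by (elim dvdE)
  have "x = 1 \<odot> x" using assms by simp
  also have "\<dots> = h \<odot> ((1 + 1) \<odot> x)"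
    by (subst h) (simp add: sm_assoc[symmetric] mult.commute assms)
  also have "(1 + 1) \<odot> x = \<zero>" using assms by (simp add: sm_ladd)
  finally show ?thesis by simp
qed

lemma submodI:
  assumes "H \<subseteq> carrier M" "\<zero> \<in> H" "\<And>a b. \<lbrakk>a \<in> H; b \<in> H\<rbrakk> \<Longrightarrow> a \<oplus> b \<in> H"
    and "\<And>r x. x \<in> H \<Longrightarrow> r \<odot> x \<in> H"
  shows "submodule H scalars M"
proof (rule submoduleI)
  fix a assume a: "a \<in> H"
  have "(- 1) \<odot> a \<in> H" using a assms by blast
  with a assms show "\<ominus> a \<in> H" by (auto simp: sm_lminus subset_iff)
qed (use assms in auto)

lemma submodD:
  assumes "submodule H scalars M"
  shows "H \<subseteq> carrier M" "\<zero> \<in> H" "\<And>a b. \<lbrakk>a \<in> H; b \<in> H\<rbrakk> \<Longrightarrow> a \<oplus> b \<in> H"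
    and "\<And>r x. x \<in> H \<Longrightarrow> r \<odot> x \<in> H" "\<And>x. x \<in> H \<Longrightarrow> \<ominus> x \<in> H"
    "\<And>a b. \<lbrakk>a \<in> H; b \<in> H\<rbrakk> \<Longrightarrow> a \<ominus> b \<in> H" "\<And>e x. x \<in> H \<Longrightarrow> ksgn M e x \<in> H"
  using submoduleE[OF assms] subgroup.one_closed[OF submodule.axioms(1)[OF assms]]
  by (auto simp: a_minus_def ksgn_def)

lemma mspan_submodule:
  assumes "X \<subseteq> carrier M" shows "submodule (mspan M X) scalars M"
proof (rule submodI)
  have "submodule (carrier M) scalars M" by (rule submodI) auto
  then show "mspan M X \<subseteq> carrier M" using assms by (auto simp: mspan_def)
qed (auto simp: mspan_def dest: submodD)

lemma mspan_incl: "X \<subseteq> mspan M X"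
  by (auto simp: mspan_def)

lemma mspan_minimal: "\<lbrakk>submodule H scalars M; X \<subseteq> H\<rbrakk> \<Longrightarrow> mspan M X \<subseteq> H"
  by (auto simp: mspan_def)

end

section \<open>Linear maps\<close>

lemma linear_mapsD:
  assumes "f \<in> linear_maps M N"
  shows "\<And>x. x \<in> carrier M \<Longrightarrow> f x \<in> carrier N"
    "\<And>x y. \<lbrakk>x \<in> carrier M; y \<in> carrier M\<rbrakk> \<Longrightarrow> f (x \<oplus>\<^bsub>M\<^esub> y) = f x \<oplus>\<^bsub>N\<^esub> f y"
    "\<And>r x. x \<in> carrier M \<Longrightarrow> f (r \<odot>\<^bsub>M\<^esub> x) = r \<odot>\<^bsub>N\<^esub> f x"
  using assms by (auto simp: linear_maps_def)

lemma linear_mapsI: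
  assumes "\<And>x. x \<in> carrier M \<Longrightarrow> f x \<in> carrier N"
    "\<And>x y. \<lbrakk>x \<in> carrier M; y \<in> carrier M\<rbrakk> \<Longrightarrow> f (x \<oplus>\<^bsub>M\<^esub> y) = f x \<oplus>\<^bsub>N\<^esub> f y"
    "\<And>r x. x \<in> carrier M \<Longrightarrow> f (r \<odot>\<^bsub>M\<^esub> x) = r \<odot>\<^bsub>N\<^esub> f x"
  shows "f \<in> linear_maps M N"
  using assms by (auto simp: linear_maps_def)

lemma linear_map_zero:
  assumes "smod M" "smod N" "f \<in> linear_maps M N"
  shows "f \<zero>\<^bsub>M\<^esub> = \<zero>\<^bsub>N\<^esub>"
proof -
  interpret M: smod M by fact
  interpret N: smod N by fact
  have "f (0 \<odot>\<^bsub>M\<^esub> \<zero>\<^bsub>M\<^esub>) = 0 \<odot>\<^bsub>N\<^esub> f \<zero>\<^bsub>M\<^esub>" by (rule linear_mapsD[OF assms(3)]) simp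
  with linear_mapsD(1)[OF assms(3)] show ?thesis by simp
qed

lemma linear_map_inv:
  assumes "smod M" "smod N" "f \<in> linear_maps M N" "x \<in> carrier M"
  shows "f (\<ominus>\<^bsub>M\<^esub> x) = \<ominus>\<^bsub>N\<^esub> f x"
proof -
  interpret M: smod M by fact
  interpret N: smod N by fact
  have "f ((- 1) \<odot>\<^bsub>M\<^esub> x) = (- 1) \<odot>\<^bsub>N\<^esub> f x" by (rule linear_mapsD[OF assms(3)]) fact
  with linear_mapsD(1)[OF assms(3)] assms show ?thesis by (simp add: M.sm_lminus N.sm_lminus)
qed

lemma linear_map_minus:
  assumes "smod M" "smod N" "f \<in> linear_maps M N" "x \<in> carrier M" "y \<in> carrier M"
  shows "f (x \<ominus>\<^bsub>M\<^esub> y) = f x \<ominus>\<^bsub>N\<^esub> f y"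
proof -
  interpret M: smod M by fact
  interpret N: smod N by fact
  show ?thesis using assms linear_mapsD[OF assms(3)] linear_map_inv[OF assms(1-3)]
    by (simp add: a_minus_def)
qed

lemma linear_map_ksgn:
  assumes "smod M" "smod N" "f \<in> linear_maps M N" "x \<in> carrier M"
  shows "f (ksgn M e x) = ksgn N e (f x)"
  using linear_map_inv[OF assms] by (simp add: ksgn_def)

lemma linear_map_comp:
  "\<lbrakk>f \<in> linear_maps M N; g \<in> linear_maps N P\<rbrakk> \<Longrightarrow> (\<lambda>x. g (f x)) \<in> linear_maps M P"
  by (rule linear_mapsI) (simp_all add: linear_mapsD)

lemma linear_map_kernel:
  assumes "smod M" "smod N" "f \<in> linear_maps M N"
  shows "submodule {x \<in> carrier M. f x = \<zero>\<^bsub>N\<^esub>} scalars M"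
proof -
  interpret M: smod M by fact
  interpret N: smod N by fact
  show ?thesis
    by (rule M.submodI) (auto simp: linear_map_zero[OF assms] linear_mapsD[OF assms(3)])
qed

lemma linear_maps_add:
  assumes "smod N" "f \<in> linear_maps M N" "g \<in> linear_maps M N"
  shows "(\<lambda>x. f x \<oplus>\<^bsub>N\<^esub> g x) \<in> linear_maps M N"
proof -
  interpret N: smod N by fact
  note D = linear_mapsD[OF assms(2)] linear_mapsD[OF assms(3)]
  show ?thesis by (rule linear_mapsI) (simp_all add: D N.sm_radd N.a_ac)
qed

lemma linear_maps_ksgn:
  assumes "smod N" "f \<in> linear_maps M N"
  shows "(\<lambda>x. ksgn N e (f x)) \<in> linear_maps M N"
proof -
  interpret N: smod N by fact
  note D = linear_mapsD[OF assms(2)]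
  show ?thesis by (rule linear_mapsI) (simp_all add: D N.sg_add N.sg_smult)
qed

lemma linear_maps_smult:
  assumes "smod N" "f \<in> linear_maps M N"
  shows "(\<lambda>x. r \<odot>\<^bsub>N\<^esub> (f x)) \<in> linear_maps M N"
proof -
  interpret N: smod N by fact
  note D = linear_mapsD[OF assms(2)]
  show ?thesis
    by (rule linear_mapsI) (simp_all add: D N.sm_radd N.sm_assoc[symmetric] mult.commute)
qed

lemma linear_maps_zero: "smod N \<Longrightarrow> (\<lambda>x. \<zero>\<^bsub>N\<^esub>) \<in> linear_maps M N"
proof -
  assume "smod N"
  then interpret N: smod N .
  show ?thesis by (rule linear_mapsI) simp_all
qed

subsection \<open>Quotients\<close>

context smod
begin

context
  fixes H assumes H: "submodule H scalars M"
begin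

interpretation ab: abelian_subgroup H M
  using submodule.axioms(1)[OF H] abelian_group_axioms
  by (intro abelian_subgroupI3 additive_subgroupI)

lemma quot_carrier: "carrier (quot M H) = (\<lambda>x. H +> x) ` carrier M"
  by (auto simp: quot_def FactRing_def A_RCOSETS_def')

lemma quot_add:
  "\<lbrakk>x \<in> carrier M; y \<in> carrier M\<rbrakk> \<Longrightarrow> (H +> x) \<oplus>\<^bsub>quot M H\<^esub> (H +> y) = H +> (x \<oplus> y)"
  by (simp add: quot_def FactRing_def ab.a_rcos_sum)

lemma quot_zero: "\<zero>\<^bsub>quot M H\<^esub> = H +> \<zero>"
  using submodD(1)[OF H] by (simp add: quot_def FactRing_def)

text \<open>If r is not a unit, r times a coset is in general only a part of a coset; the summand
  \<open>H\<close> in the definition of \<open>quot\<close> completes it.\<close>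

lemma quot_smult:
  assumes "x \<in> carrier M"
  shows "r \<odot>\<^bsub>quot M H\<^esub> (H +> x) = H +> (r \<odot> x)"
proof -
  have "\<exists>h'\<in>H. h \<oplus> r \<odot> (h2 \<oplus> x) = h' \<oplus> r \<odot> x" if "h \<in> H" "h2 \<in> H" for h h2
    using that assms submodD[OF H] by (intro bexI[of _ "h \<oplus> r \<odot> h2"]) (auto simp: sm_radd a_assoc subset_iff)
  moreover have "\<exists>h1\<in>H. \<exists>h2\<in>H. h \<oplus> r \<odot> x = h1 \<oplus> r \<odot> (h2 \<oplus> x)" if "h \<in> H" for h
    using that assms submodD[OF H] by (intro bexI[of _ h] bexI[of _ \<zero>]) (auto simp: subset_iff)
  ultimately show ?thesis
    unfolding quot_def set_add_def' a_r_coset_def' by fastforce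
qed

lemma quot_eq_iff:
  assumes "x \<in> carrier M" "y \<in> carrier M"
  shows "H +> x = H +> y \<longleftrightarrow> x \<ominus> y \<in> H"
proof -
  have "x \<in> H +> y \<longleftrightarrow> x \<ominus> y \<in> H"
    using ab.a_rcos_module[OF assms(2,1)] by (simp add: a_minus_def)
  moreover have "H +> x = H +> y \<longleftrightarrow> x \<in> H +> y"
    using ab.a_rcos_self[OF assms(1)] ab.a_repr_independence'[OF _ assms(2)] by metis
  ultimately show ?thesis by simp
qed

lemma quot_smod: "smod (quot M H)"
proof -
  have *: "\<exists>x\<in>carrier M. X = H +> x" if "X \<in> carrier (quot M H)" for X
    using that by (auto simp: quot_carrier)
  have cl: "H +> x \<in> carrier (quot M H)" if "x \<in> carrier M" for x
    using that by (auto simp: quot_carrier)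
  show ?thesis unfolding smod_def
  proof (rule moduleI)
    show "abelian_group (quot M H)"
    proof (rule abelian_groupI)
      fix X assume "X \<in> carrier (quot M H)"
      then obtain x where x: "x \<in> carrier M" "X = H +> x" using * by blast
      show "\<exists>Y\<in>carrier (quot M H). Y \<oplus>\<^bsub>quot M H\<^esub> X = \<zero>\<^bsub>quot M H\<^esub>"
        using x by (intro bexI[of _ "H +> \<ominus> x"]) (simp_all add: quot_add quot_zero l_neg cl)
    qed (auto dest!: * simp: quot_add quot_zero cl a_ac)
  qed (auto dest!: * simp: cring_scalars quot_add quot_smult cl sm_ladd sm_radd sm_assoc)
qed

lemma quot_proj: "(\<lambda>x. H +> x) \<in> linear_maps M (quot M H)"
  by (rule linear_mapsI) (auto simp: quot_carrier quot_add quot_smult)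

lemma quot_eq_zero_iff: "x \<in> carrier M \<Longrightarrow> H +> x = \<zero>\<^bsub>quot M H\<^esub> \<longleftrightarrow> x \<in> H"
  by (simp add: quot_zero quot_eq_iff)

lemma quot_lift:
  assumes N: "smod N" and f: "f \<in> linear_maps M N" and z: "\<And>x. x \<in> H \<Longrightarrow> f x = \<zero>\<^bsub>N\<^esub>"
  obtains g where "g \<in> linear_maps (quot M H) N" "\<And>x. x \<in> carrier M \<Longrightarrow> g (H +> x) = f x"
proof -
  interpret N: smod N by fact
  \<comment> \<open>A representative is chosen in each coset; two choices differ by an element of
    \<open>H\<close>, on which f vanishes.\<close>
  define g where "g X = f (SOME x. x \<in> carrier M \<and> H +> x = X)" for X
  have g: "g (H +> x) = f x" if x: "x \<in> carrier M" for x
  proof -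
    define y where "y = (SOME y. y \<in> carrier M \<and> H +> y = H +> x)"
    have y: "y \<in> carrier M" "H +> y = H +> x"
      using someI[of "\<lambda>y. y \<in> carrier M \<and> H +> y = H +> x" x] x by (auto simp: y_def)
    then have "y \<ominus> x \<in> H" using x by (simp add: quot_eq_iff)
    then have "f y \<ominus>\<^bsub>N\<^esub> f x = \<zero>\<^bsub>N\<^esub>"
      using z linear_map_minus[OF smod_axioms N f y(1) x] by simp
    then show ?thesis
      using linear_mapsD(1)[OF f] x y(1) by (simp add: g_def y_def[symmetric] N.minus_eq_zero_iff)
  qed
  have "g \<in> linear_maps (quot M H) N"
    by (rule linear_mapsI) (auto simp: quot_carrier quot_add quot_smult g linear_mapsD[OF f])
  then show ?thesis using g by (rule that)
qed

end

subsection \<open>Gradings of quotients\<close>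

text \<open>Disjointness of the two parts comes from the parity involution, here allowed to take values
  in the quotient: an element of both parts equals its own negative.\<close>

lemma quot_supermodule:
  assumes two: "(1 + 1 :: 'r) dvd 1" and H: "submodule H scalars M"
    and gr: "\<And>p. submodule (grade M p) scalars M"
    and dec: "\<And>x. x \<in> carrier M \<Longrightarrow> \<exists>a\<in>grade M 0. \<exists>b\<in>grade M 1. H +> x = H +> (a \<oplus> b)"
    and S: "S \<in> linear_maps M (quot M H)" "\<And>x. x \<in> H \<Longrightarrow> S x = \<zero>\<^bsub>quot M H\<^esub>"
    and Sg: "\<And>p x. x \<in> grade M p \<Longrightarrow> S x = ksgn (quot M H) p (H +> x)"
  shows "supermodule (quot M H)"
proof -
  interpret q: smod "quot M H" by (rule quot_smod) fact
  have grade: "grade (quot M H) p = (\<lambda>x. H +> x) ` grade M p" for p by (simp add: quot_def)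
  have sub: "x \<in> carrier M" if "x \<in> grade M p" for x p using submodD(1)[OF gr] that by blast
  have gsub: "submodule (grade (quot M H) p) scalars (quot M H)" for p
  proof (rule q.submodI)
    show "grade (quot M H) p \<subseteq> carrier (quot M H)" by (auto simp: grade quot_carrier[OF H] sub)
    show "\<zero>\<^bsub>quot M H\<^esub> \<in> grade (quot M H) p"
      using submodD(2)[OF gr] by (auto simp: quot_zero[OF H] grade)
  qed (auto simp: grade quot_add[OF H] quot_smult[OF H] sub intro!: imageI submodD(3,4)[OF gr])
  show ?thesis
  proof (intro supermodule.intro supermodule_axioms.intro gsub)
    show "Module.module scalars (quot M H)" by (rule q.module_axioms)
    show "grade (quot M H) 0 \<inter> grade (quot M H) 1 = {\<zero>\<^bsub>quot M H\<^esub>}"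
    proof (intro equalityI subsetI)
      fix X assume "X \<in> grade (quot M H) 0 \<inter> grade (quot M H) 1"
      then obtain a b where a: "a \<in> grade M 0" "X = H +> a" and b: "b \<in> grade M 1" "X = H +> b"
        by (auto simp: grade)
      have X: "X \<in> carrier (quot M H)" using a sub by (auto simp: quot_carrier[OF H])
      have "a \<ominus> b \<in> H" using a b by (simp add: quot_eq_iff[OF H, symmetric] sub)
      then have "S a \<ominus>\<^bsub>quot M H\<^esub> S b = \<zero>\<^bsub>quot M H\<^esub>"
        using S(2) linear_map_minus[OF smod_axioms q.smod_axioms S(1) sub[OF a(1)] sub[OF b(1)]] by simp
      then have "X \<oplus>\<^bsub>quot M H\<^esub> X = \<zero>\<^bsub>quot M H\<^esub>"
        using Sg[OF a(1)] Sg[OF b(1)] a(2) b(2) X by (simp add: q.sg_1 a_minus_def)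
      then show "X \<in> {\<zero>\<^bsub>quot M H\<^esub>}" using q.double_eq_zero[OF two X] by simp
    qed (use submodD(2)[OF gr] in \<open>auto simp: quot_zero[OF H] grade\<close>)
    show "carrier (quot M H) = grade (quot M H) 0 <+>\<^bsub>quot M H\<^esub> grade (quot M H) 1"
    proof (intro equalityI subsetI)
      fix X assume "X \<in> carrier (quot M H)"
      then obtain x where "x \<in> carrier M" "X = H +> x" by (auto simp: quot_carrier[OF H])
      then obtain a b where "a \<in> grade M 0" "b \<in> grade M 1" "X = H +> (a \<oplus> b)" using dec by blast
      then show "X \<in> grade (quot M H) 0 <+>\<^bsub>quot M H\<^esub> grade (quot M H) 1"
        unfolding set_add_def' by (auto simp: grade quot_add[OF H, symmetric] sub)
    next
      fix X assume "X \<in> grade (quot M H) 0 <+>\<^bsub>quot M H\<^esub> grade (quot M H) 1"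
      then show "X \<in> carrier (quot M H)"
        unfolding set_add_def' using q.submodD(1)[OF gsub] by (auto simp: subset_iff)
    qed
  qed
qed

end

sublocale supermodule \<subseteq> smod ..

section \<open>Algebras over the ground ring\<close>

locale salg = smod A + ring A
  for A :: "('r :: {comm_ring, comm_monoid_mult}, 'm) supermod" (structure) +
  assumes sm_mult_left: "\<lbrakk>x \<in> carrier A; y \<in> carrier A\<rbrakk> \<Longrightarrow> (r \<odot> x) \<otimes> y = r \<odot> (x \<otimes> y)"
    and sm_mult_right: "\<lbrakk>x \<in> carrier A; y \<in> carrier A\<rbrakk> \<Longrightarrow> x \<otimes> (r \<odot> y) = r \<odot> (x \<otimes> y)"
begin

lemma sg_mult_left: "\<lbrakk>x \<in> carrier A; y \<in> carrier A\<rbrakk> \<Longrightarrow> ksgn A e x \<otimes> y = ksgn A e (x \<otimes> y)"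
  by (simp add: ksgn_def l_minus)

lemma sg_mult_right: "\<lbrakk>x \<in> carrier A; y \<in> carrier A\<rbrakk> \<Longrightarrow> x \<otimes> ksgn A e y = ksgn A e (x \<otimes> y)"
  by (simp add: ksgn_def r_minus)

lemma ideal_submodule: "ideal I A \<Longrightarrow> submodule I scalars A"
proof (rule submodI)
  assume I: "ideal I A"
  then interpret ideal I A .
  show "I \<subseteq> carrier A" by (rule a_subset)
  \<comment> \<open>A ring ideal is closed under scalars because r x is the product of r 1 with
    x.\<close>
  show "r \<odot> x \<in> I" if "x \<in> I" for r x
    using sm_mult_left[of \<one> x r] I_l_closed[OF that, of "r \<odot> \<one>"] a_Hcarr[OF that] by simp
qed (auto intro: additive_subgroup.zero_closed additive_subgroup.a_closed dest: ideal.axioms)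

lemma mult_linear_left: "a \<in> carrier A \<Longrightarrow> (\<lambda>x. a \<otimes> x) \<in> linear_maps A A"
  by (rule linear_mapsI) (simp_all add: r_distr sm_mult_right)

lemma mult_linear_right: "a \<in> carrier A \<Longrightarrow> (\<lambda>x. x \<otimes> a) \<in> linear_maps A A"
  by (rule linear_mapsI) (simp_all add: l_distr sm_mult_left)

context
  fixes I assumes I: "ideal I A"
begin

interpretation I: ideal I A by (rule I)
interpretation q: smod "quot A I" by (rule quot_smod) (rule ideal_submodule[OF I])

lemma quot_mult:
  "\<lbrakk>x \<in> carrier A; y \<in> carrier A\<rbrakk> \<Longrightarrow> (I +> x) \<otimes>\<^bsub>quot A I\<^esub> (I +> y) = I +> (x \<otimes> y)"
  by (simp add: quot_def FactRing_def I.rcoset_mult_add)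

lemma quot_one: "\<one>\<^bsub>quot A I\<^esub> = I +> \<one>"
  by (simp add: quot_def FactRing_def)

lemma quot_salg: "salg (quot A I)"
proof -
  note S = ideal_submodule[OF I]
  have *: "\<exists>x\<in>carrier A. X = I +> x" if "X \<in> carrier (quot A I)" for X
    using that by (auto simp: quot_carrier[OF S])
  have cl: "I +> x \<in> carrier (quot A I)" if "x \<in> carrier A" for x
    using that by (auto simp: quot_carrier[OF S])
  note R = quot_mult quot_one quot_add[OF S] quot_smult[OF S] cl
  have "ring (quot A I)"
  proof (rule ringI)
    show "monoid (quot A I)" by (rule monoidI) (auto dest!: * simp: R m_assoc)
  qed (auto dest!: * simp: R l_distr r_distr q.abelian_group_axioms)
  then show ?thesis
    by (intro salg.intro salg_axioms.intro q.smod_axioms)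
      (auto dest!: * simp: R sm_mult_left sm_mult_right)
qed

end

end

sublocale superalgebra \<subseteq> salg
  by unfold_locales (simp_all add: smult_mult_left smult_mult_right)

section \<open>Parity twists\<close>

context supermodule
begin

lemma grade_carrier: "x \<in> grade M p \<Longrightarrow> x \<in> carrier M"
  using submodD(1)[OF grade_submodule] by blast

lemma grade_closed [simp]:
  "\<zero> \<in> grade M p"
  "\<lbrakk>x \<in> grade M p; y \<in> grade M p\<rbrakk> \<Longrightarrow> x \<oplus> y \<in> grade M p"
  "x \<in> grade M p \<Longrightarrow> r \<odot> x \<in> grade M p"
  "x \<in> grade M p \<Longrightarrow> \<ominus> x \<in> grade M p"
  "x \<in> grade M p \<Longrightarrow> ksgn M e x \<in> grade M p"
  by (rule submodD[OF grade_submodule]; assumption)+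

lemma parts_exist: "x \<in> carrier M \<Longrightarrow> \<exists>a\<in>grade M 0. \<exists>b\<in>grade M 1. x = a \<oplus> b"
  using grade_sum by (auto simp: set_add_def')

text \<open>The difference of the even parts equals the opposite difference of the odd parts, so it
  is both even and odd and therefore zero.\<close>

lemma parts_unique:
  assumes "a \<in> grade M 0" "b \<in> grade M 1" "a' \<in> grade M 0" "b' \<in> grade M 1" "a \<oplus> b = a' \<oplus> b'"
  shows "a = a' \<and> b = b'"
proof -
  note c = assms(1-4)[THEN grade_carrier]
  have "(a \<ominus> a') \<oplus> (b \<ominus> b') = (a \<oplus> b) \<ominus> (a' \<oplus> b')"
    using c by (simp add: a_minus_def minus_add a_ac)
  also have "\<dots> = \<zero>" using c assms(5) by (simp add: a_minus_def r_neg)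
  finally have "\<ominus> (b \<ominus> b') = a \<ominus> a'" using c by (intro minus_equality) simp_all
  then have e: "a \<ominus> a' = b' \<ominus> b" using c by (simp add: a_minus_def minus_add a_comm)
  have "a \<ominus> a' \<in> grade M 0" "b' \<ominus> b \<in> grade M 1" using assms by (simp_all add: a_minus_def)
  then have "a \<ominus> a' = \<zero>" "b' \<ominus> b = \<zero>" using grade_disjoint e by auto
  then show ?thesis using c by (simp add: minus_eq_zero_iff)
qed

text \<open>The Koszul sign of moving an operator of parity d past x, extended linearly to
  inhomogeneous x. For d = 1 it is the parity involution.\<close>

definition twist :: "bit \<Rightarrow> 'm \<Rightarrow> 'm" where
  "twist d x = (THE y. \<exists>a\<in>grade M 0. \<exists>b\<in>grade M 1. x = a \<oplus> b \<and> y = a \<oplus> ksgn M d b)"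

lemma twist_eq:
  assumes "a \<in> grade M 0" "b \<in> grade M 1"
  shows "twist d (a \<oplus> b) = a \<oplus> ksgn M d b"
  unfolding twist_def using assms by (intro the_equality) (auto dest: parts_unique)

lemma twist_linear: "twist d \<in> linear_maps M M"
proof (rule linear_mapsI)
  fix x y r assume "x \<in> carrier M"
  then obtain a b where x: "a \<in> grade M 0" "b \<in> grade M 1" "x = a \<oplus> b" using parts_exist by blast
  note x' = x(1,2)[THEN grade_carrier]
  show "twist d x \<in> carrier M" using x x' by (simp add: twist_eq)
  have "twist d (r \<odot> a \<oplus> r \<odot> b) = r \<odot> a \<oplus> ksgn M d (r \<odot> b)" using x by (intro twist_eq) auto
  then show "twist d (r \<odot> x) = r \<odot> twist d x" using x x' by (simp add: twist_eq sm_radd sg_smult)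
  assume "y \<in> carrier M"
  then obtain a2 b2 where y: "a2 \<in> grade M 0" "b2 \<in> grade M 1" "y = a2 \<oplus> b2" using parts_exist by blast
  note y' = y(1,2)[THEN grade_carrier]
  have "twist d ((a \<oplus> a2) \<oplus> (b \<oplus> b2)) = (a \<oplus> a2) \<oplus> ksgn M d (b \<oplus> b2)"
    using x y by (intro twist_eq) auto
  moreover have "x \<oplus> y = (a \<oplus> a2) \<oplus> (b \<oplus> b2)" using x y x' y' by (simp add: a_ac)
  ultimately show "twist d (x \<oplus> y) = twist d x \<oplus> twist d y"
    using x y x' y' by (simp add: twist_eq sg_add a_ac)
qed

lemma twist_closed [simp]: "x \<in> carrier M \<Longrightarrow> twist d x \<in> carrier M"
  using linear_mapsD(1)[OF twist_linear] .

lemma twist_grade: "x \<in> grade M p \<Longrightarrow> twist d x = ksgn M (d * p) x"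
  using twist_eq[of x "\<zero>" d] twist_eq[of "\<zero>" x d] by (cases p) (simp_all add: grade_carrier)

lemma graded_linear_eqI:
  assumes "smod N" "f \<in> linear_maps M N" "g \<in> linear_maps M N"
    and "\<And>p x. x \<in> grade M p \<Longrightarrow> f x = g x" and "x \<in> carrier M"
  shows "f x = g x"
  using parts_exist[OF assms(5)] by (auto simp: linear_mapsD(2)[OF assms(2)] linear_mapsD(2)[OF assms(3)] assms(4) grade_carrier)

end

context superalgebra
begin

text \<open>Both sides are linear in each factor, so homogeneous factors suffice, and there the
  exponents add.\<close>

lemma twist_mult: "\<lbrakk>x \<in> carrier A; y \<in> carrier A\<rbrakk> \<Longrightarrow> twist d (x \<otimes> y) = twist d x \<otimes> twist d y"
proof -
  assume x: "x \<in> carrier A" and y: "y \<in> carrier A"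
  have *: "twist d (a \<otimes> b) = twist d a \<otimes> twist d b" if "a \<in> grade A p" "b \<in> grade A q" for a b p q
    using that grade_mult[OF that]
    by (simp add: twist_grade grade_carrier sg_mult_left sg_mult_right sg_sg distrib_left add.commute)
  have 1: "twist d (a \<otimes> y) = twist d a \<otimes> twist d y" if "a \<in> grade A p" for a p
    using * that y by (intro graded_linear_eqI[OF smod_axioms _ _ _ y, of "\<lambda>y. twist d (a \<otimes> y)" "\<lambda>y. twist d a \<otimes> twist d y"]
        linear_map_comp[OF mult_linear_left twist_linear] linear_map_comp[OF twist_linear mult_linear_left]) (auto simp: grade_carrier)
  show ?thesis
    using 1 x y by (intro graded_linear_eqI[OF smod_axioms _ _ _ x, of "\<lambda>x. twist d (x \<otimes> y)" "\<lambda>x. twist d x \<otimes> twist d y"]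
        linear_map_comp[OF mult_linear_right twist_linear] linear_map_comp[OF twist_linear mult_linear_right]) auto
qed

end

section \<open>Free modules\<close>

abbreviation scal :: "'r \<Rightarrow> ('x \<Rightarrow>\<^sub>0 'r) \<Rightarrow> 'x \<Rightarrow>\<^sub>0 'r :: {comm_ring, comm_monoid_mult}" where
  "scal r \<equiv> Poly_Mapping.map ((*) r)"

abbreviation mono :: "'x \<Rightarrow> 'x \<Rightarrow>\<^sub>0 'r :: {comm_ring, comm_monoid_mult}" where
  "mono x \<equiv> Poly_Mapping.single x 1"

lemma lookup_scal [simp]: "Poly_Mapping.lookup (scal r f) x = r * Poly_Mapping.lookup f x"
  by (auto simp: map.rep_eq when_def)

lemma keys_scal: "Poly_Mapping.keys (scal r f) \<subseteq> Poly_Mapping.keys f"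
  by (auto simp: in_keys_iff)

lemma scal_mono: "scal r (mono x) = Poly_Mapping.single x r"
  by (simp add: poly_mapping_eq_iff lookup_single when_def fun_eq_iff)

lemma free_induct [consumes 1, case_names zero single add]:
  assumes "Poly_Mapping.keys f \<subseteq> X" "P 0" "\<And>x r. x \<in> X \<Longrightarrow> P (Poly_Mapping.single x r)"
    and "\<And>f g. \<lbrakk>Poly_Mapping.keys f \<subseteq> X; Poly_Mapping.keys g \<subseteq> X; P f; P g\<rbrakk> \<Longrightarrow> P (f + g)"
  shows "P (f :: 'x \<Rightarrow>\<^sub>0 'r :: {comm_ring, comm_monoid_mult})"
proof -
  let ?s = "\<lambda>S. \<Sum>x\<in>S. Poly_Mapping.single x (Poly_Mapping.lookup f x)"
  have "Poly_Mapping.keys (?s S) \<subseteq> X \<and> P (?s S)" if "finite S" "S \<subseteq> X" for S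
    using that
  proof (induction S)
    case (insert x S)
    have "Poly_Mapping.keys (Poly_Mapping.single x (Poly_Mapping.lookup f x)) \<subseteq> X"
      using insert by auto
    with insert show ?case
      using keys_add[of "Poly_Mapping.single x (Poly_Mapping.lookup f x)" "?s S"]
      by (auto intro!: assms)
  qed (simp add: assms)
  moreover have "f = ?s (Poly_Mapping.keys f)"
    by (rule poly_mapping_eqI) (auto simp: lookup_sum lookup_single when_def in_keys_iff)
  ultimately show ?thesis using assms(1) by (metis finite_keys)
qed

text \<open>The common shape of the free algebra on words and of the path algebra. Products and
  gradings are left out, so that linear extension from a basis is developed once for both.\<close>

definition free_on :: "('r :: {comm_ring, comm_monoid_mult}, 'x \<Rightarrow>\<^sub>0 'r) supermod \<Rightarrow> 'x set \<Rightarrow> bool" where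
  "free_on P X \<longleftrightarrow> carrier P = {f. Poly_Mapping.keys f \<subseteq> X} \<and> add P = (+) \<and> zero P = 0 \<and> smult P = scal"

lemma keys_add_subset: "\<lbrakk>Poly_Mapping.keys f \<subseteq> X; Poly_Mapping.keys g \<subseteq> X\<rbrakk> \<Longrightarrow> Poly_Mapping.keys (f + g) \<subseteq> X"
  using keys_add[of f g] by auto

lemma keys_scal_subset: "Poly_Mapping.keys f \<subseteq> X \<Longrightarrow> Poly_Mapping.keys (scal r f) \<subseteq> X"
  using keys_scal[of r f] by auto

lemma free_onD:
  assumes "free_on P X"
  shows "f \<in> carrier P \<longleftrightarrow> Poly_Mapping.keys f \<subseteq> X" "f \<oplus>\<^bsub>P\<^esub> g = f + g" "\<zero>\<^bsub>P\<^esub> = 0"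
    "r \<odot>\<^bsub>P\<^esub> f = scal r f"
  using assms by (simp_all add: free_on_def)

lemma free_on_smod:
  assumes "free_on P X" shows "smod P"
  unfolding smod_def
proof (rule moduleI)
  note P = free_onD[OF assms]
  show "abelian_group P"
  proof (rule abelian_groupI)
    show "\<exists>y\<in>carrier P. y \<oplus>\<^bsub>P\<^esub> x = \<zero>\<^bsub>P\<^esub>" if "x \<in> carrier P" for x
      using that by (intro bexI[of _ "- x"]) (auto simp: P in_keys_iff)
  qed (auto simp: P add_ac dest: keys_add[THEN subsetD])
qed (auto simp: free_onD[OF assms] cring_scalars poly_mapping_eq_iff lookup_add fun_eq_iff
    algebra_simps dest: keys_scal[THEN subsetD])

lemma free_on_minus:
  assumes "free_on P X" "f \<in> carrier P" shows "\<ominus>\<^bsub>P\<^esub> f = - f"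
proof -
  interpret smod P by (rule free_on_smod) fact
  show ?thesis
    using assms(2) by (intro minus_equality) (auto simp: free_onD[OF assms(1)] in_keys_iff)
qed

definition lift :: "('r :: {comm_ring, comm_monoid_mult}, 'm) supermod \<Rightarrow> ('x \<Rightarrow> 'm) \<Rightarrow> ('x \<Rightarrow>\<^sub>0 'r) \<Rightarrow> 'm" where
  "lift B F f = finsum B (\<lambda>x. Poly_Mapping.lookup f x \<odot>\<^bsub>B\<^esub> F x) (Poly_Mapping.keys f)"

context smod
begin

text \<open>Additivity compares sums over the supports of f, g and f + g. Cancellation can shrink a
  support, so all three are taken over one larger finite set.\<close>

lemma lift_superset:
  assumes "finite S" "Poly_Mapping.keys f \<subseteq> S" "\<And>x. x \<in> S \<Longrightarrow> F x \<in> carrier M"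
  shows "lift M F f = finsum M (\<lambda>x. Poly_Mapping.lookup f x \<odot> F x) S"
  unfolding lift_def using assms
  by (intro add.finprod_mono_neutral_cong_left) (auto simp: in_keys_iff)

lemma lift_linear:
  assumes "free_on P X" "\<And>x. x \<in> X \<Longrightarrow> F x \<in> carrier M"
  shows "lift M F \<in> linear_maps P M"
proof (rule linear_mapsI)
  note P = free_onD[OF assms(1)]
  fix f assume "f \<in> carrier P"
  then have f: "Poly_Mapping.keys f \<subseteq> X" by (simp add: P)
  show "lift M F f \<in> carrier M"
    unfolding lift_def using f assms(2) by (intro finsum_closed) auto
  show "lift M F (r \<odot>\<^bsub>P\<^esub> f) = r \<odot> lift M F f" for r
  proof -
    have "lift M F (r \<odot>\<^bsub>P\<^esub> f) = finsum M (\<lambda>x. r \<odot> (Poly_Mapping.lookup f x \<odot> F x)) (Poly_Mapping.keys f)"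
      using f assms(2) keys_scal[of r f]
      by (subst lift_superset[of "Poly_Mapping.keys f"])
        (auto simp: P sm_assoc subset_iff intro!: add.finprod_cong')
    also have "\<dots> = r \<odot> lift M F f"
      unfolding lift_def using f assms(2) by (subst finsum_smult_ldistr) auto
    finally show ?thesis .
  qed
  fix g assume "g \<in> carrier P"
  then have g: "Poly_Mapping.keys g \<subseteq> X" by (simp add: P)
  let ?S = "Poly_Mapping.keys f \<union> Poly_Mapping.keys g"
  have *: "lift M F h = finsum M (\<lambda>x. Poly_Mapping.lookup h x \<odot> F x) ?S" if "Poly_Mapping.keys h \<subseteq> ?S" for h
    using that f g assms(2) by (intro lift_superset) auto
  have F: "F x \<in> carrier M" if "x \<in> ?S" for x using that f g assms(2) by auto
  have "lift M F (f + g) = finsum M (\<lambda>x. Poly_Mapping.lookup f x \<odot> F x \<oplus> Poly_Mapping.lookup g x \<odot> F x) ?S"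
    unfolding *[OF keys_add] using F by (intro add.finprod_cong') (auto simp: lookup_add sm_ladd)
  also have "\<dots> = lift M F f \<oplus> lift M F g"
    using F by (subst finsum_addf) (auto simp: *)
  finally show "lift M F (f \<oplus>\<^bsub>P\<^esub> g) = lift M F f \<oplus> lift M F g" by (simp add: P)
qed

lemma lift_single: "F x \<in> carrier M \<Longrightarrow> lift M F (Poly_Mapping.single x r) = r \<odot> F x"
  by (simp add: lift_def)

end

text \<open>The set \<open>Y\<close> may be smaller than the basis: with \<open>Y\<close> the basis
  elements of one parity, this compares two maps on a homogeneous part.\<close>

lemma free_ext:
  assumes "free_on P X" "smod B" "f \<in> linear_maps P B" "g \<in> linear_maps P B"
    and "\<And>x. x \<in> Y \<Longrightarrow> f (mono x) = g (mono x)" "Y \<subseteq> X" "Poly_Mapping.keys a \<subseteq> Y"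
  shows "f a = g a"
proof -
  interpret P: smod P by (rule free_on_smod) fact
  note P = free_onD[OF assms(1)]
  note lin = linear_mapsD[OF assms(3)] linear_mapsD[OF assms(4)]
  show ?thesis using assms(7)
  proof (induction a rule: free_induct)
    case zero show ?case
      using linear_map_zero[OF P.smod_axioms assms(2,3)] linear_map_zero[OF P.smod_axioms assms(2,4)]
      by (simp only: P(3))
  next
    case (single x r)
    have m: "mono x \<in> carrier P" using single assms(6) by (auto simp: P(1))
    show ?case using lin(3)[OF m, of r] lin(6)[OF m, of r] assms(5)[OF single] by (simp only: P(4) scal_mono)
  next
    case (add a b)
    then have "a \<in> carrier P" "b \<in> carrier P" using assms(6) by (auto simp: P(1))
    then show ?case using lin(2)[of a b] lin(5)[of a b] add.IH by (simp only: P(2))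
  qed
qed

section \<open>The tensor algebra\<close>

lemma (in smod) add_minus_cancel:
  assumes "x \<in> carrier M" "y \<in> carrier M"
  shows "x \<oplus> y \<ominus> x \<ominus> y = \<zero>"
proof -
  have "x \<oplus> y \<ominus> x \<ominus> y = (x \<oplus> y) \<oplus> \<ominus> (x \<oplus> y)"
    using assms by (simp add: a_minus_def minus_add a_assoc)
  then show ?thesis using assms by (simp add: r_neg)
qed

lemma free_on_diff:
  assumes "free_on P X" "f \<in> carrier P" "g \<in> carrier P" shows "f \<ominus>\<^bsub>P\<^esub> g = f - g"
  using assms by (simp add: a_minus_def free_on_minus free_onD(2)[OF assms(1)])

lemma mono_mult: "mono u * mono v = (mono (u @ v) :: _ \<Rightarrow>\<^sub>0 'r :: {comm_ring, comm_monoid_mult})"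
  by (simp add: mult_single plus_list_def)

lemma scal_conv_mult: "scal r f = Poly_Mapping.single [] r * f"
  using mult_map_scale_conv_mult[of r f] by (simp add: zero_list_def)

lemma mono_Nil_mult: "mono [] * f = f" and mult_mono_Nil: "f * mono [] = f"
  for f :: "'x list \<Rightarrow>\<^sub>0 'r :: {comm_ring, comm_monoid_mult}"
proof -
  show "mono [] * f = f"
    by (simp add: scal_conv_mult[symmetric] poly_mapping_eq_iff fun_eq_iff)
  have "Poly_Mapping.keys f \<subseteq> UNIV" by simp
  then show "f * mono [] = f"
    by (induction f rule: free_induct) (simp_all add: mult_single plus_list_def distrib_right)
qed

lemma single_Nil_commute: "f * Poly_Mapping.single [] r = Poly_Mapping.single [] r * f"
  for f :: "'x list \<Rightarrow>\<^sub>0 'r :: {comm_ring, comm_monoid_mult}"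
proof -
  have "Poly_Mapping.keys f \<subseteq> UNIV" by simp
  then show ?thesis
    by (induction f rule: free_induct)
      (simp_all add: mult_single plus_list_def distrib_right distrib_left mult.commute)
qed

lemma free_alg_free_on: "free_on (free_alg M) (lists (carrier M))"
  by (simp add: free_on_def free_alg_def)

lemma free_alg_simps:
  "f \<otimes>\<^bsub>free_alg M\<^esub> g = f * g" "\<one>\<^bsub>free_alg M\<^esub> = mono []"
  by (simp_all add: free_alg_def)

lemma keys_mult_lists:
  assumes "Poly_Mapping.keys f \<subseteq> A" "Poly_Mapping.keys g \<subseteq> B" "\<And>u v. \<lbrakk>u \<in> A; v \<in> B\<rbrakk> \<Longrightarrow> u @ v \<in> C"
  shows "Poly_Mapping.keys (f * g) \<subseteq> C"
  using keys_mult[of f g] assms by (fastforce simp: plus_list_def)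

lemma free_alg_salg: "salg (free_alg M)"
proof -
  note P = free_onD[OF free_alg_free_on[of M]]
  interpret smod "free_alg M" by (rule free_on_smod[OF free_alg_free_on])
  have closed: "f * g \<in> carrier (free_alg M)" if "f \<in> carrier (free_alg M)" "g \<in> carrier (free_alg M)" for f g
    using that keys_mult_lists[of f "lists (carrier M)" g "lists (carrier M)" "lists (carrier M)"]
    by (simp add: P)
  have one: "mono [] \<in> carrier (free_alg M)" by (simp add: P)
  have "ring (free_alg M)"
  proof (rule ringI)
    show "monoid (free_alg M)"
      by (rule monoidI) (simp_all add: free_alg_simps mono_Nil_mult mult_mono_Nil mult.assoc closed one)
  qed (simp_all add: free_alg_simps P distrib_left distrib_right abelian_group_axioms)
  then show ?thesis
    by (intro salg.intro salg_axioms.intro smod_axioms)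
      (simp_all add: free_alg_simps P scal_conv_mult single_Nil_commute mult.assoc[symmetric])
qed

section \<open>Multilinear functions on words and maps out of the tensor algebra\<close>

definition multilinear :: "('r :: {comm_ring, comm_monoid_mult}, 'm) supermod \<Rightarrow> ('r, 'b) supermod \<Rightarrow> ('m list \<Rightarrow> 'b) \<Rightarrow> bool" where
  "multilinear M B F \<longleftrightarrow> (\<forall>w\<in>lists (carrier M). F w \<in> carrier B) \<and>
    (\<forall>u\<in>lists (carrier M). \<forall>v\<in>lists (carrier M). \<forall>x\<in>carrier M.
      (\<forall>y\<in>carrier M. F (u @ (x \<oplus>\<^bsub>M\<^esub> y) # v) = F (u @ x # v) \<oplus>\<^bsub>B\<^esub> F (u @ y # v)) \<and>
      (\<forall>r. F (u @ (r \<odot>\<^bsub>M\<^esub> x) # v) = r \<odot>\<^bsub>B\<^esub> F (u @ x # v)))"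

lemma multilinearD:
  assumes "multilinear M B F"
  shows "w \<in> lists (carrier M) \<Longrightarrow> F w \<in> carrier B"
    "\<lbrakk>u \<in> lists (carrier M); v \<in> lists (carrier M); x \<in> carrier M; y \<in> carrier M\<rbrakk>
      \<Longrightarrow> F (u @ (x \<oplus>\<^bsub>M\<^esub> y) # v) = F (u @ x # v) \<oplus>\<^bsub>B\<^esub> F (u @ y # v)"
    "\<lbrakk>u \<in> lists (carrier M); v \<in> lists (carrier M); x \<in> carrier M\<rbrakk>
      \<Longrightarrow> F (u @ (r \<odot>\<^bsub>M\<^esub> x) # v) = r \<odot>\<^bsub>B\<^esub> F (u @ x # v)"
  using assms by (simp_all add: multilinear_def)

lemma multilinear_comp:
  assumes "multilinear M B F" "g \<in> linear_maps B C"
  shows "multilinear M C (\<lambda>w. g (F w))"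
  using multilinearD[OF assms(1)] linear_mapsD[OF assms(2)] by (simp add: multilinear_def)

lemma linear_map_sandwich:
  assumes "salg A" "smod B" "L \<in> linear_maps A B" "g \<in> carrier A" "h \<in> carrier A"
  shows "(\<lambda>x. L (g \<otimes>\<^bsub>A\<^esub> x \<otimes>\<^bsub>A\<^esub> h)) \<in> linear_maps A B"
proof -
  interpret A: salg A by fact
  show ?thesis
    using linear_map_comp[OF linear_map_comp[OF A.mult_linear_left[OF assms(4)] A.mult_linear_right[OF assms(5)]] assms(3)] .
qed

text \<open>This is the largest ideal on which L vanishes. It reduces vanishing on a generated ideal
  to the generators multiplied from both sides, without any description of the elements of that
  ideal.\<close>

lemma ideal_in_kernel:
  assumes "salg A" "smod B" "L \<in> linear_maps A B"
  shows "ideal {f \<in> carrier A. \<forall>g\<in>carrier A. \<forall>h\<in>carrier A. L (g \<otimes>\<^bsub>A\<^esub> f \<otimes>\<^bsub>A\<^esub> h) = \<zero>\<^bsub>B\<^esub>} A" (is "ideal ?K A")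
proof -
  interpret A: salg A by fact
  interpret B: smod B by fact
  have "submodule ?K scalars A"
  proof (rule A.submodI)
    note sw = linear_map_sandwich[OF assms]
    show "\<zero>\<^bsub>A\<^esub> \<in> ?K" using linear_map_zero[OF A.smod_axioms assms(2) sw] by auto
    show "a \<oplus>\<^bsub>A\<^esub> b \<in> ?K" if "a \<in> ?K" "b \<in> ?K" for a b using linear_mapsD(2)[OF sw] that by auto
    show "r \<odot>\<^bsub>A\<^esub> a \<in> ?K" if "a \<in> ?K" for r a using linear_mapsD(3)[OF sw] that by auto
  qed auto
  then have "subgroup ?K (add_monoid A)" by (rule submodule.axioms)
  then show ?thesis
    by (rule idealI[OF A.ring_axioms]) (auto simp: A.m_assoc[symmetric], auto simp: A.m_assoc)
qed

lemma genideal_in_kernel: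
  assumes "salg A" "smod B" "L \<in> linear_maps A B" "X \<subseteq> carrier A" "f \<in> Idl\<^bsub>A\<^esub> X"
    and "\<And>x g h. \<lbrakk>x \<in> X; g \<in> carrier A; h \<in> carrier A\<rbrakk> \<Longrightarrow> L (g \<otimes>\<^bsub>A\<^esub> x \<otimes>\<^bsub>A\<^esub> h) = \<zero>\<^bsub>B\<^esub>"
  shows "L f = \<zero>\<^bsub>B\<^esub>"
proof -
  interpret A: salg A by fact
  let ?K = "{f \<in> carrier A. \<forall>g\<in>carrier A. \<forall>h\<in>carrier A. L (g \<otimes>\<^bsub>A\<^esub> f \<otimes>\<^bsub>A\<^esub> h) = \<zero>\<^bsub>B\<^esub>}"
  have "X \<subseteq> ?K" using assms by auto
  then have "f \<in> ?K" using A.genideal_minimal[OF ideal_in_kernel[OF assms(1-3)]] assms(5) by blast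
  then have f: "f \<in> carrier A" and "L (\<one>\<^bsub>A\<^esub> \<otimes>\<^bsub>A\<^esub> f \<otimes>\<^bsub>A\<^esub> \<one>\<^bsub>A\<^esub>) = \<zero>\<^bsub>B\<^esub>"
    using A.one_closed by blast+
  then show ?thesis using f by (simp only: A.l_one A.r_one)
qed

definition tw :: "('r :: {comm_ring, comm_monoid_mult}, 'm) supermod \<Rightarrow> 'm list \<Rightarrow> ('r, 'm) tens" where
  "tw M w = tensor_class M (mono w)"

definition sw :: "('r :: {comm_ring, comm_monoid_mult}, 'm) supermod \<Rightarrow> 'm list \<Rightarrow> ('r, 'm) symm" where
  "sw M w = sym_class M (tw M w)"

text \<open>Words with homogeneous letters and total parity p. They span the part of parity p of the
  tensor algebra, so identities with Koszul signs are tested on them.\<close>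

definition hwords :: "('r, 'm) supermod \<Rightarrow> bit \<Rightarrow> 'm list set" where
  "hwords M p = {w. \<exists>ps. list_all2 (\<lambda>x q. x \<in> grade M q) w ps \<and> sum_list ps = p}"

lemma hwords_Nil: "[] \<in> hwords M p \<longleftrightarrow> p = 0"
  by (auto simp: hwords_def)

lemma hwords_Cons: "x # w \<in> hwords M p \<longleftrightarrow> (\<exists>q r. x \<in> grade M q \<and> w \<in> hwords M r \<and> p = q + r)"
  by (force simp: hwords_def list_all2_Cons1)

lemma hwords_append: "\<lbrakk>u \<in> hwords M p; v \<in> hwords M q\<rbrakk> \<Longrightarrow> u @ v \<in> hwords M (p + q)"
  by (induction u arbitrary: p) (auto simp: hwords_Nil hwords_Cons add.assoc)

context smod
begin

abbreviation "F\<^sub>M \<equiv> free_alg M"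
abbreviation "T\<^sub>M \<equiv> tensor_alg M"
abbreviation "W \<equiv> lists (carrier M)"

interpretation F: salg F\<^sub>M by (rule free_alg_salg)

lemmas freeD = free_onD[OF free_alg_free_on[of M]]

lemma linearity_gens:
  "({mono [x \<oplus> y] - mono [x] - mono [y] | x y. x \<in> carrier M \<and> y \<in> carrier M} \<union>
     {mono [r \<odot> x] - Poly_Mapping.single [x] r | r x. x \<in> carrier M}) \<subseteq> carrier F\<^sub>M" (is "?G \<subseteq> _")
proof -
  have m: "Poly_Mapping.single [x] r \<in> carrier F\<^sub>M" if "x \<in> carrier M" for x r
    using that by (simp add: freeD(1))
  have d: "f - g \<in> carrier F\<^sub>M" if "f \<in> carrier F\<^sub>M" "g \<in> carrier F\<^sub>M" for f g
    using free_on_diff[OF free_alg_free_on that] F.minus_closed[OF that] by simp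
  show ?thesis by (auto intro!: m d)
qed

lemma linearity_ideal: "ideal (linearity_ideal M) F\<^sub>M"
  unfolding linearity_ideal_def by (rule F.genideal_ideal[OF linearity_gens])

lemma linearity_submodule: "submodule (linearity_ideal M) scalars F\<^sub>M"
  by (rule F.ideal_submodule[OF linearity_ideal])

text \<open>The expression is linear in g and in h, so both may be taken to be words.\<close>

lemma free_sandwich_zero:
  assumes B: "smod B" and L: "L \<in> linear_maps F\<^sub>M B" and a: "a \<in> carrier F\<^sub>M"
    and z: "\<And>u v. \<lbrakk>u \<in> W; v \<in> W\<rbrakk> \<Longrightarrow> L (mono u * a * mono v) = \<zero>\<^bsub>B\<^esub>"
    and g: "g \<in> carrier F\<^sub>M" and h: "h \<in> carrier F\<^sub>M"
  shows "L (g * a * h) = \<zero>\<^bsub>B\<^esub>"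
proof -
  interpret B: smod B by fact
  have m: "mono u \<in> carrier F\<^sub>M" if "u \<in> W" for u using that by (simp add: freeD)
  have 1: "L (mono u * a * h) = \<zero>\<^bsub>B\<^esub>" if u: "u \<in> W" for u
  proof (rule free_ext[OF free_alg_free_on B _ linear_maps_zero[OF B], where Y = W and f = "\<lambda>h. L (mono u * a * h)"])
    have "mono u * a \<in> carrier F\<^sub>M" using F.m_closed[OF m[OF u] a] by (simp only: free_alg_simps)
    from linear_map_comp[OF F.mult_linear_left[OF this] L]
    show "(\<lambda>h. L (mono u * a * h)) \<in> linear_maps F\<^sub>M B" by (simp only: free_alg_simps)
    show "L (mono u * a * mono v) = \<zero>\<^bsub>B\<^esub>" if "v \<in> W" for v by (rule z[OF u that])
    show "Poly_Mapping.keys h \<subseteq> W" using h by (simp only: freeD(1))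
  qed (rule order_refl)
  show ?thesis
  proof (rule free_ext[OF free_alg_free_on B _ linear_maps_zero[OF B], where Y = W and f = "\<lambda>g. L (g * a * h)"])
    have "a * h \<in> carrier F\<^sub>M" using F.m_closed[OF a h] by (simp only: free_alg_simps)
    from linear_map_comp[OF F.mult_linear_right[OF this] L]
    show "(\<lambda>g. L (g * a * h)) \<in> linear_maps F\<^sub>M B" by (simp only: free_alg_simps mult.assoc)
    show "L (mono u * a * h) = \<zero>\<^bsub>B\<^esub>" if "u \<in> W" for u by (rule 1[OF that])
    show "Poly_Mapping.keys g \<subseteq> W" using g by (simp only: freeD(1))
  qed (rule order_refl)
qed

text \<open>Placed between two words, a generator of the ideal becomes the defect of additivity or
  of homogeneity in one letter, and a multilinear \<open>F\<close> annihilates it.\<close>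

lemma lift_linearity_ideal:
  assumes B: "smod B" and F: "multilinear M B F" and f: "f \<in> linearity_ideal M"
  shows "lift B F f = \<zero>\<^bsub>B\<^esub>"
proof -
  interpret B: smod B by fact
  note ml = multilinearD[OF F]
  have L: "lift B F \<in> linear_maps F\<^sub>M B" by (rule B.lift_linear[OF free_alg_free_on ml(1)])
  have m: "Poly_Mapping.single u r \<in> carrier F\<^sub>M" if "u \<in> W" for u r using that by (auto simp: freeD(1))
  have Ls: "lift B F (Poly_Mapping.single u r) = r \<odot>\<^bsub>B\<^esub> F u" if "u \<in> W" for u r
    by (rule B.lift_single, rule ml(1)[OF that])
  have Ld: "lift B F (f - g) = lift B F f \<ominus>\<^bsub>B\<^esub> lift B F g" if "f \<in> carrier F\<^sub>M" "g \<in> carrier F\<^sub>M" for f g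
    using linear_map_minus[OF F.smod_axioms B L that] free_on_diff[OF free_alg_free_on that] by simp
  have d: "f - g \<in> carrier F\<^sub>M" if "f \<in> carrier F\<^sub>M" "g \<in> carrier F\<^sub>M" for f g
    using free_on_diff[OF free_alg_free_on that] F.minus_closed[OF that] by simp
  show ?thesis
  proof (rule genideal_in_kernel[OF F.salg_axioms B L linearity_gens f[unfolded linearity_ideal_def]])
    fix a g h assume a: "a \<in> {mono [x \<oplus> y] - mono [x] - mono [y] | x y. x \<in> carrier M \<and> y \<in> carrier M} \<union>
     {mono [r \<odot> x] - Poly_Mapping.single [x] r | r x. x \<in> carrier M}" and gh: "g \<in> carrier F\<^sub>M" "h \<in> carrier F\<^sub>M"
    have "lift B F (mono u * a * mono v) = \<zero>\<^bsub>B\<^esub>" if uv: "u \<in> W" "v \<in> W" for u v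
      using a
    proof (elim UnE CollectE exE conjE)
      fix x y assume xy: "x \<in> carrier M" "y \<in> carrier M" and a: "a = mono [x \<oplus> y] - mono [x] - mono [y]"
      have "mono u * a * mono v = mono (u @ (x \<oplus> y) # v) - mono (u @ x # v) - mono (u @ y # v)"
        by (simp add: a right_diff_distrib left_diff_distrib mono_mult)
      then show ?thesis using uv xy
        by (simp add: Ld m d Ls ml B.add_minus_cancel)
    next
      fix x r assume x: "x \<in> carrier M" and a: "a = mono [r \<odot> x] - Poly_Mapping.single [x] r"
      have "mono u * a * mono v = mono (u @ (r \<odot> x) # v) - Poly_Mapping.single (u @ x # v) r"
        by (simp add: a right_diff_distrib left_diff_distrib mult_single plus_list_def)
      moreover have "u @ (r \<odot> x) # v \<in> W" "u @ x # v \<in> W" using uv x by auto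
      ultimately show ?thesis
        using Ld[OF m m, of "u @ (r \<odot> x) # v" "u @ x # v" 1 r] Ls[of "u @ (r \<odot> x) # v" 1] Ls[of "u @ x # v" r]
          ml(3)[OF uv x, of r] ml(1)[of "u @ (r \<odot> x) # v"] by (simp add: B.minus_eq_zero_iff)
    qed
    moreover have "a \<in> carrier F\<^sub>M" using a linearity_gens by blast
    ultimately show "lift B F (g \<otimes>\<^bsub>F\<^sub>M\<^esub> a \<otimes>\<^bsub>F\<^sub>M\<^esub> h) = \<zero>\<^bsub>B\<^esub>"
      unfolding free_alg_simps by (intro free_sandwich_zero[OF B L _ _ gh])
  qed
qed

lemma tensor_salg: "salg T\<^sub>M"
  unfolding tensor_alg_def by (rule F.quot_salg[OF linearity_ideal])

lemma tensor_class_linear: "tensor_class M \<in> linear_maps F\<^sub>M T\<^sub>M"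
  using F.quot_proj[OF linearity_submodule] by (simp add: tensor_class_def[abs_def] tensor_alg_def)

lemma tensor_class_mult:
  "\<lbrakk>f \<in> carrier F\<^sub>M; g \<in> carrier F\<^sub>M\<rbrakk> \<Longrightarrow> tensor_class M (f * g) = tensor_class M f \<otimes>\<^bsub>T\<^sub>M\<^esub> tensor_class M g"
  using F.quot_mult[OF linearity_ideal, of f g] by (simp add: tensor_class_def tensor_alg_def free_alg_simps)

lemma tensor_carrier: "carrier T\<^sub>M = tensor_class M ` carrier F\<^sub>M"
  using F.quot_carrier[OF linearity_submodule] by (simp add: tensor_class_def[abs_def] tensor_alg_def)

lemma tensor_class_eq_zero_iff: "f \<in> carrier F\<^sub>M \<Longrightarrow> tensor_class M f = \<zero>\<^bsub>T\<^sub>M\<^esub> \<longleftrightarrow> f \<in> linearity_ideal M"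
  using F.quot_eq_zero_iff[OF linearity_submodule, of f] by (simp add: tensor_class_def tensor_alg_def)

lemma tensor_grade: "grade T\<^sub>M p = tensor_class M ` {f. Poly_Mapping.keys f \<subseteq> hwords M p}"
  by (simp add: tensor_class_def[abs_def] tensor_alg_def quot_def free_alg_def hwords_def)

lemma mono_closed: "w \<in> W \<Longrightarrow> mono w \<in> carrier F\<^sub>M"
  by (simp add: freeD)

lemma tw_closed: "w \<in> W \<Longrightarrow> tw M w \<in> carrier T\<^sub>M"
  unfolding tw_def using linear_mapsD(1)[OF tensor_class_linear] mono_closed by blast

lemma tw_append: "\<lbrakk>u \<in> W; v \<in> W\<rbrakk> \<Longrightarrow> tw M (u @ v) = tw M u \<otimes>\<^bsub>T\<^sub>M\<^esub> tw M v"
  using tensor_class_mult[of "mono u" "mono v"] by (simp add: tw_def mono_closed mono_mult)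

lemma tw_Nil: "tw M [] = \<one>\<^bsub>T\<^sub>M\<^esub>"
  using F.quot_one[OF linearity_ideal] by (simp add: tw_def tensor_class_def tensor_alg_def free_alg_simps)

text \<open>A word with a distinguished letter is a product of three classes, and for a one-letter
  word additivity and homogeneity are the generators of the ideal.\<close>

lemma tw_multilinear: "multilinear M T\<^sub>M (tw M)"
proof -
  interpret T: salg T\<^sub>M by (rule tensor_salg)
  note lin = linear_mapsD[OF tensor_class_linear] linear_map_minus[OF F.smod_axioms T.smod_axioms tensor_class_linear]
  have s: "Poly_Mapping.single [x] r \<in> carrier F\<^sub>M" if "x \<in> carrier M" for x r using that by (simp add: freeD)
  have d: "tensor_class M f = tensor_class M g"
    if "f \<in> carrier F\<^sub>M" "g \<in> carrier F\<^sub>M" "f - g \<in> linearity_ideal M" for f g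
  proof -
    have "tensor_class M (f \<ominus>\<^bsub>F\<^sub>M\<^esub> g) = \<zero>\<^bsub>T\<^sub>M\<^esub>"
      using that F.submodD(1)[OF linearity_submodule]
      by (subst tensor_class_eq_zero_iff) (auto simp: free_on_diff[OF free_alg_free_on])
    then show ?thesis using that by (simp add: lin T.minus_eq_zero_iff)
  qed
  have gen: "g \<in> linearity_ideal M" if "g \<in> ({mono [x \<oplus> y] - mono [x] - mono [y] | x y. x \<in> carrier M \<and> y \<in> carrier M} \<union>
     {mono [r \<odot> x] - Poly_Mapping.single [x] r | r x. x \<in> carrier M})" for g
    unfolding linearity_ideal_def using F.genideal_self[OF linearity_gens] that by blast
  have add: "tw M [x \<oplus> y] = tw M [x] \<oplus>\<^bsub>T\<^sub>M\<^esub> tw M [y]" if "x \<in> carrier M" "y \<in> carrier M" for x y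
  proof -
    have "mono [x \<oplus> y] - (mono [x] + mono [y]) \<in> linearity_ideal M"
      using that by (intro gen) (auto simp: algebra_simps)
    then have "tensor_class M (mono [x \<oplus> y]) = tensor_class M (mono [x] \<oplus>\<^bsub>F\<^sub>M\<^esub> mono [y])"
      using that s F.a_closed[OF s s] by (intro d) (simp_all add: freeD(2))
    then show ?thesis using that by (simp add: tw_def lin s)
  qed
  have sm: "tw M [r \<odot> x] = r \<odot>\<^bsub>T\<^sub>M\<^esub> tw M [x]" if "x \<in> carrier M" for x r
  proof -
    have "tensor_class M (mono [r \<odot> x]) = tensor_class M (r \<odot>\<^bsub>F\<^sub>M\<^esub> mono [x])"
      using that s by (intro d gen) (auto simp: freeD(4) scal_mono)
    then show ?thesis using that by (simp add: tw_def lin s)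
  qed
  have split: "tw M (u @ x # v) = tw M u \<otimes>\<^bsub>T\<^sub>M\<^esub> tw M [x] \<otimes>\<^bsub>T\<^sub>M\<^esub> tw M v" if "u \<in> W" "v \<in> W" "x \<in> carrier M" for u x v
    using that tw_append[of u "[x] @ v"] tw_append[of "[x]" v] by (simp add: T.m_assoc tw_closed)
  show ?thesis
    unfolding multilinear_def
    using tw_closed by (auto simp: split add sm T.r_distr T.l_distr T.sm_mult_left T.sm_mult_right)
qed

lemma tensor_universal:
  assumes B: "smod B" and F: "multilinear M B F"
  obtains L where "L \<in> linear_maps T\<^sub>M B" "\<And>f. f \<in> carrier F\<^sub>M \<Longrightarrow> L (tensor_class M f) = lift B F f"
    "\<And>w. w \<in> W \<Longrightarrow> L (tw M w) = F w"
proof -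
  interpret B: smod B by fact
  note ml = multilinearD[OF F]
  have L: "lift B F \<in> linear_maps F\<^sub>M B" by (rule B.lift_linear[OF free_alg_free_on ml(1)])
  obtain L where L: "L \<in> linear_maps T\<^sub>M B" "\<And>f. f \<in> carrier F\<^sub>M \<Longrightarrow> L (tensor_class M f) = lift B F f"
    using F.quot_lift[OF linearity_submodule B L lift_linearity_ideal[OF B F]]
    by (auto simp: tensor_class_def tensor_alg_def)
  moreover have "L (tw M w) = F w" if "w \<in> W" for w
    using that ml(1) by (simp add: tw_def L mono_closed B.lift_single)
  ultimately show ?thesis by (rule that)
qed

lemma tensor_linear_eqI:
  assumes "smod B" "f \<in> linear_maps T\<^sub>M B" "g \<in> linear_maps T\<^sub>M B" "\<And>w. w \<in> W \<Longrightarrow> f (tw M w) = g (tw M w)"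
    "t \<in> carrier T\<^sub>M"
  shows "f t = g t"
proof -
  obtain a where a: "a \<in> carrier F\<^sub>M" "t = tensor_class M a" using assms(5) by (auto simp: tensor_carrier)
  show ?thesis unfolding a(2)
    using a(1) assms(4)
    by (intro free_ext[OF free_alg_free_on assms(1) linear_map_comp[OF tensor_class_linear assms(2)]
        linear_map_comp[OF tensor_class_linear assms(3)], of W a]) (auto simp: tw_def freeD)
qed

end

section \<open>The grading of the tensor algebra\<close>

context supermodule
begin

interpretation F: salg "free_alg M" by (rule free_alg_salg)
interpretation T: salg "tensor_alg M" by (rule tensor_salg)

lemma hwords_lists: "w \<in> hwords M p \<Longrightarrow> w \<in> lists (carrier M)"
  by (induction w arbitrary: p) (auto simp: hwords_Cons grade_carrier)

lemma tensor_grade_eqI: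
  assumes "smod B" "f \<in> linear_maps T\<^sub>M B" "g \<in> linear_maps T\<^sub>M B"
    and "\<And>w. w \<in> hwords M p \<Longrightarrow> f (tw M w) = g (tw M w)" and "t \<in> grade T\<^sub>M p"
  shows "f t = g t"
proof -
  obtain a where a: "Poly_Mapping.keys a \<subseteq> hwords M p" "t = tensor_class M a"
    using assms(5) by (auto simp: tensor_grade)
  have "f (tensor_class M a) = g (tensor_class M a)"
  proof (rule free_ext[OF free_alg_free_on assms(1)])
    show "(\<lambda>x. f (tensor_class M x)) \<in> linear_maps F\<^sub>M B" "(\<lambda>x. g (tensor_class M x)) \<in> linear_maps F\<^sub>M B"
      by (intro linear_map_comp[OF tensor_class_linear] assms)+
    show "f (tensor_class M (mono w)) = g (tensor_class M (mono w))" if "w \<in> hwords M p" for w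
      using assms(4)[OF that] by (simp add: tw_def)
    show "hwords M p \<subseteq> lists (carrier M)" using hwords_lists by blast
  qed (rule a(1))
  then show ?thesis by (simp add: a(2))
qed

lemma tensor_grade_closed:
  "\<zero>\<^bsub>T\<^sub>M\<^esub> \<in> grade T\<^sub>M p"
  "\<lbrakk>x \<in> grade T\<^sub>M p; y \<in> grade T\<^sub>M p\<rbrakk> \<Longrightarrow> x \<oplus>\<^bsub>T\<^sub>M\<^esub> y \<in> grade T\<^sub>M p"
  "x \<in> grade T\<^sub>M p \<Longrightarrow> r \<odot>\<^bsub>T\<^sub>M\<^esub> x \<in> grade T\<^sub>M p"
  "\<lbrakk>x \<in> grade T\<^sub>M p; y \<in> grade T\<^sub>M q\<rbrakk> \<Longrightarrow> x \<otimes>\<^bsub>T\<^sub>M\<^esub> y \<in> grade T\<^sub>M (p + q)"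
  "x \<in> grade T\<^sub>M p \<Longrightarrow> x \<in> carrier T\<^sub>M"
proof -
  note lin = linear_mapsD[OF tensor_class_linear]
  have c: "f \<in> carrier F\<^sub>M" if "Poly_Mapping.keys f \<subseteq> hwords M p" for f p
    using that hwords_lists by (auto simp: freeD(1))
  have "Poly_Mapping.keys (0 :: _ \<Rightarrow>\<^sub>0 'r) \<subseteq> hwords M p" by simp
  then have "tensor_class M 0 \<in> grade T\<^sub>M p" unfolding tensor_grade by (intro imageI) simp
  then show "\<zero>\<^bsub>T\<^sub>M\<^esub> \<in> grade T\<^sub>M p"
    using linear_map_zero[OF F.smod_axioms T.smod_axioms tensor_class_linear] by (simp add: freeD(3))
  have E: "\<exists>f. Poly_Mapping.keys f \<subseteq> hwords M p \<and> x = tensor_class M f" if "x \<in> grade T\<^sub>M p" for x p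
    using that by (auto simp: tensor_grade)
  have I: "tensor_class M f \<in> grade T\<^sub>M p" if "Poly_Mapping.keys f \<subseteq> hwords M p" for f p
    unfolding tensor_grade by (rule imageI) (use that in simp)
  show "x \<oplus>\<^bsub>T\<^sub>M\<^esub> y \<in> grade T\<^sub>M p" if xy: "x \<in> grade T\<^sub>M p" "y \<in> grade T\<^sub>M p"
  proof -
    obtain f g where fg: "Poly_Mapping.keys f \<subseteq> hwords M p" "x = tensor_class M f"
      "Poly_Mapping.keys g \<subseteq> hwords M p" "y = tensor_class M g"
      using E[OF xy(1)] E[OF xy(2)] by blast
    then have "x \<oplus>\<^bsub>T\<^sub>M\<^esub> y = tensor_class M (f + g)" using lin(2)[OF c c] by (simp add: freeD(2))
    then show ?thesis using I[OF keys_add_subset[OF fg(1,3)]] by simp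
  qed
  show "r \<odot>\<^bsub>T\<^sub>M\<^esub> x \<in> grade T\<^sub>M p" if x: "x \<in> grade T\<^sub>M p"
  proof -
    obtain f where f: "Poly_Mapping.keys f \<subseteq> hwords M p" "x = tensor_class M f" using E[OF x] by blast
    then have "r \<odot>\<^bsub>T\<^sub>M\<^esub> x = tensor_class M (scal r f)" using lin(3)[OF c, of f p r] by (simp add: freeD(4))
    then show ?thesis using I[OF keys_scal_subset[OF f(1)]] by simp
  qed
  show "x \<otimes>\<^bsub>T\<^sub>M\<^esub> y \<in> grade T\<^sub>M (p + q)" if xy: "x \<in> grade T\<^sub>M p" "y \<in> grade T\<^sub>M q"
  proof -
    obtain f g where fg: "Poly_Mapping.keys f \<subseteq> hwords M p" "x = tensor_class M f"
      "Poly_Mapping.keys g \<subseteq> hwords M q" "y = tensor_class M g"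
      using E[OF xy(1)] E[OF xy(2)] by blast
    then have "x \<otimes>\<^bsub>T\<^sub>M\<^esub> y = tensor_class M (f * g)" using tensor_class_mult[OF c c] by simp
    then show ?thesis using I[OF keys_mult_lists[OF fg(1,3) hwords_append]] by simp
  qed
  show "x \<in> carrier T\<^sub>M" if "x \<in> grade T\<^sub>M p"
    using that c by (auto simp: tensor_grade tensor_carrier)
qed

lemma tw_grade: "w \<in> hwords M p \<Longrightarrow> tw M w \<in> grade T\<^sub>M p"
  by (auto simp: tensor_grade tw_def intro!: imageI)

lemma tw_singleton: "(\<lambda>x. tw M [x]) \<in> linear_maps M T\<^sub>M"
  using multilinearD(2,3)[OF tw_multilinear, of "[]" "[]"] tw_closed
  by (intro linear_mapsI) simp_all

lemma tw_Cons: "\<lbrakk>x \<in> carrier M; w \<in> lists (carrier M)\<rbrakk> \<Longrightarrow> tw M (x # w) = tw M [x] \<otimes>\<^bsub>T\<^sub>M\<^esub> tw M w"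
  using tw_append[of "[x]" w] by simp

lemma tw_twist:
  "w \<in> hwords M p \<Longrightarrow> tw M (map (twist d) w) = ksgn T\<^sub>M (d * p) (tw M w)"
proof (induction w arbitrary: p)
  case (Cons x w)
  then obtain q r where x: "x \<in> grade M q" "w \<in> hwords M r" "p = q + r" by (auto simp: hwords_Cons)
  note c = grade_carrier[OF x(1)] hwords_lists[OF x(2)]
  have m: "map (twist d) w \<in> lists (carrier M)" using c(2) by (induction w) auto
  have "tw M (map (twist d) (x # w)) = ksgn T\<^sub>M (d * q) (tw M [x]) \<otimes>\<^bsub>T\<^sub>M\<^esub> ksgn T\<^sub>M (d * r) (tw M w)"
    using c m Cons.IH[OF x(2)] linear_map_ksgn[OF smod_axioms T.smod_axioms tw_singleton c(1)]
    by (simp add: tw_Cons[of "ksgn M (d * q) x" "map (twist d) w"] twist_grade[OF x(1)])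
  then show ?case using c
    by (simp add: x(3) tw_Cons[of x w] T.sg_mult_left T.sg_mult_right T.sg_sg tw_closed distrib_left add.commute)
qed (simp add: hwords_Nil)

text \<open>Induction on the word: if the first letter is y + z and the rest is a + b, both split by
  parity, then y a + z b is the even part of the product and y b + z a the odd part.\<close>

lemma tw_decompose: "w \<in> lists (carrier M) \<Longrightarrow> \<exists>a\<in>grade T\<^sub>M 0. \<exists>b\<in>grade T\<^sub>M 1. tw M w = a \<oplus>\<^bsub>T\<^sub>M\<^esub> b"
proof (induction w)
  case Nil
  then show ?case using tw_grade[of "[]" 0] tensor_grade_closed(1)[of 1]
    by (intro bexI[of _ "tw M []"] bexI[of _ "\<zero>\<^bsub>T\<^sub>M\<^esub>"]) (auto simp: hwords_Nil tw_closed)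
next
  case (Cons x w)
  then obtain a b where ab: "a \<in> grade T\<^sub>M 0" "b \<in> grade T\<^sub>M 1" "tw M w = a \<oplus>\<^bsub>T\<^sub>M\<^esub> b" by auto
  have x: "x \<in> carrier M" using Cons by auto
  then obtain y z where yz: "y \<in> grade M 0" "z \<in> grade M 1" "x = y \<oplus> z" using parts_exist by blast
  have g: "tw M [y] \<in> grade T\<^sub>M 0" "tw M [z] \<in> grade T\<^sub>M 1"
    using yz by (auto intro!: tw_grade simp: hwords_Cons hwords_Nil)
  note c = ab(1,2)[THEN tensor_grade_closed(5)] g[THEN tensor_grade_closed(5)]
  have "tw M (x # w) = (tw M [y] \<oplus>\<^bsub>T\<^sub>M\<^esub> tw M [z]) \<otimes>\<^bsub>T\<^sub>M\<^esub> (a \<oplus>\<^bsub>T\<^sub>M\<^esub> b)"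
    using Cons.prems x yz ab(3) linear_mapsD(2)[OF tw_singleton] by (subst tw_Cons) (auto simp: grade_carrier)
  also have "\<dots> = (tw M [y] \<otimes>\<^bsub>T\<^sub>M\<^esub> a \<oplus>\<^bsub>T\<^sub>M\<^esub> tw M [z] \<otimes>\<^bsub>T\<^sub>M\<^esub> b) \<oplus>\<^bsub>T\<^sub>M\<^esub> (tw M [y] \<otimes>\<^bsub>T\<^sub>M\<^esub> b \<oplus>\<^bsub>T\<^sub>M\<^esub> tw M [z] \<otimes>\<^bsub>T\<^sub>M\<^esub> a)"
    using c by (simp add: T.l_distr T.r_distr T.a_ac)
  finally have e: "tw M (x # w) = (tw M [y] \<otimes>\<^bsub>T\<^sub>M\<^esub> a \<oplus>\<^bsub>T\<^sub>M\<^esub> tw M [z] \<otimes>\<^bsub>T\<^sub>M\<^esub> b) \<oplus>\<^bsub>T\<^sub>M\<^esub> (tw M [y] \<otimes>\<^bsub>T\<^sub>M\<^esub> b \<oplus>\<^bsub>T\<^sub>M\<^esub> tw M [z] \<otimes>\<^bsub>T\<^sub>M\<^esub> a)" .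
  show ?case
  proof (intro bexI)
    show "tw M [y] \<otimes>\<^bsub>T\<^sub>M\<^esub> a \<oplus>\<^bsub>T\<^sub>M\<^esub> tw M [z] \<otimes>\<^bsub>T\<^sub>M\<^esub> b \<in> grade T\<^sub>M 0"
      using tensor_grade_closed(4)[OF g(1) ab(1)] tensor_grade_closed(4)[OF g(2) ab(2)]
      by (intro tensor_grade_closed(2)) simp_all
    show "tw M [y] \<otimes>\<^bsub>T\<^sub>M\<^esub> b \<oplus>\<^bsub>T\<^sub>M\<^esub> tw M [z] \<otimes>\<^bsub>T\<^sub>M\<^esub> a \<in> grade T\<^sub>M 1"
      using tensor_grade_closed(4)[OF g(1) ab(2)] tensor_grade_closed(4)[OF g(2) ab(1)]
      by (intro tensor_grade_closed(2)) simp_all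
  qed (rule e)
qed

lemma tensor_decompose:
  assumes "t \<in> carrier T\<^sub>M" shows "\<exists>a\<in>grade T\<^sub>M 0. \<exists>b\<in>grade T\<^sub>M 1. t = a \<oplus>\<^bsub>T\<^sub>M\<^esub> b"
proof -
  obtain f where f: "f \<in> carrier F\<^sub>M" "t = tensor_class M f" using assms by (auto simp: tensor_carrier)
  from f(1) have "Poly_Mapping.keys f \<subseteq> lists (carrier M)" by (simp add: freeD)
  then show ?thesis unfolding f(2)
  proof (induction f rule: free_induct)
    case zero
    have "tensor_class M 0 = \<zero>\<^bsub>T\<^sub>M\<^esub>"
      using linear_map_zero[OF F.smod_axioms T.smod_axioms tensor_class_linear] by (simp add: freeD(3))
    then show ?case using tensor_grade_closed(1)[of 0] tensor_grade_closed(1)[of 1]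
      by (intro bexI[of _ "\<zero>\<^bsub>T\<^sub>M\<^esub>"]) simp_all
  next
    case (single w r)
    obtain a b where ab: "a \<in> grade T\<^sub>M 0" "b \<in> grade T\<^sub>M 1" "tw M w = a \<oplus>\<^bsub>T\<^sub>M\<^esub> b"
      using tw_decompose[OF single] by blast
    have "tensor_class M (Poly_Mapping.single w r) = r \<odot>\<^bsub>T\<^sub>M\<^esub> tw M w"
      using linear_mapsD(3)[OF tensor_class_linear mono_closed[OF single], of r] by (simp add: tw_def freeD(4) scal_mono)
    also have "\<dots> = r \<odot>\<^bsub>T\<^sub>M\<^esub> a \<oplus>\<^bsub>T\<^sub>M\<^esub> r \<odot>\<^bsub>T\<^sub>M\<^esub> b" using ab by (simp add: T.sm_radd tensor_grade_closed(5))
    finally show ?case using tensor_grade_closed(3)[OF ab(1)] tensor_grade_closed(3)[OF ab(2)] by blast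
  next
    case (add f g)
    then obtain a b a' b' where ab: "a \<in> grade T\<^sub>M 0" "b \<in> grade T\<^sub>M 1" "tensor_class M f = a \<oplus>\<^bsub>T\<^sub>M\<^esub> b"
      "a' \<in> grade T\<^sub>M 0" "b' \<in> grade T\<^sub>M 1" "tensor_class M g = a' \<oplus>\<^bsub>T\<^sub>M\<^esub> b'" by blast
    have "tensor_class M (f + g) = tensor_class M f \<oplus>\<^bsub>T\<^sub>M\<^esub> tensor_class M g"
      using linear_mapsD(2)[OF tensor_class_linear, of f g] add.hyps by (simp add: freeD)
    also have "\<dots> = (a \<oplus>\<^bsub>T\<^sub>M\<^esub> a') \<oplus>\<^bsub>T\<^sub>M\<^esub> (b \<oplus>\<^bsub>T\<^sub>M\<^esub> b')" using ab(1,2,4,5)[THEN tensor_grade_closed(5)] by (simp add: ab T.a_ac)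
    finally show ?case
      using tensor_grade_closed(2)[OF ab(1,4)] tensor_grade_closed(2)[OF ab(2,5)] by blast
  qed
qed

text \<open>The parity involution on tensors comes from twisting every letter of a word. This is
  again multilinear, so its lift kills the linearity ideal, as \<open>quot_supermodule\<close>
  requires.\<close>

theorem tensor_superalgebra:
  assumes two: "(1 + 1 :: 'r) dvd 1" shows "superalgebra T\<^sub>M"
proof -
  have "multilinear M T\<^sub>M (\<lambda>w. tw M (map (twist 1) w))"
    unfolding multilinear_def
  proof (intro conjI ballI allI)
    have m: "map (twist 1) w \<in> lists (carrier M)" if "w \<in> lists (carrier M)" for w
      using that by (induction w) auto
    show "tw M (map (twist 1) w) \<in> carrier T\<^sub>M" if "w \<in> lists (carrier M)" for w
      by (rule tw_closed[OF m[OF that]])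
    note ml = multilinearD(2,3)[OF tw_multilinear m m]
    show "tw M (map (twist 1) (u @ (x \<oplus> y) # v)) = tw M (map (twist 1) (u @ x # v)) \<oplus>\<^bsub>T\<^sub>M\<^esub> tw M (map (twist 1) (u @ y # v))"
      if "u \<in> lists (carrier M)" "v \<in> lists (carrier M)" "x \<in> carrier M" "y \<in> carrier M" for u v x y
      using ml(1)[OF that(1,2), of "twist 1 x" "twist 1 y"] that(3,4) linear_mapsD(2)[OF twist_linear that(3,4)] by simp
    show "tw M (map (twist 1) (u @ (r \<odot> x) # v)) = r \<odot>\<^bsub>T\<^sub>M\<^esub> tw M (map (twist 1) (u @ x # v))"
      if "u \<in> lists (carrier M)" "v \<in> lists (carrier M)" "x \<in> carrier M" for u v x r
      using ml(2)[OF that(1,2), of "twist 1 x" r] that(3) linear_mapsD(3)[OF twist_linear that(3)] by simp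
  qed
  note ml = this
  let ?S = "lift T\<^sub>M (\<lambda>w. tw M (map (twist 1) w))"
  have S: "?S \<in> linear_maps F\<^sub>M T\<^sub>M"
    by (rule T.lift_linear[OF free_alg_free_on multilinearD(1)[OF ml]])
  have grF: "grade F\<^sub>M p = {f. Poly_Mapping.keys f \<subseteq> hwords M p}" for p
    by (simp add: free_alg_def hwords_def)
  have Teq: "quot F\<^sub>M (linearity_ideal M) = T\<^sub>M" by (simp add: tensor_alg_def)
  have c: "linearity_ideal M +>\<^bsub>F\<^sub>M\<^esub> x = tensor_class M x" for x by (simp add: tensor_class_def)
  have hl: "hwords M p \<subseteq> lists (carrier M)" for p using hwords_lists by blast
  have "supermodule (quot F\<^sub>M (linearity_ideal M))"
  proof (rule F.quot_supermodule[OF two linearity_submodule, where S = ?S], unfold Teq c)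
    show "submodule (grade F\<^sub>M p) scalars F\<^sub>M" for p
      unfolding grF
    proof (rule F.submodI)
      show "{f. Poly_Mapping.keys f \<subseteq> hwords M p} \<subseteq> carrier F\<^sub>M"
        using hl[of p] by (intro subsetI) (simp only: mem_Collect_eq freeD(1) subset_trans)
    qed (simp_all add: freeD(2-4) keys_add_subset keys_scal_subset)
    show "\<exists>a\<in>grade F\<^sub>M 0. \<exists>b\<in>grade F\<^sub>M 1. tensor_class M x = tensor_class M (a \<oplus>\<^bsub>F\<^sub>M\<^esub> b)"
      if x: "x \<in> carrier F\<^sub>M" for x
    proof -
      have "tensor_class M x \<in> carrier T\<^sub>M" by (rule linear_mapsD(1)[OF tensor_class_linear x])
      from tensor_decompose[OF this] obtain a b where
        ab: "Poly_Mapping.keys a \<subseteq> hwords M 0" "Poly_Mapping.keys b \<subseteq> hwords M 1"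
          "tensor_class M x = tensor_class M a \<oplus>\<^bsub>T\<^sub>M\<^esub> tensor_class M b"
        by (auto simp: tensor_grade)
      moreover have "a \<in> carrier F\<^sub>M" "b \<in> carrier F\<^sub>M" using ab(1,2) hl by (simp_all only: freeD(1) subset_trans)
      ultimately show ?thesis
        by (intro bexI[of _ a] bexI[of _ b]) (simp_all add: grF linear_mapsD(2)[OF tensor_class_linear])
    qed
    show "?S x = \<zero>\<^bsub>T\<^sub>M\<^esub>" if "x \<in> linearity_ideal M" for x
      by (rule lift_linearity_ideal[OF T.smod_axioms ml that])
    show "?S x = ksgn T\<^sub>M p (tensor_class M x)" if "x \<in> grade F\<^sub>M p" for x p
    proof (rule free_ext[OF free_alg_free_on T.smod_axioms S, where Y = "hwords M p"])
      show "(\<lambda>x. ksgn T\<^sub>M p (tensor_class M x)) \<in> linear_maps F\<^sub>M T\<^sub>M"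
        by (rule linear_maps_ksgn[OF T.smod_axioms tensor_class_linear])
      show "?S (mono w) = ksgn T\<^sub>M p (tensor_class M (mono w))" if "w \<in> hwords M p" for w
        using tw_twist[OF that, of 1] that tw_closed[OF hwords_lists[OF that]]
        by (subst T.lift_single) (simp_all add: tw_def[symmetric])
    qed (use that hl in \<open>simp_all add: grF\<close>)
  qed (rule S)
  then interpret sT: supermodule T\<^sub>M by (simp only: Teq)
  show ?thesis
  proof (intro superalgebra.intro superalgebra_axioms.intro sT.supermodule_axioms T.ring_axioms)
    show "\<one>\<^bsub>T\<^sub>M\<^esub> \<in> grade T\<^sub>M 0" using tw_grade[of "[]" 0] by (simp add: hwords_Nil tw_Nil)
  qed (simp_all add: T.sm_mult_left T.sm_mult_right tensor_grade_closed(4))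
qed

end

section \<open>The free supercommutative superalgebra\<close>

locale supermodule2 = supermodule M for M :: "('r :: {comm_ring, comm_monoid_mult}, 'm) supermod" (structure) +
  assumes two: "(1 + 1 :: 'r) dvd 1"
begin

abbreviation "S\<^sub>M \<equiv> sym_alg M"

interpretation F: salg F\<^sub>M by (rule free_alg_salg)
interpretation T: superalgebra T\<^sub>M by (rule tensor_superalgebra[OF two])

lemma commutators_closed: "graded_commutators T\<^sub>M \<subseteq> carrier T\<^sub>M"
  unfolding graded_commutators_def by (auto simp: T.grade_carrier)

lemma supercomm_ideal: "ideal (supercomm_ideal M) T\<^sub>M"
  unfolding supercomm_ideal_def by (rule T.genideal_ideal[OF commutators_closed])

lemma supercomm_submodule: "submodule (supercomm_ideal M) scalars T\<^sub>M"
  by (rule T.ideal_submodule[OF supercomm_ideal])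

lemma sym_salg: "salg S\<^sub>M"
  unfolding sym_alg_def by (rule T.quot_salg[OF supercomm_ideal])

interpretation S: salg S\<^sub>M by (rule sym_salg)

lemma sym_class_linear: "sym_class M \<in> linear_maps T\<^sub>M S\<^sub>M"
  using T.quot_proj[OF supercomm_submodule] by (simp add: sym_class_def[abs_def] sym_alg_def)

lemma sym_class_mult:
  "\<lbrakk>x \<in> carrier T\<^sub>M; y \<in> carrier T\<^sub>M\<rbrakk> \<Longrightarrow> sym_class M (x \<otimes>\<^bsub>T\<^sub>M\<^esub> y) = sym_class M x \<otimes>\<^bsub>S\<^sub>M\<^esub> sym_class M y"
  using T.quot_mult[OF supercomm_ideal, of x y] by (simp add: sym_class_def sym_alg_def)

lemma sym_class_one: "sym_class M \<one>\<^bsub>T\<^sub>M\<^esub> = \<one>\<^bsub>S\<^sub>M\<^esub>"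
  using T.quot_one[OF supercomm_ideal] by (simp add: sym_class_def sym_alg_def)

lemma sym_carrier: "carrier S\<^sub>M = sym_class M ` carrier T\<^sub>M"
  using T.quot_carrier[OF supercomm_submodule] by (simp add: sym_class_def[abs_def] sym_alg_def)

lemma sym_class_eq_zero_iff: "x \<in> carrier T\<^sub>M \<Longrightarrow> sym_class M x = \<zero>\<^bsub>S\<^sub>M\<^esub> \<longleftrightarrow> x \<in> supercomm_ideal M"
  using T.quot_eq_zero_iff[OF supercomm_submodule, of x] by (simp add: sym_class_def sym_alg_def)

lemma sym_grade: "grade S\<^sub>M p = sym_class M ` grade T\<^sub>M p"
  by (simp add: sym_class_def[abs_def] sym_alg_def quot_def)

lemma sym_class_commute:
  assumes "x \<in> grade T\<^sub>M p" "y \<in> grade T\<^sub>M q"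
  shows "sym_class M x \<otimes>\<^bsub>S\<^sub>M\<^esub> sym_class M y = ksgn S\<^sub>M (p * q) (sym_class M y \<otimes>\<^bsub>S\<^sub>M\<^esub> sym_class M x)"
proof -
  note c = assms[THEN T.grade_carrier]
  note lin = linear_mapsD[OF sym_class_linear] linear_map_minus[OF T.smod_axioms S.smod_axioms sym_class_linear]
    linear_map_ksgn[OF T.smod_axioms S.smod_axioms sym_class_linear]
  have "x \<otimes>\<^bsub>T\<^sub>M\<^esub> y \<ominus>\<^bsub>T\<^sub>M\<^esub> ksgn T\<^sub>M (p * q) (y \<otimes>\<^bsub>T\<^sub>M\<^esub> x) \<in> graded_commutators T\<^sub>M"
    unfolding graded_commutators_def using assms by blast
  then have "x \<otimes>\<^bsub>T\<^sub>M\<^esub> y \<ominus>\<^bsub>T\<^sub>M\<^esub> ksgn T\<^sub>M (p * q) (y \<otimes>\<^bsub>T\<^sub>M\<^esub> x) \<in> supercomm_ideal M"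
    unfolding supercomm_ideal_def using T.genideal_self[OF commutators_closed] by blast
  then have "sym_class M (x \<otimes>\<^bsub>T\<^sub>M\<^esub> y \<ominus>\<^bsub>T\<^sub>M\<^esub> ksgn T\<^sub>M (p * q) (y \<otimes>\<^bsub>T\<^sub>M\<^esub> x)) = \<zero>\<^bsub>S\<^sub>M\<^esub>"
    using c by (subst sym_class_eq_zero_iff) simp_all
  then have "sym_class M (x \<otimes>\<^bsub>T\<^sub>M\<^esub> y) = ksgn S\<^sub>M (p * q) (sym_class M (y \<otimes>\<^bsub>T\<^sub>M\<^esub> x))"
    using c by (simp add: lin S.minus_eq_zero_iff)
  then show ?thesis using c by (simp add: sym_class_mult)
qed

theorem sym_supercommutative: "supercommutative_superalgebra S\<^sub>M"
proof -
  note pi = sym_class_linear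
  note ksg = linear_map_ksgn[OF T.smod_axioms S.smod_axioms sym_class_linear]
  have Seq: "quot T\<^sub>M (supercomm_ideal M) = S\<^sub>M" by (simp add: sym_alg_def)
  have c: "supercomm_ideal M +>\<^bsub>T\<^sub>M\<^esub> x = sym_class M x" for x by (simp add: sym_class_def)
  have S: "(\<lambda>x. sym_class M (T.twist 1 x)) \<in> linear_maps T\<^sub>M S\<^sub>M"
    by (rule linear_map_comp[OF T.twist_linear pi])
  have "supermodule (quot T\<^sub>M (supercomm_ideal M))"
  proof (rule T.quot_supermodule[OF two supercomm_submodule T.grade_submodule, where S = "\<lambda>x. sym_class M (T.twist 1 x)"], unfold Seq c)
    show "\<exists>a\<in>grade T\<^sub>M 0. \<exists>b\<in>grade T\<^sub>M 1. sym_class M x = sym_class M (a \<oplus>\<^bsub>T\<^sub>M\<^esub> b)" if "x \<in> carrier T\<^sub>M" for x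
      using T.parts_exist[OF that] by blast
    show "sym_class M (T.twist 1 x) = ksgn S\<^sub>M p (sym_class M x)" if "x \<in> grade T\<^sub>M p" for x p
      using that by (simp add: T.twist_grade ksg T.grade_carrier)
    show "sym_class M (T.twist 1 x) = \<zero>\<^bsub>S\<^sub>M\<^esub>" if "x \<in> supercomm_ideal M" for x
    proof (rule genideal_in_kernel[OF T.salg_axioms S.smod_axioms S commutators_closed that[unfolded supercomm_ideal_def]])
      fix z g h assume z: "z \<in> graded_commutators T\<^sub>M" and gh: "g \<in> carrier T\<^sub>M" "h \<in> carrier T\<^sub>M"
      from z obtain x y p q where xy: "x \<in> grade T\<^sub>M p" "y \<in> grade T\<^sub>M q"
        and z': "z = x \<otimes>\<^bsub>T\<^sub>M\<^esub> y \<ominus>\<^bsub>T\<^sub>M\<^esub> ksgn T\<^sub>M (p * q) (y \<otimes>\<^bsub>T\<^sub>M\<^esub> x)"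
        unfolding graded_commutators_def by blast
      have "y \<otimes>\<^bsub>T\<^sub>M\<^esub> x \<in> grade T\<^sub>M (p + q)" using T.grade_mult[OF xy(2,1)] by (simp add: add.commute)
      \<comment> \<open>Graded commutators are homogeneous, so the parity involution only changes
        their sign and maps the ideal into itself.\<close>
      then have zg: "z \<in> grade T\<^sub>M (p + q)"
        unfolding z' a_minus_def using T.grade_mult[OF xy] by simp
      have zc: "z \<in> carrier T\<^sub>M" using zg by (rule T.grade_carrier)
      have "z \<in> supercomm_ideal M"
        unfolding supercomm_ideal_def using T.genideal_self[OF commutators_closed] z by blast
      then have "sym_class M z = \<zero>\<^bsub>S\<^sub>M\<^esub>" using sym_class_eq_zero_iff[OF zc] by simp
      then show "sym_class M (T.twist 1 (g \<otimes>\<^bsub>T\<^sub>M\<^esub> z \<otimes>\<^bsub>T\<^sub>M\<^esub> h)) = \<zero>\<^bsub>S\<^sub>M\<^esub>"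
        using gh zc linear_mapsD(1)[OF pi]
        by (simp add: T.twist_mult T.twist_grade[OF zg] sym_class_mult ksg S.sg_mult_left S.sg_mult_right)
    qed
  qed (rule S)
  then interpret sS: supermodule S\<^sub>M by (simp only: Seq)
  show ?thesis
  proof (intro supercommutative_superalgebra.intro superalgebra.intro superalgebra_axioms.intro
      supercommutative_superalgebra_axioms.intro sS.supermodule_axioms S.ring_axioms)
    show "\<one>\<^bsub>S\<^sub>M\<^esub> \<in> grade S\<^sub>M 0" using T.grade_one sym_class_one unfolding sym_grade by (metis imageI)
    show "x \<otimes>\<^bsub>S\<^sub>M\<^esub> y \<in> grade S\<^sub>M (p + q)" if "x \<in> grade S\<^sub>M p" "y \<in> grade S\<^sub>M q" for x y p q
      using that T.grade_mult unfolding sym_grade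
      by (auto simp: sym_class_mult[symmetric] T.grade_carrier)
    show "x \<otimes>\<^bsub>S\<^sub>M\<^esub> y = ksgn S\<^sub>M (p * q) (y \<otimes>\<^bsub>S\<^sub>M\<^esub> x)" if "x \<in> grade S\<^sub>M p" "y \<in> grade S\<^sub>M q" for x y p q
      using that unfolding sym_grade by (elim imageE, hypsubst, intro sym_class_commute)
  qed (simp_all add: S.sm_mult_left S.sm_mult_right)
qed

interpretation S: supercommutative_superalgebra S\<^sub>M by (rule sym_supercommutative)

lemma sw_closed: "w \<in> lists (carrier M) \<Longrightarrow> sw M w \<in> carrier S\<^sub>M"
  unfolding sw_def by (rule linear_mapsD(1)[OF sym_class_linear tw_closed])

lemma sw_append: "\<lbrakk>u \<in> lists (carrier M); v \<in> lists (carrier M)\<rbrakk> \<Longrightarrow> sw M (u @ v) = sw M u \<otimes>\<^bsub>S\<^sub>M\<^esub> sw M v"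
  by (simp add: sw_def tw_append sym_class_mult tw_closed)

lemma sw_Nil: "sw M [] = \<one>\<^bsub>S\<^sub>M\<^esub>"
  by (simp add: sw_def tw_Nil sym_class_one)

lemma sym_gen_eq: "sym_gen M x = sw M [x]"
  by (simp add: sym_gen_def sw_def tw_def tensor_gen_def)

lemma sw_Cons: "\<lbrakk>x \<in> carrier M; w \<in> lists (carrier M)\<rbrakk> \<Longrightarrow> sw M (x # w) = sym_gen M x \<otimes>\<^bsub>S\<^sub>M\<^esub> sw M w"
  using sw_append[of "[x]" w] by (simp add: sym_gen_eq)

lemma sw_grade: "w \<in> hwords M p \<Longrightarrow> sw M w \<in> grade S\<^sub>M p"
  by (simp add: sw_def sym_grade tw_grade)

lemma sw_multilinear: "multilinear M S\<^sub>M (sw M)"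
  unfolding sw_def[abs_def] by (rule multilinear_comp[OF tw_multilinear sym_class_linear])

lemma sym_gen_linear: "sym_gen M \<in> linear_maps M S\<^sub>M"
  using linear_map_comp[OF tw_singleton sym_class_linear] by (simp add: sym_gen_eq[abs_def] sw_def)

lemma sym_gen_grade: "x \<in> grade M p \<Longrightarrow> sym_gen M x \<in> grade S\<^sub>M p"
  unfolding sym_gen_eq by (rule sw_grade) (auto simp: hwords_Cons hwords_Nil)

lemma sym_linear_eqI:
  assumes "smod B" "f \<in> linear_maps S\<^sub>M B" "g \<in> linear_maps S\<^sub>M B"
    and "\<And>w. w \<in> lists (carrier M) \<Longrightarrow> f (sw M w) = g (sw M w)" and "t \<in> carrier S\<^sub>M"
  shows "f t = g t"
  using assms(4,5) tensor_linear_eqI[OF assms(1) linear_map_comp[OF sym_class_linear assms(2)] linear_map_comp[OF sym_class_linear assms(3)]]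
  by (auto simp: sym_carrier sw_def)

lemma sym_grade_eqI:
  assumes "smod B" "f \<in> linear_maps S\<^sub>M B" "g \<in> linear_maps S\<^sub>M B"
    and "\<And>w. w \<in> hwords M p \<Longrightarrow> f (sw M w) = g (sw M w)" and "t \<in> grade S\<^sub>M p"
  shows "f t = g t"
  using assms(4,5) tensor_grade_eqI[OF assms(1) linear_map_comp[OF sym_class_linear assms(2)] linear_map_comp[OF sym_class_linear assms(3)]]
  by (auto simp: sym_grade sw_def)

text \<open>Membership in \<open>H\<close> becomes an equation after composing f with the projection
  to the quotient by \<open>H\<close>, and equations are already reduced to words by
  \<open>tensor_grade_eqI\<close>.\<close>

lemma tensor_grade_mem:
  assumes H: "submodule H scalars B" and B: "smod B" and f: "f \<in> linear_maps T\<^sub>M B"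
    and w: "\<And>w. w \<in> hwords M p \<Longrightarrow> f (tw M w) \<in> H" and t: "t \<in> grade T\<^sub>M p"
  shows "f t \<in> H"
proof -
  interpret B: smod B by fact
  have "H +>\<^bsub>B\<^esub> f t = \<zero>\<^bsub>quot B H\<^esub>"
  proof (rule tensor_grade_eqI[OF B.quot_smod[OF H] linear_map_comp[OF f B.quot_proj[OF H]] linear_maps_zero[OF B.quot_smod[OF H]] _ t])
    show "H +>\<^bsub>B\<^esub> f (tw M w) = \<zero>\<^bsub>quot B H\<^esub>" if "w \<in> hwords M p" for w
      using w[OF that] B.submodD(1)[OF H] by (subst B.quot_eq_zero_iff[OF H]) auto
  qed
  then show ?thesis
    using linear_mapsD(1)[OF f T.grade_carrier[OF t]] by (simp add: B.quot_eq_zero_iff[OF H])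
qed

lemma sym_grade_mem:
  assumes "submodule H scalars B" "smod B" "f \<in> linear_maps S\<^sub>M B"
    and "\<And>w. w \<in> hwords M p \<Longrightarrow> f (sw M w) \<in> H" and "t \<in> grade S\<^sub>M p"
  shows "f t \<in> H"
  using assms(4,5) tensor_grade_mem[OF assms(1,2) linear_map_comp[OF sym_class_linear assms(3)]]
  by (auto simp: sym_grade sw_def)

section \<open>Universal property of the free supercommutative superalgebra\<close>

definition supersymmetric :: "('r, 'b) supermod \<Rightarrow> ('m list \<Rightarrow> 'b) \<Rightarrow> bool" where
  "supersymmetric B F \<longleftrightarrow> (\<forall>u\<in>lists (carrier M). \<forall>v\<in>lists (carrier M). \<forall>p q.
     \<forall>x\<in>grade M p. \<forall>y\<in>grade M q. F (u @ x # y # v) = ksgn B (p * q) (F (u @ y # x # v)))"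

lemma supersymmetric_letter:
  assumes "smod B" "multilinear M B F" "supersymmetric B F"
    and "u \<in> lists (carrier M)" "v \<in> lists (carrier M)" "x \<in> grade M p" "w \<in> hwords M q"
  shows "F (u @ x # w @ v) = ksgn B (p * q) (F (u @ w @ x # v))"
  using assms(4-)
proof (induction w arbitrary: u q)
  case Nil
  interpret B: smod B by fact
  show ?case using Nil by (simp add: hwords_Nil)
next
  case (Cons y w)
  interpret B: smod B by fact
  obtain r s where y: "y \<in> grade M r" "w \<in> hwords M s" "q = r + s" using Cons.prems(4) by (auto simp: hwords_Cons)
  have c: "y \<in> carrier M" "w \<in> lists (carrier M)" "x \<in> carrier M"
    using y Cons.prems(3) hwords_lists by (auto simp: grade_carrier)
  have "F (u @ x # y # (w @ v)) = ksgn B (p * r) (F (u @ y # x # (w @ v)))"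
    using assms(3) Cons.prems y c unfolding supersymmetric_def by (metis append_in_lists_conv)
  also have "\<dots> = ksgn B (p * r) (ksgn B (p * s) (F ((u @ [y]) @ w @ x # v)))"
    using Cons.IH[of "u @ [y]" s] Cons.prems y c by simp
  also have "\<dots> = ksgn B (p * q) (F (u @ (y # w) @ x # v))"
    using multilinearD(1)[OF assms(2), of "u @ y # w @ x # v"] Cons.prems c y(3)
    by (simp add: B.sg_sg distrib_left)
  finally show ?case by simp
qed

lemma supersymmetric_block:
  assumes "smod B" "multilinear M B F" "supersymmetric B F"
    and "u \<in> lists (carrier M)" "v \<in> lists (carrier M)" "w \<in> hwords M p" "w' \<in> hwords M q"
  shows "F (u @ w @ w' @ v) = ksgn B (p * q) (F (u @ w' @ w @ v))"
  using assms(4-)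
proof (induction w arbitrary: u p)
  case Nil
  interpret B: smod B by fact
  show ?case using Nil by (simp add: hwords_Nil)
next
  case (Cons x w)
  interpret B: smod B by fact
  obtain r s where x: "x \<in> grade M r" "w \<in> hwords M s" "p = r + s" using Cons.prems(3) by (auto simp: hwords_Cons)
  have c: "x \<in> carrier M" "w \<in> lists (carrier M)" "w' \<in> lists (carrier M)"
    using x Cons.prems(4) hwords_lists by (auto simp: grade_carrier)
  have "F (u @ (x # w) @ w' @ v) = ksgn B (s * q) (F (u @ x # w' @ (w @ v)))"
    using Cons.IH[of "u @ [x]" s] Cons.prems x c by simp
  also have "\<dots> = ksgn B (s * q) (ksgn B (r * q) (F (u @ w' @ x # w @ v)))"
    using supersymmetric_letter[OF assms(1-3), of u "w @ v" x r w' q] Cons.prems x c by simp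
  also have "\<dots> = ksgn B (p * q) (F (u @ w' @ (x # w) @ v))"
    using multilinearD(1)[OF assms(2), of "u @ w' @ x # w @ v"] Cons.prems c x(3)
    by (simp add: B.sg_sg distrib_right add.commute)
  finally show ?case by simp
qed

text \<open>The ideal is generated by commutators of arbitrary homogeneous tensors, whereas
  \<open>supersymmetric\<close> speaks of two adjacent letters. The facts 0 to 4 bridge the gap:
  homogeneous blocks are exchanged first, then each block is replaced by a homogeneous tensor and
  each outer word by an arbitrary tensor, one argument at a time by linearity.\<close>

theorem sym_universal:
  assumes B: "smod B" and F: "multilinear M B F" and sF: "supersymmetric B F"
  obtains L where "L \<in> linear_maps S\<^sub>M B" "\<And>w. w \<in> lists (carrier M) \<Longrightarrow> L (sw M w) = F w"
proof -
  interpret B: smod B by fact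
  obtain L where L: "L \<in> linear_maps T\<^sub>M B" "\<And>w. w \<in> lists (carrier M) \<Longrightarrow> L (tw M w) = F w"
    using tensor_universal[OF B F] by blast
  have tc: "tw M w \<in> carrier T\<^sub>M" if "w \<in> lists (carrier M)" for w by (rule tw_closed[OF that])
  have lm: "(\<lambda>x. L (a \<otimes>\<^bsub>T\<^sub>M\<^esub> x \<otimes>\<^bsub>T\<^sub>M\<^esub> b)) \<in> linear_maps T\<^sub>M B" if "a \<in> carrier T\<^sub>M" "b \<in> carrier T\<^sub>M" for a b
    by (rule linear_map_sandwich[OF T.salg_axioms B L(1) that])
  let ?sw = "\<lambda>p q a x y b. L (a \<otimes>\<^bsub>T\<^sub>M\<^esub> (x \<otimes>\<^bsub>T\<^sub>M\<^esub> y) \<otimes>\<^bsub>T\<^sub>M\<^esub> b) = ksgn B (p * q) (L (a \<otimes>\<^bsub>T\<^sub>M\<^esub> (y \<otimes>\<^bsub>T\<^sub>M\<^esub> x) \<otimes>\<^bsub>T\<^sub>M\<^esub> b))"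
  have 0: "?sw p q (tw M u) (tw M w) (tw M w') (tw M v)"
    if "u \<in> lists (carrier M)" "v \<in> lists (carrier M)" "w \<in> hwords M p" "w' \<in> hwords M q" for p q u v w w'
    using supersymmetric_block[OF B F sF that] that hwords_lists
    by (simp add: tw_append[symmetric] L(2) del: append_assoc) (simp add: L(2))
  have 1: "?sw p q (tw M u) x (tw M w') (tw M v)"
    if "u \<in> lists (carrier M)" "v \<in> lists (carrier M)" "x \<in> grade T\<^sub>M p" "w' \<in> hwords M q" for p q u v x w'
  proof (rule tensor_grade_eqI[OF B, where f = "\<lambda>x. L (tw M u \<otimes>\<^bsub>T\<^sub>M\<^esub> (x \<otimes>\<^bsub>T\<^sub>M\<^esub> tw M w') \<otimes>\<^bsub>T\<^sub>M\<^esub> tw M v)"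
        and g = "\<lambda>x. ksgn B (p * q) (L (tw M u \<otimes>\<^bsub>T\<^sub>M\<^esub> (tw M w' \<otimes>\<^bsub>T\<^sub>M\<^esub> x) \<otimes>\<^bsub>T\<^sub>M\<^esub> tw M v))"])
    show "(\<lambda>x. L (tw M u \<otimes>\<^bsub>T\<^sub>M\<^esub> (x \<otimes>\<^bsub>T\<^sub>M\<^esub> tw M w') \<otimes>\<^bsub>T\<^sub>M\<^esub> tw M v)) \<in> linear_maps T\<^sub>M B"
      "(\<lambda>x. ksgn B (p * q) (L (tw M u \<otimes>\<^bsub>T\<^sub>M\<^esub> (tw M w' \<otimes>\<^bsub>T\<^sub>M\<^esub> x) \<otimes>\<^bsub>T\<^sub>M\<^esub> tw M v))) \<in> linear_maps T\<^sub>M B"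
      by (intro linear_map_comp[OF T.mult_linear_right lm] linear_map_comp[OF T.mult_linear_left lm] linear_maps_ksgn[OF B] tc that hwords_lists[OF that(4)])+
  qed (use that 0[OF that(1,2) _ that(4)] in simp_all)
  have 2: "?sw p q (tw M u) x y (tw M v)"
    if "u \<in> lists (carrier M)" "v \<in> lists (carrier M)" "x \<in> grade T\<^sub>M p" "y \<in> grade T\<^sub>M q" for p q u v x y
  proof (rule tensor_grade_eqI[OF B, where f = "\<lambda>y. L (tw M u \<otimes>\<^bsub>T\<^sub>M\<^esub> (x \<otimes>\<^bsub>T\<^sub>M\<^esub> y) \<otimes>\<^bsub>T\<^sub>M\<^esub> tw M v)"
        and g = "\<lambda>y. ksgn B (p * q) (L (tw M u \<otimes>\<^bsub>T\<^sub>M\<^esub> (y \<otimes>\<^bsub>T\<^sub>M\<^esub> x) \<otimes>\<^bsub>T\<^sub>M\<^esub> tw M v))"])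
    show "(\<lambda>y. L (tw M u \<otimes>\<^bsub>T\<^sub>M\<^esub> (x \<otimes>\<^bsub>T\<^sub>M\<^esub> y) \<otimes>\<^bsub>T\<^sub>M\<^esub> tw M v)) \<in> linear_maps T\<^sub>M B"
      "(\<lambda>y. ksgn B (p * q) (L (tw M u \<otimes>\<^bsub>T\<^sub>M\<^esub> (y \<otimes>\<^bsub>T\<^sub>M\<^esub> x) \<otimes>\<^bsub>T\<^sub>M\<^esub> tw M v))) \<in> linear_maps T\<^sub>M B"
      by (intro linear_map_comp[OF T.mult_linear_right lm] linear_map_comp[OF T.mult_linear_left lm] linear_maps_ksgn[OF B] tc that T.grade_carrier[OF that(3)])+
  qed (use that 1[OF that(1,2,3)] in simp_all)
  have 3: "?sw p q a x y (tw M v)"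
    if "a \<in> carrier T\<^sub>M" "v \<in> lists (carrier M)" "x \<in> grade T\<^sub>M p" "y \<in> grade T\<^sub>M q" for p q a v x y
  proof (rule tensor_linear_eqI[OF B, where f = "\<lambda>a. L (a \<otimes>\<^bsub>T\<^sub>M\<^esub> (x \<otimes>\<^bsub>T\<^sub>M\<^esub> y) \<otimes>\<^bsub>T\<^sub>M\<^esub> tw M v)"
        and g = "\<lambda>a. ksgn B (p * q) (L (a \<otimes>\<^bsub>T\<^sub>M\<^esub> (y \<otimes>\<^bsub>T\<^sub>M\<^esub> x) \<otimes>\<^bsub>T\<^sub>M\<^esub> tw M v))"])
    note xy = T.grade_carrier[OF that(3)] T.grade_carrier[OF that(4)]
    show "(\<lambda>a. L (a \<otimes>\<^bsub>T\<^sub>M\<^esub> (x \<otimes>\<^bsub>T\<^sub>M\<^esub> y) \<otimes>\<^bsub>T\<^sub>M\<^esub> tw M v)) \<in> linear_maps T\<^sub>M B"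
      "(\<lambda>a. ksgn B (p * q) (L (a \<otimes>\<^bsub>T\<^sub>M\<^esub> (y \<otimes>\<^bsub>T\<^sub>M\<^esub> x) \<otimes>\<^bsub>T\<^sub>M\<^esub> tw M v))) \<in> linear_maps T\<^sub>M B"
      by (intro linear_maps_ksgn[OF B] linear_map_comp[OF linear_map_comp[OF T.mult_linear_right T.mult_linear_right] L(1)] T.m_closed tc xy that(2))+
  qed (use that 2[OF _ that(2-4)] in simp_all)
  have 4: "?sw p q a x y b"
    if "a \<in> carrier T\<^sub>M" "b \<in> carrier T\<^sub>M" "x \<in> grade T\<^sub>M p" "y \<in> grade T\<^sub>M q" for p q a b x y
  proof (rule tensor_linear_eqI[OF B, where f = "\<lambda>b. L (a \<otimes>\<^bsub>T\<^sub>M\<^esub> (x \<otimes>\<^bsub>T\<^sub>M\<^esub> y) \<otimes>\<^bsub>T\<^sub>M\<^esub> b)"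
        and g = "\<lambda>b. ksgn B (p * q) (L (a \<otimes>\<^bsub>T\<^sub>M\<^esub> (y \<otimes>\<^bsub>T\<^sub>M\<^esub> x) \<otimes>\<^bsub>T\<^sub>M\<^esub> b))"])
    note xy = T.grade_carrier[OF that(3)] T.grade_carrier[OF that(4)]
    show "(\<lambda>b. L (a \<otimes>\<^bsub>T\<^sub>M\<^esub> (x \<otimes>\<^bsub>T\<^sub>M\<^esub> y) \<otimes>\<^bsub>T\<^sub>M\<^esub> b)) \<in> linear_maps T\<^sub>M B"
      "(\<lambda>b. ksgn B (p * q) (L (a \<otimes>\<^bsub>T\<^sub>M\<^esub> (y \<otimes>\<^bsub>T\<^sub>M\<^esub> x) \<otimes>\<^bsub>T\<^sub>M\<^esub> b))) \<in> linear_maps T\<^sub>M B"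
      by (intro linear_maps_ksgn[OF B] linear_map_comp[OF T.mult_linear_left L(1)] T.m_closed xy that(1))+
  qed (use that 3[OF that(1) _ that(3-4)] in simp_all)
  have ker: "L z = \<zero>\<^bsub>B\<^esub>" if "z \<in> supercomm_ideal M" for z
  proof (rule genideal_in_kernel[OF T.salg_axioms B L(1) commutators_closed that[unfolded supercomm_ideal_def]])
    fix z g h assume z: "z \<in> graded_commutators T\<^sub>M" and gh: "g \<in> carrier T\<^sub>M" "h \<in> carrier T\<^sub>M"
    from z obtain x y p q where xy: "x \<in> grade T\<^sub>M p" "y \<in> grade T\<^sub>M q"
      and z': "z = x \<otimes>\<^bsub>T\<^sub>M\<^esub> y \<ominus>\<^bsub>T\<^sub>M\<^esub> ksgn T\<^sub>M (p * q) (y \<otimes>\<^bsub>T\<^sub>M\<^esub> x)"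
      unfolding graded_commutators_def by blast
    note c = T.grade_carrier[OF xy(1)] T.grade_carrier[OF xy(2)]
    note s = lm[OF gh]
    have "L (g \<otimes>\<^bsub>T\<^sub>M\<^esub> z \<otimes>\<^bsub>T\<^sub>M\<^esub> h) = L (g \<otimes>\<^bsub>T\<^sub>M\<^esub> (x \<otimes>\<^bsub>T\<^sub>M\<^esub> y) \<otimes>\<^bsub>T\<^sub>M\<^esub> h) \<ominus>\<^bsub>B\<^esub> ksgn B (p * q) (L (g \<otimes>\<^bsub>T\<^sub>M\<^esub> (y \<otimes>\<^bsub>T\<^sub>M\<^esub> x) \<otimes>\<^bsub>T\<^sub>M\<^esub> h))"
      unfolding z' using c
      by (simp add: linear_map_minus[OF T.smod_axioms B s] linear_map_ksgn[OF T.smod_axioms B s])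
    also have "\<dots> = \<zero>\<^bsub>B\<^esub>"
      unfolding 4[OF gh xy] using linear_mapsD(1)[OF s] c by (simp add: B.minus_eq_zero_iff)
    finally show "L (g \<otimes>\<^bsub>T\<^sub>M\<^esub> z \<otimes>\<^bsub>T\<^sub>M\<^esub> h) = \<zero>\<^bsub>B\<^esub>" .
  qed
  obtain L' where L': "L' \<in> linear_maps S\<^sub>M B" "\<And>x. x \<in> carrier T\<^sub>M \<Longrightarrow> L' (sym_class M x) = L x"
    using T.quot_lift[OF supercomm_submodule B L(1) ker] unfolding sym_class_def sym_alg_def by blast
  show ?thesis
    by (rule that[OF L'(1)]) (simp add: sw_def L'(2) L(2) tc)
qed

lemma sw_swap: "supersymmetric S\<^sub>M (sw M)"
  unfolding supersymmetric_def
proof (intro ballI allI)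
  fix u v p q x y assume uv: "u \<in> lists (carrier M)" "v \<in> lists (carrier M)" and xy: "x \<in> grade M p" "y \<in> grade M q"
  note c = xy[THEN grade_carrier]
  note g = sym_gen_grade[OF xy(1)] sym_gen_grade[OF xy(2)]
  note gc = g[THEN S.grade_carrier]
  have "sym_gen M x \<otimes>\<^bsub>S\<^sub>M\<^esub> (sym_gen M y \<otimes>\<^bsub>S\<^sub>M\<^esub> sw M v) = ksgn S\<^sub>M (p * q) (sym_gen M y \<otimes>\<^bsub>S\<^sub>M\<^esub> (sym_gen M x \<otimes>\<^bsub>S\<^sub>M\<^esub> sw M v))"
    using S.supercomm[OF g] gc sw_closed[OF uv(2)]
    by (simp add: S.m_assoc[symmetric] S.sg_mult_left)
  then show "sw M (u @ x # y # v) = ksgn S\<^sub>M (p * q) (sw M (u @ y # x # v))"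
    using uv c gc by (simp add: sw_append sw_Cons sw_closed S.sg_mult_right)
qed

end

section \<open>Differential operators\<close>

lemma hom_endsD:
  assumes "D \<in> hom_ends A d"
  shows "D \<in> linear_maps A A" "x \<in> grade A p \<Longrightarrow> D x \<in> grade A (d + p)"
  using assms by (auto simp: hom_ends_def)

lemma hom_endsI:
  "\<lbrakk>D \<in> linear_maps A A; \<And>p x. x \<in> grade A p \<Longrightarrow> D x \<in> grade A (d + p)\<rbrakk> \<Longrightarrow> D \<in> hom_ends A d"
  by (auto simp: hom_ends_def)

lemma linear_maps_cong:
  assumes "smod M" "\<And>x. x \<in> carrier M \<Longrightarrow> f x = g x" "g \<in> linear_maps M N"
  shows "f \<in> linear_maps M N"
proof -
  interpret smod M by fact
  show ?thesis using linear_mapsD[OF assms(3)] assms(2) by (intro linear_mapsI) simp_all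
qed

text \<open>With the index shifted by one, the recursion starts at the zero operator.\<close>

primrec dop :: "('r, 'm) supermod \<Rightarrow> nat \<Rightarrow> bit \<Rightarrow> ('m \<Rightarrow> 'm) \<Rightarrow> bool" where
  "dop A 0 d D \<longleftrightarrow> D \<in> hom_ends A d \<and> (\<forall>x\<in>carrier A. D x = \<zero>\<^bsub>A\<^esub>)"
| "dop A (Suc n) d D \<longleftrightarrow> D \<in> hom_ends A d \<and>
    (\<forall>e. \<forall>a\<in>grade A e. dop A n (d + e) (mult_commutator A d D e a))"

context supercommutative_superalgebra
begin

lemma hom_ends_cong:
  assumes "\<And>x. x \<in> carrier A \<Longrightarrow> D x = D' x" "D' \<in> hom_ends A d"
  shows "D \<in> hom_ends A d"
  using assms(1) hom_endsD[OF assms(2)]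
  by (intro hom_endsI linear_maps_cong[OF smod_axioms assms(1)]) (auto simp: grade_carrier)

lemma dop_cong:
  assumes "\<And>x. x \<in> carrier A \<Longrightarrow> D x = D' x" "dop A n d D'"
  shows "dop A n d D"
  using assms
proof (induction n arbitrary: d D D')
  case 0
  then show ?case using hom_ends_cong[of D D' d] by simp
next
  case (Suc n)
  have "dop A n (d + e) (mult_commutator A d D e a)" if "a \<in> grade A e" for a e
  proof (rule Suc.IH)
    show "dop A n (d + e) (mult_commutator A d D' e a)" using Suc.prems(2) that by simp
    show "mult_commutator A d D e a x = mult_commutator A d D' e a x" if "x \<in> carrier A" for x
      using Suc.prems(1) that grade_carrier[OF \<open>a \<in> grade A e\<close>] by (simp add: mult_commutator_def)
  qed
  then show ?case using Suc.prems hom_ends_cong[of D D' d] by simp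
qed

lemma diff_op_iff_dop: "diff_op A n d D \<longleftrightarrow> dop A (Suc n) d D"
proof (induction n arbitrary: d D)
  case 0
  have "mult_commutator A d D e a \<in> hom_ends A (d + e)"
    if "D \<in> hom_ends A d" "a \<in> grade A e" "\<forall>x\<in>carrier A. mult_commutator A d D e a x = \<zero>" for e a
    using that(3) by (intro hom_ends_cong[OF _ hom_endsI[OF linear_maps_zero[OF smod_axioms]]]) simp_all
  then show ?case by auto
qed simp

lemma dop_hom: "dop A n d D \<Longrightarrow> D \<in> hom_ends A d"
  by (cases n) auto

lemma mult_commutator_hom:
  assumes D: "D \<in> hom_ends A d" and a: "a \<in> grade A e"
  shows "mult_commutator A d D e a \<in> hom_ends A (d + e)"
proof -
  have ac: "a \<in> carrier A" by (rule grade_carrier[OF a])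
  note Dl = linear_mapsD(1)[OF hom_endsD(1)[OF D]]
  have eq: "mult_commutator A d D e a x = D (a \<otimes> x) \<oplus> ksgn A (1 + d * e) (a \<otimes> D x)" if "x \<in> carrier A" for x
    using that ac Dl by (simp add: mult_commutator_def a_minus_def sg_sg[symmetric] sg_1)
  show ?thesis
  proof (rule hom_ends_cong[OF eq hom_endsI])
    show "(\<lambda>x. D (a \<otimes> x) \<oplus> ksgn A (1 + d * e) (a \<otimes> D x)) \<in> linear_maps A A"
      by (intro linear_maps_add linear_maps_ksgn smod_axioms linear_map_comp[OF mult_linear_left[OF ac]]
          linear_map_comp[OF _ mult_linear_left[OF ac]] hom_endsD(1)[OF D])
    fix p x assume x: "x \<in> grade A p"
    show "D (a \<otimes> x) \<oplus> ksgn A (1 + d * e) (a \<otimes> D x) \<in> grade A (d + e + p)"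
      using hom_endsD(2)[OF D grade_mult[OF a x]] grade_mult[OF a hom_endsD(2)[OF D x]]
      by (simp add: add.assoc add.left_commute)
  qed
qed

lemma dop_zero: "dop A n d (\<lambda>x. \<zero>)"
proof (induction n arbitrary: d)
  have h: "(\<lambda>x. \<zero>) \<in> hom_ends A d" for d by (intro hom_endsI linear_maps_zero smod_axioms) simp
  {
    case 0 show ?case using h by simp
  next
    case (Suc n)
    have "dop A n (d + e) (mult_commutator A d (\<lambda>x. \<zero>) e a)" if "a \<in> grade A e" for a e
      using that Suc by (intro dop_cong[OF _ Suc[of "d + e"]]) (simp add: mult_commutator_def grade_carrier)
    then show ?case using h by simp
  }
qed

lemma dop_add:
  assumes "dop A n d D" "dop A n d D'"
  shows "dop A n d (\<lambda>x. D x \<oplus> D' x)"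
  using assms
proof (induction n arbitrary: d D D')
  have h: "(\<lambda>x. D x \<oplus> D' x) \<in> hom_ends A d" if "D \<in> hom_ends A d" "D' \<in> hom_ends A d" for d D D'
    using hom_endsD(2)[OF that(1)] hom_endsD(2)[OF that(2)]
    by (intro hom_endsI linear_maps_add smod_axioms hom_endsD(1)[OF that(1)] hom_endsD(1)[OF that(2)]) simp
  {
    case 0 then show ?case using h by simp
  next
    case (Suc n)
    have "dop A n (d + e) (mult_commutator A d (\<lambda>x. D x \<oplus> D' x) e a)" if a: "a \<in> grade A e" for a e
    proof (rule dop_cong)
      show "dop A n (d + e) (\<lambda>x. mult_commutator A d D e a x \<oplus> mult_commutator A d D' e a x)"
        using Suc a by simp
      have ac: "a \<in> carrier A" by (rule grade_carrier[OF a])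
      note l = linear_mapsD(1)[OF hom_endsD(1)[OF dop_hom[OF Suc.prems(1)]]] linear_mapsD(1)[OF hom_endsD(1)[OF dop_hom[OF Suc.prems(2)]]]
      show "mult_commutator A d (\<lambda>x. D x \<oplus> D' x) e a x = mult_commutator A d D e a x \<oplus> mult_commutator A d D' e a x"
        if "x \<in> carrier A" for x
        using that ac l by (simp add: mult_commutator_def a_minus_def r_distr sg_add minus_add a_ac)
    qed
    then show ?case using Suc.prems h by simp
  }
qed

lemma dop_smult:
  assumes "dop A n d D" shows "dop A n d (\<lambda>x. r \<odot> D x)"
  using assms
proof (induction n arbitrary: d D)
  have h: "(\<lambda>x. r \<odot> D x) \<in> hom_ends A d" if "D \<in> hom_ends A d" for d D
    using hom_endsD(2)[OF that] by (intro hom_endsI linear_maps_smult smod_axioms hom_endsD(1)[OF that]) simp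
  {
    case 0 then show ?case using h by simp
  next
    case (Suc n)
    have "dop A n (d + e) (mult_commutator A d (\<lambda>x. r \<odot> D x) e a)" if a: "a \<in> grade A e" for a e
    proof (rule dop_cong)
      show "dop A n (d + e) (\<lambda>x. r \<odot> mult_commutator A d D e a x)" using Suc a by simp
      have ac: "a \<in> carrier A" by (rule grade_carrier[OF a])
      note l = linear_mapsD(1)[OF hom_endsD(1)[OF dop_hom[OF Suc.prems(1)]]]
      show "mult_commutator A d (\<lambda>x. r \<odot> D x) e a x = r \<odot> mult_commutator A d D e a x"
        if "x \<in> carrier A" for x
        using that ac l by (simp add: mult_commutator_def a_minus_def sm_radd sm_minus sg_smult sm_mult_right)
    qed
    then show ?case using Suc.prems h by simp
  }
qed

lemma dop_ksgn:
  assumes "dop A n d D" shows "dop A n d (\<lambda>x. ksgn A e (D x))"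
  by (rule dop_cong[OF _ dop_smult[OF assms, of "if e = 0 then 1 else - 1"]])
    (use linear_mapsD(1)[OF hom_endsD(1)[OF dop_hom[OF assms]]] in \<open>simp add: ksgn_def sm_lminus\<close>)

lemma commute_left:
  assumes "a \<in> grade A p" "b \<in> grade A q" "x \<in> carrier A"
  shows "a \<otimes> (b \<otimes> x) = ksgn A (p * q) (b \<otimes> (a \<otimes> x))"
  using supercomm[OF assms(1,2)] assms(3) assms(1,2)[THEN grade_carrier]
  by (simp add: m_assoc[symmetric] sg_mult_left)

text \<open>Multiplication by b supercommutes with every multiplication, so taking the commutator of
  the composite with a only affects D, and the order is not raised.\<close>

lemma dop_mult_left:
  assumes "dop A n d D" "b \<in> grade A q"
  shows "dop A n (q + d) (\<lambda>x. b \<otimes> D x)"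
  using assms(1)
proof (induction n arbitrary: d D)
  have bc: "b \<in> carrier A" by (rule grade_carrier[OF assms(2)])
  have h: "(\<lambda>x. b \<otimes> D x) \<in> hom_ends A (q + d)" if "D \<in> hom_ends A d" for d D
    using grade_mult[OF assms(2) hom_endsD(2)[OF that]]
    by (intro hom_endsI linear_map_comp[OF hom_endsD(1)[OF that] mult_linear_left[OF bc]]) (simp add: add.assoc)
  {
    case 0 then show ?case using h bc by simp
  next
    case (Suc n)
    have "dop A n (q + d + e) (mult_commutator A (q + d) (\<lambda>x. b \<otimes> D x) e a)" if a: "a \<in> grade A e" for a e
    proof (rule dop_cong)
      show "dop A n (q + d + e) (\<lambda>x. b \<otimes> mult_commutator A d D e a x)"
        using Suc.IH[of "d + e"] Suc.prems a by (simp add: add.assoc)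
      have ac: "a \<in> carrier A" by (rule grade_carrier[OF a])
      note l = linear_mapsD(1)[OF hom_endsD(1)[OF dop_hom[OF Suc.prems(1)]]]
      show "mult_commutator A (q + d) (\<lambda>x. b \<otimes> D x) e a x = b \<otimes> mult_commutator A d D e a x"
        if x: "x \<in> carrier A" for x
        using x ac bc l[OF x] l[OF m_closed[OF ac x]] commute_left[OF a assms(2) l[OF x]]
        by (simp add: mult_commutator_def a_minus_def r_distr r_minus sg_mult_right sg_sg distrib_left distrib_right mult.commute add_ac)
    qed
    then show ?case using Suc.prems h by simp
  }
qed

lemma dop_mult_right:
  assumes "dop A n d D" "b \<in> grade A q"
  shows "dop A n (d + q) (\<lambda>x. D (b \<otimes> x))"
  using assms(1)
proof (induction n arbitrary: d D)
  have bc: "b \<in> carrier A" by (rule grade_carrier[OF assms(2)])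
  have h: "(\<lambda>x. D (b \<otimes> x)) \<in> hom_ends A (d + q)" if "D \<in> hom_ends A d" for d D
    using hom_endsD(2)[OF that grade_mult[OF assms(2)]]
    by (intro hom_endsI linear_map_comp[OF mult_linear_left[OF bc] hom_endsD(1)[OF that]]) (simp add: add.assoc)
  {
    case 0 then show ?case using h bc by simp
  next
    case (Suc n)
    have "dop A n (d + q + e) (mult_commutator A (d + q) (\<lambda>x. D (b \<otimes> x)) e a)" if a: "a \<in> grade A e" for a e
    proof (rule dop_cong)
      have "dop A n (d + e + q) (\<lambda>x. mult_commutator A d D e a (b \<otimes> x))"
        using Suc.IH[of "d + e"] Suc.prems a by simp
      moreover have "d + e + q = d + q + e" by (simp only: add_ac)
      ultimately show "dop A n (d + q + e) (\<lambda>x. ksgn A (q * e) (mult_commutator A d D e a (b \<otimes> x)))"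
        using dop_ksgn by simp
      have ac: "a \<in> carrier A" by (rule grade_carrier[OF a])
      have dl: "D \<in> linear_maps A A" by (rule hom_endsD(1)[OF dop_hom[OF Suc.prems(1)]])
      note l = linear_mapsD(1)[OF dl]
      show "mult_commutator A (d + q) (\<lambda>x. D (b \<otimes> x)) e a x = ksgn A (q * e) (mult_commutator A d D e a (b \<otimes> x))"
        if x: "x \<in> carrier A" for x
      proof -
        have "D (b \<otimes> (a \<otimes> x)) = ksgn A (q * e) (D (a \<otimes> (b \<otimes> x)))"
          using commute_left[OF assms(2) a x] linear_map_ksgn[OF smod_axioms smod_axioms dl] ac bc x by simp
        then show ?thesis using x ac bc l
          by (simp add: mult_commutator_def a_minus_def sg_add sg_inv sg_sg distrib_right add.commute)
      qed
    qed
    then show ?case using Suc.prems h by simp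
  }
qed

lemma dop_mult:
  assumes "c \<in> grade A d" shows "dop A 1 d (\<lambda>x. c \<otimes> x)"
proof -
  have cc: "c \<in> carrier A" by (rule grade_carrier[OF assms])
  have "(\<lambda>x. c \<otimes> x) \<in> hom_ends A d"
    by (intro hom_endsI mult_linear_left[OF cc] grade_mult[OF assms])
  moreover have "mult_commutator A d (\<lambda>x. c \<otimes> x) e a x = \<zero>" if "a \<in> grade A e" "x \<in> carrier A" for e a x
    using that commute_left[OF assms that] cc grade_carrier[OF that(1)]
    by (simp add: mult_commutator_def minus_eq_zero_iff)
  ultimately show ?thesis using mult_commutator_hom by simp
qed

text \<open>A Leibniz rule in the multiplier: D is moved past a and then past b, and the two
  intermediate terms cancel. It permits induction over products of generators.\<close>

lemma mult_commutator_mult: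
  assumes D: "D \<in> hom_ends A d" and a: "a \<in> grade A p" and b: "b \<in> grade A q" and x: "x \<in> carrier A"
  shows "mult_commutator A d D (p + q) (a \<otimes> b) x =
    mult_commutator A d D p a (b \<otimes> x) \<oplus> ksgn A (d * p) (a \<otimes> mult_commutator A d D q b x)"
proof -
  note c = a[THEN grade_carrier] b[THEN grade_carrier] linear_mapsD(1)[OF hom_endsD(1)[OF D]]
  let ?y = "ksgn A (d * p) (a \<otimes> D (b \<otimes> x))"
  have "(D (a \<otimes> (b \<otimes> x)) \<oplus> \<ominus> ?y) \<oplus> (?y \<oplus> \<ominus> ksgn A (d * p + d * q) (a \<otimes> (b \<otimes> D x))) =
    D (a \<otimes> (b \<otimes> x)) \<oplus> \<ominus> ksgn A (d * p + d * q) (a \<otimes> (b \<otimes> D x))"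
    using c x by (simp add: a_assoc r_neg1)
  then show ?thesis
    using c x by (simp add: mult_commutator_def a_minus_def m_assoc r_distr sg_add sg_mult_right sg_sg sg_inv r_minus distrib_left)
qed

end

section \<open>Operators on the free supercommutative superalgebra\<close>

context supermodule
begin

text \<open>The component of parity p. It serves to extend constructions that depend on the parity
  of their argument to inhomogeneous elements.\<close>

definition part :: "bit \<Rightarrow> 'm \<Rightarrow> 'm" where
  "part p x = (THE y. \<exists>a\<in>grade M 0. \<exists>b\<in>grade M 1. x = a \<oplus> b \<and> y = (if p = 0 then a else b))"

lemma part_eq:
  assumes "a \<in> grade M 0" "b \<in> grade M 1"
  shows "part p (a \<oplus> b) = (if p = 0 then a else b)"
  unfolding part_def
proof (rule the_equality)
  show "\<exists>a'\<in>grade M 0. \<exists>b'\<in>grade M 1. a \<oplus> b = a' \<oplus> b' \<and> (if p = 0 then a else b) = (if p = 0 then a' else b')"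
    using assms by blast
next
  fix y assume "\<exists>a'\<in>grade M 0. \<exists>b'\<in>grade M 1. a \<oplus> b = a' \<oplus> b' \<and> y = (if p = 0 then a' else b')"
  then obtain a' b' where *: "a' \<in> grade M 0" "b' \<in> grade M 1" "a \<oplus> b = a' \<oplus> b'" "y = (if p = 0 then a' else b')"
    by blast
  show "y = (if p = 0 then a else b)" using parts_unique[OF assms *(1-3)] *(4) by simp
qed

lemma part_grade:
  assumes "x \<in> carrier M" shows "part p x \<in> grade M p"
proof -
  obtain a b where "a \<in> grade M 0" "b \<in> grade M 1" "x = a \<oplus> b" using parts_exist[OF assms] by blast
  then show ?thesis by (cases p) (simp_all add: part_eq)
qed

lemma part_homogeneous: "x \<in> grade M q \<Longrightarrow> part p x = (if p = q then x else \<zero>)"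
  using part_eq[of x "\<zero>" p] part_eq[of "\<zero>" x p] by (cases q; cases p) (simp_all add: grade_carrier)

lemma part_linear: "part p \<in> linear_maps M M"
proof (rule linear_mapsI)
  fix x y r assume x: "x \<in> carrier M"
  then show "part p x \<in> carrier M" using part_grade grade_carrier by blast
  obtain a b where ab: "a \<in> grade M 0" "b \<in> grade M 1" "x = a \<oplus> b" using parts_exist[OF x] by blast
  have "r \<odot> x = r \<odot> a \<oplus> r \<odot> b" using ab by (simp add: sm_radd grade_carrier)
  then show "part p (r \<odot> x) = r \<odot> part p x" using ab part_eq[of "r \<odot> a" "r \<odot> b"] by (simp add: part_eq)
  assume "y \<in> carrier M"
  then obtain a' b' where ab': "a' \<in> grade M 0" "b' \<in> grade M 1" "y = a' \<oplus> b'" using parts_exist by blast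
  have "x \<oplus> y = (a \<oplus> a') \<oplus> (b \<oplus> b')" using ab(1,2) ab'(1,2) by (simp add: ab(3) ab'(3) a_ac grade_carrier)
  then show "part p (x \<oplus> y) = part p x \<oplus> part p y"
    using ab ab' part_eq[of "a \<oplus> a'" "b \<oplus> b'"] by (simp add: part_eq)
qed

end

context supermodule2
begin

interpretation S: supercommutative_superalgebra S\<^sub>M by (rule sym_supercommutative)

abbreviation gen :: "'m \<Rightarrow> ('r, 'm) symm" where "gen \<equiv> sym_gen M"

lemma gen_closed: "x \<in> carrier M \<Longrightarrow> gen x \<in> carrier S\<^sub>M"
  by (rule linear_mapsD(1)[OF sym_gen_linear])

lemma sw_Cons_grade:
  assumes "x \<in> grade M p" "w \<in> hwords M q" shows "sw M (x # w) = gen x \<otimes>\<^bsub>S\<^sub>M\<^esub> sw M w"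
  using sw_Cons grade_carrier[OF assms(1)] hwords_lists[OF assms(2)] by blast

lemma hwords_eqI:
  assumes "smod B" "f \<in> linear_maps S\<^sub>M B" "g \<in> linear_maps S\<^sub>M B"
    and eq: "\<And>w p. w \<in> hwords M p \<Longrightarrow> f (sw M w) = g (sw M w)" and t: "t \<in> carrier S\<^sub>M"
  shows "f t = g t"
  by (rule S.graded_linear_eqI[OF assms(1-3) sym_grade_eqI[OF assms(1-3) eq] t])

text \<open>The multipliers of a given parity whose commutator with D has the required order form a
  submodule, and by \<open>mult_commutator_mult\<close> products of such multipliers are of the same
  kind. Hence the generators suffice.\<close>

lemma dop_generators:
  assumes D: "D \<in> hom_ends S\<^sub>M d"
    and gen: "\<And>p x. x \<in> grade M p \<Longrightarrow> dop S\<^sub>M n (d + p) (mult_commutator S\<^sub>M d D p (gen x))"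
  shows "dop S\<^sub>M (Suc n) d D"
proof -
  note Dl = hom_endsD(1)[OF D]
  have "dop S\<^sub>M n (d + e) (mult_commutator S\<^sub>M d D e a)" if a: "a \<in> grade S\<^sub>M e" for a e
  proof -
    let ?H = "{a \<in> grade S\<^sub>M e. dop S\<^sub>M n (d + e) (mult_commutator S\<^sub>M d D e a)}"
    have mc: "mult_commutator S\<^sub>M d D e (a \<oplus>\<^bsub>S\<^sub>M\<^esub> b) x = mult_commutator S\<^sub>M d D e a x \<oplus>\<^bsub>S\<^sub>M\<^esub> mult_commutator S\<^sub>M d D e b x"
      if "a \<in> carrier S\<^sub>M" "b \<in> carrier S\<^sub>M" "x \<in> carrier S\<^sub>M" for a b x
      using that linear_mapsD[OF Dl]
      by (simp add: mult_commutator_def a_minus_def S.l_distr S.sg_add S.minus_add S.a_ac)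
    have ms: "mult_commutator S\<^sub>M d D e (r \<odot>\<^bsub>S\<^sub>M\<^esub> a) x = r \<odot>\<^bsub>S\<^sub>M\<^esub> mult_commutator S\<^sub>M d D e a x"
      if "a \<in> carrier S\<^sub>M" "x \<in> carrier S\<^sub>M" for a r x
      using that linear_mapsD[OF Dl]
      by (simp add: mult_commutator_def a_minus_def S.sm_mult_left S.sm_radd S.sm_minus S.sg_smult)
    have H: "submodule ?H scalars S\<^sub>M"
    proof (rule S.submodI)
      have "dop S\<^sub>M n (d + e) (mult_commutator S\<^sub>M d D e \<zero>\<^bsub>S\<^sub>M\<^esub>)"
        using linear_map_zero[OF S.smod_axioms S.smod_axioms Dl] linear_mapsD(1)[OF Dl]
        by (intro S.dop_cong[OF _ S.dop_zero]) (simp add: mult_commutator_def)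
      then show "\<zero>\<^bsub>S\<^sub>M\<^esub> \<in> ?H" by simp
      show "a \<oplus>\<^bsub>S\<^sub>M\<^esub> b \<in> ?H" if "a \<in> ?H" "b \<in> ?H" for a b
      proof -
        have "dop S\<^sub>M n (d + e) (mult_commutator S\<^sub>M d D e (a \<oplus>\<^bsub>S\<^sub>M\<^esub> b))"
        proof (rule S.dop_cong)
          show "dop S\<^sub>M n (d + e) (\<lambda>x. mult_commutator S\<^sub>M d D e a x \<oplus>\<^bsub>S\<^sub>M\<^esub> mult_commutator S\<^sub>M d D e b x)"
            using that S.dop_add by blast
        qed (use that mc S.grade_carrier in blast)
        then show ?thesis using that by simp
      qed
      show "r \<odot>\<^bsub>S\<^sub>M\<^esub> a \<in> ?H" if "a \<in> ?H" for r a
      proof -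
        have "dop S\<^sub>M n (d + e) (mult_commutator S\<^sub>M d D e (r \<odot>\<^bsub>S\<^sub>M\<^esub> a))"
        proof (rule S.dop_cong)
          show "dop S\<^sub>M n (d + e) (\<lambda>x. r \<odot>\<^bsub>S\<^sub>M\<^esub> mult_commutator S\<^sub>M d D e a x)"
            using that S.dop_smult by blast
        qed (use that ms S.grade_carrier in blast)
        then show ?thesis using that by simp
      qed
    qed (auto simp: S.grade_carrier)
    have w: "dop S\<^sub>M n (d + p) (mult_commutator S\<^sub>M d D p (sw M w))" if "w \<in> hwords M p" for w p
      using that
    proof (induction w arbitrary: p)
      case Nil
      have "mult_commutator S\<^sub>M d D 0 \<one>\<^bsub>S\<^sub>M\<^esub> x = \<zero>\<^bsub>S\<^sub>M\<^esub>" if "x \<in> carrier S\<^sub>M" for x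
        using that linear_mapsD(1)[OF Dl] by (simp add: mult_commutator_def S.minus_eq_zero_iff)
      then have "dop S\<^sub>M n d (mult_commutator S\<^sub>M d D 0 \<one>\<^bsub>S\<^sub>M\<^esub>)" by (rule S.dop_cong[OF _ S.dop_zero])
      then show ?case using Nil by (simp add: hwords_Nil sw_Nil)
    next
      case (Cons x w)
      obtain q r where x: "x \<in> grade M q" "w \<in> hwords M r" "p = q + r" using Cons.prems by (auto simp: hwords_Cons)
      note g = sym_gen_grade[OF x(1)] sw_grade[OF x(2)]
      have "dop S\<^sub>M n (d + p) (\<lambda>z. mult_commutator S\<^sub>M d D q (gen x) (sw M w \<otimes>\<^bsub>S\<^sub>M\<^esub> z) \<oplus>\<^bsub>S\<^sub>M\<^esub>
          ksgn S\<^sub>M (d * q) (gen x \<otimes>\<^bsub>S\<^sub>M\<^esub> mult_commutator S\<^sub>M d D r (sw M w) z))"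
      proof (rule S.dop_add)
        show "dop S\<^sub>M n (d + p) (\<lambda>z. mult_commutator S\<^sub>M d D q (gen x) (sw M w \<otimes>\<^bsub>S\<^sub>M\<^esub> z))"
          using S.dop_mult_right[OF gen[OF x(1)] g(2)] by (simp add: x(3) add.assoc)
        show "dop S\<^sub>M n (d + p) (\<lambda>z. ksgn S\<^sub>M (d * q) (gen x \<otimes>\<^bsub>S\<^sub>M\<^esub> mult_commutator S\<^sub>M d D r (sw M w) z))"
          using S.dop_ksgn[OF S.dop_mult_left[OF Cons.IH[OF x(2)] g(1)]] by (simp add: x(3) add.left_commute)
      qed
      then show ?case
        unfolding sw_Cons_grade[OF x(1,2)] x(3)
        by (rule S.dop_cong[OF S.mult_commutator_mult[OF D g], rotated])
    qed
    have "(\<lambda>x. x) \<in> linear_maps S\<^sub>M S\<^sub>M" by (rule linear_mapsI) simp_all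
    from sym_grade_mem[OF H S.smod_axioms this _ a] show ?thesis using w sw_grade by blast
  qed
  then show ?thesis using D by simp
qed

text \<open>With the shifted index, an operator of order less than n is determined by words with
  fewer than n letters. By induction its commutator with each generator vanishes, so D supercommutes
  with the generators, and D 1 = 0 spreads to all words.\<close>

lemma dop_unique:
  assumes "dop S\<^sub>M n d D" "\<And>w. \<lbrakk>w \<in> lists (carrier M); length w < n\<rbrakk> \<Longrightarrow> D (sw M w) = \<zero>\<^bsub>S\<^sub>M\<^esub>"
    and "z \<in> carrier S\<^sub>M"
  shows "D z = \<zero>\<^bsub>S\<^sub>M\<^esub>"
  using assms
proof (induction n arbitrary: d D z)
  case (Suc n)
  have D: "D \<in> hom_ends S\<^sub>M d" using Suc.prems by simp
  note Dl = hom_endsD(1)[OF D]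
  have step: "D (gen x \<otimes>\<^bsub>S\<^sub>M\<^esub> z) = ksgn S\<^sub>M (d * p) (gen x \<otimes>\<^bsub>S\<^sub>M\<^esub> D z)"
    if x: "x \<in> grade M p" and z: "z \<in> carrier S\<^sub>M" for x p z
  proof -
    have xc: "x \<in> carrier M" by (rule grade_carrier[OF x])
    have "mult_commutator S\<^sub>M d D p (gen x) z = \<zero>\<^bsub>S\<^sub>M\<^esub>"
    proof (rule Suc.IH[OF _ _ z])
      show "dop S\<^sub>M n (d + p) (mult_commutator S\<^sub>M d D p (gen x))"
        using Suc.prems(1) sym_gen_grade[OF x] by simp
      show "mult_commutator S\<^sub>M d D p (gen x) (sw M w) = \<zero>\<^bsub>S\<^sub>M\<^esub>" if "w \<in> lists (carrier M)" "length w < n" for w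
        using Suc.prems(2)[of w] Suc.prems(2)[of "x # w"] that xc
        by (simp add: mult_commutator_def sw_Cons gen_closed)
    qed
    then show ?thesis using z linear_mapsD(1)[OF Dl] gen_closed[OF xc] by (simp add: mult_commutator_def S.minus_eq_zero_iff)
  qed
  have "D (sw M w) = \<zero>\<^bsub>S\<^sub>M\<^esub>" if "w \<in> hwords M p" for w p
    using that
  proof (induction w arbitrary: p)
    case Nil
    then show ?case using Suc.prems(2)[of "[]"] by simp
  next
    case (Cons x w)
    then obtain q r where x: "x \<in> grade M q" "w \<in> hwords M r" "p = q + r" by (auto simp: hwords_Cons)
    show ?case
      using step[OF x(1) sw_closed[OF hwords_lists[OF x(2)]]] Cons.IH[OF x(2)] gen_closed[OF grade_carrier[OF x(1)]]
      by (simp add: sw_Cons_grade[OF x(1,2)])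
  qed
  then show ?case
    by (intro hwords_eqI[OF S.smod_axioms Dl linear_maps_zero[OF S.smod_axioms] _ Suc.prems(3)])
qed simp

text \<open>An operator is built from prescribed commutators \<open>a x\<close> with the generators.
  Assumption \<open>a_sym\<close> is the consistency condition: the values on x y z and on y x z
  must agree up to the Koszul sign.\<close>

theorem operator_exists:
  assumes a_lin: "\<And>x. x \<in> carrier M \<Longrightarrow> a x \<in> linear_maps S\<^sub>M S\<^sub>M"
    and a_add: "\<And>x y z. \<lbrakk>x \<in> carrier M; y \<in> carrier M; z \<in> carrier S\<^sub>M\<rbrakk> \<Longrightarrow> a (x \<oplus> y) z = a x z \<oplus>\<^bsub>S\<^sub>M\<^esub> a y z"
    and a_smult: "\<And>x r z. \<lbrakk>x \<in> carrier M; z \<in> carrier S\<^sub>M\<rbrakk> \<Longrightarrow> a (r \<odot> x) z = r \<odot>\<^bsub>S\<^sub>M\<^esub> a x z"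
    and a_hom: "\<And>x p. x \<in> grade M p \<Longrightarrow> a x \<in> hom_ends S\<^sub>M (d + p)"
    and a_sym: "\<And>x y p q z. \<lbrakk>x \<in> grade M p; y \<in> grade M q; z \<in> carrier S\<^sub>M\<rbrakk> \<Longrightarrow>
      a x (gen y \<otimes>\<^bsub>S\<^sub>M\<^esub> z) \<oplus>\<^bsub>S\<^sub>M\<^esub> ksgn S\<^sub>M (d * p) (gen x \<otimes>\<^bsub>S\<^sub>M\<^esub> a y z) =
      ksgn S\<^sub>M (p * q) (a y (gen x \<otimes>\<^bsub>S\<^sub>M\<^esub> z) \<oplus>\<^bsub>S\<^sub>M\<^esub> ksgn S\<^sub>M (d * q) (gen y \<otimes>\<^bsub>S\<^sub>M\<^esub> a x z))"
  obtains D where "D \<in> hom_ends S\<^sub>M d" "D \<one>\<^bsub>S\<^sub>M\<^esub> = \<zero>\<^bsub>S\<^sub>M\<^esub>"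
    "\<And>x p z. \<lbrakk>x \<in> grade M p; z \<in> carrier S\<^sub>M\<rbrakk> \<Longrightarrow>
      D (gen x \<otimes>\<^bsub>S\<^sub>M\<^esub> z) = a x z \<oplus>\<^bsub>S\<^sub>M\<^esub> ksgn S\<^sub>M (d * p) (gen x \<otimes>\<^bsub>S\<^sub>M\<^esub> D z)"
proof -
  \<comment> \<open>The recursion that the wanted operator must satisfy on words. The sign in it
    makes sense only for homogeneous letters; \<open>twist\<close> replaces it by a linear
    expression, so that \<open>F\<close> becomes multilinear.\<close>
  define F where "F = rec_list \<zero>\<^bsub>S\<^sub>M\<^esub> (\<lambda>x w f. a x (sw M w) \<oplus>\<^bsub>S\<^sub>M\<^esub> gen (twist d x) \<otimes>\<^bsub>S\<^sub>M\<^esub> f)"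
  have F: "F [] = \<zero>\<^bsub>S\<^sub>M\<^esub>" "F (x # w) = a x (sw M w) \<oplus>\<^bsub>S\<^sub>M\<^esub> gen (twist d x) \<otimes>\<^bsub>S\<^sub>M\<^esub> F w" for x w
    by (simp_all add: F_def)
  note a_cl = linear_mapsD(1)[OF a_lin]
  have Fc: "F w \<in> carrier S\<^sub>M" if "w \<in> lists (carrier M)" for w
    using that by (induction w) (auto simp: F a_cl sw_closed gen_closed)
  note gl = linear_mapsD[OF linear_map_comp[OF twist_linear sym_gen_linear]]
  note cl = Fc a_cl sw_closed gen_closed
  note swl = multilinearD(2,3)[OF sw_multilinear]
  have add: "F (u @ (x \<oplus> y) # v) = F (u @ x # v) \<oplus>\<^bsub>S\<^sub>M\<^esub> F (u @ y # v)"
    if "u \<in> lists (carrier M)" and v: "v \<in> lists (carrier M)" "x \<in> carrier M" "y \<in> carrier M" for u v x y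
    using that(1)
  proof (induction u)
    case Nil
    then show ?case using v by (simp add: F a_add gl cl S.l_distr S.a_ac)
  next
    case (Cons z u)
    then have u: "u \<in> lists (carrier M)" and z: "z \<in> carrier M" by auto
    note l = linear_mapsD(2)[OF a_lin[OF z]]
    show ?case using v u z Cons.IH by (simp add: F swl l cl S.r_distr S.a_ac)
  qed
  have sm: "F (u @ (r \<odot> x) # v) = r \<odot>\<^bsub>S\<^sub>M\<^esub> F (u @ x # v)"
    if "u \<in> lists (carrier M)" and v: "v \<in> lists (carrier M)" "x \<in> carrier M" for u v x r
    using that(1)
  proof (induction u)
    case Nil
    then show ?case using v by (simp add: F a_smult gl cl S.sm_mult_left S.sm_radd)
  next
    case (Cons z u)
    then have u: "u \<in> lists (carrier M)" and z: "z \<in> carrier M" by auto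
    note l = linear_mapsD(3)[OF a_lin[OF z]]
    show ?case using v u z Cons.IH by (simp add: F swl l cl S.sm_mult_right S.sm_radd)
  qed
  have ml: "multilinear M S\<^sub>M F" using Fc add sm by (simp add: multilinear_def)
  have gtw: "gen (twist d x) = ksgn S\<^sub>M (d * p) (gen x)" if "x \<in> grade M p" for x p
    using that linear_map_ksgn[OF smod_axioms S.smod_axioms sym_gen_linear] by (simp add: twist_grade grade_carrier)
  have sup: "F (u @ x # y # v) = ksgn S\<^sub>M (p * q) (F (u @ y # x # v))"
    if "u \<in> lists (carrier M)" and v: "v \<in> lists (carrier M)" and xy: "x \<in> grade M p" "y \<in> grade M q" for u v x y p q
    using that(1)
  proof (induction u)
    case Nil
    note c = xy[THEN grade_carrier]
    let ?v = "sw M v"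
    note cc = gen_closed[OF c(1)] gen_closed[OF c(2)] Fc[OF v] sw_closed[OF v] a_cl[OF c(1)] a_cl[OF c(2)]
    have e: "F (x # y # v) = (a x (gen y \<otimes>\<^bsub>S\<^sub>M\<^esub> ?v) \<oplus>\<^bsub>S\<^sub>M\<^esub> ksgn S\<^sub>M (d * p) (gen x \<otimes>\<^bsub>S\<^sub>M\<^esub> a y ?v)) \<oplus>\<^bsub>S\<^sub>M\<^esub>
        ksgn S\<^sub>M (d * p + d * q) (gen x \<otimes>\<^bsub>S\<^sub>M\<^esub> (gen y \<otimes>\<^bsub>S\<^sub>M\<^esub> F v))"
      if xy: "x \<in> grade M p" "y \<in> grade M q" for x y p q
    proof -
      note c = xy[THEN grade_carrier]
      note cc = gen_closed[OF c(1)] gen_closed[OF c(2)] Fc[OF v] sw_closed[OF v] a_cl[OF c(1)] a_cl[OF c(2)]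
      show ?thesis
        using cc c v by (simp add: F gtw[OF xy(1)] gtw[OF xy(2)] sw_Cons S.r_distr S.sg_add S.sg_mult_left S.sg_mult_right S.sg_sg S.a_assoc add.commute)
    qed
    show ?case
      using cc S.commute_left[OF sym_gen_grade[OF xy(1)] sym_gen_grade[OF xy(2)] Fc[OF v]]
      by (simp add: e[OF xy] e[OF xy(2,1)] a_sym[OF xy sw_closed[OF v]] S.sg_add S.sg_sg add_ac mult.commute)
  next
    case (Cons z u)
    then have u: "u \<in> lists (carrier M)" and z: "z \<in> carrier M" by auto
    note c = xy[THEN grade_carrier]
    have "sw M (u @ x # y # v) = ksgn S\<^sub>M (p * q) (sw M (u @ y # x # v))"
      using sw_swap u v xy unfolding supersymmetric_def by blast
    then show ?case
      using v u z c Cons.IH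
      by (simp add: F cl linear_map_ksgn[OF S.smod_axioms S.smod_axioms a_lin[OF z]] S.sg_add S.sg_mult_right)
  qed
  have "supersymmetric S\<^sub>M F" unfolding supersymmetric_def using sup by blast
  then obtain D where D: "D \<in> linear_maps S\<^sub>M S\<^sub>M" "\<And>w. w \<in> lists (carrier M) \<Longrightarrow> D (sw M w) = F w"
    using sym_universal[OF S.smod_axioms ml] by blast
  have rec: "D (gen x \<otimes>\<^bsub>S\<^sub>M\<^esub> z) = a x z \<oplus>\<^bsub>S\<^sub>M\<^esub> ksgn S\<^sub>M (d * p) (gen x \<otimes>\<^bsub>S\<^sub>M\<^esub> D z)"
    if x: "x \<in> grade M p" and z: "z \<in> carrier S\<^sub>M" for x p z
  proof (rule sym_linear_eqI[OF S.smod_axioms _ _ _ z, where f = "\<lambda>z. D (gen x \<otimes>\<^bsub>S\<^sub>M\<^esub> z)"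
        and g = "\<lambda>z. a x z \<oplus>\<^bsub>S\<^sub>M\<^esub> ksgn S\<^sub>M (d * p) (gen x \<otimes>\<^bsub>S\<^sub>M\<^esub> D z)"])
    note xc = grade_carrier[OF x]
    show "(\<lambda>z. D (gen x \<otimes>\<^bsub>S\<^sub>M\<^esub> z)) \<in> linear_maps S\<^sub>M S\<^sub>M"
      by (rule linear_map_comp[OF S.mult_linear_left[OF gen_closed[OF xc]] D(1)])
    show "(\<lambda>z. a x z \<oplus>\<^bsub>S\<^sub>M\<^esub> ksgn S\<^sub>M (d * p) (gen x \<otimes>\<^bsub>S\<^sub>M\<^esub> D z)) \<in> linear_maps S\<^sub>M S\<^sub>M"
      by (intro linear_maps_add linear_maps_ksgn S.smod_axioms a_lin xc
          linear_map_comp[OF D(1) S.mult_linear_left[OF gen_closed[OF xc]]])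
    show "D (gen x \<otimes>\<^bsub>S\<^sub>M\<^esub> sw M w) = a x (sw M w) \<oplus>\<^bsub>S\<^sub>M\<^esub> ksgn S\<^sub>M (d * p) (gen x \<otimes>\<^bsub>S\<^sub>M\<^esub> D (sw M w))"
      if "w \<in> lists (carrier M)" for w
      using that D(2)[of "x # w"] D(2)[of w] xc
      by (simp add: sw_Cons F gtw[OF x] S.sg_mult_left gen_closed Fc)
  qed
  have "F w \<in> grade S\<^sub>M (d + p)" if "w \<in> hwords M p" for w p
    using that
  proof (induction w arbitrary: p)
    case (Cons x w)
    then obtain q r where x: "x \<in> grade M q" "w \<in> hwords M r" "p = q + r" by (auto simp: hwords_Cons)
    have "gen x \<otimes>\<^bsub>S\<^sub>M\<^esub> F w \<in> grade S\<^sub>M (d + p)"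
      using S.grade_mult[OF sym_gen_grade[OF x(1)] Cons.IH[OF x(2)]] by (simp add: x(3) add_ac)
    moreover have "a x (sw M w) \<in> grade S\<^sub>M (d + p)"
      using hom_endsD(2)[OF a_hom[OF x(1)] sw_grade[OF x(2)]] by (simp add: x(3) add_ac)
    moreover have "F w \<in> carrier S\<^sub>M" using Fc hwords_lists x(2) by blast
    ultimately show ?case
      using gen_closed[OF grade_carrier[OF x(1)]] by (simp add: F gtw[OF x(1)] S.sg_mult_left)
  qed (simp add: F)
  then have "D x \<in> grade S\<^sub>M (d + p)" if "x \<in> grade S\<^sub>M p" for x p
    using sym_grade_mem[OF S.grade_submodule S.smod_axioms D(1) _ that] D(2) hwords_lists by simp
  then have "D \<in> hom_ends S\<^sub>M d" by (rule hom_endsI[OF D(1)])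
  moreover have "D \<one>\<^bsub>S\<^sub>M\<^esub> = \<zero>\<^bsub>S\<^sub>M\<^esub>" using D(2)[of "[]"] by (simp add: sw_Nil F)
  ultimately show ?thesis using rec by (rule that)
qed

end

text \<open>The cobracket extends to a first-order operator, which is later added to the
  second-order operator of the bracket.\<close>

lemma (in supercommutative_superalgebra) dop_Suc: "dop A n d D \<Longrightarrow> dop A (Suc n) d D"
proof (induction n arbitrary: d D)
  case 0
  then have D: "D \<in> hom_ends A d" and z: "\<And>x. x \<in> carrier A \<Longrightarrow> D x = \<zero>" by simp_all
  have "dop A 0 (d + e) (mult_commutator A d D e a)" if "a \<in> grade A e" for a e
    using that z by (intro dop_cong[OF _ dop_zero]) (simp add: mult_commutator_def grade_carrier)
  then show ?case using D by simp
next
  case (Suc n)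
  then have "D \<in> hom_ends A d" "\<And>a e. a \<in> grade A e \<Longrightarrow> dop A (Suc n) (d + e) (mult_commutator A d D e a)"
    by auto
  then show ?case by (subst dop.simps(2)) blast
qed

section \<open>Extension of brackets and cobrackets to operators\<close>

context supermodule2
begin

interpretation S: supercommutative_superalgebra S\<^sub>M by (rule sym_supercommutative)

lemma recursion_unique:
  assumes D: "D \<in> linear_maps S\<^sub>M S\<^sub>M" and D': "D' \<in> linear_maps S\<^sub>M S\<^sub>M"
    and one: "D \<one>\<^bsub>S\<^sub>M\<^esub> = D' \<one>\<^bsub>S\<^sub>M\<^esub>"
    and rec: "\<And>x p z. \<lbrakk>x \<in> grade M p; z \<in> carrier S\<^sub>M\<rbrakk> \<Longrightarrow> D (gen x \<otimes>\<^bsub>S\<^sub>M\<^esub> z) = a x z \<oplus>\<^bsub>S\<^sub>M\<^esub> ksgn S\<^sub>M (d * p) (gen x \<otimes>\<^bsub>S\<^sub>M\<^esub> D z)"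
    and rec': "\<And>x p z. \<lbrakk>x \<in> grade M p; z \<in> carrier S\<^sub>M\<rbrakk> \<Longrightarrow> D' (gen x \<otimes>\<^bsub>S\<^sub>M\<^esub> z) = a x z \<oplus>\<^bsub>S\<^sub>M\<^esub> ksgn S\<^sub>M (d * p) (gen x \<otimes>\<^bsub>S\<^sub>M\<^esub> D' z)"
    and t: "t \<in> carrier S\<^sub>M"
  shows "D t = D' t"
proof (rule hwords_eqI[OF S.smod_axioms D D' _ t])
  show "D (sw M w) = D' (sw M w)" if "w \<in> hwords M p" for w p
    using that
  proof (induction w arbitrary: p)
    case (Cons x w)
    then obtain q r where x: "x \<in> grade M q" "w \<in> hwords M r" by (auto simp: hwords_Cons)
    show ?case
      using rec[OF x(1) sw_closed[OF hwords_lists[OF x(2)]]] rec'[OF x(1) sw_closed[OF hwords_lists[OF x(2)]]] Cons.IH[OF x(2)]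
      by (simp add: sw_Cons_grade[OF x])
  qed (simp add: sw_Nil one)
qed

lemma recursion_commutator:
  assumes D: "D \<in> hom_ends S\<^sub>M d" and x: "x \<in> grade M p" and z: "z \<in> carrier S\<^sub>M" and a: "a \<in> carrier S\<^sub>M"
    and rec: "D (gen x \<otimes>\<^bsub>S\<^sub>M\<^esub> z) = a \<oplus>\<^bsub>S\<^sub>M\<^esub> ksgn S\<^sub>M (d * p) (gen x \<otimes>\<^bsub>S\<^sub>M\<^esub> D z)"
  shows "mult_commutator S\<^sub>M d D p (gen x) z = a"
proof -
  have "D z \<in> carrier S\<^sub>M" by (rule linear_mapsD(1)[OF hom_endsD(1)[OF D] z])
  then show ?thesis
    using a gen_closed[OF grade_carrier[OF x]] by (simp add: mult_commutator_def rec a_minus_def S.a_assoc S.r_neg)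
qed

text \<open>The commutator with x is to be multiplication by \<gamma> x; the consistency condition
  of \<open>operator_exists\<close> then amounts to supercommutativity.\<close>

lemma derivation_exists:
  assumes g: "\<gamma> \<in> linear_maps M S\<^sub>M" and gg: "\<And>x p. x \<in> grade M p \<Longrightarrow> \<gamma> x \<in> grade S\<^sub>M (d + p)"
  obtains D where "D \<in> hom_ends S\<^sub>M d" "D \<one>\<^bsub>S\<^sub>M\<^esub> = \<zero>\<^bsub>S\<^sub>M\<^esub>" "dop S\<^sub>M 2 d D"
    "\<And>x p z. \<lbrakk>x \<in> grade M p; z \<in> carrier S\<^sub>M\<rbrakk> \<Longrightarrow>
      D (gen x \<otimes>\<^bsub>S\<^sub>M\<^esub> z) = \<gamma> x \<otimes>\<^bsub>S\<^sub>M\<^esub> z \<oplus>\<^bsub>S\<^sub>M\<^esub> ksgn S\<^sub>M (d * p) (gen x \<otimes>\<^bsub>S\<^sub>M\<^esub> D z)"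
proof -
  note gl = linear_mapsD[OF g]
  obtain D where D: "D \<in> hom_ends S\<^sub>M d" "D \<one>\<^bsub>S\<^sub>M\<^esub> = \<zero>\<^bsub>S\<^sub>M\<^esub>"
    and rec: "\<And>x p z. \<lbrakk>x \<in> grade M p; z \<in> carrier S\<^sub>M\<rbrakk> \<Longrightarrow>
      D (gen x \<otimes>\<^bsub>S\<^sub>M\<^esub> z) = \<gamma> x \<otimes>\<^bsub>S\<^sub>M\<^esub> z \<oplus>\<^bsub>S\<^sub>M\<^esub> ksgn S\<^sub>M (d * p) (gen x \<otimes>\<^bsub>S\<^sub>M\<^esub> D z)"
  proof (rule operator_exists[of "\<lambda>x z. \<gamma> x \<otimes>\<^bsub>S\<^sub>M\<^esub> z" d])
    show "(\<lambda>z. \<gamma> x \<otimes>\<^bsub>S\<^sub>M\<^esub> z) \<in> linear_maps S\<^sub>M S\<^sub>M" if "x \<in> carrier M" for x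
      by (rule S.mult_linear_left[OF gl(1)[OF that]])
    show "(\<lambda>z. \<gamma> x \<otimes>\<^bsub>S\<^sub>M\<^esub> z) \<in> hom_ends S\<^sub>M (d + p)" if "x \<in> grade M p" for x p
      by (rule S.dop_hom[OF S.dop_mult[OF gg[OF that]]])
    show "\<gamma> x \<otimes>\<^bsub>S\<^sub>M\<^esub> (gen y \<otimes>\<^bsub>S\<^sub>M\<^esub> z) \<oplus>\<^bsub>S\<^sub>M\<^esub> ksgn S\<^sub>M (d * p) (gen x \<otimes>\<^bsub>S\<^sub>M\<^esub> (\<gamma> y \<otimes>\<^bsub>S\<^sub>M\<^esub> z)) =
      ksgn S\<^sub>M (p * q) (\<gamma> y \<otimes>\<^bsub>S\<^sub>M\<^esub> (gen x \<otimes>\<^bsub>S\<^sub>M\<^esub> z) \<oplus>\<^bsub>S\<^sub>M\<^esub> ksgn S\<^sub>M (d * q) (gen y \<otimes>\<^bsub>S\<^sub>M\<^esub> (\<gamma> x \<otimes>\<^bsub>S\<^sub>M\<^esub> z)))"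
      if x: "x \<in> grade M p" and y: "y \<in> grade M q" and z: "z \<in> carrier S\<^sub>M" for x y p q z
    proof -
      note c = gl(1)[OF grade_carrier[OF x]] gl(1)[OF grade_carrier[OF y]] gen_closed[OF grade_carrier[OF x]] gen_closed[OF grade_carrier[OF y]]
      have 1: "\<gamma> x \<otimes>\<^bsub>S\<^sub>M\<^esub> (gen y \<otimes>\<^bsub>S\<^sub>M\<^esub> z) = ksgn S\<^sub>M (p * q + d * q) (gen y \<otimes>\<^bsub>S\<^sub>M\<^esub> (\<gamma> x \<otimes>\<^bsub>S\<^sub>M\<^esub> z))"
        using S.commute_left[OF gg[OF x] sym_gen_grade[OF y] z] by (simp add: distrib_right add.commute)
      have 2: "\<gamma> y \<otimes>\<^bsub>S\<^sub>M\<^esub> (gen x \<otimes>\<^bsub>S\<^sub>M\<^esub> z) = ksgn S\<^sub>M (p * q + d * p) (gen x \<otimes>\<^bsub>S\<^sub>M\<^esub> (\<gamma> y \<otimes>\<^bsub>S\<^sub>M\<^esub> z))"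
        using S.commute_left[OF gg[OF y] sym_gen_grade[OF x] z] by (simp add: distrib_left distrib_right add.commute mult.commute)
      show ?thesis unfolding 1 2 using c z by (simp add: S.sg_add S.sg_sg add_ac S.a_comm)
    qed
  qed (auto simp: gl S.l_distr S.sm_mult_left)
  have "dop S\<^sub>M (Suc 1) d D"
  proof (rule dop_generators[OF D(1)])
    fix p x assume x: "x \<in> grade M p"
    show "dop S\<^sub>M 1 (d + p) (mult_commutator S\<^sub>M d D p (gen x))"
    proof (rule S.dop_cong[OF _ S.dop_mult[OF gg[OF x]]])
      show "mult_commutator S\<^sub>M d D p (gen x) z = \<gamma> x \<otimes>\<^bsub>S\<^sub>M\<^esub> z" if z: "z \<in> carrier S\<^sub>M" for z
        by (rule recursion_commutator[OF D(1) x z _ rec[OF x z]]) (simp add: gl z grade_carrier[OF x])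
    qed
  qed
  then show ?thesis using D rec by (intro that) (simp_all add: numeral_2_eq_2)
qed

theorem extend_cobracket:
  assumes g: "(\<lambda>x. sym_class M (c x)) \<in> linear_maps M S\<^sub>M"
    and gg: "\<And>x p. x \<in> grade M p \<Longrightarrow> sym_class M (c x) \<in> grade S\<^sub>M (1 + p)"
  defines "D \<equiv> extend_cobracket M c"
  shows "D \<in> hom_ends S\<^sub>M 1" "D \<one>\<^bsub>S\<^sub>M\<^esub> = \<zero>\<^bsub>S\<^sub>M\<^esub>" "dop S\<^sub>M 2 1 D"
    "\<lbrakk>x \<in> grade M p; z \<in> carrier S\<^sub>M\<rbrakk> \<Longrightarrow>
      D (gen x \<otimes>\<^bsub>S\<^sub>M\<^esub> z) = sym_class M (c x) \<otimes>\<^bsub>S\<^sub>M\<^esub> z \<oplus>\<^bsub>S\<^sub>M\<^esub> ksgn S\<^sub>M p (gen x \<otimes>\<^bsub>S\<^sub>M\<^esub> D z)"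
proof -
  obtain E where E: "E \<in> hom_ends S\<^sub>M 1" "E \<one>\<^bsub>S\<^sub>M\<^esub> = \<zero>\<^bsub>S\<^sub>M\<^esub>" "dop S\<^sub>M 2 1 E"
    and rec: "\<And>x p z. \<lbrakk>x \<in> grade M p; z \<in> carrier S\<^sub>M\<rbrakk> \<Longrightarrow>
      E (gen x \<otimes>\<^bsub>S\<^sub>M\<^esub> z) = sym_class M (c x) \<otimes>\<^bsub>S\<^sub>M\<^esub> z \<oplus>\<^bsub>S\<^sub>M\<^esub> ksgn S\<^sub>M (1 * p) (gen x \<otimes>\<^bsub>S\<^sub>M\<^esub> E z)"
    using derivation_exists[OF g gg] by blast
  note El = hom_endsD(1)[OF E(1)]
  \<comment> \<open>Restricting to the carrier gives the normalised operator at which the definite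
    description aims.\<close>
  define E' where "E' = restrict E (carrier S\<^sub>M)"
  have eq: "E' z = E z" if "z \<in> carrier S\<^sub>M" for z using that by (simp add: E'_def)
  have E'h: "E' \<in> hom_ends S\<^sub>M 1" by (rule S.hom_ends_cong[OF eq E(1)])
  note cc = linear_mapsD(1)[OF El] linear_mapsD(1)[OF g] gen_closed
  have Eg: "E (gen x) = sym_class M (c x)" if x: "x \<in> carrier M" for x
  proof (rule graded_linear_eqI[OF S.smod_axioms linear_map_comp[OF sym_gen_linear El] g _ x])
    show "E (gen x) = sym_class M (c x)" if "x \<in> grade M p" for x p
      using rec[OF that S.one_closed] cc grade_carrier[OF that] by (simp add: E(2))
  qed
  have Ed: "E (x \<otimes>\<^bsub>S\<^sub>M\<^esub> y) = E x \<otimes>\<^bsub>S\<^sub>M\<^esub> y \<oplus>\<^bsub>S\<^sub>M\<^esub> ksgn S\<^sub>M p (x \<otimes>\<^bsub>S\<^sub>M\<^esub> E y)"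
    if x: "x \<in> grade S\<^sub>M p" and y: "y \<in> carrier S\<^sub>M" for x y p
  proof (rule sym_grade_eqI[OF S.smod_axioms _ _ _ x, where f = "\<lambda>x. E (x \<otimes>\<^bsub>S\<^sub>M\<^esub> y)"
        and g = "\<lambda>x. E x \<otimes>\<^bsub>S\<^sub>M\<^esub> y \<oplus>\<^bsub>S\<^sub>M\<^esub> ksgn S\<^sub>M p (x \<otimes>\<^bsub>S\<^sub>M\<^esub> E y)"])
    show "(\<lambda>x. E (x \<otimes>\<^bsub>S\<^sub>M\<^esub> y)) \<in> linear_maps S\<^sub>M S\<^sub>M" by (rule linear_map_comp[OF S.mult_linear_right[OF y] El])
    show "(\<lambda>x. E x \<otimes>\<^bsub>S\<^sub>M\<^esub> y \<oplus>\<^bsub>S\<^sub>M\<^esub> ksgn S\<^sub>M p (x \<otimes>\<^bsub>S\<^sub>M\<^esub> E y)) \<in> linear_maps S\<^sub>M S\<^sub>M"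
      by (intro linear_maps_add linear_maps_ksgn S.smod_axioms linear_map_comp[OF El S.mult_linear_right[OF y]]
          S.mult_linear_right cc y)
    show "E (sw M w \<otimes>\<^bsub>S\<^sub>M\<^esub> y) = E (sw M w) \<otimes>\<^bsub>S\<^sub>M\<^esub> y \<oplus>\<^bsub>S\<^sub>M\<^esub> ksgn S\<^sub>M p (sw M w \<otimes>\<^bsub>S\<^sub>M\<^esub> E y)" if "w \<in> hwords M p" for w
      using that
    proof (induction w arbitrary: p)
      case Nil
      then show ?case using y cc by (simp add: hwords_Nil sw_Nil E(2))
    next
      case (Cons x w)
      then obtain q r where x: "x \<in> grade M q" "w \<in> hwords M r" "p = q + r" by (auto simp: hwords_Cons)
      note xc = grade_carrier[OF x(1)] and wc = sw_closed[OF hwords_lists[OF x(2)]]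
      show ?case
        using xc wc y cc rec[OF x(1) wc] rec[OF x(1) S.m_closed[OF wc y]] Cons.IH[OF x(2)]
        by (simp add: sw_Cons_grade[OF x(1,2)] x(3) S.m_assoc S.l_distr S.r_distr S.sg_add S.sg_mult_left S.sg_mult_right S.sg_sg S.a_assoc)
    qed
  qed
  have "extend_cobracket M c = E'"
    unfolding extend_cobracket_def
  proof (rule the_equality, intro conjI ballI)
    show "E' \<in> extensional (carrier S\<^sub>M)" by (simp add: E'_def)
    show "derivation S\<^sub>M 1 E'"
      unfolding derivation_def using E'h Ed by (simp add: eq S.grade_carrier)
    show "E' (gen x) = sym_class M (c x)" if "x \<in> carrier M" for x using that by (simp add: eq gen_closed Eg)
  next
    fix F assume "F \<in> extensional (carrier S\<^sub>M) \<and> derivation S\<^sub>M 1 F \<and> (\<forall>x\<in>carrier M. F (gen x) = sym_class M (c x))"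
    then have ext: "F \<in> extensional (carrier S\<^sub>M)" and Fh: "F \<in> hom_ends S\<^sub>M 1"
      and Fd: "\<And>x y p. \<lbrakk>x \<in> grade S\<^sub>M p; y \<in> carrier S\<^sub>M\<rbrakk> \<Longrightarrow> F (x \<otimes>\<^bsub>S\<^sub>M\<^esub> y) = F x \<otimes>\<^bsub>S\<^sub>M\<^esub> y \<oplus>\<^bsub>S\<^sub>M\<^esub> ksgn S\<^sub>M (1 * p) (x \<otimes>\<^bsub>S\<^sub>M\<^esub> F y)"
      and Fg: "\<And>x. x \<in> carrier M \<Longrightarrow> F (gen x) = sym_class M (c x)"
      by (auto simp: derivation_def)
    note Fl = hom_endsD(1)[OF Fh]
    \<comment> \<open>A derivation kills the unit: applied to the product of 1 with itself, its rule
      gives F 1 = F 1 + F 1.\<close>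
    have "F \<one>\<^bsub>S\<^sub>M\<^esub> \<oplus>\<^bsub>S\<^sub>M\<^esub> F \<one>\<^bsub>S\<^sub>M\<^esub> = F \<one>\<^bsub>S\<^sub>M\<^esub>"
      using Fd[OF S.grade_one S.one_closed] linear_mapsD(1)[OF Fl] by simp
    then have F1: "F \<one>\<^bsub>S\<^sub>M\<^esub> = E \<one>\<^bsub>S\<^sub>M\<^esub>" using linear_mapsD(1)[OF Fl] by (simp add: E(2))
    have "F z = E z" if "z \<in> carrier S\<^sub>M" for z
    proof (rule recursion_unique[OF Fl El F1 _ rec that])
      show "F (gen x \<otimes>\<^bsub>S\<^sub>M\<^esub> z) = sym_class M (c x) \<otimes>\<^bsub>S\<^sub>M\<^esub> z \<oplus>\<^bsub>S\<^sub>M\<^esub> ksgn S\<^sub>M (1 * p) (gen x \<otimes>\<^bsub>S\<^sub>M\<^esub> F z)"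
        if "x \<in> grade M p" "z \<in> carrier S\<^sub>M" for x p z
        using Fd[OF sym_gen_grade[OF that(1)] that(2)] Fg grade_carrier[OF that(1)] by simp
    qed
    then show "F = E'" using ext by (intro extensionalityI[of _ "carrier S\<^sub>M"]) (simp_all add: E'_def)
  qed
  then have D: "D = E'" by (simp add: D_def)
  show "D \<in> hom_ends S\<^sub>M 1" "D \<one>\<^bsub>S\<^sub>M\<^esub> = \<zero>\<^bsub>S\<^sub>M\<^esub>" "dop S\<^sub>M 2 1 D"
    using E'h E S.dop_cong[OF eq E(3)] by (simp_all add: D eq)
  show "D (gen x \<otimes>\<^bsub>S\<^sub>M\<^esub> z) = sym_class M (c x) \<otimes>\<^bsub>S\<^sub>M\<^esub> z \<oplus>\<^bsub>S\<^sub>M\<^esub> ksgn S\<^sub>M p (gen x \<otimes>\<^bsub>S\<^sub>M\<^esub> D z)"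
    if "x \<in> grade M p" "z \<in> carrier S\<^sub>M"
    using rec[OF that] that gen_closed[OF grade_carrier[OF that(1)]] by (simp add: D eq)
qed

definition bracket_like :: "('m \<times> 'm \<Rightarrow> 'm) \<Rightarrow> bool" where
  "bracket_like b \<longleftrightarrow> (\<forall>x\<in>carrier M. (\<lambda>y. b (x, y)) \<in> linear_maps M M) \<and>
    (\<forall>y\<in>carrier M. (\<lambda>x. b (x, y)) \<in> linear_maps M M) \<and>
    (\<forall>p q. \<forall>x\<in>grade M p. \<forall>y\<in>grade M q. b (x, y) \<in> grade M (1 + p + q) \<and> b (x, y) = ksgn M (p * q) (b (y, x)))"

text \<open>The commutator of the operator with x has to be the derivation that sends a generator y
  to b (x, y). So existence is \<open>derivation_exists\<close> for each x, followed by
  \<open>operator_exists\<close>, with the symmetry of b as consistency condition. The derivations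
  are kept in the conclusion because their recursion is needed for the evaluation on
  strings.\<close>

theorem extend_bracket:
  assumes b: "bracket_like b"
  defines "D \<equiv> extend_bracket M b"
  shows "D \<in> hom_ends S\<^sub>M 1" "D \<one>\<^bsub>S\<^sub>M\<^esub> = \<zero>\<^bsub>S\<^sub>M\<^esub>" "dop S\<^sub>M 3 1 D"
    "\<exists>ad. (\<forall>p. \<forall>x\<in>grade M p. ad p x \<in> hom_ends S\<^sub>M (1 + p) \<and> ad p x \<one>\<^bsub>S\<^sub>M\<^esub> = \<zero>\<^bsub>S\<^sub>M\<^esub> \<and>
      (\<forall>z\<in>carrier S\<^sub>M. D (gen x \<otimes>\<^bsub>S\<^sub>M\<^esub> z) = ad p x z \<oplus>\<^bsub>S\<^sub>M\<^esub> ksgn S\<^sub>M p (gen x \<otimes>\<^bsub>S\<^sub>M\<^esub> D z) \<and>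
        (\<forall>q. \<forall>y\<in>grade M q. ad p x (gen y \<otimes>\<^bsub>S\<^sub>M\<^esub> z) =
          gen (b (x, y)) \<otimes>\<^bsub>S\<^sub>M\<^esub> z \<oplus>\<^bsub>S\<^sub>M\<^esub> ksgn S\<^sub>M ((1 + p) * q) (gen y \<otimes>\<^bsub>S\<^sub>M\<^esub> ad p x z))))"
proof -
  have bl: "(\<lambda>y. b (x, y)) \<in> linear_maps M M" "(\<lambda>y. b (y, x)) \<in> linear_maps M M" if "x \<in> carrier M" for x
    using b that unfolding bracket_like_def by blast+
  have bg: "b (x, y) \<in> grade M (1 + p + q)" and bs: "b (x, y) = ksgn M (p * q) (b (y, x))"
    if "x \<in> grade M p" "y \<in> grade M q" for x y p q
    using b that unfolding bracket_like_def by blast+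
  note bc = linear_mapsD(1)[OF bl(1)]
  let ?P = "\<lambda>p x E. E \<in> hom_ends S\<^sub>M (1 + p) \<and> E \<one>\<^bsub>S\<^sub>M\<^esub> = \<zero>\<^bsub>S\<^sub>M\<^esub> \<and> dop S\<^sub>M 2 (1 + p) E \<and>
    (\<forall>q. \<forall>y\<in>grade M q. \<forall>z\<in>carrier S\<^sub>M. E (gen y \<otimes>\<^bsub>S\<^sub>M\<^esub> z) =
      gen (b (x, y)) \<otimes>\<^bsub>S\<^sub>M\<^esub> z \<oplus>\<^bsub>S\<^sub>M\<^esub> ksgn S\<^sub>M ((1 + p) * q) (gen y \<otimes>\<^bsub>S\<^sub>M\<^esub> E z))"
  have "\<exists>E. ?P p x E" if x: "x \<in> grade M p" for p x
  proof -
    have 1: "(\<lambda>y. gen (b (x, y))) \<in> linear_maps M S\<^sub>M"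
      by (rule linear_map_comp[OF bl(1)[OF grade_carrier[OF x]] sym_gen_linear])
    have 2: "gen (b (x, y)) \<in> grade S\<^sub>M (1 + p + q)" if "y \<in> grade M q" for y q
      by (rule sym_gen_grade[OF bg[OF x that]])
    obtain E where "E \<in> hom_ends S\<^sub>M (1 + p)" "E \<one>\<^bsub>S\<^sub>M\<^esub> = \<zero>\<^bsub>S\<^sub>M\<^esub>" "dop S\<^sub>M 2 (1 + p) E"
      "\<And>y q z. \<lbrakk>y \<in> grade M q; z \<in> carrier S\<^sub>M\<rbrakk> \<Longrightarrow> E (gen y \<otimes>\<^bsub>S\<^sub>M\<^esub> z) =
        gen (b (x, y)) \<otimes>\<^bsub>S\<^sub>M\<^esub> z \<oplus>\<^bsub>S\<^sub>M\<^esub> ksgn S\<^sub>M ((1 + p) * q) (gen y \<otimes>\<^bsub>S\<^sub>M\<^esub> E z)"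
      by (rule derivation_exists[OF 1 2]) auto
    then show ?thesis by blast
  qed
  note ex = this
  define ad where "ad p x = (SOME E. ?P p x E)" for p x
  have ad: "?P p x (ad p x)" if "x \<in> grade M p" for p x
    unfolding ad_def by (rule someI_ex[OF ex[OF that]])
  have adh: "ad p x \<in> hom_ends S\<^sub>M (1 + p)" and ad1: "ad p x \<one>\<^bsub>S\<^sub>M\<^esub> = \<zero>\<^bsub>S\<^sub>M\<^esub>" and add: "dop S\<^sub>M 2 (1 + p) (ad p x)"
    if "x \<in> grade M p" for p x using ad[OF that] by blast+
  have adr: "ad p x (gen y \<otimes>\<^bsub>S\<^sub>M\<^esub> z) = gen (b (x, y)) \<otimes>\<^bsub>S\<^sub>M\<^esub> z \<oplus>\<^bsub>S\<^sub>M\<^esub> ksgn S\<^sub>M ((1 + p) * q) (gen y \<otimes>\<^bsub>S\<^sub>M\<^esub> ad p x z)"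
    if "x \<in> grade M p" "y \<in> grade M q" "z \<in> carrier S\<^sub>M" for p x y q z using ad[OF that(1)] that(2,3) by blast
  note adl = hom_endsD(1)[OF adh] and adc = linear_mapsD(1)[OF hom_endsD(1)[OF adh]]
  \<comment> \<open>The operators \<open>ad p x\<close> come from a choice for each x, yet they
    depend linearly on x, because their recursion determines them.\<close>
  have ad_add: "ad p (x \<oplus> x') z = ad p x z \<oplus>\<^bsub>S\<^sub>M\<^esub> ad p x' z"
    if x: "x \<in> grade M p" "x' \<in> grade M p" and z: "z \<in> carrier S\<^sub>M" for p x x' z
  proof (rule recursion_unique[OF adl _ _ _ _ z, where D' = "\<lambda>z. ad p x z \<oplus>\<^bsub>S\<^sub>M\<^esub> ad p x' z"])
    show s: "x \<oplus> x' \<in> grade M p" using x by simp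
    show "(\<lambda>z. ad p x z \<oplus>\<^bsub>S\<^sub>M\<^esub> ad p x' z) \<in> linear_maps S\<^sub>M S\<^sub>M"
      by (intro linear_maps_add S.smod_axioms adl x)
    show "ad p (x \<oplus> x') \<one>\<^bsub>S\<^sub>M\<^esub> = ad p x \<one>\<^bsub>S\<^sub>M\<^esub> \<oplus>\<^bsub>S\<^sub>M\<^esub> ad p x' \<one>\<^bsub>S\<^sub>M\<^esub>" using x s by (simp add: ad1)
    fix y q z assume y: "y \<in> grade M q" and z: "z \<in> carrier S\<^sub>M"
    show "ad p (x \<oplus> x') (gen y \<otimes>\<^bsub>S\<^sub>M\<^esub> z) = gen (b (x \<oplus> x', y)) \<otimes>\<^bsub>S\<^sub>M\<^esub> z \<oplus>\<^bsub>S\<^sub>M\<^esub> ksgn S\<^sub>M ((1 + p) * q) (gen y \<otimes>\<^bsub>S\<^sub>M\<^esub> ad p (x \<oplus> x') z)"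
      by (rule adr[OF s y z])
    note xc = x[THEN grade_carrier] and yc = grade_carrier[OF y]
    have "gen (b (x \<oplus> x', y)) = gen (b (x, y)) \<oplus>\<^bsub>S\<^sub>M\<^esub> gen (b (x', y))"
      using linear_mapsD(2)[OF linear_map_comp[OF bl(2)[OF yc] sym_gen_linear] xc] .
    then show "ad p x (gen y \<otimes>\<^bsub>S\<^sub>M\<^esub> z) \<oplus>\<^bsub>S\<^sub>M\<^esub> ad p x' (gen y \<otimes>\<^bsub>S\<^sub>M\<^esub> z) =
      gen (b (x \<oplus> x', y)) \<otimes>\<^bsub>S\<^sub>M\<^esub> z \<oplus>\<^bsub>S\<^sub>M\<^esub> ksgn S\<^sub>M ((1 + p) * q) (gen y \<otimes>\<^bsub>S\<^sub>M\<^esub> (ad p x z \<oplus>\<^bsub>S\<^sub>M\<^esub> ad p x' z))"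
      using xc yc z by (simp add: adr[OF x(1) y z] adr[OF x(2) y z] adc[OF x(1)] adc[OF x(2)] bc gen_closed
          S.l_distr S.r_distr S.sg_add S.a_ac)
  qed
  have ad_smult: "ad p (r \<odot> x) z = r \<odot>\<^bsub>S\<^sub>M\<^esub> ad p x z"
    if x: "x \<in> grade M p" and z: "z \<in> carrier S\<^sub>M" for p x r z
  proof (rule recursion_unique[OF adl _ _ _ _ z, where D' = "\<lambda>z. r \<odot>\<^bsub>S\<^sub>M\<^esub> ad p x z"])
    show s: "r \<odot> x \<in> grade M p" using x by simp
    show "(\<lambda>z. r \<odot>\<^bsub>S\<^sub>M\<^esub> ad p x z) \<in> linear_maps S\<^sub>M S\<^sub>M"
      by (intro linear_maps_smult S.smod_axioms adl x)
    show "ad p (r \<odot> x) \<one>\<^bsub>S\<^sub>M\<^esub> = r \<odot>\<^bsub>S\<^sub>M\<^esub> ad p x \<one>\<^bsub>S\<^sub>M\<^esub>" using x s by (simp add: ad1)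
    fix y q z assume y: "y \<in> grade M q" and z: "z \<in> carrier S\<^sub>M"
    show "ad p (r \<odot> x) (gen y \<otimes>\<^bsub>S\<^sub>M\<^esub> z) = gen (b (r \<odot> x, y)) \<otimes>\<^bsub>S\<^sub>M\<^esub> z \<oplus>\<^bsub>S\<^sub>M\<^esub> ksgn S\<^sub>M ((1 + p) * q) (gen y \<otimes>\<^bsub>S\<^sub>M\<^esub> ad p (r \<odot> x) z)"
      by (rule adr[OF s y z])
    note xc = grade_carrier[OF x] and yc = grade_carrier[OF y]
    have "gen (b (r \<odot> x, y)) = r \<odot>\<^bsub>S\<^sub>M\<^esub> gen (b (x, y))"
      using linear_mapsD(3)[OF linear_map_comp[OF bl(2)[OF yc] sym_gen_linear] xc] .
    then show "r \<odot>\<^bsub>S\<^sub>M\<^esub> ad p x (gen y \<otimes>\<^bsub>S\<^sub>M\<^esub> z) =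
      gen (b (r \<odot> x, y)) \<otimes>\<^bsub>S\<^sub>M\<^esub> z \<oplus>\<^bsub>S\<^sub>M\<^esub> ksgn S\<^sub>M ((1 + p) * q) (gen y \<otimes>\<^bsub>S\<^sub>M\<^esub> (r \<odot>\<^bsub>S\<^sub>M\<^esub> ad p x z))"
      using xc yc z by (simp add: adr[OF x y z] adc[OF x] bc gen_closed
          S.sm_radd S.sm_mult_left S.sm_mult_right S.sg_smult)
  qed
  \<comment> \<open>Assembles the operators chosen for homogeneous x into a family that is linear in
    all x.\<close>
  define a where "a x z = ad 0 (part 0 x) z \<oplus>\<^bsub>S\<^sub>M\<^esub> ad 1 (part 1 x) z" for x z
  have ad0: "ad p \<zero> z = \<zero>\<^bsub>S\<^sub>M\<^esub>" if "z \<in> carrier S\<^sub>M" for p z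
    using ad_smult[of \<zero> p z 0] adc[of \<zero> p z] that by simp
  have a_ad: "a x z = ad p x z" if "x \<in> grade M p" "z \<in> carrier S\<^sub>M" for x p z
    using that adc[OF that] by (cases p) (simp_all add: a_def part_homogeneous ad0)
  obtain E where E: "E \<in> hom_ends S\<^sub>M 1" "E \<one>\<^bsub>S\<^sub>M\<^esub> = \<zero>\<^bsub>S\<^sub>M\<^esub>"
    and Ea: "\<And>x p z. \<lbrakk>x \<in> grade M p; z \<in> carrier S\<^sub>M\<rbrakk> \<Longrightarrow>
      E (gen x \<otimes>\<^bsub>S\<^sub>M\<^esub> z) = a x z \<oplus>\<^bsub>S\<^sub>M\<^esub> ksgn S\<^sub>M (1 * p) (gen x \<otimes>\<^bsub>S\<^sub>M\<^esub> E z)"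
  proof (rule operator_exists[of a 1])
    note pl = linear_mapsD[OF part_linear]
    show "a x \<in> linear_maps S\<^sub>M S\<^sub>M" if "x \<in> carrier M" for x
      unfolding a_def[abs_def] by (intro linear_maps_add S.smod_axioms adl part_grade that)
    show "a (x \<oplus> y) z = a x z \<oplus>\<^bsub>S\<^sub>M\<^esub> a y z" if "x \<in> carrier M" "y \<in> carrier M" "z \<in> carrier S\<^sub>M" for x y z
      using that by (simp add: a_def pl ad_add part_grade adc S.a_ac)
    show "a (r \<odot> x) z = r \<odot>\<^bsub>S\<^sub>M\<^esub> a x z" if "x \<in> carrier M" "z \<in> carrier S\<^sub>M" for x r z
      using that by (simp add: a_def pl ad_smult part_grade adc S.sm_radd)
    show "a x \<in> hom_ends S\<^sub>M (1 + p)" if "x \<in> grade M p" for x p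
      by (rule S.hom_ends_cong[OF a_ad[OF that] adh[OF that]])
    show "a x (gen y \<otimes>\<^bsub>S\<^sub>M\<^esub> z) \<oplus>\<^bsub>S\<^sub>M\<^esub> ksgn S\<^sub>M (1 * p) (gen x \<otimes>\<^bsub>S\<^sub>M\<^esub> a y z) =
      ksgn S\<^sub>M (p * q) (a y (gen x \<otimes>\<^bsub>S\<^sub>M\<^esub> z) \<oplus>\<^bsub>S\<^sub>M\<^esub> ksgn S\<^sub>M (1 * q) (gen y \<otimes>\<^bsub>S\<^sub>M\<^esub> a x z))"
      if x: "x \<in> grade M p" and y: "y \<in> grade M q" and z: "z \<in> carrier S\<^sub>M" for x y p q z
    proof -
      note xc = grade_carrier[OF x] and yc = grade_carrier[OF y]
      have "gen (b (x, y)) = ksgn S\<^sub>M (p * q) (gen (b (y, x)))"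
        using bs[OF x y] linear_map_ksgn[OF smod_axioms S.smod_axioms sym_gen_linear] bc[OF yc xc] by simp
      then show ?thesis
        using xc yc z
        by (simp add: a_ad[OF x] a_ad[OF y] gen_closed adr[OF x y z] adr[OF y x z] bc adc[OF x] adc[OF y]
            S.sg_add S.sg_sg S.sg_mult_left distrib_right S.a_assoc mult.commute[of q p] add.commute[of "p * q"])
          (simp add: S.a_comm adc[OF x] adc[OF y] gen_closed)
    qed
  qed blast
  have Er: "E (gen x \<otimes>\<^bsub>S\<^sub>M\<^esub> z) = ad p x z \<oplus>\<^bsub>S\<^sub>M\<^esub> ksgn S\<^sub>M p (gen x \<otimes>\<^bsub>S\<^sub>M\<^esub> E z)"
    if "x \<in> grade M p" "z \<in> carrier S\<^sub>M" for x p z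
    using Ea[OF that] a_ad[OF that] by simp
  have Edop: "dop S\<^sub>M (Suc 2) 1 E"
  proof (rule dop_generators[OF E(1)])
    fix p x assume x: "x \<in> grade M p"
    show "dop S\<^sub>M 2 (1 + p) (mult_commutator S\<^sub>M 1 E p (gen x))"
    proof (rule S.dop_cong[OF _ add[OF x]])
      show "mult_commutator S\<^sub>M 1 E p (gen x) z = ad p x z" if z: "z \<in> carrier S\<^sub>M" for z
        by (rule recursion_commutator[OF E(1) x z adc[OF x z]]) (simp add: Er[OF x z])
    qed
  qed
  note El = hom_endsD(1)[OF E(1)]
  note Ec = linear_mapsD(1)[OF El]
  define E' where "E' = restrict E (carrier S\<^sub>M)"
  have eq: "E' z = E z" if "z \<in> carrier S\<^sub>M" for z using that by (simp add: E'_def)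
  have E'h: "E' \<in> hom_ends S\<^sub>M 1" by (rule S.hom_ends_cong[OF eq E(1)])
  have E1: "E (gen x) = \<zero>\<^bsub>S\<^sub>M\<^esub>" if x: "x \<in> carrier M" for x
  proof (rule graded_linear_eqI[OF S.smod_axioms linear_map_comp[OF sym_gen_linear El] linear_maps_zero[OF S.smod_axioms] _ x])
    show "E (gen x) = \<zero>\<^bsub>S\<^sub>M\<^esub>" if "x \<in> grade M p" for x p
      using Er[OF that S.one_closed] gen_closed[OF grade_carrier[OF that]] by (simp add: E(2) ad1[OF that])
  qed
  have E2: "E (gen x \<otimes>\<^bsub>S\<^sub>M\<^esub> gen y) = gen (b (x, y))" if x: "x \<in> carrier M" and y: "y \<in> carrier M" for x y
  proof (rule graded_linear_eqI[OF S.smod_axioms _ _ _ x, where f = "\<lambda>x. E (gen x \<otimes>\<^bsub>S\<^sub>M\<^esub> gen y)" and g = "\<lambda>x. gen (b (x, y))"])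
    show "(\<lambda>x. E (gen x \<otimes>\<^bsub>S\<^sub>M\<^esub> gen y)) \<in> linear_maps M S\<^sub>M"
      by (rule linear_map_comp[OF linear_map_comp[OF sym_gen_linear S.mult_linear_right[OF gen_closed[OF y]]] El])
    show "(\<lambda>x. gen (b (x, y))) \<in> linear_maps M S\<^sub>M" by (rule linear_map_comp[OF bl(2)[OF y] sym_gen_linear])
    fix p x assume x: "x \<in> grade M p"
    note xc = grade_carrier[OF x]
    show "E (gen x \<otimes>\<^bsub>S\<^sub>M\<^esub> gen y) = gen (b (x, y))"
    proof (rule graded_linear_eqI[OF S.smod_axioms _ _ _ y, where f = "\<lambda>y. E (gen x \<otimes>\<^bsub>S\<^sub>M\<^esub> gen y)" and g = "\<lambda>y. gen (b (x, y))"])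
      show "(\<lambda>y. E (gen x \<otimes>\<^bsub>S\<^sub>M\<^esub> gen y)) \<in> linear_maps M S\<^sub>M"
        by (rule linear_map_comp[OF linear_map_comp[OF sym_gen_linear S.mult_linear_left[OF gen_closed[OF xc]]] El])
      show "(\<lambda>y. gen (b (x, y))) \<in> linear_maps M S\<^sub>M" by (rule linear_map_comp[OF bl(1)[OF xc] sym_gen_linear])
      fix q y assume y: "y \<in> grade M q"
      note yc = grade_carrier[OF y]
      have "ad p x (gen y) = gen (b (x, y))"
        using adr[OF x y S.one_closed] xc yc by (simp add: gen_closed bc ad1[OF x])
      then show "E (gen x \<otimes>\<^bsub>S\<^sub>M\<^esub> gen y) = gen (b (x, y))"
        using Er[OF x gen_closed[OF yc]] xc yc by (simp add: E1 gen_closed bc)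
    qed
  qed
  have upto: "z \<in> carrier S\<^sub>M \<and> E z = \<zero>\<^bsub>S\<^sub>M\<^esub>" if z: "z \<in> sym_upto M 1" for z
  proof -
    obtain f where f: "Poly_Mapping.keys f \<subseteq> {w \<in> lists (carrier M). length w \<le> 1}" "z = sym_class M (tensor_class M f)"
      using z unfolding sym_upto_def by blast
    have fc: "f \<in> carrier F\<^sub>M" using f(1) by (auto simp: freeD(1))
    have "E (sym_class M (tensor_class M f)) = \<zero>\<^bsub>S\<^sub>M\<^esub>"
    proof (rule free_ext[OF free_alg_free_on S.smod_axioms _ linear_maps_zero[OF S.smod_axioms] _ _ f(1)])
      show "(\<lambda>f. E (sym_class M (tensor_class M f))) \<in> linear_maps F\<^sub>M S\<^sub>M"
        by (rule linear_map_comp[OF linear_map_comp[OF tensor_class_linear sym_class_linear] El])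
      fix w assume "w \<in> {w \<in> lists (carrier M). length w \<le> 1}"
      then have "w = [] \<or> (\<exists>x\<in>carrier M. w = [x])" by (cases w) auto
      then have "E (sw M w) = \<zero>\<^bsub>S\<^sub>M\<^esub>" by (auto simp: sw_Nil E(2) E1 sym_gen_eq[symmetric])
      then show "E (sym_class M (tensor_class M (mono w))) = \<zero>\<^bsub>S\<^sub>M\<^esub>" by (simp add: sw_def tw_def)
    qed auto
    moreover have "z \<in> carrier S\<^sub>M"
      using linear_mapsD(1)[OF sym_class_linear linear_mapsD(1)[OF tensor_class_linear fc]] f(2) by simp
    ultimately show ?thesis using f(2) by simp
  qed
  have swu: "sw M w \<in> sym_upto M 1" if "w \<in> lists (carrier M)" "length w \<le> 1" for w
    unfolding sym_upto_def sw_def tw_def using that by (intro imageI) simp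
  have E'd: "diff_op S\<^sub>M 2 1 E'"
    unfolding S.diff_op_iff_dop by (rule S.dop_cong[OF eq Edop])
  have "extend_bracket M b = E'"
    unfolding extend_bracket_def
  proof (rule the_equality, intro conjI ballI)
    show "E' \<in> extensional (carrier S\<^sub>M)" by (simp add: E'_def)
    show "diff_op S\<^sub>M 2 1 E'" by (rule E'd)
    show "E' z = \<zero>\<^bsub>S\<^sub>M\<^esub>" if "z \<in> sym_upto M 1" for z using upto[OF that] by (simp add: eq)
    show "E' (gen x \<otimes>\<^bsub>S\<^sub>M\<^esub> gen y) = gen (b (x, y))" if "x \<in> carrier M" "y \<in> carrier M" for x y
      using that by (simp add: eq gen_closed E2)
  next
    fix F assume F: "F \<in> extensional (carrier S\<^sub>M) \<and> diff_op S\<^sub>M 2 1 F \<and> (\<forall>z\<in>sym_upto M 1. F z = \<zero>\<^bsub>S\<^sub>M\<^esub>) \<and>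
      (\<forall>x\<in>carrier M. \<forall>y\<in>carrier M. F (gen x \<otimes>\<^bsub>S\<^sub>M\<^esub> gen y) = gen (b (x, y)))"
    have Fd: "dop S\<^sub>M (Suc 2) 1 F" using F unfolding S.diff_op_iff_dop by blast
    note Fc = linear_mapsD(1)[OF hom_endsD(1)[OF S.dop_hom[OF Fd]]]
    \<comment> \<open>The difference of two candidates has order at most 2, so it is enough that it
      vanishes on words of at most two letters.\<close>
    have dd: "dop S\<^sub>M (Suc 2) 1 (\<lambda>z. F z \<oplus>\<^bsub>S\<^sub>M\<^esub> ksgn S\<^sub>M 1 (E z))"
      by (rule S.dop_add[OF Fd S.dop_ksgn[OF Edop]])
    have "F z \<oplus>\<^bsub>S\<^sub>M\<^esub> ksgn S\<^sub>M 1 (E z) = \<zero>\<^bsub>S\<^sub>M\<^esub>" if z: "z \<in> carrier S\<^sub>M" for z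
    proof (rule dop_unique[OF dd _ z])
      fix w assume w: "w \<in> lists (carrier M)" "length w < Suc 2"
      show "F (sw M w) \<oplus>\<^bsub>S\<^sub>M\<^esub> ksgn S\<^sub>M 1 (E (sw M w)) = \<zero>\<^bsub>S\<^sub>M\<^esub>"
      proof (cases "length w \<le> 1")
        case True
        then show ?thesis using upto[OF swu[OF w(1)]] F swu[OF w(1)] by simp
      next
        case False
        then have "length w = Suc (Suc 0)" using w(2) by simp
        then obtain x y where xy: "w = [x, y]" by (auto simp: length_Suc_conv)
        then have c: "x \<in> carrier M" "y \<in> carrier M" using w(1) by auto
        then have "sw M w = gen x \<otimes>\<^bsub>S\<^sub>M\<^esub> gen y" by (simp add: xy sw_Cons sw_Nil gen_closed)
        then show ?thesis using F c by (simp add: E2 S.sg_1 S.r_neg gen_closed bc)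
      qed
    qed
    then have "F z = E z" if "z \<in> carrier S\<^sub>M" for z
      using that Fc[OF that] Ec[OF that] S.minus_eq_zero_iff[OF Fc[OF that] Ec[OF that]]
      by (simp add: S.sg_1 a_minus_def)
    then show "F = E'" using F by (intro extensionalityI[of _ "carrier S\<^sub>M"]) (simp_all add: E'_def)
  qed
  then have D: "D = E'" by (simp add: D_def)
  show "D \<in> hom_ends S\<^sub>M 1" "D \<one>\<^bsub>S\<^sub>M\<^esub> = \<zero>\<^bsub>S\<^sub>M\<^esub>" using E'h E(2) by (simp_all add: D eq)
  show "dop S\<^sub>M 3 1 D" using E'd unfolding S.diff_op_iff_dop by (simp add: D numeral_3_eq_3 numeral_2_eq_2)
  show "\<exists>ad. (\<forall>p. \<forall>x\<in>grade M p. ad p x \<in> hom_ends S\<^sub>M (1 + p) \<and> ad p x \<one>\<^bsub>S\<^sub>M\<^esub> = \<zero>\<^bsub>S\<^sub>M\<^esub> \<and>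
      (\<forall>z\<in>carrier S\<^sub>M. D (gen x \<otimes>\<^bsub>S\<^sub>M\<^esub> z) = ad p x z \<oplus>\<^bsub>S\<^sub>M\<^esub> ksgn S\<^sub>M p (gen x \<otimes>\<^bsub>S\<^sub>M\<^esub> D z) \<and>
        (\<forall>q. \<forall>y\<in>grade M q. ad p x (gen y \<otimes>\<^bsub>S\<^sub>M\<^esub> z) =
          gen (b (x, y)) \<otimes>\<^bsub>S\<^sub>M\<^esub> z \<oplus>\<^bsub>S\<^sub>M\<^esub> ksgn S\<^sub>M ((1 + p) * q) (gen y \<otimes>\<^bsub>S\<^sub>M\<^esub> ad p x z))))"
    using adh ad1 adr Er by (intro exI[of _ ad]) (simp add: D eq gen_closed grade_carrier)
qed

end

section \<open>Signed extraction from lists\<close>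

context smod
begin

text \<open>
  \<open>ex\<close> sums over the ways to extract an element from a list, with the Koszul sign of moving it to
  the front, \<open>ux\<close> over unordered pairs of elements, and \<open>ew\<close> over the letters of a word.
\<close>

primrec ex :: "('x \<Rightarrow> bit) \<Rightarrow> 'x list \<Rightarrow> ('x \<Rightarrow> 'x list \<Rightarrow> 'm) \<Rightarrow> 'm" where
  "ex d [] H = \<zero>"
| "ex d (x # L) H = H x L \<oplus> ex d L (\<lambda>y r. ksgn M (d x * d y) (H y (x # r)))"

primrec ux :: "('x \<Rightarrow> bit) \<Rightarrow> 'x list \<Rightarrow> ('x \<Rightarrow> 'x \<Rightarrow> 'x list \<Rightarrow> 'm) \<Rightarrow> 'm" where
  "ux d [] H = \<zero>"
| "ux d (x # L) H = ex d L (H x) \<oplus> ux d L (\<lambda>y z r. ksgn M (d x * (d y + d z)) (H y z (x # r)))"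

primrec ew :: "'l list \<Rightarrow> ('l list \<Rightarrow> 'l \<Rightarrow> 'l list \<Rightarrow> 'm) \<Rightarrow> 'm" where
  "ew [] H = \<zero>"
| "ew (p # w) H = H [] p w \<oplus> ew w (\<lambda>u q v. H (p # u) q v)"

abbreviation dl :: "('x \<Rightarrow> bit) \<Rightarrow> 'x list \<Rightarrow> bit" where "dl d L \<equiv> sum_list (map d L)"

lemma ex_closed: "(\<And>x r. H x r \<in> carrier M) \<Longrightarrow> ex d L H \<in> carrier M"
  by (induction L arbitrary: H) simp_all

lemma ux_closed: "(\<And>x y r. H x y r \<in> carrier M) \<Longrightarrow> ux d L H \<in> carrier M"
  by (induction L arbitrary: H) (simp_all add: ex_closed)

lemma ew_closed: "(\<And>u p v. H u p v \<in> carrier M) \<Longrightarrow> ew w H \<in> carrier M"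
  by (induction w arbitrary: H) simp_all

text \<open>The hypothesis records that x and r rearrange \<open>L\<close>. Properties of lists that
  depend only on the multiset, such as \<open>valid\<close> and \<open>small\<close> below, thereby
  pass to every summand.\<close>

lemma ex_cong:
  assumes "\<And>x r. mset (x # r) = mset L \<Longrightarrow> H x r = H' x r"
  shows "ex d L H = ex d L H'"
  using assms
proof (induction L arbitrary: H H')
  case (Cons a L)
  have "ex d L (\<lambda>y r. ksgn M (d a * d y) (H y (a # r))) = ex d L (\<lambda>y r. ksgn M (d a * d y) (H' y (a # r)))"
    by (rule Cons.IH) (simp add: Cons.prems add_mset_commute)
  moreover have "H a L = H' a L" by (rule Cons.prems) simp
  ultimately show ?case by simp
qed simp

lemma ux_cong:
  assumes "\<And>x y r. mset (x # y # r) = mset L \<Longrightarrow> H x y r = H' x y r"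
  shows "ux d L H = ux d L H'"
  using assms
proof (induction L arbitrary: H H')
  case (Cons a L)
  have "ux d L (\<lambda>y z r. ksgn M (d a * (d y + d z)) (H y z (a # r))) = ux d L (\<lambda>y z r. ksgn M (d a * (d y + d z)) (H' y z (a # r)))"
    by (rule Cons.IH) (simp add: Cons.prems add_mset_commute)
  moreover have "ex d L (H a) = ex d L (H' a)" by (rule ex_cong) (simp add: Cons.prems)
  ultimately show ?case by simp
qed simp

lemma ew_cong: "(\<And>u p v. w = u @ p # v \<Longrightarrow> H u p v = H' u p v) \<Longrightarrow> ew w H = ew w H'"
proof (induction w arbitrary: H H')
  case (Cons a w)
  have "ew w (\<lambda>u q v. H (a # u) q v) = ew w (\<lambda>u q v. H' (a # u) q v)"
    by (rule Cons.IH) (simp add: Cons.prems)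
  then show ?case using Cons.prems[of "[]" a w] by simp
qed simp

lemma ex_zero: "(\<And>x r. mset (x # r) = mset L \<Longrightarrow> H x r = \<zero>) \<Longrightarrow> ex d L H = \<zero>"
proof -
  have "ex d L (\<lambda>x r. \<zero>) = \<zero>" by (induction L) simp_all
  moreover assume "\<And>x r. mset (x # r) = mset L \<Longrightarrow> H x r = \<zero>"
  then have "ex d L H = ex d L (\<lambda>x r. \<zero>)" by (rule ex_cong)
  ultimately show ?thesis by simp
qed

lemma ux_zero: "(\<And>x y r. mset (x # y # r) = mset L \<Longrightarrow> H x y r = \<zero>) \<Longrightarrow> ux d L H = \<zero>"
proof -
  have "ux d L (\<lambda>x y r. \<zero>) = \<zero>" by (induction L) (simp_all add: ex_zero)
  moreover assume "\<And>x y r. mset (x # y # r) = mset L \<Longrightarrow> H x y r = \<zero>"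
  then have "ux d L H = ux d L (\<lambda>x y r. \<zero>)" by (rule ux_cong)
  ultimately show ?thesis by simp
qed

lemma ew_zero: "(\<And>u p v. w = u @ p # v \<Longrightarrow> H u p v = \<zero>) \<Longrightarrow> ew w H = \<zero>"
proof -
  have "ew w (\<lambda>u p v. \<zero>) = \<zero>" by (induction w) simp_all
  moreover assume "\<And>u p v. w = u @ p # v \<Longrightarrow> H u p v = \<zero>"
  then have "ew w H = ew w (\<lambda>u p v. \<zero>)" by (rule ew_cong)
  ultimately show ?thesis by simp
qed

lemma ex_add:
  "\<lbrakk>\<And>x r. H x r \<in> carrier M; \<And>x r. H' x r \<in> carrier M\<rbrakk> \<Longrightarrow> ex d L (\<lambda>x r. H x r \<oplus> H' x r) = ex d L H \<oplus> ex d L H'"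
proof (induction L arbitrary: H H')
  case (Cons a L)
  have "ex d L (\<lambda>y r. ksgn M (d a * d y) (H y (a # r)) \<oplus> ksgn M (d a * d y) (H' y (a # r))) =
    ex d L (\<lambda>y r. ksgn M (d a * d y) (H y (a # r))) \<oplus> ex d L (\<lambda>y r. ksgn M (d a * d y) (H' y (a # r)))"
    by (rule Cons.IH) (simp_all add: Cons.prems)
  then show ?case using Cons.prems by (simp add: sg_add ex_closed a_ac)
qed simp

lemma ew_add:
  "\<lbrakk>\<And>u p v. H u p v \<in> carrier M; \<And>u p v. H' u p v \<in> carrier M\<rbrakk>
    \<Longrightarrow> ew w (\<lambda>u p v. H u p v \<oplus> H' u p v) = ew w H \<oplus> ew w H'"
  by (induction w arbitrary: H H') (simp_all add: ew_closed a_ac)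

lemma ex_hom:
  assumes "f \<in> linear_maps M M" "\<And>x r. H x r \<in> carrier M"
  shows "ex d L (\<lambda>x r. f (H x r)) = f (ex d L H)"
  using assms(2)
proof (induction L arbitrary: H)
  case (Cons a L)
  have "ex d L (\<lambda>y r. f (ksgn M (d a * d y) (H y (a # r)))) = f (ex d L (\<lambda>y r. ksgn M (d a * d y) (H y (a # r))))"
    by (rule Cons.IH) (simp add: Cons.prems)
  then show ?case
    using Cons.prems linear_mapsD(2)[OF assms(1)] linear_map_ksgn[OF smod_axioms smod_axioms assms(1)]
    by (simp add: ex_closed)
qed (simp add: linear_map_zero[OF smod_axioms smod_axioms assms(1)])

lemma ux_hom:
  assumes "f \<in> linear_maps M M" "\<And>x y r. H x y r \<in> carrier M"
  shows "ux d L (\<lambda>x y r. f (H x y r)) = f (ux d L H)"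
  using assms(2)
proof (induction L arbitrary: H)
  case (Cons a L)
  have "ux d L (\<lambda>y z r. f (ksgn M (d a * (d y + d z)) (H y z (a # r)))) = f (ux d L (\<lambda>y z r. ksgn M (d a * (d y + d z)) (H y z (a # r))))"
    by (rule Cons.IH) (simp add: Cons.prems)
  then show ?case
    using Cons.prems linear_mapsD(2)[OF assms(1)] linear_map_ksgn[OF smod_axioms smod_axioms assms(1)]
    by (simp add: ex_closed ux_closed ex_hom[OF assms(1)])
qed (simp add: linear_map_zero[OF smod_axioms smod_axioms assms(1)])

lemma ew_hom:
  assumes "smod N" "f \<in> linear_maps M N" "\<And>u p v. H u p v \<in> carrier M"
  shows "smod.ew N w (\<lambda>u p v. f (H u p v)) = f (ew w H)"
proof -
  interpret N: smod N by fact
  show ?thesis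
    using assms(3)
    by (induction w arbitrary: H)
      (simp_all add: linear_map_zero[OF smod_axioms assms(1,2)] linear_mapsD(2)[OF assms(2)] ew_closed)
qed

lemma ksgn_linear: "ksgn M e \<in> linear_maps M M"
  by (rule linear_mapsI) (simp_all add: sg_add sg_smult)

lemma ex_sg: "(\<And>x r. H x r \<in> carrier M) \<Longrightarrow> ex d L (\<lambda>x r. ksgn M e (H x r)) = ksgn M e (ex d L H)"
  by (rule ex_hom[OF ksgn_linear])

lemma ux_sg: "(\<And>x y r. H x y r \<in> carrier M) \<Longrightarrow> ux d L (\<lambda>x y r. ksgn M e (H x y r)) = ksgn M e (ux d L H)"
  by (rule ux_hom[OF ksgn_linear])

lemma ew_sg: "(\<And>u p v. H u p v \<in> carrier M) \<Longrightarrow> ew w (\<lambda>u p v. ksgn M e (H u p v)) = ksgn M e (ew w H)"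
  by (rule ew_hom[OF smod_axioms ksgn_linear])

lemma ew_append:
  "(\<And>u p v. H u p v \<in> carrier M) \<Longrightarrow>
    ew (w @ w') H = ew w (\<lambda>u p v. H u p (v @ w')) \<oplus> ew w' (\<lambda>u p v. H (w @ u) p v)"
  by (induction w arbitrary: H) (simp_all add: ew_closed a_assoc)

lemma ew_commute:
  assumes "\<And>u p v x q y. H u p v x q y \<in> carrier M"
  shows "ew w (\<lambda>u p v. ew w' (H u p v)) = ew w' (\<lambda>x q y. ew w (\<lambda>u p v. H u p v x q y))"
  using assms
proof (induction w arbitrary: H)
  case Nil
  then show ?case by (simp add: ew_zero)
next
  case (Cons a w)
  then show ?case by (simp add: ew_add ew_closed)
qed

lemma ex_append:
  assumes "\<And>x r. H x r \<in> carrier M"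
  shows "ex d (L @ L') H = ex d L (\<lambda>x r. H x (r @ L')) \<oplus> ex d L' (\<lambda>x r. ksgn M (dl d L * d x) (H x (L @ r)))"
  using assms
  by (induction L arbitrary: H) (simp_all add: ex_closed a_assoc sg_sg distrib_right add.commute)

text \<open>The two orders of extracting the same two elements differ by the sign of exchanging them
  once they stand in front.\<close>

lemma ex_swap2:
  assumes "\<And>x y r. H x y r \<in> carrier M"
  shows "ex d L (\<lambda>x r. ex d r (\<lambda>y r'. H x y r')) = ex d L (\<lambda>x r. ex d r (\<lambda>y r'. ksgn M (d x * d y) (H y x r')))"
  using assms
proof (induction L arbitrary: H)
  case (Cons a L)
  have IH: "ex d L (\<lambda>x r. ex d r (\<lambda>y r'. ksgn M (d a * d x + d a * d y) (H x y (a # r')))) =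
     ex d L (\<lambda>x r. ex d r (\<lambda>y r'. ksgn M (d x * d y) (ksgn M (d a * d y + d a * d x) (H y x (a # r')))))"
    by (rule Cons.IH) (simp add: Cons.prems)
  have 1: "ex d L (\<lambda>x r. ksgn M (d a * d x) (H x a r \<oplus> ex d r (\<lambda>y r'. ksgn M (d a * d y) (H x y (a # r'))))) =
    ex d L (\<lambda>x r. ksgn M (d a * d x) (H x a r)) \<oplus> ex d L (\<lambda>x r. ex d r (\<lambda>y r'. ksgn M (d a * d x + d a * d y) (H x y (a # r'))))"
    using Cons.prems by (simp add: sg_add ex_closed ex_add ex_sg[symmetric] sg_sg)
  have 2: "ex d L (\<lambda>x r. ksgn M (d a * d x) (ksgn M (d x * d a) (H a x r) \<oplus> ex d r (\<lambda>y r'. ksgn M (d a * d y) (ksgn M (d x * d y) (H y x (a # r')))))) =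
    ex d L (\<lambda>x r. H a x r) \<oplus> ex d L (\<lambda>x r. ex d r (\<lambda>y r'. ksgn M (d x * d y) (ksgn M (d a * d y + d a * d x) (H y x (a # r')))))"
    using Cons.prems by (simp add: sg_add ex_closed ex_add ex_sg[symmetric] sg_sg mult.commute add_ac)
  show ?case
    unfolding ex.simps 1 2 IH using Cons.prems by (simp add: ex_closed a_ac)
qed simp

text \<open>If neither a nor b is extracted, the hypothesis on H applies to the remaining list. If
  one of them is, the same rest occurs on both sides, and the difference of the Koszul signs is the
  sign claimed.\<close>

lemma ex_transpose:
  assumes cl: "\<And>x r. H x r \<in> carrier M"
    and H: "\<And>x r r'. mset (x # r @ a # b # r') = mset (L @ a # b # L') \<Longrightarrow>
      H x (r @ a # b # r') = ksgn M (d a * d b) (H x (r @ b # a # r'))"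
  shows "ex d (L @ a # b # L') H = ksgn M (d a * d b) (ex d (L @ b # a # L') H)"
proof -
  have 1: "ex d L (\<lambda>x r. H x (r @ a # b # L')) = ksgn M (d a * d b) (ex d L (\<lambda>x r. H x (r @ b # a # L')))"
  proof -
    have "ex d L (\<lambda>x r. H x (r @ a # b # L')) = ex d L (\<lambda>x r. ksgn M (d a * d b) (H x (r @ b # a # L')))"
      by (rule ex_cong, rule H) simp
    then show ?thesis by (simp add: ex_sg cl)
  qed
  have 2: "ex d L' (\<lambda>x r. ksgn M (d b * d x) (ksgn M (d a * d x) (ksgn M (dl d L * d x) (H x (L @ a # b # r))))) =
    ksgn M (d a * d b) (ex d L' (\<lambda>x r. ksgn M (d a * d x) (ksgn M (d b * d x) (ksgn M (dl d L * d x) (H x (L @ b # a # r))))))"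
  proof -
    have "ex d L' (\<lambda>x r. ksgn M (d b * d x) (ksgn M (d a * d x) (ksgn M (dl d L * d x) (H x (L @ a # b # r))))) = ex d L' (\<lambda>x r. ksgn M (d a * d b) (ksgn M (d a * d x) (ksgn M (d b * d x) (ksgn M (dl d L * d x) (H x (L @ b # a # r))))))"
    proof (rule ex_cong)
      fix x r assume m: "mset (x # r) = mset L'"
      have *: "H x (L @ a # b # r) = ksgn M (d a * d b) (H x (L @ b # a # r))"
        by (rule H) (simp add: m[symmetric] add_mset_commute)
      show "ksgn M (d b * d x) (ksgn M (d a * d x) (ksgn M (dl d L * d x) (H x (L @ a # b # r)))) = ksgn M (d a * d b) (ksgn M (d a * d x) (ksgn M (d b * d x) (ksgn M (dl d L * d x) (H x (L @ b # a # r)))))"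
        unfolding * by (simp add: sg_sg cl add_ac)
    qed
    then show ?thesis by (simp add: ex_sg cl)
  qed
  show ?thesis
    unfolding ex_append[OF cl] ex.simps 1 2
    using cl by (simp add: ex_closed sg_add sg_sg) (simp add: a_ac ex_closed add_ac mult.commute)
qed

text \<open>The case that is new compared with \<open>ex_transpose\<close> is the pair formed by a
  and b themselves; it requires H to be symmetric.\<close>

lemma ux_transpose:
  assumes cl: "\<And>x y r. H x y r \<in> carrier M"
    and sym: "\<And>x y r. mset (x # y # r) = mset (L @ a # b # L') \<Longrightarrow> H x y r = ksgn M (d x * d y) (H y x r)"
    and H: "\<And>x y r r'. mset (x # y # r @ a # b # r') = mset (L @ a # b # L') \<Longrightarrow>
      H x y (r @ a # b # r') = ksgn M (d a * d b) (H x y (r @ b # a # r'))"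
  shows "ux d (L @ a # b # L') H = ksgn M (d a * d b) (ux d (L @ b # a # L') H)"
  using assms
proof (induction L arbitrary: H)
  case Nil
  have "ux d L' (\<lambda>y z r. ksgn M (d b * (d y + d z)) (ksgn M (d a * (d y + d z)) (H y z (a # b # r)))) = ux d L' (\<lambda>y z r. ksgn M (d a * d b) (ksgn M (d a * (d y + d z)) (ksgn M (d b * (d y + d z)) (H y z (b # a # r)))))"
  proof (rule ux_cong)
    fix y z r assume m: "mset (y # z # r) = mset L'"
    then have *: "H y z ([] @ a # b # r) = ksgn M (d a * d b) (H y z ([] @ b # a # r))"
      by (intro Nil.prems(3)) (simp add: m[symmetric] add_mset_commute)
    show "ksgn M (d b * (d y + d z)) (ksgn M (d a * (d y + d z)) (H y z (a # b # r))) = ksgn M (d a * d b) (ksgn M (d a * (d y + d z)) (ksgn M (d b * (d y + d z)) (H y z (b # a # r))))"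
      using * by (simp add: sg_sg Nil.prems(1) add_ac)
  qed
  then have 1: "ux d L' (\<lambda>y z r. ksgn M (d b * (d y + d z)) (ksgn M (d a * (d y + d z)) (H y z (a # b # r)))) = ksgn M (d a * d b) (ux d L' (\<lambda>y z r. ksgn M (d a * (d y + d z)) (ksgn M (d b * (d y + d z)) (H y z (b # a # r)))))"
    by (simp add: ux_sg Nil.prems(1))
  have 2: "ex d L' (\<lambda>y r. ksgn M (d x * (d z + d y)) (H z y (x # r))) = ksgn M (d x * d z) (ex d L' (\<lambda>y r. ksgn M (d x * d y) (H z y (x # r))))" for x z
    by (simp add: ex_sg[symmetric] sg_sg distrib_left Nil.prems(1))
  have 3: "H a b L' = ksgn M (d a * d b) (H b a L')" by (rule Nil.prems(2)) simp
  have 4: "H b a L' = ksgn M (d a * d b) (H a b L')"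
    using Nil.prems(2)[of b a L'] by (simp add: mult.commute add_mset_commute)
  show ?case
    unfolding append_Nil ux.simps ex.simps 1 2 using Nil.prems(1) 3 4
    by (simp add: ex_closed ux_closed sg_add sg_sg mult.commute[of "d b" "d a"]) (simp add: a_ac ex_closed ux_closed)
next
  case (Cons h L)
  have 1: "ex d (L @ a # b # L') (H h) = ksgn M (d a * d b) (ex d (L @ b # a # L') (H h))"
    by (rule ex_transpose) (use Cons.prems(1,3) in auto)
  have 2: "ux d (L @ a # b # L') (\<lambda>y z r. ksgn M (d h * (d y + d z)) (H y z (h # r))) =
    ksgn M (d a * d b) (ux d (L @ b # a # L') (\<lambda>y z r. ksgn M (d h * (d y + d z)) (H y z (h # r))))"
  proof (rule Cons.IH)
    fix x y r assume m: "mset (x # y # r) = mset (L @ a # b # L')"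
    then have "H x y (h # r) = ksgn M (d x * d y) (H y x (h # r))" by (intro Cons.prems(2)) (use m in \<open>auto simp: add_mset_commute\<close>)
    then show "ksgn M (d h * (d x + d y)) (H x y (h # r)) = ksgn M (d x * d y) (ksgn M (d h * (d y + d x)) (H y x (h # r)))"
      by (simp add: sg_sg Cons.prems(1) add_ac)
  next
    fix x y r r' assume m: "mset (x # y # r @ a # b # r') = mset (L @ a # b # L')"
    then have "H x y ((h # r) @ a # b # r') = ksgn M (d a * d b) (H x y ((h # r) @ b # a # r'))"
      by (intro Cons.prems(3)) (use m in \<open>auto simp: add_mset_commute\<close>)
    then show "ksgn M (d h * (d x + d y)) (H x y (h # r @ a # b # r')) = ksgn M (d a * d b) (ksgn M (d h * (d x + d y)) (H x y (h # r @ b # a # r')))"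
      by (simp add: sg_sg Cons.prems(1) add_ac)
  qed (simp add: Cons.prems(1))
  show ?case using Cons.prems(1) by (simp add: 1 2 ex_closed ux_closed sg_add)
qed

text \<open>Each unordered pair occurs in two orders, and the symmetry of H makes the two
  contributions equal.\<close>

lemma ex_ex_ux:
  assumes cl: "\<And>x y r. H x y r \<in> carrier M"
    and sym: "\<And>x y r. mset (x # y # r) = mset L \<Longrightarrow> H x y r = ksgn M (d x * d y) (H y x r)"
  shows "ex d L (\<lambda>x r. ex d r (H x)) = ux d L H \<oplus> ux d L H"
  using assms
proof (induction L arbitrary: H)
  case (Cons a L)
  let ?H = "\<lambda>y z r. ksgn M (d a * (d y + d z)) (H y z (a # r))"
  have "ex d L (\<lambda>x r. ksgn M (d a * d x) (H x a r)) = ex d L (H a)"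
  proof (rule ex_cong)
    fix x r assume m: "mset (x # r) = mset L"
    then have "H a x r = ksgn M (d a * d x) (H x a r)" by (intro Cons.prems(2)) (simp add: m[symmetric] add_mset_commute)
    then show "ksgn M (d a * d x) (H x a r) = H a x r" by simp
  qed
  moreover have "ex d L (\<lambda>x r. ex d r (?H x)) = ux d L ?H \<oplus> ux d L ?H"
  proof (rule Cons.IH)
    fix x y r assume m: "mset (x # y # r) = mset L"
    then have "H x y (a # r) = ksgn M (d x * d y) (H y x (a # r))" by (intro Cons.prems(2)) (simp add: m[symmetric] add_mset_commute)
    then show "?H x y r = ksgn M (d x * d y) (?H y x r)" by (simp add: sg_sg Cons.prems(1) add_ac)
  qed (simp add: Cons.prems(1))
  moreover have "ex d L (\<lambda>x r. ksgn M (d a * d x) (H x a r \<oplus> ex d r (\<lambda>y r'. ksgn M (d a * d y) (H x y (a # r'))))) =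
    ex d L (\<lambda>x r. ksgn M (d a * d x) (H x a r)) \<oplus> ex d L (\<lambda>x r. ex d r (?H x))"
    using Cons.prems(1) by (simp add: sg_add ex_closed ex_add ex_sg[symmetric] sg_sg distrib_left)
  ultimately show ?case
    using Cons.prems(1) by (simp add: ex_closed ux_closed a_ac)
qed simp

text \<open>The recursive call of \<open>E\<close> lies inside \<open>ex\<close>; this rule lets the
  function package see that the remaining list is shorter.\<close>

lemma ex_fundef_cong [fundef_cong]:
  assumes "L = L'" "\<And>x r. Suc (length r) = length L' \<Longrightarrow> H x r = H' x r"
  shows "ex d L H = ex d L' H'"
  unfolding assms(1) by (rule ex_cong) (metis assms(2) length_Cons mset_eq_length)

end

section \<open>Evaluation of open strings\<close>

text \<open>A string \<open>(w, i, j)\<close> is a walk \<open>w\<close> with labelled ends. Lists of strings whose ends match up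
  are evaluated by gluing equal labels, which yields a product of closed walks.\<close>

type_synonym ('v, 'e) str = "'e darrow list \<times> (nat \<times> 'v) \<times> (nat \<times> 'v)"

abbreviation src :: "('v, 'e) str \<Rightarrow> nat \<times> 'v" where "src s \<equiv> fst (snd s)"
abbreviation tgt :: "('v, 'e) str \<Rightarrow> nat \<times> 'v" where "tgt s \<equiv> snd (snd s)"

definition sp :: "('v, 'e) str \<Rightarrow> bit" where "sp s = wpar (fst s)"

lemma sp_simp [simp]: "sp (w, i) = wpar w"
  by (simp add: sp_def)

text \<open>What the combinatorics requires of the algebra. The parity condition is imposed for all
  words, so that signs can be computed without side conditions; a word that is not a closed walk
  must then also receive a value, later zero.\<close>

locale cyclic_words = supercommutative_superalgebra A
  for A :: "('r :: {comm_ring, comm_monoid_mult}, 'm) supermod" (structure) +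
  fixes Q :: "('v, 'e) pre_digraph" and cl :: "'v \<Rightarrow> 'e darrow list \<Rightarrow> 'm"
  assumes wf: "wf_digraph (double Q)"
    and cl_grade: "cl x w \<in> grade A (wpar w)"
    and cl_rotate: "\<lbrakk>pre_digraph.awalk (double Q) x u y; pre_digraph.awalk (double Q) y v x\<rbrakk>
      \<Longrightarrow> cl x (u @ v) = ksgn A (wpar u * wpar v) (cl y (v @ u))"
begin

interpretation D: wf_digraph "double Q" by (rule wf)

abbreviation walk :: "'v \<Rightarrow> 'e darrow list \<Rightarrow> 'v \<Rightarrow> bool" where
  "walk \<equiv> pre_digraph.awalk (double Q)"

lemma walk_append: "walk x (u @ v) z \<longleftrightarrow> (\<exists>y. walk x u y \<and> walk y v z)"
  by (metis D.awalk_append_iff D.awalk_appendI)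

lemma walk_appendI: "\<lbrakk>walk x u y; walk y v z\<rbrakk> \<Longrightarrow> walk x (u @ v) z"
  by (rule D.awalk_appendI)

lemma cl_closed [simp]: "cl x w \<in> carrier A"
  by (rule grade_carrier[OF cl_grade])

text \<open>The first string is prolonged at its right end until it closes up, and then it
  contributes a factor. The continuation is found by the signed sum \<open>ex\<close> and not by a
  choice: for a valid list at most one summand is nonzero, its sign is that of moving the
  continuation forward, and the general laws of \<open>ex\<close> apply.\<close>

function (sequential) E :: "('v, 'e) str list \<Rightarrow> 'm" where
  "E [] = \<one>"
| "E ((w, i, j) # L) = (if i = j then cl (snd i) w \<otimes> E L
     else ex sp L (\<lambda>t r. if src t = j then E ((w @ fst t, i, tgt t) # r) else \<zero>))"
  by pat_completeness auto
termination by (relation "measure length") auto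

declare E.simps(2) [simp del]

lemma E_closed [simp]: "E L \<in> carrier A"
proof (induction L rule: length_induct)
  case (1 L)
  show ?case
  proof (cases L)
    case (Cons s L')
    obtain w i j where s: "s = (w, i, j)" by (cases s)
    have "ex sp L' (\<lambda>t r. if src t = j then E ((w @ fst t, i, tgt t) # r) else \<zero>) =
      ex sp L' (\<lambda>t r. if E ((w @ fst t, i, tgt t) # r) \<in> carrier A then if src t = j then E ((w @ fst t, i, tgt t) # r) else \<zero> else \<zero>)"
    proof (rule ex_cong)
      fix t r assume "mset (t # r) = mset L'"
      then have "length ((w @ fst t, i, tgt t) # r) < length L" using mset_eq_length[of "t # r" L'] Cons by simp
      then show "(if src t = j then E ((w @ fst t, i, tgt t) # r) else \<zero>) =
        (if E ((w @ fst t, i, tgt t) # r) \<in> carrier A then if src t = j then E ((w @ fst t, i, tgt t) # r) else \<zero> else \<zero>)"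
        using 1 by simp
    qed
    also have "\<dots> \<in> carrier A" by (rule ex_closed) simp
    finally show ?thesis using 1 Cons s by (simp add: E.simps(2))
  qed simp
qed

lemma E_closed_string: "E ((w, i, i) # L) = cl (snd i) w \<otimes> E L"
  by (simp add: E.simps(2))

lemma E_open: "i \<noteq> j \<Longrightarrow> E ((w, i, j) # L) = ex sp L (\<lambda>t r. if src t = j then E ((w @ fst t, i, tgt t) # r) else \<zero>)"
  by (simp add: E.simps(2))

text \<open>Every label is the source of one string and the target of one string. The labels thus
  describe a permutation of the strings, and \<open>E\<close> is, up to sign, the product over its
  cycles.\<close>

definition valid :: "('v, 'e) str list \<Rightarrow> bool" where
  "valid L \<longleftrightarrow> distinct (map src L) \<and> distinct (map tgt L) \<and> src ` set L = tgt ` set L \<and>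
    (\<forall>s\<in>set L. walk (snd (src s)) (fst s) (snd (tgt s)))"

lemma distinct_map_mset: "mset L = mset L' \<Longrightarrow> distinct (map f L) \<longleftrightarrow> distinct (map f L')"
  by (metis mset_map mset_eq_imp_distinct_iff)

lemma valid_mset: "mset L = mset L' \<Longrightarrow> valid L \<longleftrightarrow> valid L'"
  unfolding valid_def using distinct_map_mset[of L L' src] distinct_map_mset[of L L' tgt] mset_eq_setD[of L L'] by simp

lemma valid_perm: "\<lbrakk>valid L; mset L' = mset L\<rbrakk> \<Longrightarrow> valid L'"
  using valid_mset by blast

lemma valid_closed_tail: "valid ((w, i, i) # L) \<Longrightarrow> valid L"
  unfolding valid_def by (auto simp: image_iff)

lemma valid_closed_walk: "valid ((w, i, i) # L) \<Longrightarrow> walk (snd i) w (snd i)"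
  by (simp add: valid_def)

lemma valid_merge: "valid ((u, i, j) # (v, j, k) # L) \<Longrightarrow> valid ((u @ v, i, k) # L)"
  unfolding valid_def by (auto intro: walk_appendI)

lemma valid_merge_ne: "valid ((u, i, j) # (v, j, k) # L) \<Longrightarrow> i \<noteq> j"
  by (auto simp: valid_def)

lemma valid_merge': "\<lbrakk>valid (s # t # L); src t = tgt s\<rbrakk> \<Longrightarrow> valid ((fst s @ fst t, src s, tgt t) # L)"
  by (cases s; cases t) (auto intro: valid_merge)

text \<open>The other strings have different source labels, so a single term of the sum
  survives.\<close>

lemma E_head:
  assumes "valid ((u, i, j) # (v, j, k) # L)"
  shows "E ((u, i, j) # (v, j, k) # L) = E ((u @ v, i, k) # L)"
proof -
  have "ex sp L (\<lambda>t r. ksgn A (sp (v, j, k) * sp t) (if src t = j then E ((u @ fst t, i, tgt t) # (v, j, k) # r) else \<zero>)) = \<zero>"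
  proof (rule ex_zero)
    fix t r assume "mset (t # r) = mset L"
    then have "t \<in> set L" by (metis list.set_intros(1) mset_eq_setD)
    then have "src t \<noteq> j" using assms by (auto simp: valid_def)
    then show "ksgn A (sp (v, j, k) * sp t) (if src t = j then E ((u @ fst t, i, tgt t) # (v, j, k) # r) else \<zero>) = \<zero>" by simp
  qed
  then show ?thesis using valid_merge_ne[OF assms] by (simp add: E_open)
qed

lemma commute_left_cl: "x \<in> carrier A \<Longrightarrow> cl i u \<otimes> (cl j v \<otimes> x) = ksgn A (wpar u * wpar v) (cl j v \<otimes> (cl i u \<otimes> x))"
  by (rule commute_left[OF cl_grade cl_grade])

text \<open>The four cases distinguish which ends of the two transposed strings are joined.\<close>

lemma E_transpose_head:
  assumes IH: "\<And>L s t L'. \<lbrakk>length (L @ s # t # L') < length L0 + 2; valid (L @ s # t # L')\<rbrakk>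
      \<Longrightarrow> E (L @ s # t # L') = ksgn A (sp s * sp t) (E (L @ t # s # L'))"
    and v: "valid ((u, i, j) # (v, k, l) # L0)"
  shows "E ((u, i, j) # (v, k, l) # L0) = ksgn A (wpar u * wpar v) (E ((v, k, l) # (u, i, j) # L0))"
proof -
  have ne: "i \<noteq> k" "j \<noteq> l" using v by (auto simp: valid_def)
  have swp: "valid ((v, k, l) # (u, i, j) # L0)" by (rule valid_perm[OF v]) simp
  \<comment> \<open>A closed string only contributes a factor. When the open string comes first, it
    is prolonged, and the induction hypothesis then carries the closed string past the prolonged
    one.\<close>
  have closed_open: "E ((u, i, i) # (v, k, l) # L0) = ksgn A (wpar u * wpar v) (E ((v, k, l) # (u, i, i) # L0))"
    if "k \<noteq> l" and v: "valid ((u, i, i) # (v, k, l) # L0)" for u i v k l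
  proof -
    have il: "i \<noteq> l" using v by (auto simp: valid_def)
    have "ex sp L0 (\<lambda>t r. ksgn A (wpar u * sp t) (if src t = l then E ((v @ fst t, k, tgt t) # (u, i, i) # r) else \<zero>)) =
      ex sp L0 (\<lambda>t r. ksgn A (wpar u * wpar v) (cl (snd i) u \<otimes> (if src t = l then E ((v @ fst t, k, tgt t) # r) else \<zero>)))"
    proof (rule ex_cong)
      fix t r assume m: "mset (t # r) = mset L0"
      show "ksgn A (wpar u * sp t) (if src t = l then E ((v @ fst t, k, tgt t) # (u, i, i) # r) else \<zero>) =
        ksgn A (wpar u * wpar v) (cl (snd i) u \<otimes> (if src t = l then E ((v @ fst t, k, tgt t) # r) else \<zero>))"
      proof (cases "src t = l")
        case True
        have "valid ((v, k, l) # t # (u, i, i) # r)"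
          by (rule valid_perm[OF v]) (simp add: m[symmetric] add_mset_commute)
        from valid_merge'[OF this] True have vv: "valid ([] @ (v @ fst t, k, tgt t) # (u, i, i) # r)" by simp
        have "E ([] @ (v @ fst t, k, tgt t) # (u, i, i) # r) = ksgn A (sp (v @ fst t, k, tgt t) * sp (u, i, i)) (E ([] @ (u, i, i) # (v @ fst t, k, tgt t) # r))"
          using mset_eq_length[OF m] by (intro IH[OF _ vv]) simp
        then show ?thesis using True by (simp add: E_closed_string sg_sg sp_def distrib_left mult.commute)
      qed simp
    qed
    also have "\<dots> = ksgn A (wpar u * wpar v) (cl (snd i) u \<otimes> ex sp L0 (\<lambda>t r. if src t = l then E ((v @ fst t, k, tgt t) # r) else \<zero>))"
      using ex_hom[OF mult_linear_left[OF cl_closed], of "\<lambda>t r. if src t = l then E ((v @ fst t, k, tgt t) # r) else \<zero>"]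
      by (simp add: ex_sg)
    finally show ?thesis
      using that il by (simp add: E_closed_string E_open sg_sg ex_closed)
  qed
  \<comment> \<open>The second string continues the first. In the wrong order it first absorbs its
    own successor t; the induction hypothesis then restores the order, and both sides become the
    walk u v prolonged by t.\<close>
  have chain: "E ((u, i, k) # (v, k, l) # L0) = ksgn A (wpar u * wpar v) (E ((v, k, l) # (u, i, k) # L0))"
    if ne: "k \<noteq> l" "l \<noteq> i" and v: "valid ((u, i, k) # (v, k, l) # L0)" for u i v k l
  proof -
    have ij: "i \<noteq> k" using v by (auto simp: valid_def)
    have "ex sp L0 (\<lambda>t r. ksgn A (wpar u * sp t) (if src t = l then E ((v @ fst t, k, tgt t) # (u, i, k) # r) else \<zero>)) =
      ex sp L0 (\<lambda>t r. ksgn A (wpar u * wpar v) (if src t = l then E (((u @ v) @ fst t, i, tgt t) # r) else \<zero>))"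
    proof (rule ex_cong)
      fix t r assume m: "mset (t # r) = mset L0"
      show "ksgn A (wpar u * sp t) (if src t = l then E ((v @ fst t, k, tgt t) # (u, i, k) # r) else \<zero>) =
        ksgn A (wpar u * wpar v) (if src t = l then E (((u @ v) @ fst t, i, tgt t) # r) else \<zero>)"
      proof (cases "src t = l")
        case True
        have "valid ((v, k, l) # t # (u, i, k) # r)"
          by (rule valid_perm[OF v]) (simp add: m[symmetric] add_mset_commute)
        from valid_merge'[OF this] True have vv: "valid ([] @ (v @ fst t, k, tgt t) # (u, i, k) # r)" by simp
        have "E ([] @ (v @ fst t, k, tgt t) # (u, i, k) # r) = ksgn A (sp (v @ fst t, k, tgt t) * sp (u, i, k)) (E ([] @ (u, i, k) # (v @ fst t, k, tgt t) # r))"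
          using mset_eq_length[OF m] by (intro IH[OF _ vv]) simp
        moreover have "valid ((u, i, k) # (v @ fst t, k, tgt t) # r)"
          by (rule valid_perm[OF vv]) (simp add: add_mset_commute)
        ultimately show ?thesis using True by (simp add: E_head sg_sg sp_def distrib_left mult.commute)
      qed simp
    qed
    also have "\<dots> = ksgn A (wpar u * wpar v) (E ((u @ v, i, l) # L0))"
      using ne by (simp add: E_open ex_sg)
    also have "\<dots> = ksgn A (wpar u * wpar v) (E ((u, i, k) # (v, k, l) # L0))"
      using v by (simp add: E_head)
    finally show ?thesis using ne ij by (simp add: E_open[of k l] sg_sg ex_closed)
  qed
  consider "i = j" "k = l" | "i = j" "k \<noteq> l" | "i \<noteq> j" "k = l" | "i \<noteq> j" "k \<noteq> l" "j = k" "l = i"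
    | "i \<noteq> j" "k \<noteq> l" "j = k" "l \<noteq> i" | "i \<noteq> j" "k \<noteq> l" "j \<noteq> k" "l = i" | "i \<noteq> j" "k \<noteq> l" "j \<noteq> k" "l \<noteq> i"
    by blast
  then show ?thesis
  proof cases
    case 1
    then show ?thesis unfolding 1 E_closed_string by (intro commute_left_cl E_closed)
  next
    case 2
    then show ?thesis using closed_open[of k l u i v] v by simp
  next
    case 3
    have "E ((v, k, l) # (u, i, j) # L0) = ksgn A (wpar v * wpar u) (E ((u, i, j) # (v, k, l) # L0))"
      using closed_open[of i j v k u] swp 3 by simp
    then show ?thesis by (simp add: sg_sg mult.commute)
  next
    \<comment> \<open>Together the strings form one closed walk, read from two starting
      points.\<close>
    case 4
    have "walk (snd i) u (snd j)" "walk (snd j) v (snd i)" using v 4 by (auto simp: valid_def)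
    from cl_rotate[OF this] show ?thesis using v swp 4 by (simp add: E_head E_closed_string sg_mult_left)
  next
    case 5
    then show ?thesis using chain[of k l i u v] v by simp
  next
    case 6
    have "E ((v, k, l) # (u, i, j) # L0) = ksgn A (wpar v * wpar u) (E ((u, i, j) # (v, k, l) # L0))"
      using chain[of i j k v u] swp 6 by simp
    then show ?thesis by (simp add: sg_sg mult.commute)
  next
    \<comment> \<open>No end of one string meets the other, so they absorb different successors x
      and y. Both sides become the same double sum, with x and y extracted in the two possible
      orders.\<close>
    case 7
    let ?H = "\<lambda>y x r. if src x = j \<and> src y = l then ksgn A (wpar u * wpar v + wpar u * sp y) (E ((v @ fst y, k, tgt y) # (u @ fst x, i, tgt x) # r)) else \<zero>"
    have len: "Suc (length r) = length L0" if "mset (x # r) = mset L0" for x r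
      using mset_eq_length[OF that] by simp
    have one: "E ((u, i, j) # (v, k, l) # L0) = ex sp L0 (\<lambda>x r. ex sp r (\<lambda>y r'. ksgn A (sp x * sp y) (?H y x r')))"
    proof -
      have "E ((u, i, j) # (v, k, l) # L0) = ex sp L0 (\<lambda>x r. ksgn A (wpar v * sp x) (if src x = j then E ((u @ fst x, i, tgt x) # (v, k, l) # r) else \<zero>))"
        using 7 by (simp add: E_open[of i j] ex_closed)
      also have "\<dots> = ex sp L0 (\<lambda>x r. ex sp r (\<lambda>y r'. ksgn A (sp x * sp y) (?H y x r')))"
      proof (rule ex_cong)
        fix x r assume m: "mset (x # r) = mset L0"
        show "ksgn A (wpar v * sp x) (if src x = j then E ((u @ fst x, i, tgt x) # (v, k, l) # r) else \<zero>) =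
          ex sp r (\<lambda>y r'. ksgn A (sp x * sp y) (?H y x r'))"
        proof (cases "src x = j")
          case True
          have "valid ((u, i, j) # x # (v, k, l) # r)"
            by (rule valid_perm[OF v]) (simp add: m[symmetric] add_mset_commute)
          from valid_merge'[OF this] True have vv: "valid ([] @ (u @ fst x, i, tgt x) # (v, k, l) # r)" by simp
          have "E ([] @ (u @ fst x, i, tgt x) # (v, k, l) # r) = ksgn A (sp (u @ fst x, i, tgt x) * sp (v, k, l)) (E ([] @ (v, k, l) # (u @ fst x, i, tgt x) # r))"
            using len[OF m] by (intro IH[OF _ vv]) simp
          then have "ksgn A (wpar v * sp x) (E ((u @ fst x, i, tgt x) # (v, k, l) # r)) = ksgn A (wpar u * wpar v) (E ((v, k, l) # (u @ fst x, i, tgt x) # r))"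
            by (simp add: sg_sg sp_def distrib_left distrib_right mult.commute add_ac)
          also have "E ((v, k, l) # (u @ fst x, i, tgt x) # r) = ex sp r (\<lambda>y r'. ksgn A (sp (u @ fst x, i, tgt x) * sp y) (if src y = l then E ((v @ fst y, k, tgt y) # (u @ fst x, i, tgt x) # r') else \<zero>))"
            using 7 by (simp add: E_open[of k l] ex_closed)
          also have "ksgn A (wpar u * wpar v) \<dots> = ex sp r (\<lambda>y r'. ksgn A (wpar u * wpar v) (ksgn A (sp (u @ fst x, i, tgt x) * sp y) (if src y = l then E ((v @ fst y, k, tgt y) # (u @ fst x, i, tgt x) # r') else \<zero>)))"
            by (rule ex_sg[symmetric]) simp
          also have "\<dots> = ex sp r (\<lambda>y r'. ksgn A (sp x * sp y) (?H y x r'))"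
            by (rule ex_cong) (simp add: True sg_sg sp_def distrib_right add_ac)
          finally show ?thesis using True by simp
        qed (simp add: ex_zero)
      qed
      finally show ?thesis .
    qed
    have two: "ksgn A (wpar u * wpar v) (E ((v, k, l) # (u, i, j) # L0)) = ex sp L0 (\<lambda>y r. ex sp r (\<lambda>x r'. ?H y x r'))"
    proof -
      have "ksgn A (wpar u * wpar v) (E ((v, k, l) # (u, i, j) # L0)) = ksgn A (wpar u * wpar v) (ex sp L0 (\<lambda>y r. ksgn A (wpar u * sp y) (if src y = l then E ((v @ fst y, k, tgt y) # (u, i, j) # r) else \<zero>)))"
        using 7 by (simp add: E_open[of k l] ex_closed)
      also have "\<dots> = ex sp L0 (\<lambda>y r. ksgn A (wpar u * wpar v) (ksgn A (wpar u * sp y) (if src y = l then E ((v @ fst y, k, tgt y) # (u, i, j) # r) else \<zero>)))"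
        by (rule ex_sg[symmetric]) simp
      also have "\<dots> = ex sp L0 (\<lambda>y r. ex sp r (\<lambda>x r'. ?H y x r'))"
      proof (rule ex_cong)
        fix y r assume m: "mset (y # r) = mset L0"
        show "ksgn A (wpar u * wpar v) (ksgn A (wpar u * sp y) (if src y = l then E ((v @ fst y, k, tgt y) # (u, i, j) # r) else \<zero>)) =
          ex sp r (\<lambda>x r'. ?H y x r')"
        proof (cases "src y = l")
          case True
          have "valid ((v, k, l) # y # (u, i, j) # r)"
            by (rule valid_perm[OF v]) (simp add: m[symmetric] add_mset_commute)
          from valid_merge'[OF this] True have vv: "valid ([] @ (v @ fst y, k, tgt y) # (u, i, j) # r)" by simp
          have "E ([] @ (v @ fst y, k, tgt y) # (u, i, j) # r) = ksgn A (sp (v @ fst y, k, tgt y) * sp (u, i, j)) (E ([] @ (u, i, j) # (v @ fst y, k, tgt y) # r))"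
            using len[OF m] by (intro IH[OF _ vv]) simp
          then have "E ((v @ fst y, k, tgt y) # (u, i, j) # r) = ksgn A (wpar (v @ fst y) * wpar u) (E ((u, i, j) # (v @ fst y, k, tgt y) # r))"
            by simp
          also have "E ((u, i, j) # (v @ fst y, k, tgt y) # r) = ex sp r (\<lambda>x r'. ksgn A (wpar (v @ fst y) * sp x) (if src x = j then E ((u @ fst x, i, tgt x) # (v @ fst y, k, tgt y) # r') else \<zero>))"
            using 7 by (simp add: E_open[of i j] ex_closed)
          also have "\<dots> = ex sp r (\<lambda>x r'. ksgn A (wpar (v @ fst y) * wpar u) (if src x = j then E ((v @ fst y, k, tgt y) # (u @ fst x, i, tgt x) # r') else \<zero>))"
          proof (rule ex_cong)
            fix x r' assume m': "mset (x # r') = mset r"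
            show "ksgn A (wpar (v @ fst y) * sp x) (if src x = j then E ((u @ fst x, i, tgt x) # (v @ fst y, k, tgt y) # r') else \<zero>) =
              ksgn A (wpar (v @ fst y) * wpar u) (if src x = j then E ((v @ fst y, k, tgt y) # (u @ fst x, i, tgt x) # r') else \<zero>)"
            proof (cases "src x = j")
              case xj: True
              have "valid ((u, i, j) # x # (v @ fst y, k, tgt y) # r')"
                by (rule valid_perm[OF vv]) (simp add: m'[symmetric] add_mset_commute)
              from valid_merge'[OF this] xj have vv': "valid ([] @ (u @ fst x, i, tgt x) # (v @ fst y, k, tgt y) # r')" by simp
              have "E ([] @ (u @ fst x, i, tgt x) # (v @ fst y, k, tgt y) # r') =
                ksgn A (sp (u @ fst x, i, tgt x) * sp (v @ fst y, k, tgt y)) (E ([] @ (v @ fst y, k, tgt y) # (u @ fst x, i, tgt x) # r'))"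
                using len[OF m] mset_eq_length[OF m'] by (intro IH[OF _ vv']) simp
              then show ?thesis using xj by (simp add: sg_sg sp_def distrib_right distrib_left mult.commute add_ac)
            qed simp
          qed
          also have "ksgn A (wpar (v @ fst y) * wpar u) \<dots> = ex sp r (\<lambda>x r'. if src x = j then E ((v @ fst y, k, tgt y) # (u @ fst x, i, tgt x) # r') else \<zero>)"
            by (simp add: ex_sg ex_closed sg_sg)
          finally have e: "E ((v @ fst y, k, tgt y) # (u, i, j) # r) = ex sp r (\<lambda>x r'. if src x = j then E ((v @ fst y, k, tgt y) # (u @ fst x, i, tgt x) # r') else \<zero>)" .
          have "ksgn A (wpar u * wpar v + wpar u * sp y) (ex sp r (\<lambda>x r'. if src x = j then E ((v @ fst y, k, tgt y) # (u @ fst x, i, tgt x) # r') else \<zero>)) =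
            ex sp r (\<lambda>x r'. ksgn A (wpar u * wpar v + wpar u * sp y) (if src x = j then E ((v @ fst y, k, tgt y) # (u @ fst x, i, tgt x) # r') else \<zero>))"
            by (rule ex_sg[symmetric]) simp
          also have "\<dots> = ex sp r (\<lambda>x r'. ?H y x r')" by (rule ex_cong) (simp add: True)
          finally show ?thesis using True e by (simp add: sg_sg ex_closed)
        qed (simp add: ex_zero)
      qed
      finally show ?thesis .
    qed
    show ?thesis unfolding one two by (rule ex_swap2[symmetric]) simp
  qed
qed

lemma E_transpose:
  assumes "valid (L @ s # t # L')"
  shows "E (L @ s # t # L') = ksgn A (sp s * sp t) (E (L @ t # s # L'))"
  using assms
proof (induction "length (L @ s # t # L')" arbitrary: L s t L' rule: less_induct)
  case less
  show ?case
  proof (cases L)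
    case Nil
    obtain u i j v k l where st: "s = (u, i, j)" "t = (v, k, l)" by (cases s; cases t)
    show ?thesis
      using E_transpose_head[of L' u i j v k l] less Nil st by (simp add: less)
  next
    case (Cons h L1)
    obtain w i j where h: "h = (w, i, j)" by (cases h)
    show ?thesis
    proof (cases "i = j")
      case True
      then show ?thesis
        using less.hyps[of L1 s t L'] less.prems Cons h valid_closed_tail[of w i "L1 @ s # t # L'"]
        by (simp add: E_closed_string sg_mult_right)
    next
      case False
      have "ex sp (L1 @ s # t # L') (\<lambda>x r. if src x = j then E ((w @ fst x, i, tgt x) # r) else \<zero>) =
        ksgn A (sp s * sp t) (ex sp (L1 @ t # s # L') (\<lambda>x r. if src x = j then E ((w @ fst x, i, tgt x) # r) else \<zero>))"
      proof (rule ex_transpose)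
        fix x r r' assume m: "mset (x # r @ s # t # r') = mset (L1 @ s # t # L')"
        show "(if src x = j then E ((w @ fst x, i, tgt x) # r @ s # t # r') else \<zero>) =
          ksgn A (sp s * sp t) (if src x = j then E ((w @ fst x, i, tgt x) # r @ t # s # r') else \<zero>)"
        proof (cases "src x = j")
          case True
          have "valid ((w, i, j) # x # r @ s # t # r')"
            by (rule valid_perm[OF less.prems]) (use m Cons h in simp)
          from valid_merge'[OF this] True have "valid (((w @ fst x, i, tgt x) # r) @ s # t # r')" by simp
          from less.hyps[OF _ this] show ?thesis
            using True mset_eq_length[OF m] Cons by simp
        qed simp
      qed simp
      then show ?thesis using False Cons h by (simp add: E_open)
    qed
  qed
qed

lemma E_move: "valid (L @ s # L') \<Longrightarrow> E (L @ s # L') = ksgn A (dl sp L * sp s) (E (s # L @ L'))"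
proof (induction L arbitrary: L' rule: rev_induct)
  case (snoc x L)
  have v: "valid (L @ s # x # L')" by (rule valid_perm[OF snoc.prems]) (simp add: add_mset_commute)
  show ?case
    using E_transpose[of L x s L'] snoc.prems snoc.IH[OF v] by (simp add: sg_sg distrib_right add_ac)
qed simp

text \<open>Both strings are brought to the front, where \<open>E_head\<close> applies, and the
  merged string is moved back; the signs of these moves cancel.\<close>

lemma E_merge:
  assumes "valid (L @ (u, i, j) # (v, j, k) # L')"
  shows "E (L @ (u, i, j) # (v, j, k) # L') = E (L @ (u @ v, i, k) # L')"
proof -
  have v1: "valid (((u, i, j) # L) @ (v, j, k) # L')" by (rule valid_perm[OF assms]) simp
  have v2: "valid ((u, i, j) # (v, j, k) # L @ L')" by (rule valid_perm[OF assms]) simp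
  have v3: "valid (L @ (u @ v, i, k) # L')" by (rule valid_perm[OF valid_merge[OF v2]]) simp
  have "E (L @ (u, i, j) # (v, j, k) # L') = ksgn A (dl sp L * wpar u) (E (((u, i, j) # L) @ (v, j, k) # L'))"
    using E_move[OF assms] by simp
  also have "\<dots> = ksgn A (dl sp L * wpar u + (wpar u + dl sp L) * wpar v) (E ((v, j, k) # (u, i, j) # L @ L'))"
    using E_move[OF v1] by (simp add: sg_sg)
  also have "E ((v, j, k) # (u, i, j) # L @ L') = ksgn A (wpar u * wpar v) (E ((u, i, j) # (v, j, k) # L @ L'))"
    using E_transpose[of "[]" "(v, j, k)" "(u, i, j)" "L @ L'"] valid_perm[OF v2, of "(v, j, k) # (u, i, j) # L @ L'"]
    by (simp add: mult.commute add_mset_commute)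
  also have "E ((u, i, j) # (v, j, k) # L @ L') = E ((u @ v, i, k) # L @ L')" by (rule E_head[OF v2])
  finally show ?thesis using E_move[OF v3] by (simp add: sg_sg distrib_left distrib_right add_ac)
qed

end

section \<open>Contraction of letters\<close>

lemmas bit_ring = distrib_left distrib_right mult.commute mult.left_commute add_ac

lemma paired_sym: "paired p q \<longleftrightarrow> paired q p"
  by (auto simp: paired_def)

lemma paired_parity: "paired p q \<Longrightarrow> parity q = 1 + parity p"
  by (auto simp: paired_def)

locale contraction = cyclic_words A Q cl
  for A :: "('r :: {comm_ring, comm_monoid_mult}, 'm) supermod" (structure)
    and Q :: "('v, 'e) pre_digraph" and cl :: "'v \<Rightarrow> 'e darrow list \<Rightarrow> 'm" +
  fixes plus :: bool
begin

interpretation D: wf_digraph "double Q" by (rule wf)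

abbreviation hd_of :: "'e darrow \<Rightarrow> 'v" where "hd_of \<equiv> pre_digraph.head (double Q)"
abbreviation tl_of :: "'e darrow \<Rightarrow> 'v" where "tl_of \<equiv> pre_digraph.tail (double Q)"

lemma walk_mid:
  "walk x (u @ p # v) z \<longleftrightarrow> walk x u (tl_of p) \<and> p \<in> arcs (double Q) \<and> walk (hd_of p) v z"
  using walk_append[of x u "p # v" z] by (auto simp: D.awalk_Cons_iff)

lemma paired_ends: "paired p q \<Longrightarrow> hd_of q = tl_of p \<and> tl_of q = hd_of p"
  by (auto simp: paired_def double_def)

text \<open>The parity of an inserted word, which is odd when it is nonempty, because the letters of
  a pair have opposite parities.\<close>

definition bd :: bit where "bd = (if plus then 1 else 0)"

text \<open>The words inserted at the two new junctions.\<close>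

definition al :: "'e darrow \<Rightarrow> 'e darrow \<Rightarrow> 'e darrow list" where
  "al p q = (if plus then [p, q] else [])"

lemma wpar_al: "paired p q \<Longrightarrow> wpar (al p q) = bd"
  by (auto simp: al_def bd_def dest: paired_parity)

lemma walk_al:
  assumes "paired p q" "p \<in> arcs (double Q)" "q \<in> arcs (double Q)"
  shows "walk (tl_of p) (al p q) (hd_of q)"
  using assms paired_ends[OF assms(1)] by (auto simp: al_def D.awalk_Cons_iff D.awalk_Nil_iff)

text \<open>
  The signs are dictated by those of the bracket and the cobracket on closed words together with
  compatibility with gluing, see \<open>X_merge\<close> and \<open>Y_merge\<close>.
\<close>

definition eps :: "'e darrow list \<Rightarrow> 'e darrow \<Rightarrow> 'e darrow list \<Rightarrow> 'e darrow list \<Rightarrow> 'e darrow \<Rightarrow> 'e darrow list \<Rightarrow> bit" where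
  "eps u p v x q y = bd * parity p + parity p * wpar u + parity q * (wpar u + wpar v + wpar x) +
     bd * (wpar x + wpar y) + wpar v * (wpar x + wpar y) + wpar x * wpar y"

definition eps' :: "'e darrow list \<Rightarrow> 'e darrow \<Rightarrow> 'e darrow list \<Rightarrow> 'e darrow \<Rightarrow> bit" where
  "eps' u p v q = bd * parity p + parity p * wpar u + parity q * (wpar u + wpar v) + bd + bd * wpar u + wpar u * wpar v"

text \<open>Contracting a letter of s with a letter of t exchanges the parts of the strings that
  follow these letters. Sources stay in place and the two targets are exchanged.\<close>

definition X :: "('v, 'e) str \<Rightarrow> ('v, 'e) str \<Rightarrow> ('v, 'e) str list \<Rightarrow> 'm" where
  "X s t r = ew (fst s) (\<lambda>u p v. ew (fst t) (\<lambda>x q y. if paired p q then ksgn A (eps u p v x q y)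
     (E ((u @ al p q @ y, src s, tgt t) # (x @ al q p @ v, src t, tgt s) # r)) else \<zero>))"

text \<open>Contracting two letters of one string splits off the word between them as a closed one.
  Only p before q is summed, so each pair counts once and the factor one half of the cobracket is
  absorbed, see \<open>class_dl\<close>.\<close>

definition Y :: "('v, 'e) str \<Rightarrow> ('v, 'e) str list \<Rightarrow> 'm" where
  "Y s r = ew (fst s) (\<lambda>u p w. ew w (\<lambda>v q y. if paired p q then ksgn A (eps' u p v q)
     (cl (hd_of p) (v @ al q p) \<otimes> E ((u @ al p q @ y, src s, tgt s) # r)) else \<zero>))"

definition D :: "('v, 'e) str list \<Rightarrow> 'm" where
  "D L = ux sp L X \<oplus> ex sp L Y"

lemma X_closed [simp]: "X s t r \<in> carrier A"
  by (simp add: X_def ew_closed)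

lemma Y_closed [simp]: "Y s r \<in> carrier A"
  by (simp add: Y_def ew_closed)

lemma D_closed [simp]: "D L \<in> carrier A"
  by (simp add: D_def ux_closed ex_closed)

lemma ksgn_X: "ksgn A e (X s t r) = ew (fst s) (\<lambda>u p v. ew (fst t) (\<lambda>x q y. if paired p q then ksgn A (e + eps u p v x q y)
     (E ((u @ al p q @ y, src s, tgt t) # (x @ al q p @ v, src t, tgt s) # r)) else \<zero>))"
  unfolding X_def
  by (simp add: ew_sg[symmetric] ew_closed sg_sg if_distrib[of "ksgn A e"] cong: if_cong)

lemma ksgn_Y: "ksgn A e (Y s r) = ew (fst s) (\<lambda>u p w. ew w (\<lambda>v q y. if paired p q then ksgn A (e + eps' u p v q)
     (cl (hd_of p) (v @ al q p) \<otimes> E ((u @ al p q @ y, src s, tgt s) # r)) else \<zero>))"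
  unfolding Y_def
  by (simp add: ew_sg[symmetric] ew_closed sg_sg if_distrib[of "ksgn A e"] cong: if_cong)

text \<open>Paired letters run in opposite directions, so the walk up to p can be continued by the
  walk after q, and conversely.\<close>

lemma valid_contract:
  assumes "valid ((u @ p # v, i, j) # (x @ q # y, k, l) # r)" "paired p q"
  shows "valid ((u @ al p q @ y, i, l) # (x @ al q p @ v, k, j) # r)"
proof -
  have w: "walk (snd i) u (tl_of p)" "p \<in> arcs (double Q)" "walk (hd_of p) v (snd j)"
    "walk (snd k) x (tl_of q)" "q \<in> arcs (double Q)" "walk (hd_of q) y (snd l)"
    using assms(1) by (auto simp: valid_def walk_mid simp del: D.awalk_append_iff)
  have "walk (snd i) (u @ al p q @ y) (snd l)" "walk (snd k) (x @ al q p @ v) (snd j)"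
    using w walk_al[OF assms(2)] walk_al[of q p] assms(2) by (auto intro!: walk_appendI simp: paired_sym[of q p] simp del: D.awalk_append_iff)
  then show ?thesis using assms(1) unfolding valid_def by (auto simp del: D.awalk_append_iff)
qed

lemma valid_self:
  assumes "valid ((u @ p # v @ q # y, i, j) # r)" "paired p q"
  shows "valid ((u @ al p q @ y, i, j) # r)" "walk (hd_of p) (v @ al q p) (hd_of p)"
proof -
  have w: "walk (snd i) u (tl_of p)" "p \<in> arcs (double Q)" "walk (hd_of p) v (tl_of q)"
    "q \<in> arcs (double Q)" "walk (hd_of q) y (snd j)"
    using assms(1) by (auto simp: valid_def walk_mid simp del: D.awalk_append_iff)
  have "walk (snd i) (u @ al p q @ y) (snd j)"
    using w walk_al[OF assms(2)] by (auto intro!: walk_appendI simp del: D.awalk_append_iff)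
  then show "valid ((u @ al p q @ y, i, j) # r)" using assms(1) unfolding valid_def by (auto simp del: D.awalk_append_iff)
  show "walk (hd_of p) (v @ al q p) (hd_of p)"
    using w walk_al[of q p] assms(2) by (auto intro!: walk_appendI simp: paired_sym[of q p] simp del: D.awalk_append_iff)
qed

lemma X_transpose:
  assumes "valid (s # t # r @ a # b # r')"
  shows "X s t (r @ a # b # r') = ksgn A (sp a * sp b) (X s t (r @ b # a # r'))"
  unfolding ksgn_X unfolding X_def
proof (intro ew_cong)
  fix u p v x q y assume *: "fst s = u @ p # v" "fst t = x @ q # y"
  show "(if paired p q then ksgn A (eps u p v x q y) (E ((u @ al p q @ y, src s, tgt t) # (x @ al q p @ v, src t, tgt s) # r @ a # b # r')) else \<zero>) =
    (if paired p q then ksgn A (sp a * sp b + eps u p v x q y) (E ((u @ al p q @ y, src s, tgt t) # (x @ al q p @ v, src t, tgt s) # r @ b # a # r')) else \<zero>)"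
  proof (cases "paired p q")
    case True
    have "valid ((u @ p # v, src s, tgt s) # (x @ q # y, src t, tgt t) # r @ a # b # r')"
      using assms * by (cases s; cases t) simp
    from E_transpose[of "(u @ al p q @ y, src s, tgt t) # (x @ al q p @ v, src t, tgt s) # r" a b r'] valid_contract[OF this True]
    show ?thesis using True by (simp add: sg_sg add.commute)
  qed simp
qed

lemma Y_transpose:
  assumes "valid (s # r @ a # b # r')"
  shows "Y s (r @ a # b # r') = ksgn A (sp a * sp b) (Y s (r @ b # a # r'))"
  unfolding ksgn_Y unfolding Y_def
proof (intro ew_cong)
  fix u p w v q y assume *: "fst s = u @ p # w" "w = v @ q # y"
  show "(if paired p q then ksgn A (eps' u p v q) (cl (hd_of p) (v @ al q p) \<otimes> E ((u @ al p q @ y, src s, tgt s) # r @ a # b # r')) else \<zero>) =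
    (if paired p q then ksgn A (sp a * sp b + eps' u p v q) (cl (hd_of p) (v @ al q p) \<otimes> E ((u @ al p q @ y, src s, tgt s) # r @ b # a # r')) else \<zero>)"
  proof (cases "paired p q")
    case True
    have "valid ((u @ p # v @ q # y, src s, tgt s) # r @ a # b # r')"
      using assms * by (cases s) simp
    from E_transpose[of "(u @ al p q @ y, src s, tgt s) # r" a b r'] valid_self(1)[OF this True]
    show ?thesis using True by (simp add: sg_sg sg_mult_right add.commute)
  qed simp
qed

text \<open>Exchanging the roles of p and q reproduces the same two new strings in the opposite
  order. What remains is an identity between two values of \<open>eps\<close> and the sign of one
  transposition.\<close>

lemma X_sym:
  assumes "valid (s # t # r)"
  shows "X s t r = ksgn A (sp s * sp t) (X t s r)"
proof -
  have "ksgn A (sp s * sp t) (X t s r) = ew (fst s) (\<lambda>u p v. ew (fst t) (\<lambda>x q y. if paired q p then ksgn A (sp s * sp t + eps x q y u p v)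
     (E ((x @ al q p @ v, src t, tgt s) # (u @ al p q @ y, src s, tgt t) # r)) else \<zero>))"
    unfolding ksgn_X by (rule ew_commute) simp
  also have "\<dots> = X s t r"
    unfolding X_def
  proof (intro ew_cong)
    fix u p v x q y assume *: "fst s = u @ p # v" "fst t = x @ q # y"
    show "(if paired q p then ksgn A (sp s * sp t + eps x q y u p v)
     (E ((x @ al q p @ v, src t, tgt s) # (u @ al p q @ y, src s, tgt t) # r)) else \<zero>) =
      (if paired p q then ksgn A (eps u p v x q y)
     (E ((u @ al p q @ y, src s, tgt t) # (x @ al q p @ v, src t, tgt s) # r)) else \<zero>)"
    proof (cases "paired p q")
      case True
      have "valid ((u @ p # v, src s, tgt s) # (x @ q # y, src t, tgt t) # r)"
        using assms * by (cases s; cases t) simp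
      note v = valid_contract[OF this True]
      have e: "E ((u @ al p q @ y, src s, tgt t) # (x @ al q p @ v, src t, tgt s) # r) =
        ksgn A (wpar (u @ al p q @ y) * wpar (x @ al q p @ v)) (E ((x @ al q p @ v, src t, tgt s) # (u @ al p q @ y, src s, tgt t) # r))"
        using E_transpose[of "[]" _ _ r] v by simp
      have qp: "paired q p" using True paired_sym by blast
      show ?thesis
        unfolding e using True qp
        by (simp add: sg_sg sp_def * wpar_al eps_def paired_parity[OF True] bit_ring)
    qed (simp add: paired_sym[of q p])
  qed
  finally show ?thesis by simp
qed

lemma X_merge_tail:
  assumes "valid (s # t # (u, i, j) # (v, j, k) # r)"
  shows "X s t ((u, i, j) # (v, j, k) # r) = X s t ((u @ v, i, k) # r)"
  unfolding X_def
proof (intro ew_cong)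
  fix a p b x q y assume *: "fst s = a @ p # b" "fst t = x @ q # y"
  show "(if paired p q then ksgn A (eps a p b x q y) (E ((a @ al p q @ y, src s, tgt t) # (x @ al q p @ b, src t, tgt s) # (u, i, j) # (v, j, k) # r)) else \<zero>) =
    (if paired p q then ksgn A (eps a p b x q y) (E ((a @ al p q @ y, src s, tgt t) # (x @ al q p @ b, src t, tgt s) # (u @ v, i, k) # r)) else \<zero>)"
  proof (cases "paired p q")
    case True
    have "valid ((a @ p # b, src s, tgt s) # (x @ q # y, src t, tgt t) # (u, i, j) # (v, j, k) # r)"
      using assms * by (cases s; cases t) simp
    from E_merge[of "[(a @ al p q @ y, src s, tgt t), (x @ al q p @ b, src t, tgt s)]"] valid_contract[OF this True]
    show ?thesis by simp
  qed simp
qed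

lemma Y_merge_tail:
  assumes "valid (s # (u, i, j) # (v, j, k) # r)"
  shows "Y s ((u, i, j) # (v, j, k) # r) = Y s ((u @ v, i, k) # r)"
  unfolding Y_def
proof (intro ew_cong)
  fix a p w b q y assume *: "fst s = a @ p # w" "w = b @ q # y"
  show "(if paired p q then ksgn A (eps' a p b q) (cl (hd_of p) (b @ al q p) \<otimes> E ((a @ al p q @ y, src s, tgt s) # (u, i, j) # (v, j, k) # r)) else \<zero>) =
    (if paired p q then ksgn A (eps' a p b q) (cl (hd_of p) (b @ al q p) \<otimes> E ((a @ al p q @ y, src s, tgt s) # (u @ v, i, k) # r)) else \<zero>)"
  proof (cases "paired p q")
    case True
    have "valid ((a @ p # b @ q # y, src s, tgt s) # (u, i, j) # (v, j, k) # r)"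
      using assms * by (cases s) simp
    from E_merge[of "[(a @ al p q @ y, src s, tgt s)]"] valid_self(1)[OF this True]
    show ?thesis by simp
  qed simp
qed

text \<open>The contracted letter of u v lies in u or in v. In the first case v is glued to the new
  string that ends where u ended; in the second case u is glued to the front of the new string that
  starts where v started.\<close>

lemma X_merge:
  assumes val: "valid ((u, i, j) # (v, j, k) # t # r)"
  shows "ksgn A (wpar v * sp t) (X (u, i, j) t ((v, j, k) # r)) \<oplus>
    ksgn A (wpar u * wpar v + wpar u * sp t) (X (v, j, k) t ((u, i, j) # r)) = X (u @ v, i, k) t r"
proof -
  let ?G = "\<lambda>a p b x q y. if paired p q then ksgn A (eps a p b x q y)
     (E ((a @ al p q @ y, i, tgt t) # (x @ al q p @ b, src t, k) # r)) else \<zero>"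
  have "X (u @ v, i, k) t r = ew u (\<lambda>a p b. ew (fst t) (?G a p (b @ v))) \<oplus> ew v (\<lambda>a p b. ew (fst t) (?G (u @ a) p b))"
    unfolding X_def fst_conv snd_conv by (rule ew_append) (simp add: ew_closed)
  moreover have "ew u (\<lambda>a p b. ew (fst t) (?G a p (b @ v))) = ksgn A (wpar v * sp t) (X (u, i, j) t ((v, j, k) # r))"
    unfolding ksgn_X fst_conv snd_conv
  proof (intro ew_cong)
    fix a p b x q y assume *: "u = a @ p # b" "fst t = x @ q # y"
    show "?G a p (b @ v) x q y = (if paired p q then ksgn A (wpar v * sp t + eps a p b x q y)
      (E ((a @ al p q @ y, i, tgt t) # (x @ al q p @ b, src t, j) # (v, j, k) # r)) else \<zero>)"
    proof (cases "paired p q")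
      case True
      have "valid ((a @ p # b, i, j) # (x @ q # y, src t, tgt t) # (v, j, k) # r)"
        by (rule valid_perm[OF val]) (use * in \<open>cases t; simp add: add_mset_commute\<close>)
      from E_merge[of "[(a @ al p q @ y, i, tgt t)]" "x @ al q p @ b" "src t" j v k r] valid_contract[OF this True]
      show ?thesis using True by (simp add: eps_def sp_def * bit_ring)
    qed simp
  qed
  moreover have "ew v (\<lambda>a p b. ew (fst t) (?G (u @ a) p b)) = ksgn A (wpar u * wpar v + wpar u * sp t) (X (v, j, k) t ((u, i, j) # r))"
    unfolding ksgn_X fst_conv snd_conv
  proof (intro ew_cong)
    fix a p b x q y assume *: "v = a @ p # b" "fst t = x @ q # y"
    show "?G (u @ a) p b x q y = (if paired p q then ksgn A (wpar u * wpar v + wpar u * sp t + eps a p b x q y)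
      (E ((a @ al p q @ y, j, tgt t) # (x @ al q p @ b, src t, k) # (u, i, j) # r)) else \<zero>)"
    proof (cases "paired p q")
      case True
      let ?s1 = "(a @ al p q @ y, j, tgt t)" and ?s2 = "(x @ al q p @ b, src t, k)"
      have "valid ((a @ p # b, j, k) # (x @ q # y, src t, tgt t) # (u, i, j) # r)"
        by (rule valid_perm[OF val]) (use * in \<open>cases t; simp add: add_mset_commute\<close>)
      note vc = valid_contract[OF this True]
      have v2: "valid ((u, i, j) # ?s1 # ?s2 # r)"
        by (rule valid_perm[OF vc]) (simp add: add_mset_commute)
      have "E ([?s1, ?s2] @ (u, i, j) # r) = ksgn A (dl sp [?s1, ?s2] * wpar u) (E ((u, i, j) # [?s1, ?s2] @ r))"
        using E_move[of "[?s1, ?s2]" "(u, i, j)" r] vc by simp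
      also have "E ((u, i, j) # [?s1, ?s2] @ r) = E ((u @ a @ al p q @ y, i, tgt t) # ?s2 # r)"
        using E_head[OF v2] by simp
      finally have e: "E (?s1 # ?s2 # (u, i, j) # r) = ksgn A (dl sp [?s1, ?s2] * wpar u) (E ((u @ a @ al p q @ y, i, tgt t) # ?s2 # r))"
        by simp
      have qp: "paired q p" using True paired_sym by blast
      show ?thesis unfolding e using True qp
        by (simp add: eps_def sp_def * sg_sg wpar_al paired_parity[OF True] bit_ring)
    qed simp
  qed
  ultimately show ?thesis by simp
qed

text \<open>Two letters of u v both lie in u, both in v, or one in each. In the last case
  contracting the pieces produces a string from j to j, which is a closed word: the cobracket of the
  glued string contains the bracket of its pieces.\<close>

lemma Y_merge:
  assumes val: "valid ((u, i, j) # (v, j, k) # r)"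
  shows "Y (u, i, j) ((v, j, k) # r) \<oplus> ksgn A (wpar u * wpar v) (Y (v, j, k) ((u, i, j) # r)) \<oplus> X (u, i, j) (v, j, k) r = Y (u @ v, i, k) r"
proof -
  let ?G = "\<lambda>a p b q y. if paired p q then ksgn A (eps' a p b q)
     (cl (hd_of p) (b @ al q p) \<otimes> E ((a @ al p q @ y, i, k) # r)) else \<zero>"
  have "Y (u @ v, i, k) r = ew u (\<lambda>a p w. ew (w @ v) (?G a p)) \<oplus> ew v (\<lambda>a p w. ew w (?G (u @ a) p))"
    unfolding Y_def fst_conv snd_conv by (rule ew_append) (simp add: ew_closed)
  also have "ew u (\<lambda>a p w. ew (w @ v) (?G a p)) = ew u (\<lambda>a p w. ew w (\<lambda>b q y. ?G a p b q (y @ v))) \<oplus> ew u (\<lambda>a p w. ew v (\<lambda>x q y. ?G a p (w @ x) q y))"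
    by (subst ew_add[symmetric]) (simp_all add: ew_closed ew_append)
  also have "ew u (\<lambda>a p w. ew w (\<lambda>b q y. ?G a p b q (y @ v))) = Y (u, i, j) ((v, j, k) # r)"
    unfolding Y_def fst_conv snd_conv
  proof (intro ew_cong)
    fix a p w b q y assume *: "u = a @ p # w" "w = b @ q # y"
    show "?G a p b q (y @ v) = (if paired p q then ksgn A (eps' a p b q)
      (cl (hd_of p) (b @ al q p) \<otimes> E ((a @ al p q @ y, i, j) # (v, j, k) # r)) else \<zero>)"
    proof (cases "paired p q")
      case True
      have "valid ((a @ p # b @ q # y, i, j) # (v, j, k) # r)" using val * by simp
      from E_head[OF valid_self(1)[OF this True]] show ?thesis by simp
    qed simp
  qed
  also have "ew u (\<lambda>a p w. ew v (\<lambda>x q y. ?G a p (w @ x) q y)) = X (u, i, j) (v, j, k) r"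
    unfolding X_def fst_conv snd_conv
  proof (intro ew_cong)
    fix a p b x q y assume *: "u = a @ p # b" "v = x @ q # y"
    show "?G a p (b @ x) q y = (if paired p q then ksgn A (eps a p b x q y)
      (E ((a @ al p q @ y, i, k) # (x @ al q p @ b, j, j) # r)) else \<zero>)"
    proof (cases "paired p q")
      case True
      let ?s1 = "(a @ al p q @ y, i, k)" and ?s2 = "(x @ al q p @ b, j, j)"
      have v0: "valid ((a @ p # b, i, j) # (x @ q # y, j, k) # r)" using val * by simp
      have qp: "paired q p" using True paired_sym by blast
      have w: "p \<in> arcs (double Q)" "walk (hd_of p) b (snd j)" "walk (snd j) x (tl_of q)" "q \<in> arcs (double Q)"
        using v0 by (auto simp: valid_def walk_mid simp del: D.awalk_append_iff)
      have "walk (snd j) (x @ al q p) (hd_of p)"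
        using w walk_al[OF qp] by (auto intro!: walk_appendI simp del: D.awalk_append_iff)
      from cl_rotate[OF w(2) this]
      have r: "cl (snd j) (x @ al q p @ b) = ksgn A (wpar b * wpar (x @ al q p)) (cl (hd_of p) (b @ x @ al q p))"
        by (simp add: sg_sg)
      have "E ([] @ ?s1 # ?s2 # r) = ksgn A (sp ?s1 * sp ?s2) (E ([] @ ?s2 # ?s1 # r))"
        using E_transpose[of "[]" ?s1 ?s2 r] valid_contract[OF v0 True] by simp
      then have e: "E (?s1 # ?s2 # r) = ksgn A (sp ?s1 * sp ?s2) (cl (snd j) (x @ al q p @ b) \<otimes> E (?s1 # r))"
        by (simp add: E_closed_string)
      show ?thesis unfolding e r using True qp
        by (simp add: eps_def eps'_def sg_sg sg_mult_left wpar_al paired_parity[OF True] bit_ring)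
    qed simp
  qed
  also have "ew v (\<lambda>a p w. ew w (?G (u @ a) p)) = ksgn A (wpar u * wpar v) (Y (v, j, k) ((u, i, j) # r))"
    unfolding ksgn_Y fst_conv snd_conv
  proof (intro ew_cong)
    fix a p w b q y assume *: "v = a @ p # w" "w = b @ q # y"
    show "?G (u @ a) p b q y = (if paired p q then ksgn A (wpar u * wpar v + eps' a p b q)
      (cl (hd_of p) (b @ al q p) \<otimes> E ((a @ al p q @ y, j, k) # (u, i, j) # r)) else \<zero>)"
    proof (cases "paired p q")
      case True
      let ?s1 = "(a @ al p q @ y, j, k)"
      have "valid ((a @ p # b @ q # y, j, k) # (u, i, j) # r)"
        by (rule valid_perm[OF val]) (use * in \<open>simp add: add_mset_commute\<close>)
      note v1 = valid_self(1)[OF this True]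
      have v2: "valid ((u, i, j) # ?s1 # r)" by (rule valid_perm[OF v1]) (simp add: add_mset_commute)
      have e: "E (?s1 # (u, i, j) # r) = ksgn A (sp ?s1 * wpar u) (E ((u @ a @ al p q @ y, i, k) # r))"
        using E_transpose[of "[]" ?s1 "(u, i, j)" r] v1 E_head[OF v2] by simp
      show ?thesis unfolding e using True
        by (simp add: eps'_def sg_sg sg_mult_right * wpar_al paired_parity[OF True] bit_ring)
    qed simp
  qed
  finally show ?thesis by (simp add: a_ac)
qed

end

section \<open>The operator on evaluated strings\<close>

text \<open>Moves t directly behind h inside a sum; in \<open>ad_E\<close> this brings the successor
  of a string next to it, so that both can be glued.\<close>

lemma (in smod) ex_shift:
  assumes cl: "\<And>x r. H x r \<in> carrier M"
    and H: "\<And>x r a b r'. mset (x # r @ a # b # r') = mset L0 \<Longrightarrow>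
      H x (r @ a # b # r') = ksgn M (d a * d b) (H x (r @ b # a # r'))"
    and L: "mset (h # L @ t # L') = mset L0"
  shows "ex d (h # L @ t # L') H = ksgn M (dl d L * d t) (ex d (h # t # L @ L') H)"
  using L
proof (induction L arbitrary: L' rule: rev_induct)
  case (snoc x L)
  have "ex d ((h # L) @ x # t # L') H = ksgn M (d x * d t) (ex d ((h # L) @ t # x # L') H)"
  proof (rule ex_transpose)
    fix y r r' assume "mset (y # r @ x # t # r') = mset ((h # L) @ x # t # L')"
    with snoc.prems show "H y (r @ x # t # r') = ksgn M (d x * d t) (H y (r @ t # x # r'))"
      by (intro H) (simp add: add_mset_commute)
  qed (rule cl)
  moreover have "ex d (h # L @ t # x # L') H = ksgn M (dl d L * d t) (ex d (h # t # L @ x # L') H)"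
    by (rule snoc.IH) (use snoc.prems in \<open>simp add: add_mset_commute\<close>)
  moreover have "ex d L H \<in> carrier M" for L by (rule ex_closed[OF cl])
  ultimately show ?case by (simp del: ex.simps add: sg_sg distrib_right add_ac)
qed (simp add: ex_closed cl del: ex.simps)

context contraction
begin

text \<open>The value of \<open>Y\<close> on a closed string, without the factor from the other
  strings. Likewise \<open>bracket_word\<close> is \<open>X\<close> on two closed strings, whose two
  new strings glue to a single closed word.\<close>

definition delta_word :: "'v \<Rightarrow> 'e darrow list \<Rightarrow> 'm" where
  "delta_word i w = ew w (\<lambda>u p z. ew z (\<lambda>v q y. if paired p q then ksgn A (eps' u p v q)
     (cl (hd_of p) (v @ al q p) \<otimes> cl i (u @ al p q @ y)) else \<zero>))"

definition bracket_word :: "'v \<Rightarrow> 'e darrow list \<Rightarrow> 'e darrow list \<Rightarrow> 'm" where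
  "bracket_word i w w' = ew w (\<lambda>u p v. ew w' (\<lambda>x q y. if paired p q then ksgn A (eps u p v x q y)
     (cl i (u @ al p q @ y @ x @ al q p @ v)) else \<zero>))"

lemma bracket_word_closed [simp]: "bracket_word i w w' \<in> carrier A"
  by (simp add: bracket_word_def ew_closed)

lemma delta_word_closed [simp]: "delta_word i w \<in> carrier A"
  by (simp add: delta_word_def ew_closed)

lemma D_transpose:
  assumes "valid (L @ a # b # L')"
  shows "D (L @ a # b # L') = ksgn A (sp a * sp b) (D (L @ b # a # L'))"
proof -
  have "ux sp (L @ a # b # L') X = ksgn A (sp a * sp b) (ux sp (L @ b # a # L') X)"
  proof (rule ux_transpose)
    show "X x y r = ksgn A (sp x * sp y) (X y x r)" if "mset (x # y # r) = mset (L @ a # b # L')" for x y r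
      by (rule X_sym[OF valid_perm[OF assms that]])
    show "X x y (r @ a # b # r') = ksgn A (sp a * sp b) (X x y (r @ b # a # r'))"
      if "mset (x # y # r @ a # b # r') = mset (L @ a # b # L')" for x y r r'
      by (rule X_transpose[OF valid_perm[OF assms that]])
  qed simp
  moreover have "ex sp (L @ a # b # L') Y = ksgn A (sp a * sp b) (ex sp (L @ b # a # L') Y)"
  proof (rule ex_transpose)
    show "Y x (r @ a # b # r') = ksgn A (sp a * sp b) (Y x (r @ b # a # r'))"
      if "mset (x # r @ a # b # r') = mset (L @ a # b # L')" for x r r'
      by (rule Y_transpose[OF valid_perm[OF assms that]])
  qed simp
  ultimately show ?thesis by (simp add: D_def sg_add ux_closed ex_closed)
qed

lemma D_shift:
  "valid (h # L @ t # L') \<Longrightarrow> D (h # L @ t # L') = ksgn A (dl sp L * sp t) (D (h # t # L @ L'))"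
proof (induction L arbitrary: L' rule: rev_induct)
  case (snoc x L)
  have v: "valid (h # L @ t # x # L')" by (rule valid_perm[OF snoc.prems]) (simp add: add_mset_commute)
  show ?case
    using D_transpose[of "h # L" x t L'] snoc.prems snoc.IH[OF v] by (simp add: sg_sg distrib_right add_ac)
qed simp

lemma E_shift:
  "valid (h # L @ t # L') \<Longrightarrow> E (h # L @ t # L') = ksgn A (dl sp L * sp t) (E (h # t # L @ L'))"
proof (induction L arbitrary: L' rule: rev_induct)
  case (snoc x L)
  have v: "valid (h # L @ t # x # L')" by (rule valid_perm[OF snoc.prems]) (simp add: add_mset_commute)
  show ?case
    using E_transpose[of "h # L" x t L'] snoc.prems snoc.IH[OF v] by (simp add: sg_sg distrib_right add_ac)
qed simp

text \<open>Pairs of strings are sorted by how they involve the glued string. The pair formed by its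
  two pieces moves from the sum over \<open>X\<close> to the sum over \<open>Y\<close>, by
  \<open>Y_merge\<close>.\<close>

lemma D_merge:
  assumes val: "valid ((u, i, j) # (v, j, k) # L)"
  shows "D ((u, i, j) # (v, j, k) # L) = D ((u @ v, i, k) # L)"
proof -
  let ?s = "(u, i, j)" and ?t = "(v, j, k)" and ?st = "(u @ v, i, k)"
  have p: "valid (x # y # ?s # ?t # r)" if "mset (x # y # r) = mset L" for x y r
    by (rule valid_perm[OF val]) (simp add: that[symmetric] add_mset_commute)
  have p1: "valid (?s # ?t # x # r)" "valid (x # ?s # ?t # r)" if "mset (x # r) = mset L" for x r
    by (rule valid_perm[OF val], simp add: that[symmetric] add_mset_commute)+
  have 1: "ux sp L (\<lambda>x y r. ksgn A (wpar v * (sp x + sp y)) (ksgn A (wpar u * (sp x + sp y)) (X x y (?s # ?t # r)))) =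
    ux sp L (\<lambda>x y r. ksgn A (wpar (u @ v) * (sp x + sp y)) (X x y (?st # r)))"
    by (rule ux_cong) (simp add: X_merge_tail[OF p] sg_sg bit_ring)
  have 2: "ex sp L (\<lambda>x r. ksgn A (wpar v * sp x) (X ?s x (?t # r))) \<oplus>
      ex sp L (\<lambda>x r. ksgn A (wpar u * (wpar v + sp x)) (X ?t x (?s # r))) = ex sp L (X ?st)"
  proof -
    have "ex sp L (\<lambda>x r. ksgn A (wpar v * sp x) (X ?s x (?t # r)) \<oplus> ksgn A (wpar u * (wpar v + sp x)) (X ?t x (?s # r))) = ex sp L (X ?st)"
      by (rule ex_cong) (simp add: X_merge[OF p1(1), symmetric] distrib_left)
    then show ?thesis by (simp add: ex_add)
  qed
  have 3: "ex sp L (\<lambda>x r. ksgn A (wpar v * sp x) (ksgn A (wpar u * sp x) (Y x (?s # ?t # r)))) =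
    ex sp L (\<lambda>x r. ksgn A (wpar (u @ v) * sp x) (Y x (?st # r)))"
    by (rule ex_cong) (simp add: Y_merge_tail[OF p1(2)] sg_sg bit_ring)
  show ?thesis
    unfolding D_def ux.simps ex.simps sp_simp 1 3 2[symmetric] Y_merge[OF val, symmetric]
    by (simp add: a_ac ex_closed ux_closed)
qed

text \<open>A contraction removes two letters of opposite parity and inserts two words of equal
  parity, so it is odd. Hence the 1 in the exponent with which a closed string that takes no part is
  pulled out.\<close>

lemma X_closed_tail:
  assumes "valid (s # t # (w, i, i) # r)"
  shows "X s t ((w, i, i) # r) = ksgn A (wpar w * (1 + sp s + sp t)) (cl (snd i) w \<otimes> X s t r)"
proof -
  have "cl (snd i) w \<otimes> X s t r = ew (fst s) (\<lambda>u p v. ew (fst t) (\<lambda>x q y. cl (snd i) w \<otimes> (if paired p q then ksgn A (eps u p v x q y)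
     (E ((u @ al p q @ y, src s, tgt t) # (x @ al q p @ v, src t, tgt s) # r)) else \<zero>)))"
    unfolding X_def by (simp add: ew_hom[OF smod_axioms mult_linear_left[OF cl_closed]] ew_closed)
  then have "ksgn A (wpar w * (1 + sp s + sp t)) (cl (snd i) w \<otimes> X s t r) = ew (fst s) (\<lambda>u p v. ew (fst t) (\<lambda>x q y.
     ksgn A (wpar w * (1 + sp s + sp t)) (cl (snd i) w \<otimes> (if paired p q then ksgn A (eps u p v x q y)
     (E ((u @ al p q @ y, src s, tgt t) # (x @ al q p @ v, src t, tgt s) # r)) else \<zero>))))"
    by (simp add: ew_sg ew_closed)
  also have "\<dots> = X s t ((w, i, i) # r)"
    unfolding X_def
  proof (intro ew_cong)
    fix u p v x q y assume *: "fst s = u @ p # v" "fst t = x @ q # y"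
    let ?a = "(u @ al p q @ y, src s, tgt t)" and ?b = "(x @ al q p @ v, src t, tgt s)"
    show "ksgn A (wpar w * (1 + sp s + sp t)) (cl (snd i) w \<otimes> (if paired p q then ksgn A (eps u p v x q y) (E (?a # ?b # r)) else \<zero>)) =
      (if paired p q then ksgn A (eps u p v x q y) (E (?a # ?b # (w, i, i) # r)) else \<zero>)"
    proof (cases "paired p q")
      case True
      have "valid ((u @ p # v, src s, tgt s) # (x @ q # y, src t, tgt t) # (w, i, i) # r)"
        using assms * by (cases s; cases t) simp
      from E_move[of "[?a, ?b]" "(w, i, i)" r] valid_contract[OF this True]
      have e: "E (?a # ?b # (w, i, i) # r) = ksgn A (dl sp [?a, ?b] * wpar w) (cl (snd i) w \<otimes> E (?a # ?b # r))"
        by (simp add: E_closed_string)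
      have qp: "paired q p" using True paired_sym by blast
      show ?thesis unfolding e using True qp
        by (simp add: sg_sg sg_mult_right sp_def * wpar_al paired_parity[OF True] bit_ring)
    qed simp
  qed
  finally show ?thesis by simp
qed

lemma Y_closed_tail:
  assumes "valid (s # (w, i, i) # r)"
  shows "Y s ((w, i, i) # r) = ksgn A (wpar w * (1 + sp s)) (cl (snd i) w \<otimes> Y s r)"
proof -
  have "cl (snd i) w \<otimes> Y s r = ew (fst s) (\<lambda>u p z. ew z (\<lambda>v q y. cl (snd i) w \<otimes> (if paired p q then ksgn A (eps' u p v q)
     (cl (hd_of p) (v @ al q p) \<otimes> E ((u @ al p q @ y, src s, tgt s) # r)) else \<zero>)))"
    unfolding Y_def by (simp add: ew_hom[OF smod_axioms mult_linear_left[OF cl_closed]] ew_closed)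
  then have "ksgn A (wpar w * (1 + sp s)) (cl (snd i) w \<otimes> Y s r) = ew (fst s) (\<lambda>u p z. ew z (\<lambda>v q y.
     ksgn A (wpar w * (1 + sp s)) (cl (snd i) w \<otimes> (if paired p q then ksgn A (eps' u p v q)
     (cl (hd_of p) (v @ al q p) \<otimes> E ((u @ al p q @ y, src s, tgt s) # r)) else \<zero>))))"
    by (simp add: ew_sg ew_closed)
  also have "\<dots> = Y s ((w, i, i) # r)"
    unfolding Y_def
  proof (intro ew_cong)
    fix u p z v q y assume *: "fst s = u @ p # z" "z = v @ q # y"
    let ?a = "(u @ al p q @ y, src s, tgt s)"
    show "ksgn A (wpar w * (1 + sp s)) (cl (snd i) w \<otimes> (if paired p q then ksgn A (eps' u p v q) (cl (hd_of p) (v @ al q p) \<otimes> E (?a # r)) else \<zero>)) =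
      (if paired p q then ksgn A (eps' u p v q) (cl (hd_of p) (v @ al q p) \<otimes> E (?a # (w, i, i) # r)) else \<zero>)"
    proof (cases "paired p q")
      case True
      have "valid ((u @ p # v @ q # y, src s, tgt s) # (w, i, i) # r)"
        using assms * by (cases s) simp
      from E_move[of "[?a]" "(w, i, i)" r] valid_self(1)[OF this True]
      have e: "E (?a # (w, i, i) # r) = ksgn A (sp ?a * wpar w) (cl (snd i) w \<otimes> E (?a # r))"
        by (simp add: E_closed_string)
      have qp: "paired q p" using True paired_sym by blast
      show ?thesis unfolding e using True qp commute_left_cl[of "E (?a # r)" "hd_of p" "v @ al q p" "snd i" w]
        by (simp add: sg_sg sg_mult_right sp_def * wpar_al paired_parity[OF True] bit_ring)
    qed simp
  qed
  finally show ?thesis by simp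
qed

text \<open>The terms are sorted by whether they involve the closed string. The result has the form
  of the recursion of the operator on the product with a generator.\<close>

lemma D_closed_head:
  assumes val: "valid ((w, i, i) # L)"
  shows "D ((w, i, i) # L) = delta_word (snd i) w \<otimes> E L \<oplus> ex sp L (X (w, i, i)) \<oplus> ksgn A (wpar w) (cl (snd i) w \<otimes> D L)"
proof -
  let ?s = "(w, i, i)"
  have "Y ?s L = delta_word (snd i) w \<otimes> E L"
  proof -
    have "delta_word (snd i) w \<otimes> E L = ew w (\<lambda>u p z. ew z (\<lambda>v q y. (if paired p q then ksgn A (eps' u p v q)
       (cl (hd_of p) (v @ al q p) \<otimes> cl (snd i) (u @ al p q @ y)) else \<zero>) \<otimes> E L))"
      unfolding delta_word_def by (simp add: ew_hom[OF smod_axioms mult_linear_right[OF E_closed]] ew_closed)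
    also have "\<dots> = Y ?s L"
      unfolding Y_def fst_conv snd_conv
      by (intro ew_cong) (simp add: E_closed_string sg_mult_left m_assoc)
    finally show ?thesis by simp
  qed
  moreover have "ux sp L (\<lambda>x y r. ksgn A (wpar w * (sp x + sp y)) (X x y (?s # r))) = ksgn A (wpar w) (cl (snd i) w \<otimes> ux sp L X)"
  proof -
    have "ux sp L (\<lambda>x y r. ksgn A (wpar w * (sp x + sp y)) (X x y (?s # r))) = ux sp L (\<lambda>x y r. ksgn A (wpar w) (cl (snd i) w \<otimes> X x y r))"
    proof (rule ux_cong)
      fix x y r assume m: "mset (x # y # r) = mset L"
      have "valid (x # y # ?s # r)" by (rule valid_perm[OF val]) (simp add: m[symmetric] add_mset_commute)
      from X_closed_tail[OF this] show "ksgn A (wpar w * (sp x + sp y)) (X x y (?s # r)) = ksgn A (wpar w) (cl (snd i) w \<otimes> X x y r)"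
        by (simp add: sg_sg bit_ring)
    qed
    then show ?thesis by (simp add: ux_sg ux_hom[OF mult_linear_left[OF cl_closed]])
  qed
  moreover have "ex sp L (\<lambda>x r. ksgn A (wpar w * sp x) (Y x (?s # r))) = ksgn A (wpar w) (cl (snd i) w \<otimes> ex sp L Y)"
  proof -
    have "ex sp L (\<lambda>x r. ksgn A (wpar w * sp x) (Y x (?s # r))) = ex sp L (\<lambda>x r. ksgn A (wpar w) (cl (snd i) w \<otimes> Y x r))"
    proof (rule ex_cong)
      fix x r assume m: "mset (x # r) = mset L"
      have "valid (x # ?s # r)" by (rule valid_perm[OF val]) (simp add: m[symmetric] add_mset_commute)
      from Y_closed_tail[OF this] show "ksgn A (wpar w * sp x) (Y x (?s # r)) = ksgn A (wpar w) (cl (snd i) w \<otimes> Y x r)"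
        by (simp add: sg_sg bit_ring)
    qed
    then show ?thesis by (simp add: ex_sg ex_hom[OF mult_linear_left[OF cl_closed]])
  qed
  ultimately show ?thesis
    by (simp add: D_def r_distr sg_add ex_closed ux_closed a_ac)
qed

lemma successor:
  assumes "valid ((w, i, j) # L)" "i \<noteq> j"
  obtains L1 v k L2 where "L = L1 @ (v, j, k) # L2"
proof -
  have "j \<in> src ` set L" using assms by (auto simp: valid_def)
  then obtain t where "t \<in> set L" "src t = j" by auto
  then obtain L1 L2 where "L = L1 @ t # L2" by (auto dest: split_list)
  then show ?thesis using that[of L1 "fst t" "tgt t" L2] \<open>src t = j\<close> by (cases t) auto
qed

end

text \<open>Of the operator itself only linearity and its recursion on products of closed words are
  required; \<open>ad\<close> is the bracket part of its commutator with such a word.\<close>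

locale bv_operator = contraction A Q cl plus
  for A :: "('r :: {comm_ring, comm_monoid_mult}, 'm) supermod" (structure)
    and Q :: "('v, 'e) pre_digraph" and cl :: "'v \<Rightarrow> 'e darrow list \<Rightarrow> 'm" and plus +
  fixes \<Delta> :: "'m \<Rightarrow> 'm" and ad :: "'v \<Rightarrow> 'e darrow list \<Rightarrow> 'm \<Rightarrow> 'm"
  assumes Delta_linear: "\<Delta> \<in> linear_maps A A" and Delta_one: "\<Delta> \<one> = \<zero>"
    and ad_linear: "walk i w i \<Longrightarrow> ad i w \<in> linear_maps A A" and ad_one: "walk i w i \<Longrightarrow> ad i w \<one> = \<zero>"
    and Delta_cl: "\<lbrakk>walk i w i; z \<in> carrier A\<rbrakk> \<Longrightarrow>
      \<Delta> (cl i w \<otimes> z) = delta_word i w \<otimes> z \<oplus> ad i w z \<oplus> ksgn A (wpar w) (cl i w \<otimes> \<Delta> z)"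
    and ad_cl: "\<lbrakk>walk i w i; walk k v k; z \<in> carrier A\<rbrakk> \<Longrightarrow>
      ad i w (cl k v \<otimes> z) = bracket_word i w v \<otimes> z \<oplus> ksgn A ((1 + wpar w) * wpar v) (cl k v \<otimes> ad i w z)"
begin

text \<open>Induction on the number of strings. A closed first string is handled by
  \<open>ad_cl\<close>. An open one is glued to its successor, and \<open>X_merge\<close>, turned
  around by \<open>X_sym\<close>, shows that the right side does not change.\<close>

lemma ad_E: "valid ((w, i, i) # L) \<Longrightarrow> ad (snd i) w (E L) = ex sp L (X (w, i, i))"
proof (induction L rule: length_induct)
  case (1 L)
  let ?s = "(w, i, i)"
  have w: "walk (snd i) w (snd i)" using 1(2) by (simp add: valid_def)
  note al = ad_linear[OF w]
  have xt: "X ?s x (r @ a # b # r') = ksgn A (sp a * sp b) (X ?s x (r @ b # a # r'))"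
    if "mset (x # r @ a # b # r') = mset L" for x r a b r'
    by (rule X_transpose, rule valid_perm[OF 1(2)]) (use that in simp)
  show ?case
  proof (cases L)
    case Nil
    then show ?thesis by (simp add: ad_one[OF w])
  next
    case (Cons h L')
    obtain w' k l where h: "h = (w', k, l)" by (cases h)
    show ?thesis
    proof (cases "k = l")
      case True
      have v: "valid (?s # (w', k, k) # L')" using 1(2) Cons h True by simp
      have v': "valid (?s # L')" by (rule valid_closed_tail, rule valid_perm[OF v]) (simp add: add_mset_commute)
      have w': "walk (snd k) w' (snd k)" using v by (simp add: valid_def)
      have "X ?s (w', k, k) L' = bracket_word (snd i) w w' \<otimes> E L'"
      proof -
        have "bracket_word (snd i) w w' \<otimes> E L' = ew w (\<lambda>u p v. ew w' (\<lambda>x q y. (if paired p q then ksgn A (eps u p v x q y)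
           (cl (snd i) (u @ al p q @ y @ x @ al q p @ v)) else \<zero>) \<otimes> E L'))"
          unfolding bracket_word_def by (simp add: ew_hom[OF smod_axioms mult_linear_right[OF E_closed]] ew_closed)
        also have "\<dots> = X ?s (w', k, k) L'"
          unfolding X_def fst_conv snd_conv
        proof (intro ew_cong)
          fix u p b x q y assume *: "w = u @ p # b" "w' = x @ q # y"
          show "(if paired p q then ksgn A (eps u p b x q y) (cl (snd i) (u @ al p q @ y @ x @ al q p @ b)) else \<zero>) \<otimes> E L' =
            (if paired p q then ksgn A (eps u p b x q y) (E ((u @ al p q @ y, i, k) # (x @ al q p @ b, k, i) # L')) else \<zero>)"
          proof (cases "paired p q")
            case True
            have "valid ((u @ p # b, i, i) # (x @ q # y, k, k) # L')" using v * by simp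
            from E_head[OF valid_contract[OF this True]] show ?thesis
              using True by (simp add: E_closed_string sg_mult_left)
          qed simp
        qed
        finally show ?thesis by simp
      qed
      moreover have "ex sp L' (\<lambda>x r. ksgn A (wpar w' * sp x) (X ?s x ((w', k, k) # r))) =
        ksgn A ((1 + wpar w) * wpar w') (cl (snd k) w' \<otimes> ex sp L' (X ?s))"
      proof -
        have "ex sp L' (\<lambda>x r. ksgn A (wpar w' * sp x) (X ?s x ((w', k, k) # r))) =
          ex sp L' (\<lambda>x r. ksgn A ((1 + wpar w) * wpar w') (cl (snd k) w' \<otimes> X ?s x r))"
        proof (rule ex_cong)
          fix x r assume m: "mset (x # r) = mset L'"
          have "valid (?s # x # (w', k, k) # r)" by (rule valid_perm[OF v]) (simp add: m[symmetric] add_mset_commute)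
          from X_closed_tail[OF this]
          show "ksgn A (wpar w' * sp x) (X ?s x ((w', k, k) # r)) = ksgn A ((1 + wpar w) * wpar w') (cl (snd k) w' \<otimes> X ?s x r)"
            by (simp add: sg_sg bit_ring)
        qed
        then show ?thesis by (simp add: ex_sg ex_hom[OF mult_linear_left[OF cl_closed]])
      qed
      moreover have "ad (snd i) w (E L') = ex sp L' (X ?s)" using 1(1) v' Cons by simp
      ultimately show ?thesis
        unfolding Cons h True[symmetric] ex.simps sp_simp
        using ad_cl[OF w w', of "E L'"] by (simp add: True E_closed_string)
    next
      case False
      obtain L1 v m L2 where L': "L' = L1 @ (v, l, m) # L2"
        using successor[OF valid_closed_tail[OF 1(2), unfolded Cons h] False] by blast
      let ?t = "(v, l, m)" and ?ht = "(w' @ v, k, m)" and ?R = "L1 @ L2"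
      have vs: "valid (?s # h # ?t # ?R)" by (rule valid_perm[OF 1(2)]) (simp add: Cons L' add_mset_commute)
      have v1: "valid (h # L1 @ ?t # L2)" and v2: "valid (h # ?t # ?R)"
        using valid_closed_tail[OF 1(2)] valid_closed_tail[OF vs] Cons L' by simp_all
      have "valid (h # ?t # ?s # ?R)" by (rule valid_perm[OF vs]) (simp add: add_mset_commute)
      then have "valid (?ht # ?s # ?R)" unfolding h by (rule valid_merge)
      then have vm: "valid (?s # ?ht # ?R)" by (rule valid_perm) (simp add: add_mset_commute)
      have "E L = ksgn A (dl sp L1 * wpar v) (E (?ht # ?R))"
        using E_shift[OF v1] E_head[OF v2[unfolded h]] by (simp add: Cons L' h)
      then have "ad (snd i) w (E L) = ksgn A (dl sp L1 * wpar v) (ad (snd i) w (E (?ht # ?R)))"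
        using linear_map_ksgn[OF smod_axioms smod_axioms al] by simp
      also have "ad (snd i) w (E (?ht # ?R)) = ex sp (?ht # ?R) (X ?s)"
        using 1(1) vm Cons L' by simp
      also have "\<dots> = ex sp (h # ?t # ?R) (X ?s)"
      proof -
        have "valid (h # ?t # ?s # ?R)" by (rule valid_perm[OF vs]) (simp add: add_mset_commute)
        from X_merge[OF this[unfolded h]]
        have m: "X ?ht ?s ?R = ksgn A (wpar v * wpar w) (X h ?s (?t # ?R)) \<oplus> ksgn A (wpar w' * wpar v + wpar w' * wpar w) (X ?t ?s (h # ?R))"
          by (simp add: h)
        have "valid (?s # ?t # h # ?R)" by (rule valid_perm[OF vs]) (simp add: add_mset_commute)
        then have e: "X ?s ?ht ?R = X ?s h (?t # ?R) \<oplus> ksgn A (wpar w' * wpar v) (X ?s ?t (h # ?R))"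
          using X_sym[OF vm] X_sym[OF vs] X_sym[of ?s ?t "h # ?R"]
          by (simp add: m sg_add sg_sg h bit_ring)
        have "ex sp ?R (\<lambda>x r. ksgn A (wpar v * sp x) (ksgn A (wpar w' * sp x) (X ?s x (h # ?t # r)))) =
          ex sp ?R (\<lambda>x r. ksgn A (wpar (w' @ v) * sp x) (X ?s x (?ht # r)))"
        proof (rule ex_cong)
          fix x r assume m: "mset (x # r) = mset ?R"
          have "valid (?s # x # (w', k, l) # ?t # r)"
            by (rule valid_perm[OF vs]) (use m in \<open>simp add: h m[symmetric] add_mset_commute\<close>)
          from X_merge_tail[OF this]
          show "ksgn A (wpar v * sp x) (ksgn A (wpar w' * sp x) (X ?s x (h # ?t # r))) = ksgn A (wpar (w' @ v) * sp x) (X ?s x (?ht # r))"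
            by (simp add: sg_sg h bit_ring)
        qed
        then show ?thesis by (simp add: h) (simp add: e[unfolded h] a_ac ex_closed)
      qed
      also have "ksgn A (dl sp L1 * wpar v) \<dots> = ex sp L (X ?s)"
        using ex_shift[of "X ?s" L sp h L1 ?t L2, OF X_closed xt] by (simp add: Cons L' del: ex.simps)
      finally show ?thesis .
    qed
  qed
qed

text \<open>Induction as in \<open>ad_E\<close>: for a closed first string both sides satisfy the
  same recursion, and gluing an open one to its successor produces the same sign on both
  sides.\<close>

theorem Delta_E: "valid L \<Longrightarrow> \<Delta> (E L) = D L"
proof (induction L rule: length_induct)
  case (1 L)
  show ?case
  proof (cases L)
    case Nil
    then show ?thesis by (simp add: Delta_one D_def)
  next
    case (Cons h L')
    obtain w i j where h: "h = (w, i, j)" by (cases h)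
    show ?thesis
    proof (cases "i = j")
      case True
      have v: "valid ((w, i, i) # L')" using 1(2) Cons h True by simp
      have "\<Delta> (E L') = D L'" using 1(1) valid_closed_tail[OF v] Cons by simp
      then show ?thesis
        using Delta_cl[OF valid_closed_walk[OF v], of "E L'"] D_closed_head[OF v] ad_E[OF v]
        by (simp add: Cons h True[symmetric] E_closed_string)
    next
      case False
      have v: "valid ((w, i, j) # L')" using 1(2) Cons h by simp
      obtain L1 u k L2 where L': "L' = L1 @ (u, j, k) # L2" using successor[OF v False] by blast
      let ?t = "(u, j, k)"
      have v1: "valid (h # L1 @ ?t # L2)" using v L' h by simp
      have v2: "valid ((w, i, j) # ?t # L1 @ L2)" by (rule valid_perm[OF v]) (simp add: L')
      have "E L = ksgn A (dl sp L1 * wpar u) (E ((w @ u, i, k) # L1 @ L2))"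
        using E_shift[OF v1] E_head[OF v2] by (simp add: Cons L' h)
      moreover have "\<Delta> (E ((w @ u, i, k) # L1 @ L2)) = D ((w @ u, i, k) # L1 @ L2)"
        using 1(1) valid_merge[OF v2] Cons L' by simp
      moreover have "D L = ksgn A (dl sp L1 * wpar u) (D ((w @ u, i, k) # L1 @ L2))"
        using D_shift[OF v1] D_merge[OF v2] by (simp add: Cons L' h)
      ultimately show ?thesis
        using linear_map_ksgn[OF smod_axioms smod_axioms Delta_linear] by simp
    qed
  qed
qed

end

section \<open>The square of the operator\<close>

context smod
begin

abbreviation "ex2 d L H \<equiv> ex d L (\<lambda>s r. ex d r (H s))"
abbreviation "ex3 d L H \<equiv> ex d L (\<lambda>s r. ex2 d r (H s))"
abbreviation "ex4 d L H \<equiv> ex d L (\<lambda>s r. ex3 d r (H s))"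

lemma ex2_cong:
  assumes "\<And>s t r. mset (s # t # r) = mset L \<Longrightarrow> H s t r = H' s t r"
  shows "ex2 d L H = ex2 d L H'"
  by (intro ex_cong) (metis assms mset.simps(2))

lemma ex3_cong:
  assumes "\<And>s t x r. mset (s # t # x # r) = mset L \<Longrightarrow> H s t x r = H' s t x r"
  shows "ex3 d L H = ex3 d L H'"
  by (intro ex_cong) (metis assms mset.simps(2))

lemma ex4_cong:
  assumes "\<And>s t x y r. mset (s # t # x # y # r) = mset L \<Longrightarrow> H s t x y r = H' s t x y r"
  shows "ex4 d L H = ex4 d L H'"
  by (intro ex_cong) (metis assms mset.simps(2))

text \<open>Exchanging the first two extracted elements with the last two is a product of four
  adjacent transpositions, each an instance of \<open>ex_swap2\<close>.\<close>

lemma ex4_swap: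
  assumes H: "\<And>s t x y r. H s t x y r \<in> carrier M"
  shows "ex4 d L H = ex4 d L (\<lambda>s t x y r. ksgn M ((d s + d t) * (d x + d y)) (H x y s t r))"
proof -
  have s12: "ex4 d L K = ex4 d L (\<lambda>s t x y r. ksgn M (d s * d t) (K t s x y r))"
    if "\<And>s t x y r. K s t x y r \<in> carrier M" for K L
    using ex_swap2[of "\<lambda>s t r. ex2 d r (K s t)" d L] that by (simp add: ex_sg ex_closed)
  have s23: "ex4 d L K = ex4 d L (\<lambda>s t x y r. ksgn M (d t * d x) (K s x t y r))"
    if "\<And>s t x y r. K s t x y r \<in> carrier M" for K
  proof (rule ex_cong)
    fix s r
    show "ex3 d r (K s) = ex3 d r (\<lambda>t x y r. ksgn M (d t * d x) (K s x t y r))"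
      using ex_swap2[of "\<lambda>t x r. ex d r (K s t x)" d r] that by (simp add: ex_sg ex_closed)
  qed
  have s34: "ex4 d L K = ex4 d L (\<lambda>s t x y r. ksgn M (d x * d y) (K s t y x r))"
    if "\<And>s t x y r. K s t x y r \<in> carrier M" for K
    by (intro ex_cong ex_swap2 that)
  show ?thesis
    by (subst s23, simp add: H, subst s12, simp add: H, subst s34, simp add: H, subst s23, simp add: H)
      (simp add: sg_sg H distrib_left distrib_right add_ac mult.commute)
qed

lemma self_neg_zero:
  assumes "(1 + 1 :: 'r) dvd 1" "x \<in> carrier M" "x = ksgn M 1 x"
  shows "x = \<zero>"
proof (rule double_eq_zero)
  have "x \<oplus> x = x \<oplus> \<ominus> x" using assms(3) by (simp add: ksgn_def)
  then show "x \<oplus> x = \<zero>" using assms(2) by (simp add: r_neg)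
qed (use assms in simp_all)

end

context bv_operator
begin

interpretation D: wf_digraph "double Q" by (rule wf)

definition small :: "('v, 'e) str list \<Rightarrow> bool" where
  "small L \<longleftrightarrow> (\<forall>s\<in>set L. length (fst s) \<le> 1)"

lemma small_mset: "mset L = mset L' \<Longrightarrow> small L \<longleftrightarrow> small L'"
  unfolding small_def by (metis set_mset_mset)

definition pr :: "('v, 'e) str \<Rightarrow> ('v, 'e) str \<Rightarrow> bool" where
  "pr s t \<longleftrightarrow> (\<exists>p q. fst s = [p] \<and> fst t = [q] \<and> paired p q)"

text \<open>For one-letter strings s and t, the strings after contraction are \<open>jn s t\<close>
  and \<open>jn t s\<close>.\<close>

definition jn :: "('v, 'e) str \<Rightarrow> ('v, 'e) str \<Rightarrow> ('v, 'e) str" where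
  "jn s t = (al (hd (fst s)) (hd (fst t)), src s, tgt t)"

lemma pr_sym: "pr s t \<longleftrightarrow> pr t s"
  unfolding pr_def using paired_sym by blast

lemma sp_jn: "pr s t \<Longrightarrow> sp (jn s t) = bd"
  by (auto simp: pr_def jn_def wpar_al)

lemma pr_sp: "pr s t \<Longrightarrow> sp t = 1 + sp s"
  by (auto simp: pr_def sp_def wpar_def dest: paired_parity)

lemma X_small:
  assumes "length (fst s) \<le> 1" "length (fst t) \<le> 1"
  shows "X s t r = (if pr s t then ksgn A (bd * sp s) (E (jn s t # jn t s # r)) else \<zero>)"
proof -
  obtain w i j where s: "s = (w, i, j)" by (cases s)
  obtain w' k l where t: "t = (w', k, l)" by (cases t)
  show ?thesis using assms unfolding s t
    by (cases w; cases w') (auto simp: X_def pr_def jn_def eps_def wpar_def)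
qed

lemma Y_small: "length (fst s) \<le> 1 \<Longrightarrow> Y s r = \<zero>"
  by (cases "fst s") (auto simp: Y_def)

lemma valid_jn:
  assumes "valid (s # t # r)" "pr s t"
  shows "valid (jn s t # jn t s # r)"
proof -
  obtain p q where pq: "fst s = [p]" "fst t = [q]" "paired p q" using assms(2) by (auto simp: pr_def)
  have "valid (([] @ p # [], src s, tgt s) # ([] @ q # [], src t, tgt t) # r)"
    using assms(1) pq by (cases s; cases t) simp
  from valid_contract[OF this pq(3)] show ?thesis using pq by (simp add: jn_def)
qed

text \<open>The two new strings interact with each other, or with themselves.\<close>

lemma contract_new:
  assumes v: "valid (s # t # r)" and pr: "pr s t"
  shows "X (jn s t) (jn t s) r \<oplus> Y (jn s t) (jn t s # r) \<oplus> ksgn A bd (Y (jn t s) (jn s t # r)) = \<zero>"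
proof -
  obtain p q where pq: "fst s = [p]" "fst t = [q]" "paired p q" using pr by (auto simp: pr_def)
  have qp: "paired q p" using pq(3) paired_sym by blast
  have npp: "\<not> paired p p" "\<not> paired q q" by (auto simp: paired_def)
  note vj = valid_jn[OF v pr]
  show ?thesis
  proof (cases plus)
    case False
    then have "al p q = []" "al q p = []" unfolding al_def by simp_all
    then show ?thesis by (simp add: X_def Y_def jn_def pq)
  next
    case True
    have al: "al p q = [p, q]" "al q p = [q, p]" and bd: "bd = 1" unfolding al_def bd_def using True by simp_all
    have arcs: "p \<in> arcs (double Q)" "q \<in> arcs (double Q)"
      using v pq unfolding valid_def by (cases s; cases t; auto simp: D.awalk_Cons_iff)+
    \<comment> \<open>The words p q and q p are rotations of each other, and the sign of the
      rotation is trivial because one of the two letters is even.\<close>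
    have "cl (tl_of p) ([p] @ [q]) = ksgn A (wpar [p] * wpar [q]) (cl (hd_of p) ([q] @ [p]))"
      by (rule cl_rotate) (use arcs paired_ends[OF pq(3)] in \<open>auto simp: D.awalk_Cons_iff D.awalk_Nil_iff\<close>)
    then have rot: "cl (hd_of q) [p, q] = cl (hd_of p) [q, p]"
      using paired_ends[OF pq(3)] by (simp add: wpar_def paired_parity[OF pq(3)] distrib_left)
    have e: "E (([q, p], src t, tgt s) # ([p, q], src s, tgt t) # r) = \<ominus> (E (([p, q], src s, tgt t) # ([q, p], src t, tgt s) # r))"
      using E_transpose[of "[]" "jn t s" "jn s t" r] valid_perm[OF vj, of "jn t s # jn s t # r"] sp_jn[OF pr] sp_jn[of t s] pr pr_sym[of s t] pq
      by (simp add: jn_def al bd ksgn_def add_mset_commute)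
    have par: "parity p = 0 \<or> parity p = 1" by (cases p) simp_all
    \<comment> \<open>Contracting the first letters of the two words, or their second letters,
      leaves the same strings p q p and q p q, with opposite signs.\<close>
    have x: "X (jn s t) (jn t s) r = \<zero>"
      using par pq qp npp by (elim disjE) (simp_all add: X_def jn_def al eps_def bd wpar_def paired_parity[OF pq(3)] ksgn_def l_neg r_neg)
    \<comment> \<open>Both self-contractions split off the same cyclic word and leave p q and q p.
      The sign of reordering these odd strings compensates the explicit sign, and what remains are
      signs given by the different parities of p and q.\<close>
    have y: "Y (jn s t) (jn t s # r) \<oplus> ksgn A bd (Y (jn t s) (jn s t # r)) = \<zero>"
      using par pq qp npp by (elim disjE) (simp_all add: Y_def jn_def al eps'_def bd wpar_def paired_parity[OF pq(3)] rot e ksgn_def r_minus l_neg r_neg)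
    show ?thesis using y by (simp add: x a_assoc)
  qed
qed

text \<open>After s and t have been contracted, \<open>V\<close> covers a second contraction of a
  new string with an old string x, and \<open>Z\<close> one of two old strings. The terms of
  \<open>V\<close> in which x carries the letter of t form \<open>V'\<close>; those are the terms
  that cancel when t and x are exchanged.\<close>

definition V :: "('v, 'e) str \<Rightarrow> ('v, 'e) str \<Rightarrow> ('v, 'e) str \<Rightarrow> ('v, 'e) str list \<Rightarrow> 'm" where
  "V s t x r = (if pr s t then ksgn A (bd * sp s) (ksgn A (bd * sp x) (X (jn s t) x (jn t s # r)) \<oplus>
     ksgn A (bd * (bd + sp x)) (X (jn t s) x (jn s t # r))) else \<zero>)"

definition V' :: "('v, 'e) str \<Rightarrow> ('v, 'e) str \<Rightarrow> ('v, 'e) str \<Rightarrow> ('v, 'e) str list \<Rightarrow> 'm" where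
  "V' s t x r = (if fst x = fst t then V s t x r else \<zero>)"

definition Z :: "('v, 'e) str \<Rightarrow> ('v, 'e) str \<Rightarrow> ('v, 'e) str \<Rightarrow> ('v, 'e) str \<Rightarrow> ('v, 'e) str list \<Rightarrow> 'm" where
  "Z s t x y r = (if pr s t then ksgn A (bd * sp s) (X x y (jn s t # jn t s # r)) else \<zero>)"

lemma V_closed [simp]: "V s t x r \<in> carrier A" "V' s t x r \<in> carrier A" "Z s t x y r \<in> carrier A"
  by (simp_all add: V_def V'_def Z_def)

text \<open>By \<open>Delta_E\<close> the second application is \<open>D\<close> of the new list.
  Contractions among the new strings vanish by \<open>contract_new\<close>, those inside an old
  string for lack of letters; \<open>V\<close> and \<open>Z\<close> remain.\<close>

lemma Delta_X:
  assumes v: "valid (s # t # r)" and sm: "small (s # t # r)"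
  shows "\<Delta> (X s t r) = ex sp r (V s t) \<oplus> ux sp r (Z s t)"
proof (cases "pr s t")
  case False
  then show ?thesis using sm linear_map_zero[OF smod_axioms smod_axioms Delta_linear]
    by (simp add: X_small small_def V_def Z_def ex_zero ux_zero)
next
  case True
  then have qp: "pr t s" using pr_sym by blast
  let ?a = "jn s t" and ?b = "jn t s"
  have Y0: "ex sp r (\<lambda>x r'. ksgn A (bd * sp x) (ksgn A (bd * sp x) (Y x (?a # ?b # r')))) = \<zero>"
  proof (rule ex_zero)
    fix x r' assume m: "mset (x # r') = mset r"
    have "x \<in> set r" by (metis m list.set_intros(1) set_mset_mset)
    then show "ksgn A (bd * sp x) (ksgn A (bd * sp x) (Y x (?a # ?b # r'))) = \<zero>"
      using sm by (simp add: Y_small small_def)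
  qed
  have "D (?a # ?b # r) = X ?a ?b r \<oplus> ex sp r (\<lambda>x r'. ksgn A (bd * sp x) (X ?a x (?b # r'))) \<oplus>
     (ex sp r (\<lambda>x r'. ksgn A (bd * (bd + sp x)) (X ?b x (?a # r'))) \<oplus> ux sp r (\<lambda>x y r'. X x y (?a # ?b # r'))) \<oplus>
     (Y ?a (?b # r) \<oplus> (ksgn A bd (Y ?b (?a # r)) \<oplus> \<zero>))"
    unfolding D_def using Y0 by (simp add: sp_jn[OF True] sp_jn[OF qp] sg_sg)
  also have "\<dots> = (X ?a ?b r \<oplus> Y ?a (?b # r) \<oplus> ksgn A bd (Y ?b (?a # r))) \<oplus>
     ((ex sp r (\<lambda>x r'. ksgn A (bd * sp x) (X ?a x (?b # r'))) \<oplus>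
     ex sp r (\<lambda>x r'. ksgn A (bd * (bd + sp x)) (X ?b x (?a # r')))) \<oplus> ux sp r (\<lambda>x y r'. X x y (?a # ?b # r')))"
    by (simp add: a_ac ex_closed ux_closed)
  also have "\<dots> = (ex sp r (\<lambda>x r'. ksgn A (bd * sp x) (X ?a x (?b # r'))) \<oplus>
     ex sp r (\<lambda>x r'. ksgn A (bd * (bd + sp x)) (X ?b x (?a # r')))) \<oplus> ux sp r (\<lambda>x y r'. X x y (?a # ?b # r'))"
    by (simp only: contract_new[OF v True]) (simp add: ex_closed ux_closed)
  finally have "D (?a # ?b # r) = ex sp r (\<lambda>x r'. ksgn A (bd * sp x) (X ?a x (?b # r')) \<oplus>
     ksgn A (bd * (bd + sp x)) (X ?b x (?a # r'))) \<oplus> ux sp r (\<lambda>x y r'. X x y (?a # ?b # r'))"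
    by (simp add: ex_add)
  moreover have "\<Delta> (X s t r) = ksgn A (bd * sp s) (D (?a # ?b # r))"
    using sm True valid_jn[OF v True]
    by (simp add: X_small small_def linear_map_ksgn[OF smod_axioms smod_axioms Delta_linear] Delta_E)
  moreover have "V s t = (\<lambda>x r'. ksgn A (bd * sp s) (ksgn A (bd * sp x) (X ?a x (?b # r')) \<oplus>
     ksgn A (bd * (bd + sp x)) (X ?b x (?a # r'))))"
    by (intro ext) (simp add: V_def True)
  moreover have "Z s t = (\<lambda>x y r'. ksgn A (bd * sp s) (X x y (?a # ?b # r')))"
    by (intro ext) (simp add: Z_def True)
  ultimately show ?thesis
    by (simp add: ex_sg ux_sg) (simp add: sg_add ex_closed ux_closed)
qed

text \<open>The letter q of x can be contracted only with the p of one of the new strings p q and q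
  p, which gives one term each. Exchanging t and x interchanges the two patterns of labels.\<close>

lemma V_eval:
  assumes "fst s = [p]" "fst t = [q]" "fst x = [q]" "paired p q" plus
  shows "V s t x r = E (([p, q], src s, tgt x) # ([q, p, q], src x, tgt t) # ([q, p], src t, tgt s) # r) \<oplus>
    \<ominus> E (([q, p, q], src t, tgt x) # ([q, p], src x, tgt s) # ([p, q], src s, tgt t) # r)"
proof -
  have al: "al p q = [p, q]" "al q p = [q, p]" and bd: "bd = 1" unfolding al_def bd_def using assms(5) by simp_all
  have qp: "paired q p" using assms(4) paired_sym by blast
  have n: "\<not> paired q q" by (auto simp: paired_def)
  have "parity p = 0 \<or> parity p = 1" by (cases p) simp_all
  then show ?thesis using assms(1-4) qp n
    by (elim disjE) (simp_all add: V_def pr_def jn_def X_def al eps_def bd sp_def wpar_def ksgn_def paired_parity[OF assms(4)] minus_add)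
qed

lemma V_eval_swap:
  assumes v: "valid (s # t # x # r)" and w: "fst s = [p]" "fst t = [q]" "fst x = [q]" "paired p q" and plus
  shows "E (([q, p, q], src t, tgt x) # ([q, p], src x, tgt s) # ([p, q], src s, tgt t) # r) =
    ksgn A (1 + parity p) (E (([p, q], src s, tgt t) # ([q, p, q], src t, tgt x) # ([q, p], src x, tgt s) # r))"
proof -
  have al: "al p q = [p, q]" "al q p = [q, p]" unfolding al_def using \<open>plus\<close> by simp_all
  have pr: "pr s t" using w by (simp add: pr_def)
  have "valid (([q] @ p # [], src t, tgt s) # ([] @ q # [], src x, tgt x) # ([p, q], src s, tgt t) # r)"
    by (rule valid_perm[OF valid_jn[OF v pr]]) (use w in \<open>cases x; simp add: jn_def al add_mset_commute\<close>)
  from valid_contract[OF this w(4)]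
  have "valid ([([q, p, q], src t, tgt x), ([q, p], src x, tgt s)] @ ([p, q], src s, tgt t) # r)" by (simp add: al)
  from E_move[OF this] have "E (([q, p, q], src t, tgt x) # ([q, p], src x, tgt s) # ([p, q], src s, tgt t) # r) =
    ksgn A ((wpar [q, p, q] + wpar [q, p]) * wpar [p, q]) (E (([p, q], src s, tgt t) # ([q, p, q], src t, tgt x) # ([q, p], src x, tgt s) # r))"
    by simp
  moreover have "(wpar [q, p, q] + wpar [q, p]) * wpar [p, q] = 1 + parity p"
    by (cases p) (simp_all add: wpar_def paired_parity[OF w(4)])
  ultimately show ?thesis by simp
qed

lemma V_minus: "\<not> plus \<Longrightarrow> V s t x r = \<zero>"
proof -
  assume n: "\<not> plus"
  have "al p q = []" for p q unfolding al_def using n by simp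
  then show ?thesis by (simp add: V_def X_def jn_def)
qed

text \<open>The two terms of \<open>V_eval\<close> have opposite signs and are interchanged, up to
  the order of the strings, when t and x are. If no letters are inserted, the new strings are empty
  and \<open>V\<close> vanishes.\<close>

lemma V'_swap:
  assumes v: "valid (s # t # x # r)"
  shows "V' s t x r = ksgn A (1 + sp t * sp x) (V' s x t r)"
proof (cases "fst x = fst t \<and> pr s t \<and> plus")
  case True
  then obtain p q where w: "fst s = [p]" "fst t = [q]" "fst x = [q]" "paired p q" by (auto simp: pr_def)
  have v': "valid (s # x # t # r)" by (rule valid_perm[OF v]) (simp add: add_mset_commute)
  have eq: "E (([p, q], src s, tgt x) # ([q, p, q], src x, tgt t) # ([q, p], src t, tgt s) # r) =
    ksgn A (1 + parity p) (E (([q, p, q], src x, tgt t) # ([q, p], src t, tgt s) # ([p, q], src s, tgt x) # r))"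
    using V_eval_swap[OF v' w(1,3,2,4)] True by (simp add: sg_sg)
  have "parity p = 0 \<or> parity p = 1" by (cases p) simp_all
  then show ?thesis
    unfolding V'_def V_eval[OF w, of r, OF True[THEN conjunct2, THEN conjunct2]]
      V_eval[OF w(1,3,2,4), of r, OF True[THEN conjunct2, THEN conjunct2]] V_eval_swap[OF v w True[THEN conjunct2, THEN conjunct2]] eq
    using w by (elim disjE) (simp_all add: sp_def wpar_def paired_parity[OF w(4)] ksgn_def minus_add a_comm)
next
  case False
  then consider "fst x \<noteq> fst t" | "\<not> plus" | "fst x = fst t" "\<not> pr s t" "\<not> pr s x" by (auto simp: pr_def)
  then show ?thesis
  proof cases
    case 2
    from V_minus[OF this] show ?thesis by (simp add: V'_def)
  qed (simp_all add: V'_def V_def)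
qed

text \<open>A letter paired with p or q is one of p and q, so x carries the letter of t or that of
  s. These cases exclude each other and are interchanged by the symmetry of \<open>V\<close> in its
  first two strings.\<close>

lemma V_split:
  assumes "length (fst x) \<le> 1"
  shows "V s t x r = V' s t x r \<oplus> V' t s x r"
proof (cases "pr s t")
  case True
  then obtain p q where w: "fst s = [p]" "fst t = [q]" "paired p q" by (auto simp: pr_def)
  have pr: "pr t s" using True pr_sym by blast
  have sym: "V t s x r = V s t x r"
  proof (cases plus)
    case p: True
    have "bd = 1" unfolding bd_def using p by simp
    then show ?thesis by (simp add: V_def True pr sg_add sg_sg pr_sp[OF True] bit_ring a_comm)
  next
    case False
    from V_minus[OF this] show ?thesis by simp
  qed
  have "V s t x r = \<zero>" if ne: "fst x \<noteq> [p]" "fst x \<noteq> [q]"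
  proof -
    have "\<not> paired p y \<and> \<not> paired q y" if "fst x = [y]" for y
      using w(3) that ne by (auto simp: paired_def)
    then have "X (jn s t) x z = \<zero>" "X (jn t s) x z = \<zero>" for z
      using assms w by (cases "fst x"; auto simp: X_def jn_def al_def)+
    then show ?thesis by (simp add: V_def)
  qed
  moreover have "p \<noteq> q" using w(3) by (auto simp: paired_def)
  ultimately show ?thesis using sym w by (auto simp: V'_def)
next
  case False
  then show ?thesis by (simp add: V'_def V_def pr_sym[of t s])
qed

text \<open>Exchanging t and x shows that the sum of \<open>V'\<close> is its own negative. The
  other half of \<open>V\<close> is reduced to it by exchanging s and t, which costs no sign because
  one of two paired letters is even.\<close>

lemma V_sum:
  assumes two: "(1 + 1 :: 'r) dvd 1" and v: "valid L" and sm: "small L"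
  shows "ex3 sp L V = \<zero>"
proof -
  have 0: "ex3 sp L V' = \<zero>"
  proof (rule self_neg_zero[OF two])
    have "ex3 sp L V' = ex3 sp L (\<lambda>s t x r. ksgn A (sp t * sp x) (V' s x t r))"
      by (intro ex_cong ex_swap2) simp
    also have "\<dots> = ex3 sp L (\<lambda>s t x r. ksgn A 1 (V' s t x r))"
    proof (rule ex3_cong)
      fix s t x r assume "mset (s # t # x # r) = mset L"
      from V'_swap[OF valid_perm[OF v this]]
      show "ksgn A (sp t * sp x) (V' s x t r) = ksgn A 1 (V' s t x r)" by (simp add: sg_sg bit_ring)
    qed
    also have "\<dots> = ksgn A 1 (ex3 sp L V')" by (simp add: ex_sg ex_closed)
    finally show "ex3 sp L V' = ksgn A 1 (ex3 sp L V')" .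
  qed (simp add: ex_closed)
  have "ex3 sp L V = ex3 sp L (\<lambda>s t x r. V' s t x r \<oplus> V' t s x r)"
  proof (rule ex3_cong)
    fix s t x r assume "mset (s # t # x # r) = mset L"
    from small_mset[OF this] sm show "V s t x r = V' s t x r \<oplus> V' t s x r"
      by (intro V_split) (simp add: small_def)
  qed
  also have "\<dots> = ex3 sp L (\<lambda>s t. V' t s)"
    using 0 by (simp add: ex_add ex_closed)
  also have "\<dots> = ex3 sp L (\<lambda>s t x r. ksgn A (sp s * sp t) (V' s t x r))"
    using ex_swap2[of "\<lambda>s t r. ex sp r (V' t s)" sp L] by (simp add: ex_closed ex_sg)
  also have "\<dots> = ex3 sp L V'"
    by (intro ex3_cong) (auto simp: V'_def V_def pr_sp bit_ring)
  finally show ?thesis using 0 by simp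
qed

text \<open>Contracting two disjoint pairs of strings in either order gives the same term, but
  exchanging the pairs costs a sign, since paired strings have odd total parity. So the sum over
  ordered quadruples is its own negative, and it is twice the sum in question.\<close>

lemma Z_sum:
  assumes two: "(1 + 1 :: 'r) dvd 1" and v: "valid L" and sm: "small L"
  shows "ex2 sp L (\<lambda>s t r. ux sp r (Z s t)) = \<zero>"
proof -
  have comm: "Z s t x y r = Z x y s t r" and deg: "Z s t x y r = ksgn A ((sp s + sp t) * (sp x + sp y)) (\<ominus> Z s t x y r)"
    if m: "mset (s # t # x # y # r) = mset L" for s t x y r
  proof -
    let ?c = "jn s t" and ?c' = "jn t s" and ?d = "jn x y" and ?d' = "jn y x"
    have len: "length (fst s) \<le> 1" "length (fst t) \<le> 1" "length (fst x) \<le> 1" "length (fst y) \<le> 1"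
      using small_mset[OF m] sm by (simp_all add: small_def)
    have e: "E (?d # ?d' # ?c # ?c' # r) = E (?c # ?c' # ?d # ?d' # r)" if st: "pr s t" and xy: "pr x y"
    proof -
      have "valid (x # y # ?c # ?c' # r)"
        by (rule valid_perm[OF valid_jn[OF valid_perm[OF v m] st]]) (simp add: add_mset_commute)
      from valid_jn[OF this xy] have v1: "valid (?d # ?d' # ?c # ?c' # r)" .
      have v2: "valid (?c # [?d, ?d'] @ ?c' # r)" by (rule valid_perm[OF v1]) (simp add: add_mset_commute)
      have "pr t s" "pr y x" using st xy pr_sym by blast+
      then show ?thesis
        using E_move[of "[?d, ?d']" ?c "?c' # r"] v1 E_shift[OF v2] by (simp add: sp_jn xy st)
    qed
    show "Z s t x y r = Z x y s t r"
      using e by (simp add: Z_def X_small[OF len(1,2)] X_small[OF len(3,4)] sg_sg add.commute)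
    show "Z s t x y r = ksgn A ((sp s + sp t) * (sp x + sp y)) (\<ominus> Z s t x y r)"
      by (cases "pr s t"; cases "pr x y") (simp_all add: Z_def X_small[OF len(1,2)] X_small[OF len(3,4)] pr_sp ksgn_def)
  qed
  have "ex4 sp L Z = ex4 sp L (\<lambda>s t x y r. ksgn A ((sp s + sp t) * (sp x + sp y)) (Z x y s t r))"
    by (rule ex4_swap) simp
  also have "\<dots> = ex4 sp L (\<lambda>s t x y r. ksgn A 1 (Z s t x y r))"
  proof (rule ex4_cong)
    fix s t x y r assume m: "mset (s # t # x # y # r) = mset L"
    show "ksgn A ((sp s + sp t) * (sp x + sp y)) (Z x y s t r) = ksgn A 1 (Z s t x y r)"
      using arg_cong[OF deg[OF m], of "ksgn A ((sp s + sp t) * (sp x + sp y))"] comm[OF m]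
      by (simp add: sg_sg ksgn_def split: if_splits)
  qed
  also have "\<dots> = ksgn A 1 (ex4 sp L Z)" by (simp add: ex_sg ex_closed)
  finally have z4: "ex4 sp L Z = \<zero>"
    by (rule self_neg_zero[OF two, rotated]) (simp add: ex_closed)
  have "ex4 sp L Z = ex2 sp L (\<lambda>s t r. ux sp r (Z s t) \<oplus> ux sp r (Z s t))"
  proof (rule ex2_cong)
    fix s t r assume m: "mset (s # t # r) = mset L"
    show "ex2 sp r (Z s t) = ux sp r (Z s t) \<oplus> ux sp r (Z s t)"
    proof (rule ex_ex_ux)
      fix x y r' assume m': "mset (x # y # r') = mset r"
      show "Z s t x y r' = ksgn A (sp x * sp y) (Z s t y x r')"
      proof (cases "pr s t")
        case True
        have "valid (s # t # x # y # r')" by (rule valid_perm[OF v]) (use m m' in simp)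
        from valid_jn[OF this True] have "valid (x # y # jn s t # jn t s # r')"
          by (rule valid_perm) (simp add: add_mset_commute)
        from X_sym[OF this] show ?thesis by (simp add: Z_def True sg_sg bit_ring)
      qed (simp add: Z_def)
    qed simp
  qed
  also have "\<dots> = ex2 sp L (\<lambda>s t r. ux sp r (Z s t)) \<oplus> ex2 sp L (\<lambda>s t r. ux sp r (Z s t))"
    by (simp add: ex_add ex_closed ux_closed)
  finally have d: "ex4 sp L Z = ex2 sp L (\<lambda>s t r. ux sp r (Z s t)) \<oplus> ex2 sp L (\<lambda>s t r. ux sp r (Z s t))" .
  show ?thesis
    by (rule double_eq_zero[OF two _ trans[OF sym[OF d] z4]]) (simp add: ex_closed ux_closed)
qed

text \<open>The operator is applied to twice \<open>D L\<close>, because this is the sum over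
  ordered pairs of strings, to which \<open>Delta_X\<close> applies termwise.\<close>

theorem Delta_square_small:
  assumes two: "(1 + 1 :: 'r) dvd 1" and v: "valid L" and sm: "small L"
  shows "\<Delta> (\<Delta> (E L)) = \<zero>"
proof -
  note dz = linear_map_zero[OF smod_axioms smod_axioms Delta_linear]
  note dc = linear_mapsD(1)[OF Delta_linear]
  have Y0: "ex sp L Y = \<zero>"
  proof (rule ex_zero)
    fix x r assume "mset (x # r) = mset L"
    from small_mset[OF this] sm show "Y x r = \<zero>" by (simp add: Y_small small_def)
  qed
  have "D L \<oplus> D L = ex2 sp L X"
    unfolding D_def Y0
    by (subst ex_ex_ux) (use X_sym[OF valid_perm[OF v]] in \<open>auto simp: ux_closed\<close>)
  then have "\<Delta> (D L) \<oplus> \<Delta> (D L) = \<Delta> (ex2 sp L X)"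
    using linear_mapsD(2)[OF Delta_linear, of "D L" "D L"] by simp
  also have "\<dots> = ex2 sp L (\<lambda>s t r. \<Delta> (X s t r))"
    by (simp add: ex_hom[OF Delta_linear] ex_closed)
  also have "\<dots> = ex2 sp L (\<lambda>s t r. ex sp r (V s t) \<oplus> ux sp r (Z s t))"
    by (rule ex2_cong, rule Delta_X) (use small_mset sm valid_perm[OF v] in blast)+
  also have "\<dots> = \<zero>"
    using V_sum[OF assms] Z_sum[OF assms] by (simp add: ex_add ex_closed ux_closed)
  finally have d: "\<Delta> (D L) \<oplus> \<Delta> (D L) = \<zero>" .
  show ?thesis
    unfolding Delta_E[OF v] by (rule double_eq_zero[OF two _ d]) (rule dc, simp)
qed

section \<open>Reduction to strings of length at most one\<close>

lemma fresh_index: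
  obtains n where "\<And>x. (n, x) \<notin> src ` set L"
proof -
  obtain n where "n \<notin> fst ` src ` set L"
    using ex_new_if_finite[of "fst ` src ` set L"] infinite_UNIV_nat by auto
  then show ?thesis by (intro that[of n]) force
qed

lemma valid_split:
  assumes v: "valid ((u @ v, i, k) # L)" and u: "walk (snd i) u x" and vw: "walk x v (snd k)"
    and n: "(n, x) \<notin> src ` set ((u @ v, i, k) # L)"
  shows "valid ((u, i, (n, x)) # (v, (n, x), k) # L)"
proof -
  have "(n, x) \<notin> tgt ` set ((u @ v, i, k) # L)" using v n by (simp add: valid_def)
  then show ?thesis using v n u vw unfolding valid_def by auto
qed

text \<open>Cutting the strings at fresh points reduces the general case to strings of length at most one.\<close>

lemma small_representative:
  "valid L \<Longrightarrow> \<exists>L'. valid L' \<and> small L' \<and> E L' = E L"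
proof (induction "\<Sum>s\<leftarrow>L. length (fst s) - 1" arbitrary: L rule: less_induct)
  case less
  show ?case
  proof (cases "small L")
    case False
    then obtain s where s: "s \<in> set L" "\<not> length (fst s) \<le> 1" by (auto simp: small_def)
    obtain w0 i k where s0: "s = (w0, i, k)" by (cases s)
    then obtain p w where "w0 = p # w" and w: "w \<noteq> []" using s(2) by (cases w0) auto
    then have sw: "s = (p # w, i, k)" using s0 by simp
    obtain L1 L2 where L: "L = L1 @ s # L2" using s(1) by (auto dest: split_list)
    obtain n where n: "\<And>x. (n, x) \<notin> src ` set L" by (rule fresh_index) blast
    have v1: "valid (([p] @ w, i, k) # L1 @ L2)"
      by (rule valid_perm[OF less.prems]) (simp add: L sw)
    then have pw: "walk (snd i) [p] (hd_of p)" "walk (hd_of p) w (snd k)"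
      by (auto simp: valid_def D.awalk_Cons_iff D.awalk_Nil_iff)
    let ?j = "(n, hd_of p)" and ?L = "L1 @ ([p], i, (n, hd_of p)) # (w, (n, hd_of p), k) # L2"
    have "valid (([p], i, ?j) # (w, ?j, k) # L1 @ L2)"
      by (rule valid_split[OF v1 pw]) (use n[of "hd_of p"] in \<open>auto simp: L sw\<close>)
    then have v2: "valid ?L" by (rule valid_perm) simp
    \<comment> \<open>Cutting off the first letter creates a string that contributes 0 to the
      measure and lowers the contribution of the rest by one.\<close>
    have "(\<Sum>s\<leftarrow>?L. length (fst s) - 1) < (\<Sum>s\<leftarrow>L. length (fst s) - 1)"
      using w by (cases w) (simp_all add: L sw)
    from less.hyps[OF this v2] show ?thesis using E_merge[OF v2] by (simp add: L sw)
  qed (use less.prems in blast)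
qed

theorem Delta_square_E:
  assumes "(1 + 1 :: 'r) dvd 1" "valid L"
  shows "\<Delta> (\<Delta> (E L)) = \<zero>"
proof -
  obtain L' where L': "valid L'" "small L'" "E L' = E L" using small_representative[OF assms(2)] by blast
  show ?thesis using Delta_square_small[OF assms(1) L'(1,2)] by (simp only: L'(3))
qed

text \<open>Each closed walk becomes a string whose two ends carry the same fresh label, so that it
  is evaluated as a factor of its own.\<close>

lemma Delta_square_cl:
  assumes two: "(1 + 1 :: 'r) dvd 1" and w: "\<forall>(i, w)\<in>set ws. walk i w i"
  shows "\<Delta> (\<Delta> (foldr (\<lambda>(i, w) z. cl i w \<otimes> z) ws \<one>)) = \<zero>"
proof -
  have "\<exists>L. valid L \<and> E L = foldr (\<lambda>(i, w) z. cl i w \<otimes> z) ws \<one>"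
    using w
  proof (induction ws)
    case Nil
    then show ?case by (intro exI[of _ "[]"]) (simp add: valid_def)
  next
    case (Cons iw ws)
    obtain i w where iw: "iw = (i, w)" by (cases iw)
    from Cons obtain L where L: "valid L" "E L = foldr (\<lambda>(i, w) z. cl i w \<otimes> z) ws \<one>" by auto
    obtain n where n: "\<And>x. (n, x) \<notin> src ` set L" by (rule fresh_index) blast
    have "(n, i) \<notin> tgt ` set L" using L(1) n[of i] by (simp add: valid_def)
    then have "valid ((w, (n, i), (n, i)) # L)"
      using L(1) Cons.prems n[of i] by (auto simp: iw valid_def)
    then show ?case using L(2) by (intro exI[of _ "(w, (n, i), (n, i)) # L"]) (simp add: E_closed_string iw)
  qed
  then obtain L where L: "valid L" "E L = foldr (\<lambda>(i, w) z. cl i w \<otimes> z) ws \<one>" by blast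
  show ?thesis using Delta_square_E[OF two L(1)] by (simp only: L(2))
qed

end

section \<open>Cyclic words\<close>

lemma free_on_finsum:
  assumes "free_on P X" "finite S" "\<And>x. x \<in> S \<Longrightarrow> F x \<in> carrier P"
  shows "finsum P F S = sum F S"
  using assms(2,3)
proof (induction S rule: finite_induct)
  case empty
  interpret smod P by (rule free_on_smod[OF assms(1)])
  show ?case by (simp add: free_onD[OF assms(1)])
next
  case (insert x S)
  interpret smod P by (rule free_on_smod[OF assms(1)])
  have "finsum P F (insert x S) = F x \<oplus>\<^bsub>P\<^esub> finsum P F S"
    by (rule finsum_insert) (use insert in auto)
  then show ?case using insert by (simp add: free_onD[OF assms(1)])
qed

lemma lift_free:
  assumes "free_on P X" "Poly_Mapping.keys f \<subseteq> Y" "\<And>x. x \<in> Y \<Longrightarrow> F x \<in> carrier P"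
  shows "lift P F f = (\<Sum>x\<in>Poly_Mapping.keys f. scal (Poly_Mapping.lookup f x) (F x))"
proof -
  interpret smod P by (rule free_on_smod[OF assms(1)])
  have "finsum P (\<lambda>x. Poly_Mapping.lookup f x \<odot>\<^bsub>P\<^esub> F x) (Poly_Mapping.keys f) = (\<Sum>x\<in>Poly_Mapping.keys f. Poly_Mapping.lookup f x \<odot>\<^bsub>P\<^esub> F x)"
    by (rule free_on_finsum[OF assms(1)]) (use assms(2) in \<open>auto intro!: sm_closed assms(3)\<close>)
  then show ?thesis by (simp only: lift_def free_onD(4)[OF assms(1)])
qed

lemma keys_sum_subset:
  "(\<And>x. x \<in> S \<Longrightarrow> Poly_Mapping.keys (F x) \<subseteq> X) \<Longrightarrow> Poly_Mapping.keys (sum F S) \<subseteq> X"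
  by (induction S rule: infinite_finite_induct) (simp_all add: keys_add_subset)

text \<open>The type of \<open>Q\<close> does not mention the coefficients; the parameter
  \<open>M\<close>, equal to \<open>N_gr Q\<close>, fixes their type throughout.\<close>

locale quiver =
  fixes Q :: "('v, 'e) pre_digraph" and M :: "('r :: {comm_ring, comm_monoid_mult}, ('r, 'v, 'e) cyc) supermod"
  assumes fin: "fin_digraph Q" and two: "(1 + 1 :: 'r) dvd 1" and N: "M = N_gr Q"
begin

lemma wf_double: "wf_digraph (double Q)"
proof -
  interpret fin_digraph Q by (rule fin)
  show ?thesis by unfold_locales (auto simp: double_def)
qed

interpretation D: wf_digraph "double Q" by (rule wf_double)

abbreviation P :: "('r, ('v, 'e) qpath \<Rightarrow>\<^sub>0 'r) supermod" where "P \<equiv> path_alg Q"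
abbreviation H :: "(('v, 'e) qpath \<Rightarrow>\<^sub>0 'r) set" where "H \<equiv> mspan P (graded_commutators P)"
abbreviation proj :: "(('v, 'e) qpath \<Rightarrow>\<^sub>0 'r) \<Rightarrow> ('r, 'v, 'e) cyc" where "proj x \<equiv> H +>\<^bsub>P\<^esub> x"
abbreviation walk :: "'v \<Rightarrow> 'e darrow list \<Rightarrow> 'v \<Rightarrow> bool" where "walk \<equiv> pre_digraph.awalk (double Q)"

lemma P_free: "free_on P (paths Q)"
  by (simp add: free_on_def path_alg_def)

lemmas P_simps = free_onD[OF P_free]

interpretation P: smod P by (rule free_on_smod[OF P_free])

lemma grade_P: "grade P p = {f. Poly_Mapping.keys f \<subseteq> {x \<in> paths Q. wpar (snd x) = p}}"
  by (simp add: path_alg_def)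

lemma grade_P_submodule: "submodule (grade P p) scalars P"
  unfolding grade_P by (rule P.submodI) (auto simp only: mem_Collect_eq P_simps keys_add_subset keys_scal_subset keys_zero)

lemma grade_P_carrier: "f \<in> grade P p \<Longrightarrow> f \<in> carrier P"
  using P.submodD(1)[OF grade_P_submodule] by blast

lemma mono_P: "x \<in> paths Q \<Longrightarrow> mono x \<in> carrier P" "x \<in> paths Q \<Longrightarrow> mono x \<in> grade P (wpar (snd x))"
  by (auto simp: P_simps grade_P)

text \<open>Products of basis elements of the path algebra.\<close>

definition pm :: "('v, 'e) qpath \<Rightarrow> ('v, 'e) qpath \<Rightarrow> ('v, 'e) qpath \<Rightarrow>\<^sub>0 'r" where
  "pm x y = (if pre_digraph.awlast (double Q) (fst x) (snd x) = fst y then mono (fst x, snd x @ snd y) else 0)"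

lemma pm_walk: "walk u p v \<Longrightarrow> pm (u, p) (v', q) = (if v = v' then mono (u, p @ q) else 0)"
  by (auto simp: pm_def)

lemma pm_grade:
  assumes "x \<in> paths Q" "y \<in> paths Q" shows "pm x y \<in> grade P (wpar (snd x) + wpar (snd y))"
proof -
  obtain u p u' v q v' where xy: "x = (u, p)" "y = (v, q)" "walk u p u'" "walk v q v'"
    using assms by (cases x; cases y) (auto simp: paths_def)
  then have "u' = v \<Longrightarrow> walk u (p @ q) v'" by (simp only: D.awalk_appendI)
  then show ?thesis using xy by (auto simp: pm_walk grade_P paths_def simp del: D.awalk_append_iff)
qed

lemma pm_closed: "\<lbrakk>x \<in> paths Q; y \<in> paths Q\<rbrakk> \<Longrightarrow> pm x y \<in> carrier P"
  by (rule grade_P_carrier[OF pm_grade])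

lemma path_mult_sum: "path_mult Q f g =
    (\<Sum>x\<in>Poly_Mapping.keys f. \<Sum>y\<in>Poly_Mapping.keys g. scal (Poly_Mapping.lookup f x * Poly_Mapping.lookup g y) (pm x y))"
proof -
  have "scal c (if a then mono z else 0) = (if a then Poly_Mapping.single z c else 0)" for a and z :: "('v, 'e) qpath" and c :: 'r
    by (cases a) (simp_all add: scal_mono poly_mapping_eq_iff fun_eq_iff)
  then show ?thesis
    by (simp add: path_mult_def pm_def case_prod_beta cong: if_cong)
qed

text \<open>The defining double sum over supports is read as an iterated linear extension, in either
  order. Linearity in each argument then follows from \<open>lift_linear\<close>.\<close>

lemma path_mult_eq:
  assumes f: "f \<in> carrier P" and g: "g \<in> carrier P"
  shows "path_mult Q f g = lift P (\<lambda>x. lift P (pm x) g) f" "path_mult Q f g = lift P (\<lambda>y. lift P (\<lambda>x. pm x y) f) g"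
proof -
  have fg: "Poly_Mapping.keys f \<subseteq> paths Q" "Poly_Mapping.keys g \<subseteq> paths Q" using f g by (simp_all add: P_simps)
  have ss: "scal a (sum F S) = (\<Sum>x\<in>S. scal a (F x))" for a :: 'r and F :: "('v, 'e) qpath \<Rightarrow> ('v, 'e) qpath \<Rightarrow>\<^sub>0 'r" and S
    by (rule poly_mapping_eqI) (simp add: lookup_sum sum_distrib_left)
  have s: "scal a (scal b h) = scal (a * b) h" for a b :: 'r and h :: "('v, 'e) qpath \<Rightarrow>\<^sub>0 'r"
    by (rule poly_mapping_eqI) (simp add: mult.assoc)
  have lx: "lift P (pm x) g = (\<Sum>y\<in>Poly_Mapping.keys g. scal (Poly_Mapping.lookup g y) (pm x y))" if "x \<in> paths Q" for x
    by (rule lift_free[OF P_free fg(2)]) (simp add: pm_closed that)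
  have ly: "lift P (\<lambda>x. pm x y) f = (\<Sum>x\<in>Poly_Mapping.keys f. scal (Poly_Mapping.lookup f x) (pm x y))" if "y \<in> paths Q" for y
    by (rule lift_free[OF P_free fg(1)]) (simp add: pm_closed that)
  have cl: "lift P (pm x) g \<in> carrier P" if "x \<in> paths Q" for x
    by (rule linear_mapsD(1)[OF P.lift_linear[OF P_free] g]) (simp add: pm_closed that)
  have cl': "lift P (\<lambda>x. pm x y) f \<in> carrier P" if "y \<in> paths Q" for y
    by (rule linear_mapsD(1)[OF P.lift_linear[OF P_free] f]) (simp add: pm_closed that)
  show "path_mult Q f g = lift P (\<lambda>x. lift P (pm x) g) f"
    unfolding path_mult_sum
    by (subst lift_free[OF P_free fg(1)], rule cl, assumption, rule sum.cong) (use fg(1) in \<open>auto simp: lx ss s subset_iff\<close>)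
  show "path_mult Q f g = lift P (\<lambda>y. lift P (\<lambda>x. pm x y) f) g"
    unfolding path_mult_sum
    by (subst sum.swap, subst lift_free[OF P_free fg(2)], rule cl', assumption, rule sum.cong) (use fg(2) in \<open>auto simp: ly ss s subset_iff mult.commute\<close>)
qed

lemma path_mult_linear:
  assumes "g \<in> carrier P"
  shows "(\<lambda>f. path_mult Q f g) \<in> linear_maps P P" "(\<lambda>f. path_mult Q g f) \<in> linear_maps P P"
proof -
  have "lift P (\<lambda>x. lift P (pm x) g) \<in> linear_maps P P"
    by (rule P.lift_linear[OF P_free], rule linear_mapsD(1)[OF P.lift_linear[OF P_free] assms]) (simp add: pm_closed)
  then show "(\<lambda>f. path_mult Q f g) \<in> linear_maps P P"
    by (rule linear_maps_cong[OF P.smod_axioms, rotated]) (simp add: path_mult_eq(1) assms)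
  have "lift P (\<lambda>y. lift P (\<lambda>x. pm x y) g) \<in> linear_maps P P"
    by (rule P.lift_linear[OF P_free], rule linear_mapsD(1)[OF P.lift_linear[OF P_free] assms]) (simp add: pm_closed)
  then show "(\<lambda>f. path_mult Q g f) \<in> linear_maps P P"
    by (rule linear_maps_cong[OF P.smod_axioms, rotated]) (simp add: path_mult_eq(2) assms)
qed

lemma path_mult_mono: "\<lbrakk>x \<in> paths Q; y \<in> paths Q\<rbrakk> \<Longrightarrow> path_mult Q (mono x) (mono y) = pm x y"
  by (simp add: path_mult_eq mono_P P.lift_single pm_closed)

text \<open>Both sides are linear in f and in g, so the relation is checked on paths of the given
  parities.\<close>

lemma commutator_eq:
  assumes B: "smod B" and F: "F \<in> linear_maps P B"
    and rot: "\<And>x y. \<lbrakk>x \<in> paths Q; y \<in> paths Q\<rbrakk> \<Longrightarrow> F (pm x y) = ksgn B (wpar (snd x) * wpar (snd y)) (F (pm y x))"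
    and f: "f \<in> grade P p" and g: "g \<in> grade P q"
  shows "F (path_mult Q f g) = ksgn B (p * q) (F (path_mult Q g f))"
proof -
  interpret B: smod B by (rule B)
  let ?X = "\<lambda>p. {x \<in> paths Q. wpar (snd x) = p}"
  have 1: "F (path_mult Q (mono x) g) = ksgn B (p * q) (F (path_mult Q g (mono x)))" if x: "x \<in> ?X p" for x
  proof (rule free_ext[OF P_free B, where f = "\<lambda>g. F (path_mult Q (mono x) g)" and Y = "?X q"])
    have c: "mono x \<in> carrier P" using x by (simp add: mono_P)
    show "(\<lambda>g. F (path_mult Q (mono x) g)) \<in> linear_maps P B"
      by (rule linear_map_comp[OF path_mult_linear(2)[OF c] F])
    show "(\<lambda>g. ksgn B (p * q) (F (path_mult Q g (mono x)))) \<in> linear_maps P B"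
      by (rule linear_maps_ksgn[OF B linear_map_comp[OF path_mult_linear(1)[OF c] F]])
    show "F (path_mult Q (mono x) (mono y)) = ksgn B (p * q) (F (path_mult Q (mono y) (mono x)))" if "y \<in> ?X q" for y
      using x that rot[of x y] by (simp add: path_mult_mono)
    show "?X q \<subseteq> paths Q" by auto
    show "Poly_Mapping.keys g \<subseteq> ?X q" using g by (simp add: grade_P)
  qed
  show ?thesis
  proof (rule free_ext[OF P_free B, where f = "\<lambda>f. F (path_mult Q f g)" and Y = "?X p"])
    have c: "g \<in> carrier P" by (rule grade_P_carrier[OF g])
    show "(\<lambda>f. F (path_mult Q f g)) \<in> linear_maps P B"
      by (rule linear_map_comp[OF path_mult_linear(1)[OF c] F])
    show "(\<lambda>f. ksgn B (p * q) (F (path_mult Q g f))) \<in> linear_maps P B"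
      by (rule linear_maps_ksgn[OF B linear_map_comp[OF path_mult_linear(2)[OF c] F]])
    show "F (path_mult Q (mono x) g) = ksgn B (p * q) (F (path_mult Q g (mono x)))" if "x \<in> ?X p" for x
      by (rule 1[OF that])
    show "?X p \<subseteq> paths Q" by auto
    show "Poly_Mapping.keys f \<subseteq> ?X p" using f by (simp add: grade_P)
  qed
qed

lemma mult_P: "f \<otimes>\<^bsub>P\<^esub> g = path_mult Q f g"
  by (simp add: path_alg_def)

lemma path_mult_grade:
  assumes f: "f \<in> grade P p" and g: "g \<in> grade P q"
  shows "path_mult Q f g \<in> grade P (p + q)"
proof -
  have "Poly_Mapping.keys (pm x y) \<subseteq> {x \<in> paths Q. wpar (snd x) = p + q}"
    if "x \<in> Poly_Mapping.keys f" "y \<in> Poly_Mapping.keys g" for x y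
    using pm_grade[of x y] that f g by (auto simp: grade_P)
  then show ?thesis
    unfolding path_mult_sum grade_P mem_Collect_eq by (intro keys_sum_subset keys_scal_subset)
qed

lemma commutators_closed: "graded_commutators P \<subseteq> carrier P"
  unfolding graded_commutators_def mult_P
  by (auto intro!: P.minus_closed P.sg_closed grade_P_carrier[OF path_mult_grade])

lemma H_submodule: "submodule H scalars P"
  by (rule P.mspan_submodule[OF commutators_closed])

lemma M_quot: "M = quot P H"
  by (simp add: N N_gr_def)

lemma proj_linear: "proj \<in> linear_maps P M"
  unfolding M_quot by (rule P.quot_proj[OF H_submodule])

lemma M_smod: "smod M"
  unfolding M_quot by (rule P.quot_smod[OF H_submodule])

interpretation M: smod M by (rule M_smod)

lemma proj_commutator:
  assumes "f \<in> grade P p" "g \<in> grade P q"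
  shows "proj (path_mult Q f g) = ksgn M (p * q) (proj (path_mult Q g f))"
proof -
  have c: "path_mult Q f g \<in> carrier P" "path_mult Q g f \<in> carrier P"
    by (rule grade_P_carrier, rule path_mult_grade, rule assms, rule assms)+
  have "path_mult Q f g \<ominus>\<^bsub>P\<^esub> ksgn P (p * q) (path_mult Q g f) \<in> H"
    using P.mspan_incl[of "graded_commutators P"] assms unfolding graded_commutators_def mult_P by blast
  then have "proj (path_mult Q f g) = proj (ksgn P (p * q) (path_mult Q g f))"
    using P.quot_eq_iff[OF H_submodule] c by simp
  then show ?thesis using linear_map_ksgn[OF P.smod_axioms M_smod proj_linear c(2)] by simp
qed

lemma kills_H:
  assumes B: "smod B" and F: "F \<in> linear_maps P B"
    and rot: "\<And>f g p q. \<lbrakk>f \<in> grade P p; g \<in> grade P q\<rbrakk> \<Longrightarrow> F (path_mult Q f g) = ksgn B (p * q) (F (path_mult Q g f))"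
    and x: "x \<in> H"
  shows "F x = \<zero>\<^bsub>B\<^esub>"
proof -
  interpret B: smod B by (rule B)
  have "H \<subseteq> {x \<in> carrier P. F x = \<zero>\<^bsub>B\<^esub>}"
  proof (rule P.mspan_minimal[OF linear_map_kernel[OF P.smod_axioms B F]], rule subsetI)
    fix z assume z: "z \<in> graded_commutators P"
    then obtain f g p q where fg: "f \<in> grade P p" "g \<in> grade P q" and z': "z = path_mult Q f g \<ominus>\<^bsub>P\<^esub> ksgn P (p * q) (path_mult Q g f)"
      unfolding graded_commutators_def mult_P by blast
    have c: "path_mult Q f g \<in> carrier P" "path_mult Q g f \<in> carrier P"
      by (rule grade_P_carrier, rule path_mult_grade, rule fg, rule fg)+
    have "F z = F (path_mult Q f g) \<ominus>\<^bsub>B\<^esub> ksgn B (p * q) (F (path_mult Q g f))"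
      using c by (simp add: z' linear_map_minus[OF P.smod_axioms B F] linear_map_ksgn[OF P.smod_axioms B F])
    also have "\<dots> = \<zero>\<^bsub>B\<^esub>"
      using rot[OF fg] linear_mapsD(1)[OF F c(1)] linear_mapsD(1)[OF F c(2)] by (simp add: B.minus_eq_zero_iff)
    finally show "z \<in> {x \<in> carrier P. F x = \<zero>\<^bsub>B\<^esub>}" using z commutators_closed by auto
  qed
  then show ?thesis using x by auto
qed

text \<open>The parity involution of the path algebra multiplies each path by its sign. Both
  products in a graded commutator have the same parity, so the relation survives the involution
  followed by the projection.\<close>

theorem M_supermodule: "supermodule M"
proof -
  let ?t = "lift P (\<lambda>x. ksgn P (wpar (snd x)) (mono x))"
  have t: "?t \<in> linear_maps P P"
    by (rule P.lift_linear[OF P_free]) (simp add: mono_P)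
  have tg: "?t f = ksgn P p f" if "f \<in> grade P p" for f p
  proof (rule free_ext[OF P_free P.smod_axioms t P.ksgn_linear, where Y = "{x \<in> paths Q. wpar (snd x) = p}"])
    show "Poly_Mapping.keys f \<subseteq> {x \<in> paths Q. wpar (snd x) = p}" using that by (simp add: grade_P)
  qed (auto simp: P.lift_single mono_P)
  have S: "(\<lambda>x. proj (?t x)) \<in> linear_maps P M" by (rule linear_map_comp[OF t proj_linear])
  have Sg: "proj (?t x) = ksgn M p (proj x)" if "x \<in> grade P p" for p x
    using that grade_P_carrier by (simp add: tg linear_map_ksgn[OF P.smod_axioms M_smod proj_linear])
  show ?thesis
    unfolding M_quot
  proof (rule P.quot_supermodule[OF two H_submodule grade_P_submodule, where S = "\<lambda>x. proj (?t x)"], unfold M_quot[symmetric])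
    show "proj (?t x) = \<zero>\<^bsub>M\<^esub>" if "x \<in> H" for x
    proof (rule kills_H[OF M_smod S _ that])
      fix f g p q assume fg: "f \<in> grade P p" "g \<in> grade P q"
      have gf: "path_mult Q g f \<in> grade P (p + q)" using path_mult_grade[OF fg(2,1)] by (simp add: add.commute)
      show "proj (?t (path_mult Q f g)) = ksgn M (p * q) (proj (?t (path_mult Q g f)))"
        unfolding Sg[OF path_mult_grade[OF fg]] Sg[OF gf] proj_commutator[OF fg]
        using linear_mapsD(1)[OF proj_linear grade_P_carrier[OF gf]] by (simp add: M.sg_sg add.commute)
    qed
    show "\<exists>a\<in>grade P 0. \<exists>b\<in>grade P 1. proj x = proj (a \<oplus>\<^bsub>P\<^esub> b)" if "x \<in> carrier P" for x
    proof -
      have "Poly_Mapping.keys x \<subseteq> paths Q" using that by (simp add: P_simps)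
      then have "\<exists>a\<in>grade P 0. \<exists>b\<in>grade P 1. x = a \<oplus>\<^bsub>P\<^esub> b"
      proof (induction x rule: free_induct)
        case zero
        show ?case by (intro bexI[of _ 0]) (simp_all add: P_simps grade_P)
      next
        case (single x r)
        have "wpar (snd x) = 0 \<or> wpar (snd x) = 1" by (cases "wpar (snd x)") simp_all
        then have "Poly_Mapping.single x r \<in> grade P 0 \<or> Poly_Mapping.single x r \<in> grade P 1"
          using single by (auto simp: grade_P)
        moreover have "0 \<in> grade P p" for p by (simp add: grade_P)
        ultimately show ?case by (auto simp: P_simps intro: bexI[of _ 0] bexI[of _ "Poly_Mapping.single x r"])
      next
        case (add f g)
        then obtain a b a' b' where ab: "a \<in> grade P 0" "b \<in> grade P 1" "a' \<in> grade P 0" "b' \<in> grade P 1" "f = a + b" "g = a' + b'"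
          by (auto simp: P_simps)
        have "a + a' \<in> grade P 0" "b + b' \<in> grade P 1"
          using P.submodD(3)[OF grade_P_submodule] ab by (simp_all add: P_simps)
        then show ?case
          by (intro bexI[of _ "a + a'"] bexI[of _ "b + b'"]) (simp_all add: P_simps ab add_ac)
      qed
      then show ?thesis by blast
    qed
  qed (use S Sg in auto)
qed

lemma M_supermodule2: "supermodule2 M"
  by (intro supermodule2.intro supermodule2_axioms.intro M_supermodule two)

interpretation M: supermodule2 M by (rule M_supermodule2)

abbreviation "cyc \<equiv> cyc_class Q"

lemma cyc_proj: "cyc x = proj (mono x)"
  by (simp add: cyc_class_def)

lemma grade_M: "grade M p = proj ` grade P p"
  by (simp add: M_quot quot_def)

lemma cyc_grade: "x \<in> paths Q \<Longrightarrow> cyc x \<in> grade M (wpar (snd x))"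
  by (auto simp: grade_M cyc_proj mono_P)

lemma cyc_closed: "x \<in> paths Q \<Longrightarrow> cyc x \<in> carrier M"
  by (rule M.grade_carrier[OF cyc_grade])

lemma closed_paths_paths: "closed_paths Q \<subseteq> paths Q"
  by (auto simp: closed_paths_def paths_def)

lemma proj_pm: "\<lbrakk>x \<in> paths Q; y \<in> paths Q\<rbrakk> \<Longrightarrow> proj (pm x y) = ksgn M (wpar (snd x) * wpar (snd y)) (proj (pm y x))"
  using proj_commutator[OF mono_P(2) mono_P(2), of x y] by (simp add: path_mult_mono)

lemma cyc_rotate:
  assumes "walk u p v" "walk v q u"
  shows "cyc (u, p @ q) = ksgn M (wpar p * wpar q) (cyc (v, q @ p))"
  using proj_pm[of "(u, p)" "(v, q)"] assms by (auto simp: paths_def pm_walk cyc_proj)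

text \<open>A path from u to v is its own product with the constant path at v; in the other order
  this product is zero, as u and v differ.\<close>

lemma cyc_open:
  assumes "x \<in> paths Q" "x \<notin> closed_paths Q"
  shows "cyc x = \<zero>\<^bsub>M\<^esub>"
proof -
  obtain u p v where x: "x = (u, p)" "walk u p v" "u \<noteq> v"
    using assms by (cases x) (auto simp: paths_def closed_paths_def)
  have v: "walk v [] v" using x by (auto simp: D.awalk_Nil_iff)
  have "proj (pm x (v, [])) = ksgn M 0 (proj (pm (v, []) x))"
    using proj_pm[of x "(v, [])"] x v assms by (auto simp: paths_def)
  then show ?thesis
    using x pm_walk[OF v] pm_walk[OF x(2)] linear_map_zero[OF P.smod_axioms M_smod proj_linear]
    by (simp add: cyc_proj P_simps)
qed

text \<open>The common core of the two induction rules below, with \<open>X\<close> the set of all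
  paths or of those of one parity. Open paths drop out by \<open>cyc_open\<close>.\<close>

lemma cyc_induct_aux:
  assumes "X \<subseteq> paths Q" "Poly_Mapping.keys f \<subseteq> X" "K \<zero>\<^bsub>M\<^esub>"
    and "\<And>r c. c \<in> closed_paths Q \<inter> X \<Longrightarrow> K (r \<odot>\<^bsub>M\<^esub> cyc c)"
    and "\<And>x y. \<lbrakk>x \<in> carrier M; y \<in> carrier M; K x; K y\<rbrakk> \<Longrightarrow> K (x \<oplus>\<^bsub>M\<^esub> y)"
  shows "K (proj f)"
  using assms(2)
proof (induction f rule: free_induct)
  case zero
  then show ?case using assms(3) linear_map_zero[OF P.smod_axioms M_smod proj_linear] by (simp add: P_simps)
next
  case (single x r)
  have "proj (Poly_Mapping.single x r) = r \<odot>\<^bsub>M\<^esub> cyc x"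
    using linear_mapsD(3)[OF proj_linear, of "mono x" r] single assms(1) by (auto simp: cyc_proj mono_P P_simps scal_mono)
  then show ?case using assms(1,3,4) single cyc_open[of x] by (cases "x \<in> closed_paths Q") auto
next
  case (add f g)
  then have "f \<in> carrier P" "g \<in> carrier P" using assms(1) by (auto simp: P_simps)
  then show ?case using assms(5)[of "proj f" "proj g"] add linear_mapsD(1,2)[OF proj_linear] by (simp add: P_simps)
qed

lemma cyc_induct [consumes 1, case_names zero smult add]:
  assumes "x \<in> carrier M" "K \<zero>\<^bsub>M\<^esub>" "\<And>r c. c \<in> closed_paths Q \<Longrightarrow> K (r \<odot>\<^bsub>M\<^esub> cyc c)"
    and "\<And>x y. \<lbrakk>x \<in> carrier M; y \<in> carrier M; K x; K y\<rbrakk> \<Longrightarrow> K (x \<oplus>\<^bsub>M\<^esub> y)"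
  shows "K x"
proof -
  obtain f where "x = proj f" "f \<in> carrier P"
    using assms(1) P.quot_carrier[OF H_submodule] by (auto simp: M_quot)
  then show ?thesis using cyc_induct_aux[of "paths Q" f K] assms(2-4) by (auto simp: P_simps)
qed

lemma cyc_grade_induct [consumes 1, case_names zero smult add]:
  assumes "x \<in> grade M p" "K \<zero>\<^bsub>M\<^esub>" "\<And>r c. \<lbrakk>c \<in> closed_paths Q; wpar (snd c) = p\<rbrakk> \<Longrightarrow> K (r \<odot>\<^bsub>M\<^esub> cyc c)"
    and "\<And>x y. \<lbrakk>x \<in> carrier M; y \<in> carrier M; K x; K y\<rbrakk> \<Longrightarrow> K (x \<oplus>\<^bsub>M\<^esub> y)"
  shows "K x"
proof -
  obtain f where "x = proj f" "f \<in> grade P p" using assms(1) by (auto simp: grade_M)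
  then show ?thesis using cyc_induct_aux[of "{x \<in> paths Q. wpar (snd x) = p}" f K] assms(2-4) by (auto simp: grade_P)
qed

lemma cyc_ext:
  assumes "smod B" "f \<in> linear_maps M B" "g \<in> linear_maps M B" "\<And>c. c \<in> closed_paths Q \<Longrightarrow> f (cyc c) = g (cyc c)"
    and "x \<in> carrier M"
  shows "f x = g x"
  using assms(5)
proof (induction x rule: cyc_induct)
  case zero
  then show ?case using linear_map_zero[OF M_smod assms(1,2)] linear_map_zero[OF M_smod assms(1,3)] by simp
next
  case (smult r c)
  then have "cyc c \<in> carrier M" using cyc_closed closed_paths_paths by blast
  then show ?case using linear_mapsD(3)[OF assms(2)] linear_mapsD(3)[OF assms(3)] assms(4)[OF smult] by simp
next
  case (add x y)
  then show ?case using linear_mapsD(2)[OF assms(2)] linear_mapsD(2)[OF assms(3)] by simp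
qed

text \<open>Extended by zero to open paths, \<phi> becomes a function on the basis of the path
  algebra. If only one of the two products in a commutator of paths is nonzero, this product is an
  open path, so both sides vanish.\<close>

theorem cyc_universal:
  assumes B: "smod B" and c: "\<And>x. x \<in> closed_paths Q \<Longrightarrow> \<phi> x \<in> carrier B"
    and rot: "\<And>u p v q. \<lbrakk>walk u p v; walk v q u\<rbrakk> \<Longrightarrow> \<phi> (u, p @ q) = ksgn B (wpar p * wpar q) (\<phi> (v, q @ p))"
  obtains L where "L \<in> linear_maps M B" "\<And>x. x \<in> closed_paths Q \<Longrightarrow> L (cyc x) = \<phi> x"
proof -
  interpret B: smod B by (rule B)
  define \<psi> where "\<psi> x = (if x \<in> closed_paths Q then \<phi> x else \<zero>\<^bsub>B\<^esub>)" for x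
  have pc: "\<psi> x \<in> carrier B" for x using c by (simp add: \<psi>_def)
  have F: "lift B \<psi> \<in> linear_maps P B" by (rule B.lift_linear[OF P_free pc])
  have F1: "lift B \<psi> (mono x) = \<psi> x" for x by (simp add: B.lift_single pc)
  have F0: "lift B \<psi> 0 = \<zero>\<^bsub>B\<^esub>" by (simp add: lift_def)
  have r: "lift B \<psi> (pm x y) = ksgn B (wpar (snd x) * wpar (snd y)) (lift B \<psi> (pm y x))" if xyp: "x \<in> paths Q" "y \<in> paths Q" for x y
  proof -
    obtain u p u' v q v' where xy: "x = (u, p)" "y = (v, q)" "walk u p u'" "walk v q v'"
      using xyp by (cases x; cases y) (auto simp: paths_def)
    have cl: "(u, p @ q) \<in> closed_paths Q \<longleftrightarrow> v' = u" if "u' = v"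
      using D.awalk_appendI[of u p v q v'] xy that by (auto simp: closed_paths_def dest: D.awalk_ends)
    have cl': "(v, q @ p) \<in> closed_paths Q \<longleftrightarrow> u' = v" if "v' = u"
      using D.awalk_appendI[of v q u p u'] xy that by (auto simp: closed_paths_def dest: D.awalk_ends)
    show ?thesis
      using xy cl cl' rot[of u p v q] by (auto simp: pm_walk F1 F0 \<psi>_def)
  qed
  have "lift B \<psi> x = \<zero>\<^bsub>B\<^esub>" if "x \<in> H" for x
    by (rule kills_H[OF B F commutator_eq[OF B F r] that])
  from P.quot_lift[OF H_submodule B F this] obtain g where
    g: "g \<in> linear_maps M B" "\<And>x. x \<in> carrier P \<Longrightarrow> g (proj x) = lift B \<psi> x" unfolding M_quot by blast
  show ?thesis
  proof (rule that[OF g(1)])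
    fix x assume "x \<in> closed_paths Q"
    then show "g (cyc x) = \<phi> x" using closed_paths_paths by (auto simp: cyc_proj g(2) mono_P F1 \<psi>_def)
  qed
qed

end

section \<open>Sums over the letters of a cyclic word\<close>

context smod
begin

lemma ew_mem:
  assumes K: "submodule K scalars M" and H: "\<And>u p v. w = u @ p # v \<Longrightarrow> H u p v \<in> K"
  shows "ew w H \<in> K"
  using H
proof (induction w arbitrary: H)
  case Nil
  then show ?case using submodD(2)[OF K] by simp
next
  case (Cons a w)
  have "ew w (\<lambda>u. H (a # u)) \<in> K" by (rule Cons.IH) (simp add: Cons.prems)
  then show ?case using Cons.prems[of "[]" a w] submodD(3)[OF K] by simp
qed

lemma finsum_lessThan_add:
  fixes m n :: nat
  assumes "\<And>k. g k \<in> carrier M"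
  shows "finsum M g {..<m + n} = finsum M g {..<m} \<oplus> finsum M (\<lambda>k. g (m + k)) {..<n}"
proof (induction n)
  case (Suc n)
  have "finsum M g {..<m + Suc n} = g (m + n) \<oplus> finsum M g {..<m + n}"
    using assms by (simp add: lessThan_Suc finsum_insert)
  moreover have "finsum M (\<lambda>k. g (m + k)) {..<Suc n} = g (m + n) \<oplus> finsum M (\<lambda>k. g (m + k)) {..<n}"
    using assms by (simp add: lessThan_Suc finsum_insert)
  ultimately show ?case using Suc assms by (simp add: a_lcomm)
qed (use assms in simp)

lemma finsum_cong2: "\<lbrakk>\<And>i. i \<in> I \<Longrightarrow> f i = g i; \<And>i. g i \<in> carrier M\<rbrakk> \<Longrightarrow> finsum M f I = finsum M g I"
  by (rule add.finprod_cong') auto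

lemma ew_finsum:
  assumes "\<And>u p v. H u p v \<in> carrier M"
  shows "finsum M (\<lambda>i. H (take i w) (w ! i) (drop (Suc i) w)) {..<length w} = ew w H"
  using assms
proof (induction w arbitrary: H)
  case (Cons a w)
  let ?g = "\<lambda>i. H (take i (a # w)) ((a # w) ! i) (drop (Suc i) (a # w))"
  have "finsum M ?g {..<1 + length w} = finsum M ?g {..<1} \<oplus> finsum M (\<lambda>k. ?g (1 + k)) {..<length w}"
    by (rule finsum_lessThan_add) (rule Cons.prems)
  also have "finsum M (\<lambda>k. ?g (1 + k)) {..<length w} = ew w (\<lambda>u. H (a # u))"
    using Cons.IH[of "\<lambda>u. H (a # u)"] Cons.prems by simp
  also have "finsum M ?g {..<1} = H [] a w"
    using finsum_insert[of "{}" 0 ?g] Cons.prems by (simp add: lessThan_Suc[of 0])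
  finally show ?case by simp
qed simp

text \<open>Both sides run over pairs of letters with q before p; the left side selects the later
  letter first, the right side the earlier one.\<close>

lemma ew_nest:
  assumes "\<And>x q y p z. H x q y p z \<in> carrier M"
  shows "ew w (\<lambda>u p z. ew u (\<lambda>x q y. H x q y p z)) = ew w (\<lambda>x q r. ew r (H x q))"
  using assms
proof (induction w arbitrary: H)
  case (Cons a w)
  have "ew w (\<lambda>u p z. H [] a u p z \<oplus> ew u (\<lambda>x q y. H (a # x) q y p z)) =
    ew w (H [] a) \<oplus> ew w (\<lambda>u p z. ew u (\<lambda>x q y. H (a # x) q y p z))"
    by (rule ew_add) (simp_all add: Cons.prems ew_closed)
  moreover have "ew w (\<lambda>u p z. ew u (\<lambda>x q y. H (a # x) q y p z)) = ew w (\<lambda>x q r. ew r (H (a # x) q))"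
    by (rule Cons.IH) (rule Cons.prems)
  ultimately show ?case by (simp add: ew_closed Cons.prems)
qed simp

text \<open>A sum over the letters of a cyclic word: w is rotated so that p comes first, with the
  Koszul sign of this rotation, and K sees the rest.\<close>

definition rx :: "'e darrow list \<Rightarrow> ('e darrow \<Rightarrow> 'e darrow list \<Rightarrow> 'm) \<Rightarrow> 'm" where
  "rx w K = ew w (\<lambda>u p v. ksgn M (wpar u * (parity p + wpar v)) (K p (v @ u)))"

lemma rx_closed: "(\<And>p v. K p v \<in> carrier M) \<Longrightarrow> rx w K \<in> carrier M"
  by (simp add: rx_def ew_closed)

lemma rx_cong: "(\<And>u p v. w = u @ p # v \<Longrightarrow> K p (v @ u) = K' p (v @ u)) \<Longrightarrow> rx w K = rx w K'"
  unfolding rx_def by (rule ew_cong) simp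

lemma rx_sg: "(\<And>p v. K p v \<in> carrier M) \<Longrightarrow> rx w (\<lambda>p v. ksgn M e (K p v)) = ksgn M e (rx w K)"
  unfolding rx_def by (subst ew_sg[symmetric]) (simp_all add: sg_sg add.commute)

lemma rx_hom:
  assumes "smod N" "f \<in> linear_maps M N" "\<And>p v. K p v \<in> carrier M"
  shows "smod.rx N w (\<lambda>p v. f (K p v)) = f (rx w K)"
proof -
  interpret N: smod N by fact
  show ?thesis unfolding rx_def N.rx_def
    by (subst ew_hom[OF assms(1,2), symmetric]) (simp_all add: assms(3) linear_map_ksgn[OF smod_axioms assms(1,2)])
qed

text \<open>The words u v and v u have the same rotations, and the signs differ by a factor that
  does not depend on the chosen letter. This makes brackets and cobrackets well defined on cyclic
  words.\<close>

lemma rx_rotate: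
  assumes "\<And>p v. K p v \<in> carrier M"
  shows "rx (u @ v) K = ksgn M (wpar u * wpar v) (rx (v @ u) K)"
proof -
  have 1: "ew u (\<lambda>a p b. ksgn M (wpar a * (parity p + wpar (b @ v))) (K p ((b @ v) @ a))) =
    ksgn M (wpar u * wpar v) (ew u (\<lambda>a p b. ksgn M (wpar (v @ a) * (parity p + wpar b)) (K p (b @ v @ a))))"
    by (subst ew_sg[symmetric], simp add: assms, rule ew_cong) (simp add: assms sg_sg bit_ring)
  have 2: "ew v (\<lambda>a p b. ksgn M (wpar (u @ a) * (parity p + wpar b)) (K p (b @ u @ a))) =
    ksgn M (wpar u * wpar v) (ew v (\<lambda>a p b. ksgn M (wpar a * (parity p + wpar (b @ u))) (K p ((b @ u) @ a))))"
    by (subst ew_sg[symmetric], simp add: assms, rule ew_cong) (simp add: assms sg_sg bit_ring)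
  have "rx (u @ v) K = ew u (\<lambda>a p b. ksgn M (wpar a * (parity p + wpar (b @ v))) (K p ((b @ v) @ a))) \<oplus>
    ew v (\<lambda>a p b. ksgn M (wpar (u @ a) * (parity p + wpar b)) (K p (b @ u @ a)))"
    unfolding rx_def by (rule ew_append) (simp add: assms)
  moreover have "rx (v @ u) K = ew v (\<lambda>a p b. ksgn M (wpar a * (parity p + wpar (b @ u))) (K p ((b @ u) @ a))) \<oplus>
    ew u (\<lambda>a p b. ksgn M (wpar (v @ a) * (parity p + wpar b)) (K p (b @ v @ a)))"
    unfolding rx_def by (rule ew_append) (simp add: assms)
  ultimately show ?thesis unfolding 1 2 by (simp only:) (simp add: sg_add ew_closed assms a_comm)
qed

lemma rx_commute:
  assumes "\<And>p a q b. K p a q b \<in> carrier M"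
  shows "rx w (\<lambda>p a. rx w' (K p a)) = rx w' (\<lambda>q b. rx w (\<lambda>p a. K p a q b))"
proof -
  have "rx w (\<lambda>p a. rx w' (K p a)) = ew w (\<lambda>u p v. ew w' (\<lambda>x q y.
      ksgn M (wpar u * (parity p + wpar v)) (ksgn M (wpar x * (parity q + wpar y)) (K p (v @ u) q (y @ x)))))"
    unfolding rx_def by (simp add: ew_sg assms)
  also have "\<dots> = ew w' (\<lambda>x q y. ew w (\<lambda>u p v.
      ksgn M (wpar u * (parity p + wpar v)) (ksgn M (wpar x * (parity q + wpar y)) (K p (v @ u) q (y @ x)))))"
    by (rule ew_commute) (simp add: assms)
  also have "\<dots> = ew w' (\<lambda>x q y. ew w (\<lambda>u p v.
      ksgn M (wpar x * (parity q + wpar y)) (ksgn M (wpar u * (parity p + wpar v)) (K p (v @ u) q (y @ x)))))"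
    by (simp add: sg_sg assms add.commute)
  also have "\<dots> = rx w' (\<lambda>q b. rx w (\<lambda>p a. K p a q b))"
    unfolding rx_def by (simp add: ew_sg assms)
  finally show ?thesis .
qed

lemma rx_finsum:
  assumes "\<And>p v. K p v \<in> carrier M"
  shows "finsum M (\<lambda>i. ksgn M (wpar (take i w) * wpar (drop i w)) (K (w ! i) (cyc_sub w i i))) {..<length w} = rx w K"
proof -
  have "finsum M (\<lambda>i. ksgn M (wpar (take i w) * wpar (drop i w)) (K (w ! i) (cyc_sub w i i))) {..<length w} =
    finsum M (\<lambda>i. ksgn M (wpar (take i w) * (parity (w ! i) + wpar (drop (Suc i) w))) (K (w ! i) (drop (Suc i) w @ take i w))) {..<length w}"
  proof (rule add.finprod_cong')
    fix i assume "i \<in> {..<length w}"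
    then have "drop i w = w ! i # drop (Suc i) w" by (simp add: Cons_nth_drop_Suc)
    then show "ksgn M (wpar (take i w) * wpar (drop i w)) (K (w ! i) (cyc_sub w i i)) =
      ksgn M (wpar (take i w) * (parity (w ! i) + wpar (drop (Suc i) w))) (K (w ! i) (drop (Suc i) w @ take i w))"
      by (simp add: cyc_sub_def)
  qed (use assms in auto)
  also have "\<dots> = rx w K"
    unfolding rx_def by (rule ew_finsum[of "\<lambda>u p v. ksgn M (wpar u * (parity p + wpar v)) (K p (v @ u))"]) (simp add: assms)
  finally show ?thesis .
qed

text \<open>In cyclic order the positions other than i are the letters of the rotated word v u, and
  position i contributes zero. In increasing order the block u comes before the block v, hence the
  commutation at the end.\<close>

lemma cyc_finsum:
  assumes G: "\<And>x q y. G x q y \<in> carrier M" and i: "i < length a" and z: "\<And>x y. G x (a ! i) y = \<zero>"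
  shows "finsum M (\<lambda>j. G (cyc_sub a i j) (a ! j) (cyc_sub a j i)) {..<length a} = ew (cyc_sub a i i) G"
proof -
  define u v where uv: "u = take i a" "v = drop (Suc i) a"
  have len: "length a = i + (1 + length v)" "length u = i" using i by (auto simp: uv)
  let ?g = "\<lambda>j. G (cyc_sub a i j) (a ! j) (cyc_sub a j i)"
  have a: "a = u @ a ! i # v" unfolding uv by (rule id_take_nth_drop[OF i])
  have "finsum M ?g {..<length a} = finsum M ?g {..<i} \<oplus> (finsum M (\<lambda>k. ?g (i + k)) {..<1} \<oplus> finsum M (\<lambda>k. ?g (i + (1 + k))) {..<length v})"
    unfolding len(1) using finsum_lessThan_add[of ?g i "1 + length v"] finsum_lessThan_add[of "\<lambda>k. ?g (i + k)" 1 "length v"] G by simp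
  also have "finsum M (\<lambda>k. ?g (i + k)) {..<1} = \<zero>"
    by (rule add.finprod_one_eqI) (simp add: z)
  also have "finsum M ?g {..<i} = finsum M (\<lambda>j. G (v @ take j u) (u ! j) (drop (Suc j) u)) {..<length u}"
    unfolding len(2) by (rule add.finprod_cong') (auto simp: G cyc_sub_def uv min_def drop_take)
  also have "\<dots> = ew u (\<lambda>x q y. G (v @ x) q y)"
    by (rule ew_finsum[of "\<lambda>x. G (v @ x)"]) (rule G)
  also have "finsum M (\<lambda>k. ?g (i + (1 + k))) {..<length v} = finsum M (\<lambda>k. G (take k v) (v ! k) (drop (Suc k) v @ u)) {..<length v}"
    by (rule add.finprod_cong') (auto simp: G cyc_sub_def uv drop_take add.commute)
  also have "\<dots> = ew v (\<lambda>x q y. G x q (y @ u))"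
    by (rule ew_finsum[of "\<lambda>x q y. G x q (y @ u)"]) (rule G)
  finally have "finsum M ?g {..<length a} = ew (v @ u) G"
    using G by (simp add: ew_append ew_closed a_comm)
  then show ?thesis by (simp add: uv cyc_sub_def)
qed

end

section \<open>The brackets and cobrackets\<close>

context quiver
begin

interpretation D: wf_digraph "double Q" by (rule wf_double)
interpretation M: supermodule2 M by (rule M_supermodule2)
interpretation T: superalgebra "tensor_alg M" by (rule M.tensor_superalgebra[OF two])

abbreviation "hd_of \<equiv> pre_digraph.head (double Q)"
abbreviation "tl_of \<equiv> pre_digraph.tail (double Q)"

lemma double_ends: "paired p q \<Longrightarrow> hd_of q = tl_of p \<and> tl_of q = hd_of p"
  by (auto simp: paired_def double_def)

text \<open>The value zero off closed walks yields an element of the right parity for every word, as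
  \<open>cyclic_words\<close> demands.\<close>

definition cc :: "'v \<Rightarrow> 'e darrow list \<Rightarrow> ('r, 'v, 'e) cyc" where
  "cc v w = (if walk v w v then cyc (v, w) else \<zero>\<^bsub>M\<^esub>)"

lemma cc_grade: "cc v w \<in> grade M (wpar w)"
  using cyc_grade[of "(v, w)"] by (auto simp: cc_def paths_def)

lemma cc_closed [simp]: "cc v w \<in> carrier M"
  by (rule M.grade_carrier[OF cc_grade])

lemma cc_rotate:
  assumes "walk u p v" "walk v q u"
  shows "cc u (p @ q) = ksgn M (wpar p * wpar q) (cc v (q @ p))"
  using D.awalk_appendI[OF assms] D.awalk_appendI[OF assms(2,1)] cyc_rotate[OF assms] by (simp add: cc_def)

lemma walk_rotate:
  assumes "walk i (u @ p # v) i"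
  shows "p \<in> arcs (double Q)" "walk (hd_of p) (v @ u) (tl_of p)"
proof -
  obtain x where x: "walk i u x" "walk x (p # v) i"
    using assms by (metis D.awalk_append_iff D.awalk_appendI)
  then have "x = tl_of p" "p \<in> arcs (double Q)" "walk (hd_of p) v i" by (simp_all add: D.awalk_Cons_iff)
  then show "p \<in> arcs (double Q)" "walk (hd_of p) (v @ u) (tl_of p)" using x D.awalk_appendI by blast+
qed

text \<open>A summand of the bracket after both words have been rotated to p a and q b. The signs of
  the rotations are left to \<open>rx\<close>.\<close>

definition brt :: "bool \<Rightarrow> 'e darrow \<Rightarrow> 'e darrow list \<Rightarrow> 'e darrow \<Rightarrow> 'e darrow list \<Rightarrow> ('r, 'v, 'e) cyc" where
  "brt pl p a q b = (if paired p q then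
     if pl then ksgn M (wpar a + wpar b * parity q) (cc (tl_of p) (([p] @ a @ [p]) @ [q] @ b @ [q]))
     else ksgn M (wpar a * parity q) (cc (hd_of p) (a @ b)) else \<zero>\<^bsub>M\<^esub>)"

lemma brt_closed [simp]: "brt pl p a q b \<in> carrier M"
  by (simp add: brt_def)

definition br :: "bool \<Rightarrow> 'e darrow list \<Rightarrow> 'e darrow list \<Rightarrow> ('r, 'v, 'e) cyc" where
  "br pl a b = M.rx a (\<lambda>p a'. M.rx b (brt pl p a'))"

lemma br_closed [simp]: "br pl a b \<in> carrier M"
  by (simp add: br_def M.rx_closed)

lemma walk_around: "\<lbrakk>p \<in> arcs (double Q); walk (hd_of p) a (tl_of p)\<rbrakk> \<Longrightarrow> walk (tl_of p) ([p] @ a @ [p]) (hd_of p)"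
  using D.awalk_appendI[of "hd_of p" a "tl_of p" "[p]" "hd_of p"] by (simp add: D.awalk_Cons_iff D.awalk_Nil_iff del: D.awalk_append_iff)

lemma brt_eq:
  assumes p: "p \<in> arcs (double Q)" "walk (hd_of p) a (tl_of p)" and q: "q \<in> arcs (double Q)" "walk (hd_of q) b (tl_of q)"
    and pq: "paired p q"
  shows "cc (tl_of p) (([p] @ a @ [p]) @ [q] @ b @ [q]) = cyc (tl_of p, ([p] @ a @ [p]) @ [q] @ b @ [q])"
    "cc (hd_of p) (a @ b) = cyc (hd_of p, a @ b)"
    "cc (tl_of p) (([p] @ a @ [p]) @ [q] @ b @ [q]) = ksgn M (wpar a * wpar b) (cc (tl_of q) (([q] @ b @ [q]) @ [p] @ a @ [p]))"
    "cc (hd_of p) (a @ b) = ksgn M (wpar a * wpar b) (cc (hd_of q) (b @ a))"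
proof -
  have wp: "walk (tl_of p) ([p] @ a @ [p]) (tl_of q)" "walk (hd_of p) a (hd_of q)" using walk_around[OF p] p(2) double_ends[OF pq] by simp_all
  have wq: "walk (tl_of q) ([q] @ b @ [q]) (tl_of p)" "walk (hd_of q) b (hd_of p)" using walk_around[OF q] q(2) double_ends[OF pq] by simp_all
  show "cc (tl_of p) (([p] @ a @ [p]) @ [q] @ b @ [q]) = cyc (tl_of p, ([p] @ a @ [p]) @ [q] @ b @ [q])"
    using D.awalk_appendI[OF wp(1) wq(1)] by (simp add: cc_def)
  show "cc (hd_of p) (a @ b) = cyc (hd_of p, a @ b)"
    using D.awalk_appendI[OF wp(2) wq(2)] by (simp add: cc_def)
  show "cc (tl_of p) (([p] @ a @ [p]) @ [q] @ b @ [q]) = ksgn M (wpar a * wpar b) (cc (tl_of q) (([q] @ b @ [q]) @ [p] @ a @ [p]))"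
    unfolding cc_rotate[OF wp(1) wq(1)] by (simp add: add_ac)
  show "cc (hd_of p) (a @ b) = ksgn M (wpar a * wpar b) (cc (hd_of q) (b @ a))"
    by (rule cc_rotate[OF wp(2) wq(2)])
qed

text \<open>The exponent in the definition is the sum of one rotation sign for each word and of the
  sign in \<open>brt\<close>, so the double sum over positions becomes a nested
  \<open>rx\<close>.\<close>

lemma br_path:
  assumes "(i, a) \<in> closed_paths Q" "(j, b) \<in> closed_paths Q"
  shows "(if pl then br_plus_path Q (i, a) (j, b) else br_minus_path Q (i, a) (j, b)) = br pl a b"
proof -
  let ?e = "\<lambda>k l. ksgn M (wpar (take k a) * wpar (drop k a)) (ksgn M (wpar (take l b) * wpar (drop l b)) (brt pl (a ! k) (cyc_sub a k k) (b ! l) (cyc_sub b l l)))"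
  have w: "(w ! k) \<in> arcs (double Q)" "walk (hd_of (w ! k)) (cyc_sub w k k) (tl_of (w ! k))"
    if "(x, w) \<in> closed_paths Q" "k < length w" for x w k
    using walk_rotate[of x "take k w" "w ! k" "drop (Suc k) w"] that id_take_nth_drop[OF that(2)]
    by (auto simp: closed_paths_def cyc_sub_def)
  have "(if pl then br_plus_path Q (i, a) (j, b) else br_minus_path Q (i, a) (j, b)) =
    finsum M (\<lambda>k. finsum M (?e k) {..<length b}) {..<length a}"
  proof (cases pl)
    case pl: True
    show ?thesis
      unfolding br_plus_path_def Let_def N[symmetric] snd_conv if_P[OF pl]
    proof (intro M.finsum_cong2)
      fix k l assume "k \<in> {..<length a}" "l \<in> {..<length b}"
      then have kl: "k < length a" "l < length b" by simp_all
      show "(if paired (a ! k) (b ! l) then ksgn M (wpar (take k a) * wpar (drop k a) + wpar (take l b) * wpar (drop l b) + wpar (cyc_sub a k k) +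
          wpar (cyc_sub b l l) * parity (b ! l)) (cyc (tl_of (a ! k), [a ! k] @ cyc_sub a k k @ [a ! k] @ [b ! l] @ cyc_sub b l l @ [b ! l])) else \<zero>\<^bsub>M\<^esub>) = ?e k l"
      proof (cases "paired (a ! k) (b ! l)")
        case True
        show ?thesis using brt_eq(1)[OF w[OF assms(1) kl(1)] w[OF assms(2) kl(2)] True, simplified, symmetric]
          by (simp add: True brt_def pl M.sg_sg add_ac)
      qed (simp add: brt_def)
    qed simp_all
  next
    case pl: False
    show ?thesis
      unfolding br_minus_path_def Let_def N[symmetric] snd_conv if_not_P[OF pl]
    proof (intro M.finsum_cong2)
      fix k l assume "k \<in> {..<length a}" "l \<in> {..<length b}"
      then have kl: "k < length a" "l < length b" by simp_all
      show "(if paired (a ! k) (b ! l) then ksgn M (wpar (take k a) * wpar (drop k a) + wpar (take l b) * wpar (drop l b) +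
          wpar (cyc_sub a k k) * parity (b ! l)) (cyc (hd_of (a ! k), cyc_sub a k k @ cyc_sub b l l)) else \<zero>\<^bsub>M\<^esub>) = ?e k l"
      proof (cases "paired (a ! k) (b ! l)")
        case True
        show ?thesis using brt_eq(2)[OF w[OF assms(1) kl(1)] w[OF assms(2) kl(2)] True, symmetric]
          by (simp add: True brt_def pl M.sg_sg add_ac)
      qed (simp add: brt_def)
    qed simp_all
  qed
  also have "\<dots> = finsum M (\<lambda>k. ksgn M (wpar (take k a) * wpar (drop k a)) (M.rx b (brt pl (a ! k) (cyc_sub a k k)))) {..<length a}"
  proof (rule M.finsum_cong2)
    fix k
    let ?s = "wpar (take k a) * wpar (drop k a)"
    have "finsum M (?e k) {..<length b} = finsum M (\<lambda>l. ksgn M (wpar (take l b) * wpar (drop l b)) (ksgn M ?s (brt pl (a ! k) (cyc_sub a k k) (b ! l) (cyc_sub b l l)))) {..<length b}"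
      by (simp add: M.sg_sg add.commute)
    also have "\<dots> = M.rx b (\<lambda>q b'. ksgn M ?s (brt pl (a ! k) (cyc_sub a k k) q b'))"
      by (rule M.rx_finsum) simp
    finally show "finsum M (?e k) {..<length b} = ksgn M ?s (M.rx b (brt pl (a ! k) (cyc_sub a k k)))"
      by (simp add: M.rx_sg)
  qed (simp add: M.rx_closed)
  also have "\<dots> = br pl a b"
    unfolding br_def by (rule M.rx_finsum) (simp add: M.rx_closed)
  finally show ?thesis .
qed

lemma br_rotate:
  "br pl (u @ v) b = ksgn M (wpar u * wpar v) (br pl (v @ u) b)"
  "br pl b (u @ v) = ksgn M (wpar u * wpar v) (br pl b (v @ u))"
proof -
  show "br pl (u @ v) b = ksgn M (wpar u * wpar v) (br pl (v @ u) b)"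
    unfolding br_def by (rule M.rx_rotate) (simp add: M.rx_closed)
  show "br pl b (u @ v) = ksgn M (wpar u * wpar v) (br pl b (v @ u))"
    unfolding br_def by (subst M.rx_sg[symmetric]) (simp_all add: M.rx_closed M.rx_rotate[of _ u v])
qed

lemma br_sym:
  assumes "walk i a i" "walk j b j"
  shows "br pl a b = ksgn M (wpar a * wpar b) (br pl b a)"
proof -
  have "ksgn M (wpar a * wpar b) (br pl b a) = M.rx a (\<lambda>p a'. M.rx b (\<lambda>q b'. ksgn M (wpar a * wpar b) (brt pl q b' p a')))"
    unfolding br_def by (subst M.rx_commute) (simp_all add: M.rx_sg M.rx_closed)
  also have "\<dots> = br pl a b"
    unfolding br_def
  proof (intro M.rx_cong)
    fix u p v x q y assume ab: "a = u @ p # v" "b = x @ q # y"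
    show "ksgn M (wpar a * wpar b) (brt pl q (y @ x) p (v @ u)) = brt pl p (v @ u) q (y @ x)"
    proof (cases "paired p q")
      case True
      have qp: "paired q p" using True paired_sym by blast
      note e = brt_eq(3,4)[OF walk_rotate[OF assms(1)[unfolded ab]] walk_rotate[OF assms(2)[unfolded ab]] True]
      show ?thesis unfolding brt_def e using True qp
        by (simp add: M.sg_sg ab paired_parity[OF True] bit_ring)
    qed (simp add: brt_def paired_sym[of q p])
  qed
  finally show ?thesis by simp
qed

lemma br_grade: "br pl a b \<in> grade M (1 + wpar a + wpar b)"
  unfolding br_def M.rx_def
proof (rule M.ew_mem[OF M.grade_submodule], rule M.grade_closed, rule M.ew_mem[OF M.grade_submodule], rule M.grade_closed)
  fix u p v x q y assume ab: "a = u @ p # v" "b = x @ q # y"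
  show "brt pl p (v @ u) q (y @ x) \<in> grade M (1 + wpar a + wpar b)"
  proof (cases "paired p q")
    case True
    have "wpar (([p] @ (v @ u) @ [p]) @ [q] @ (y @ x) @ [q]) = 1 + wpar a + wpar b" "wpar ((v @ u) @ y @ x) = 1 + wpar a + wpar b"
      by (simp_all add: ab paired_parity[OF True] add_ac)
    then show ?thesis using cc_grade[of "tl_of p" "([p] @ (v @ u) @ [p]) @ [q] @ (y @ x) @ [q]"] cc_grade[of "hd_of p" "(v @ u) @ y @ x"] True
      by (simp add: brt_def)
  qed (simp add: brt_def)
qed

text \<open>The universal property is used twice: L extends \<phi> in the first argument for each
  path y, then K extends the values L y m in y for each element m. Linearity of K in m is tested on
  paths in the other argument.\<close>

theorem bilinear_universal:
  assumes c: "\<And>x y. \<phi> x y \<in> carrier M"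
    and rot: "\<And>u p v q y. \<lbrakk>walk u p v; walk v q u\<rbrakk> \<Longrightarrow> \<phi> (u, p @ q) y = ksgn M (wpar p * wpar q) (\<phi> (v, q @ p) y)"
    and rot': "\<And>u p v q y. \<lbrakk>walk u p v; walk v q u\<rbrakk> \<Longrightarrow> \<phi> y (u, p @ q) = ksgn M (wpar p * wpar q) (\<phi> y (v, q @ p))"
  obtains b where "\<And>x. x \<in> carrier M \<Longrightarrow> (\<lambda>y. b (x, y)) \<in> linear_maps M M" "\<And>y. y \<in> carrier M \<Longrightarrow> (\<lambda>x. b (x, y)) \<in> linear_maps M M"
    "\<And>x y. \<lbrakk>x \<in> closed_paths Q; y \<in> closed_paths Q\<rbrakk> \<Longrightarrow> b (cyc x, cyc y) = \<phi> x y"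
proof -
  have "\<exists>L. L \<in> linear_maps M M \<and> (\<forall>x\<in>closed_paths Q. L (cyc x) = \<phi> x y)" for y
    by (rule cyc_universal[OF M.smod_axioms, of "\<lambda>x. \<phi> x y"]) (use c rot in blast)+
  then obtain L where L: "\<And>y. L y \<in> linear_maps M M" "\<And>x y. x \<in> closed_paths Q \<Longrightarrow> L y (cyc x) = \<phi> x y" by metis
  have "\<exists>K. K \<in> linear_maps M M \<and> (\<forall>y\<in>closed_paths Q. K (cyc y) = L y m)" if m: "m \<in> carrier M" for m
  proof (rule cyc_universal[OF M.smod_axioms, of "\<lambda>y. L y m"])
    show "L y m \<in> carrier M" for y by (rule linear_mapsD(1)[OF L(1) m])
    show "L (u, p @ q) m = ksgn M (wpar p * wpar q) (L (v, q @ p) m)" if "walk u p v" "walk v q u" for u p v q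
      by (rule cyc_ext[OF M.smod_axioms L(1) linear_maps_ksgn[OF M.smod_axioms L(1)] _ m]) (simp add: L(2) rot'[OF that])
  qed blast
  then obtain K where K: "\<And>m. m \<in> carrier M \<Longrightarrow> K m \<in> linear_maps M M"
    "\<And>m y. \<lbrakk>m \<in> carrier M; y \<in> closed_paths Q\<rbrakk> \<Longrightarrow> K m (cyc y) = L y m" by metis
  show ?thesis
  proof (rule that[of "\<lambda>(m, n). K m n"])
    show "(\<lambda>y. case (x, y) of (m, n) \<Rightarrow> K m n) \<in> linear_maps M M" if "x \<in> carrier M" for x using K(1)[OF that] by simp
    show "(\<lambda>x. case (x, y) of (m, n) \<Rightarrow> K m n) \<in> linear_maps M M" if y: "y \<in> carrier M" for y
    proof (rule linear_mapsI, unfold prod.case)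
      fix m assume m: "m \<in> carrier M"
      show "K m y \<in> carrier M" by (rule linear_mapsD(1)[OF K(1)[OF m] y])
      show "K (r \<odot>\<^bsub>M\<^esub> m) y = r \<odot>\<^bsub>M\<^esub> K m y" for r
        by (rule cyc_ext[OF M.smod_axioms K(1) linear_maps_smult[OF M.smod_axioms K(1)[OF m]] _ y]) (simp_all add: m K(2) linear_mapsD(3)[OF L(1)])
      show "K (m \<oplus>\<^bsub>M\<^esub> n) y = K m y \<oplus>\<^bsub>M\<^esub> K n y" if n: "n \<in> carrier M" for n
        by (rule cyc_ext[OF M.smod_axioms K(1) linear_maps_add[OF M.smod_axioms K(1)[OF m] K(1)[OF n]] _ y]) (simp_all add: m n K(2) linear_mapsD(2)[OF L(1)])
    qed
    fix x y assume "x \<in> closed_paths Q" "y \<in> closed_paths Q"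
    moreover from this(1) have "cyc x \<in> carrier M" using cyc_closed closed_paths_paths by blast
    ultimately show "(case (cyc x, cyc y) of (m, n) \<Rightarrow> K m n) = \<phi> x y" by (simp add: K(2) L(2))
  qed
qed

definition brk :: "bool \<Rightarrow> ('r, 'v, 'e) cyc \<times> ('r, 'v, 'e) cyc \<Rightarrow> ('r, 'v, 'e) cyc" where
  "brk pl = (if pl then br_plus Q else br_minus Q)"

text \<open>Existence follows from \<open>bilinear_universal\<close> once the path formula is
  replaced by \<open>br\<close>, which has the rotation rules for arbitrary words. Uniqueness holds
  because the classes of closed paths span.\<close>

lemma brk:
  "x \<in> carrier M \<Longrightarrow> (\<lambda>y. brk pl (x, y)) \<in> linear_maps M M"
  "y \<in> carrier M \<Longrightarrow> (\<lambda>x. brk pl (x, y)) \<in> linear_maps M M"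
  "\<lbrakk>(i, a) \<in> closed_paths Q; (j, c) \<in> closed_paths Q\<rbrakk> \<Longrightarrow> brk pl (cyc (i, a), cyc (j, c)) = br pl a c"
proof -
  let ?\<phi> = "if pl then br_plus_path Q else br_minus_path Q"
  let ?P = "\<lambda>b. b \<in> extensional (carrier M \<times> carrier M) \<and> (\<forall>x\<in>carrier M. (\<lambda>y. b (x, y)) \<in> linear_maps M M) \<and>
     (\<forall>y\<in>carrier M. (\<lambda>x. b (x, y)) \<in> linear_maps M M) \<and>
     (\<forall>x\<in>closed_paths Q. \<forall>y\<in>closed_paths Q. b (cyc x, cyc y) = ?\<phi> x y)"
  have phi: "?\<phi> x y = br pl (snd x) (snd y)" if "x \<in> closed_paths Q" "y \<in> closed_paths Q" for x y
    using br_path[of "fst x" "snd x" "fst y" "snd y" pl] that by (cases pl) simp_all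
  obtain b where b: "\<And>x. x \<in> carrier M \<Longrightarrow> (\<lambda>y. b (x, y)) \<in> linear_maps M M" "\<And>y. y \<in> carrier M \<Longrightarrow> (\<lambda>x. b (x, y)) \<in> linear_maps M M"
    "\<And>x y. \<lbrakk>x \<in> closed_paths Q; y \<in> closed_paths Q\<rbrakk> \<Longrightarrow> b (cyc x, cyc y) = br pl (snd x) (snd y)"
    by (rule bilinear_universal[of "\<lambda>x y. br pl (snd x) (snd y)"], simp, simp only: snd_conv, rule br_rotate(1),
      simp only: snd_conv, rule br_rotate(2), rule that, assumption+)
  let ?b = "restrict b (carrier M \<times> carrier M)"
  have "?P ?b"
  proof (intro conjI ballI)
    show "(\<lambda>y. ?b (x, y)) \<in> linear_maps M M" if "x \<in> carrier M" for x
      by (rule linear_maps_cong[OF M.smod_axioms _ b(1)[OF that]]) (simp add: that)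
    show "(\<lambda>x. ?b (x, y)) \<in> linear_maps M M" if "y \<in> carrier M" for y
      by (rule linear_maps_cong[OF M.smod_axioms _ b(2)[OF that]]) (simp add: that)
    show "?b (cyc x, cyc y) = ?\<phi> x y" if "x \<in> closed_paths Q" "y \<in> closed_paths Q" for x y
    proof -
      have "cyc x \<in> carrier M" "cyc y \<in> carrier M" using cyc_closed closed_paths_paths that by blast+
      then show ?thesis unfolding phi[OF that] using b(3)[OF that] by simp
    qed
  qed simp
  moreover have "b' = ?b" if b': "?P b'" for b'
  proof (rule extensionalityI[of _ "carrier M \<times> carrier M"])
    fix z assume "z \<in> carrier M \<times> carrier M"
    then obtain x y where z: "z = (x, y)" and x: "x \<in> carrier M" and y: "y \<in> carrier M" by auto
    have "b' (cyc c, y) = b (cyc c, y)" if c: "c \<in> closed_paths Q" for c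
    proof (rule cyc_ext[OF M.smod_axioms _ b(1) _ y, where f = "\<lambda>y. b' (cyc c, y)"])
      show "cyc c \<in> carrier M" using cyc_closed closed_paths_paths c by blast
      then show "(\<lambda>y. b' (cyc c, y)) \<in> linear_maps M M" using b' by blast
      show "b' (cyc c, cyc d) = b (cyc c, cyc d)" if "d \<in> closed_paths Q" for d
        using b' b(3)[OF c that] phi[OF c that] c that by simp
    qed
    then have "b' (x, y) = b (x, y)"
      by (intro cyc_ext[OF M.smod_axioms _ b(2)[OF y] _ x, where f = "\<lambda>x. b' (x, y)"]) (use b' y in blast)+
    then show "b' z = ?b z" using z x y by simp
  qed (use b' in auto)
  ultimately have "(THE b. ?P b) = ?b" by (rule the_equality)
  moreover have "brk pl = (THE b. ?P b)"
    by (simp add: brk_def br_plus_def br_minus_def bracket_of_def N)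
  ultimately have P: "?P (brk pl)" using \<open>?P ?b\<close> by simp
  note P1 = P[THEN conjunct2, THEN conjunct1] and P2 = P[THEN conjunct2, THEN conjunct2, THEN conjunct1]
    and P3 = P[THEN conjunct2, THEN conjunct2, THEN conjunct2]
  show "x \<in> carrier M \<Longrightarrow> (\<lambda>y. brk pl (x, y)) \<in> linear_maps M M" by (rule bspec[OF P1])
  show "y \<in> carrier M \<Longrightarrow> (\<lambda>x. brk pl (x, y)) \<in> linear_maps M M" by (rule bspec[OF P2])
  assume ij: "(i, a) \<in> closed_paths Q" "(j, c) \<in> closed_paths Q"
  have "brk pl (cyc (i, a), cyc (j, c)) = ?\<phi> (i, a) (j, c)" by (rule bspec[OF bspec[OF P3 ij(1)] ij(2)])
  then show "brk pl (cyc (i, a), cyc (j, c)) = br pl a c" by (simp only: phi[OF ij] snd_conv)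
qed

lemma linear_grade:
  assumes "smod B" "f \<in> linear_maps M B" "submodule K scalars B" "x \<in> grade M p"
    and c: "\<And>c. \<lbrakk>c \<in> closed_paths Q; wpar (snd c) = p\<rbrakk> \<Longrightarrow> f (cyc c) \<in> K"
  shows "f x \<in> K"
proof -
  interpret B: smod B by fact
  note K = B.submodD[OF assms(3)]
  show ?thesis using assms(4)
  proof (induction x rule: cyc_grade_induct)
    case zero
    then show ?case using linear_map_zero[OF M.smod_axioms assms(1,2)] K(2) by simp
  next
    case (smult r c)
    then have "cyc c \<in> carrier M" using cyc_closed closed_paths_paths by blast
    then show ?case using linear_mapsD(3)[OF assms(2)] K(4)[OF c[OF smult]] by simp
  next
    case (add x y)
    then show ?case using linear_mapsD(2)[OF assms(2)] K(3) by simp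
  qed
qed

lemma linear_grade_eq:
  assumes B: "smod B" and f: "f \<in> linear_maps M B" and g: "g \<in> linear_maps M B" and x: "x \<in> grade M p"
    and c: "\<And>c. \<lbrakk>c \<in> closed_paths Q; wpar (snd c) = p\<rbrakk> \<Longrightarrow> f (cyc c) = g (cyc c)"
  shows "f x = g x"
  using x
proof (induction x rule: cyc_grade_induct)
  case zero
  then show ?case using linear_map_zero[OF M.smod_axioms B f] linear_map_zero[OF M.smod_axioms B g] by simp
next
  case (smult r c)
  then have "cyc c \<in> carrier M" using cyc_closed closed_paths_paths by blast
  then show ?case using linear_mapsD(3)[OF f] linear_mapsD(3)[OF g] assms(5)[OF smult] by simp
next
  case (add x y)
  then show ?case using linear_mapsD(2)[OF f] linear_mapsD(2)[OF g] by simp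
qed

theorem brk_like: "M.bracket_like (brk pl)"
  unfolding M.bracket_like_def
proof (intro conjI ballI allI)
  fix p q x y assume x: "x \<in> grade M p" and y: "y \<in> grade M q"
  have xc: "x \<in> carrier M" and yc: "y \<in> carrier M" using x y M.grade_carrier by blast+
  have cl: "cyc c \<in> carrier M" if "c \<in> closed_paths Q" for c using cyc_closed closed_paths_paths that by blast
  show "brk pl (x, y) \<in> grade M (1 + p + q)"
  proof (rule linear_grade[OF M.smod_axioms brk(2)[OF yc] M.grade_submodule x])
    fix c assume c: "c \<in> closed_paths Q" "wpar (snd c) = p"
    show "brk pl (cyc c, y) \<in> grade M (1 + p + q)"
    proof (rule linear_grade[OF M.smod_axioms brk(1)[OF cl[OF c(1)]] M.grade_submodule y])
      fix d assume "d \<in> closed_paths Q" "wpar (snd d) = q"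
      then show "brk pl (cyc c, cyc d) \<in> grade M (1 + p + q)"
        using c br_grade[of pl "snd c" "snd d"] brk(3)[of "fst c" "snd c" "fst d" "snd d" pl] by simp
    qed
  qed
  show "brk pl (x, y) = ksgn M (p * q) (brk pl (y, x))"
  proof (rule linear_grade_eq[OF M.smod_axioms brk(2)[OF yc] linear_maps_ksgn[OF M.smod_axioms brk(1)[OF yc]] x])
    fix c assume c: "c \<in> closed_paths Q" "wpar (snd c) = p"
    show "brk pl (cyc c, y) = ksgn M (p * q) (brk pl (y, cyc c))"
    proof (rule linear_grade_eq[OF M.smod_axioms brk(1)[OF cl[OF c(1)]] linear_maps_ksgn[OF M.smod_axioms brk(2)[OF cl[OF c(1)]]] y])
      fix d assume d: "d \<in> closed_paths Q" "wpar (snd d) = q"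
      have "walk (fst c) (snd c) (fst c)" "walk (fst d) (snd d) (fst d)" using c d by (auto simp: closed_paths_def)
      then show "brk pl (cyc c, cyc d) = ksgn M (p * q) (brk pl (cyc d, cyc c))"
        using c d br_sym[of "fst c" "snd c" "fst d" "snd d" pl] brk(3)[of "fst c" "snd c" "fst d" "snd d" pl]
          brk(3)[of "fst d" "snd d" "fst c" "snd c" pl] by simp
    qed
  qed
qed (simp_all add: brk)

end

section \<open>The cobracket on cyclic words\<close>

context quiver
begin

interpretation D: wf_digraph "double Q" by (rule wf_double)
interpretation M: supermodule2 M by (rule M_supermodule2)
interpretation T: superalgebra "tensor_alg M" by (rule M.tensor_superalgebra[OF two])

abbreviation "T\<^sub>M \<equiv> tensor_alg M"
abbreviation "tg \<equiv> tensor_gen M"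

definition T2 :: "('r, ('r, 'v, 'e) cyc) tens set" where
  "T2 = tensor_class M ` {f. Poly_Mapping.keys f \<subseteq> {w \<in> lists (carrier M). length w = 2}}"

lemma T2_carrier: "{f. Poly_Mapping.keys f \<subseteq> {w \<in> lists (carrier M). length w = 2}} \<subseteq> carrier (free_alg M)"
  by (intro subsetI) (simp only: M.freeD mem_Collect_eq, blast)

lemma T2_submodule: "submodule T2 scalars T\<^sub>M"
proof (rule T.submodI)
  let ?K = "{f. Poly_Mapping.keys f \<subseteq> {w \<in> lists (carrier M). length w = 2}}"
  note lin = linear_mapsD[OF M.tensor_class_linear]
  have c: "f \<in> carrier (free_alg M)" if "f \<in> ?K" for f using T2_carrier that by blast
  show "T2 \<subseteq> carrier T\<^sub>M" unfolding T2_def using lin(1) c by blast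
  have "smod (free_alg M)" by (rule free_on_smod[OF free_alg_free_on])
  from linear_map_zero[OF this T.smod_axioms M.tensor_class_linear]
  have "tensor_class M 0 = \<zero>\<^bsub>T\<^sub>M\<^esub>" by (simp add: M.freeD)
  moreover have "tensor_class M 0 \<in> T2" unfolding T2_def by (rule imageI) simp
  ultimately show "\<zero>\<^bsub>T\<^sub>M\<^esub> \<in> T2" by simp
  show "a \<oplus>\<^bsub>T\<^sub>M\<^esub> b \<in> T2" if ab: "a \<in> T2" "b \<in> T2" for a b
  proof -
    obtain f g where fg: "f \<in> ?K" "g \<in> ?K" "a = tensor_class M f" "b = tensor_class M g" using ab unfolding T2_def by blast
    have "f + g \<in> ?K" using fg(1,2) by (simp add: keys_add_subset)
    moreover have "a \<oplus>\<^bsub>T\<^sub>M\<^esub> b = tensor_class M (f + g)" using lin(2)[OF c c, OF fg(1,2)] by (simp add: fg M.freeD)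
    ultimately show ?thesis unfolding T2_def by blast
  qed
  show "r \<odot>\<^bsub>T\<^sub>M\<^esub> a \<in> T2" if a: "a \<in> T2" for r a
  proof -
    obtain f where f: "f \<in> ?K" "a = tensor_class M f" using a unfolding T2_def by blast
    have "scal r f \<in> ?K" using f(1) by (simp add: keys_scal_subset)
    moreover have "r \<odot>\<^bsub>T\<^sub>M\<^esub> a = tensor_class M (scal r f)" using lin(3)[OF c[OF f(1)]] by (simp add: f M.freeD)
    ultimately show ?thesis unfolding T2_def by blast
  qed
qed

lemma tg_tw: "tg x = tw M [x]"
  by (simp add: tensor_gen_def tw_def)

lemma tg_closed: "x \<in> carrier M \<Longrightarrow> tg x \<in> carrier T\<^sub>M"
  by (simp add: tg_tw M.tw_closed)

lemma tg_T2: "\<lbrakk>x \<in> carrier M; y \<in> carrier M\<rbrakk> \<Longrightarrow> tg x \<otimes>\<^bsub>T\<^sub>M\<^esub> tg y \<in> T2"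
proof -
  assume "x \<in> carrier M" "y \<in> carrier M"
  moreover from this have "tw M ([x] @ [y]) \<in> T2" unfolding T2_def tw_def by (intro imageI) simp
  ultimately show ?thesis using M.tw_append[of "[x]" "[y]"] by (simp add: tg_tw)
qed

text \<open>The analogue of \<open>brt\<close> for the cobracket: p and q cut the cyclic word p x q
  y into the pieces x and y.\<close>

definition dlt :: "bool \<Rightarrow> 'e darrow \<Rightarrow> 'e darrow list \<Rightarrow> 'e darrow \<Rightarrow> 'e darrow list \<Rightarrow> ('r, ('r, 'v, 'e) cyc) tens" where
  "dlt pl p x q y = (if paired p q then
     if pl then ksgn T\<^sub>M (wpar x + wpar y * parity p + parity q) (tg (cc (tl_of p) ([p] @ x @ [q])) \<otimes>\<^bsub>T\<^sub>M\<^esub> tg (cc (tl_of q) ([q] @ y @ [p])))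
     else ksgn T\<^sub>M (wpar x * parity q) (tg (cc (hd_of p) x) \<otimes>\<^bsub>T\<^sub>M\<^esub> tg (cc (hd_of q) y)) else \<zero>\<^bsub>T\<^sub>M\<^esub>)"

lemma dlt_T2: "dlt pl p x q y \<in> T2"
  using T.submodD(2,7)[OF T2_submodule] tg_T2 by (simp add: dlt_def)

lemma T2_closed: "x \<in> T2 \<Longrightarrow> x \<in> carrier T\<^sub>M"
  using T.submodD(1)[OF T2_submodule] by blast

lemma dlt_closed [simp]: "dlt pl p x q y \<in> carrier T\<^sub>M"
  by (rule T2_closed[OF dlt_T2])

definition dl :: "bool \<Rightarrow> 'e darrow list \<Rightarrow> ('r, ('r, 'v, 'e) cyc) tens" where
  "dl pl a = half \<odot>\<^bsub>T\<^sub>M\<^esub> T.rx a (\<lambda>p a'. T.ew a' (dlt pl p))"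

lemma dl_T2: "dl pl a \<in> T2"
  unfolding dl_def T.rx_def
  by (intro T.submodD(4)[OF T2_submodule] T.ew_mem[OF T2_submodule] T.submodD(7)[OF T2_submodule] dlt_T2)

lemma dl_rotate: "dl pl (u @ v) = ksgn T\<^sub>M (wpar u * wpar v) (dl pl (v @ u))"
  unfolding dl_def by (subst T.rx_rotate) (simp_all add: T.ew_closed T.sg_smult T.rx_closed)

lemma cyc_sub_split:
  assumes "k < length a" "j < length a" "k \<noteq> j"
  shows "cyc_sub a k k = cyc_sub a k j @ a ! j # cyc_sub a j k"
proof (cases "j < k")
  case True
  have "take k a = take j (take k a) @ take k a ! j # drop (Suc j) (take k a)"
    by (rule id_take_nth_drop) (use True assms in simp)
  then show ?thesis using True by (simp add: cyc_sub_def min_def)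
next
  case False
  then have k: "k < j" using assms(3) by simp
  have "drop (Suc k) a = take (j - Suc k) (drop (Suc k) a) @ drop (Suc k) a ! (j - Suc k) # drop (Suc (j - Suc k)) (drop (Suc k) a)"
    by (rule id_take_nth_drop) (use k assms in simp)
  then show ?thesis using k assms by (simp add: cyc_sub_def drop_take)
qed

lemma walk_between:
  assumes a: "walk i a i" and kj: "k < length a" "j < length a" "k \<noteq> j"
  shows "a ! k \<in> arcs (double Q)" "walk (hd_of (a ! k)) (cyc_sub a k j) (tl_of (a ! j))"
    "walk (hd_of (a ! j)) (cyc_sub a j k) (tl_of (a ! k))"
proof -
  have "walk i (take k a @ a ! k # drop (Suc k) a) i" using a id_take_nth_drop[OF kj(1)] by simp
  note r = walk_rotate[OF this]
  have "walk (hd_of (a ! k)) (cyc_sub a k j @ a ! j # cyc_sub a j k) (tl_of (a ! k))"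
    using r(2) cyc_sub_split[OF kj] by (simp add: cyc_sub_def[of a k k] del: D.awalk_append_iff)
  then obtain x where "walk (hd_of (a ! k)) (cyc_sub a k j) x" "walk x (a ! j # cyc_sub a j k) (tl_of (a ! k))"
    by (metis D.awalk_append_iff D.awalk_appendI)
  then show "a ! k \<in> arcs (double Q)" "walk (hd_of (a ! k)) (cyc_sub a k j) (tl_of (a ! j))"
    "walk (hd_of (a ! j)) (cyc_sub a j k) (tl_of (a ! k))" using r(1) by (simp_all add: D.awalk_Cons_iff)
qed

text \<open>The third equation rotates p to the end, which is the form in which \<open>Y\<close>
  splits off its closed word.\<close>

lemma dlt_eq:
  assumes "p \<in> arcs (double Q)" "q \<in> arcs (double Q)" "walk (hd_of p) x (tl_of q)" "paired p q"
  shows "cc (hd_of p) x = cyc (hd_of p, x)" "cc (tl_of p) ([p] @ x @ [q]) = cyc (tl_of p, [p] @ x @ [q])"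
    "cc (tl_of p) ([p] @ x @ [q]) = ksgn M (parity p * (wpar x + parity q)) (cc (hd_of p) (x @ [q, p]))"
proof -
  note e = double_ends[OF assms(4)]
  have q: "walk (hd_of p) (x @ [q]) (tl_of p)"
    by (rule D.awalk_appendI[OF assms(3)]) (use e assms in \<open>simp add: D.awalk_Cons_iff D.awalk_Nil_iff\<close>)
  have p: "walk (tl_of p) [p] (hd_of p)" using assms by (simp add: D.awalk_Cons_iff D.awalk_Nil_iff)
  show "cc (hd_of p) x = cyc (hd_of p, x)" using assms(3) e by (simp add: cc_def)
  show "cc (tl_of p) ([p] @ x @ [q]) = cyc (tl_of p, [p] @ x @ [q])"
    using D.awalk_appendI[OF p q] by (simp add: cc_def)
  show "cc (tl_of p) ([p] @ x @ [q]) = ksgn M (parity p * (wpar x + parity q)) (cc (hd_of p) (x @ [q, p]))"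
    using cc_rotate[OF p q] by simp
qed

text \<open>The sum over the second position j becomes a sum over the word rotated at k by
  \<open>cyc_finsum\<close>; the term j = k vanishes since no letter is paired with itself.\<close>

lemma dl_path:
  assumes "(i, a) \<in> closed_paths Q"
  shows "(if pl then delta_plus_path Q (i, a) else delta_minus_path Q (i, a)) = dl pl a"
proof -
  have w: "walk i a i" using assms by (simp add: closed_paths_def)
  let ?e = "\<lambda>k j. ksgn T\<^sub>M (wpar (take k a) * wpar (drop k a)) (dlt pl (a ! k) (cyc_sub a k j) (a ! j) (cyc_sub a j k))"
  have npp: "\<not> paired p p" for p :: "'e darrow" by (auto simp: paired_def)
  have "(if pl then delta_plus_path Q (i, a) else delta_minus_path Q (i, a)) =
    half \<odot>\<^bsub>T\<^sub>M\<^esub> finsum T\<^sub>M (\<lambda>k. finsum T\<^sub>M (?e k) {..<length a}) {..<length a}"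
  proof (cases pl)
    case pl: True
    show ?thesis
      unfolding delta_plus_path_def Let_def N[symmetric] snd_conv if_P[OF pl]
    proof (intro arg_cong[of _ _ "\<lambda>x. half \<odot>\<^bsub>T\<^sub>M\<^esub> x"] T.finsum_cong2)
      fix k j assume "k \<in> {..<length a}" "j \<in> {..<length a}"
      then have kj: "k < length a" "j < length a" by simp_all
      show "(if paired (a ! k) (a ! j) then ksgn T\<^sub>M (wpar (take k a) * wpar (drop k a) + wpar (cyc_sub a k j) + wpar (cyc_sub a j k) * parity (a ! k) + parity (a ! j))
          (tg (cyc (tl_of (a ! k), [a ! k] @ cyc_sub a k j @ [a ! j])) \<otimes>\<^bsub>T\<^sub>M\<^esub> tg (cyc (tl_of (a ! j), [a ! j] @ cyc_sub a j k @ [a ! k]))) else \<zero>\<^bsub>T\<^sub>M\<^esub>) = ?e k j"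
      proof (cases "paired (a ! k) (a ! j)")
        case True
        then have ne: "k \<noteq> j" using npp by auto
        have qp: "paired (a ! j) (a ! k)" using True paired_sym by blast
        note wk = walk_between[OF w kj ne] and wj = walk_between[OF w kj(2,1) ne[symmetric]]
        show ?thesis unfolding dlt_eq(2)[OF wk(1) wj(1) wk(2) True, symmetric] dlt_eq(2)[OF wj(1) wk(1) wj(2) qp, symmetric] dlt_def
          using True pl by (simp add: T.sg_sg tg_closed add_ac)
      qed (simp add: dlt_def)
    qed simp_all
  next
    case pl: False
    show ?thesis
      unfolding delta_minus_path_def Let_def N[symmetric] snd_conv if_not_P[OF pl]
    proof (intro arg_cong[of _ _ "\<lambda>x. half \<odot>\<^bsub>T\<^sub>M\<^esub> x"] T.finsum_cong2)
      fix k j assume "k \<in> {..<length a}" "j \<in> {..<length a}"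
      then have kj: "k < length a" "j < length a" by simp_all
      show "(if paired (a ! k) (a ! j) then ksgn T\<^sub>M (wpar (take k a) * wpar (drop k a) + wpar (cyc_sub a k j) * parity (a ! j))
          (tg (cyc (hd_of (a ! k), cyc_sub a k j)) \<otimes>\<^bsub>T\<^sub>M\<^esub> tg (cyc (hd_of (a ! j), cyc_sub a j k))) else \<zero>\<^bsub>T\<^sub>M\<^esub>) = ?e k j"
      proof (cases "paired (a ! k) (a ! j)")
        case True
        then have ne: "k \<noteq> j" using npp by auto
        have qp: "paired (a ! j) (a ! k)" using True paired_sym by blast
        note wk = walk_between[OF w kj ne] and wj = walk_between[OF w kj(2,1) ne[symmetric]]
        show ?thesis unfolding dlt_eq(1)[OF wk(1) wj(1) wk(2) True, symmetric] dlt_eq(1)[OF wj(1) wk(1) wj(2) qp, symmetric] dlt_def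
          using True pl by (simp add: T.sg_sg tg_closed add_ac)
      qed (simp add: dlt_def)
    qed simp_all
  qed
  also have "finsum T\<^sub>M (\<lambda>k. finsum T\<^sub>M (?e k) {..<length a}) {..<length a} =
    finsum T\<^sub>M (\<lambda>k. ksgn T\<^sub>M (wpar (take k a) * wpar (drop k a)) (T.ew (cyc_sub a k k) (dlt pl (a ! k)))) {..<length a}"
  proof (rule T.finsum_cong2)
    fix k assume "k \<in> {..<length a}"
    then have k: "k < length a" by simp
    let ?s = "wpar (take k a) * wpar (drop k a)"
    have "finsum T\<^sub>M (?e k) {..<length a} = T.ew (cyc_sub a k k) (\<lambda>x q y. ksgn T\<^sub>M ?s (dlt pl (a ! k) x q y))"
      by (rule T.cyc_finsum[OF _ k]) (simp_all add: dlt_def npp tg_closed)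
    also have "\<dots> = ksgn T\<^sub>M ?s (T.ew (cyc_sub a k k) (dlt pl (a ! k)))" by (rule T.ew_sg) simp
    finally show "finsum T\<^sub>M (?e k) {..<length a} = ksgn T\<^sub>M ?s (T.ew (cyc_sub a k k) (dlt pl (a ! k)))" .
  qed (simp add: T.ew_closed)
  also have "\<dots> = T.rx a (\<lambda>p a'. T.ew a' (dlt pl p))"
    by (rule T.rx_finsum) (simp add: T.ew_closed)
  finally show ?thesis by (simp add: dl_def)
qed

definition cbk :: "bool \<Rightarrow> ('r, 'v, 'e) cyc \<Rightarrow> ('r, ('r, 'v, 'e) cyc) tens" where
  "cbk pl = (if pl then delta_plus Q else delta_minus Q)"

lemma linear_maps_tensor_square:
  "f \<in> linear_maps M (tensor_square M) \<longleftrightarrow> f \<in> linear_maps M T\<^sub>M \<and> (\<forall>x\<in>carrier M. f x \<in> T2)"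
  using T2_closed by (auto simp: linear_maps_def tensor_square_def T2_def[symmetric] Let_def)

lemma cbk:
  "cbk pl \<in> linear_maps M T\<^sub>M"
  "(i, a) \<in> closed_paths Q \<Longrightarrow> cbk pl (cyc (i, a)) = dl pl a"
proof -
  let ?\<phi> = "if pl then delta_plus_path Q else delta_minus_path Q"
  let ?P = "\<lambda>c. c \<in> extensional (carrier M) \<and> c \<in> linear_maps M (tensor_square M) \<and> (\<forall>x\<in>closed_paths Q. c (cyc x) = ?\<phi> x)"
  have phi: "?\<phi> x = dl pl (snd x)" if "x \<in> closed_paths Q" for x
    using dl_path[of "fst x" "snd x" pl] that by (cases pl) simp_all
  obtain L where L: "L \<in> linear_maps M T\<^sub>M" "\<And>x. x \<in> closed_paths Q \<Longrightarrow> L (cyc x) = dl pl (snd x)"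
    by (rule cyc_universal[OF T.smod_axioms, of "\<lambda>x. dl pl (snd x)"], rule T2_closed[OF dl_T2], simp only: snd_conv, rule dl_rotate,
      rule that, assumption+)
  have L2: "L x \<in> T2" if x: "x \<in> carrier M" for x
  proof -
    obtain y z where yz: "y \<in> grade M 0" "z \<in> grade M 1" "x = y \<oplus>\<^bsub>M\<^esub> z" using M.parts_exist[OF x] by blast
    have "L y \<in> T2" "L z \<in> T2"
      by (rule linear_grade[OF T.smod_axioms L(1) T2_submodule], rule yz, simp add: L(2) dl_T2)+
    then show ?thesis
      using linear_mapsD(2)[OF L(1) M.grade_carrier[OF yz(1)] M.grade_carrier[OF yz(2)]] T.submodD(3)[OF T2_submodule] yz(3) by simp
  qed
  let ?L = "restrict L (carrier M)"
  have "?P ?L"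
  proof (intro conjI ballI)
    have "?L \<in> linear_maps M T\<^sub>M" by (rule linear_maps_cong[OF M.smod_axioms _ L(1)]) simp
    then show "?L \<in> linear_maps M (tensor_square M)" using L2 by (simp add: linear_maps_tensor_square)
    show "?L (cyc x) = ?\<phi> x" if x: "x \<in> closed_paths Q" for x
    proof -
      have "cyc x \<in> carrier M" using cyc_closed closed_paths_paths x by blast
      then show ?thesis unfolding phi[OF x] using L(2)[OF x] by simp
    qed
  qed simp
  moreover have "c' = ?L" if c': "?P c'" for c'
  proof (rule extensionalityI[of _ "carrier M"])
    fix x assume x: "x \<in> carrier M"
    have "c' x = L x"
    proof (rule cyc_ext[OF T.smod_axioms _ L(1) _ x])
      show "c' \<in> linear_maps M T\<^sub>M" using c' by (simp only: linear_maps_tensor_square)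
      show "c' (cyc d) = L (cyc d)" if "d \<in> closed_paths Q" for d
        using bspec[OF c'[THEN conjunct2, THEN conjunct2] that] by (simp only: phi[OF that] L(2)[OF that])
    qed
    then show "c' x = ?L x" using x by simp
  qed (use c' in simp_all)
  ultimately have "(THE c. ?P c) = ?L" by (rule the_equality)
  moreover have "cbk pl = (THE c. ?P c)"
    by (simp add: cbk_def delta_plus_def delta_minus_def cobracket_of_def N)
  ultimately have P: "?P (cbk pl)" using \<open>?P ?L\<close> by simp
  show "cbk pl \<in> linear_maps M T\<^sub>M" using P[THEN conjunct2, THEN conjunct1] by (simp only: linear_maps_tensor_square)
  show "cbk pl (cyc (i, a)) = dl pl a" if "(i, a) \<in> closed_paths Q"
    using bspec[OF P[THEN conjunct2, THEN conjunct2] that] by (simp only: phi[OF that] snd_conv)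
qed

end

section \<open>The BV operators\<close>

context quiver
begin

interpretation D: wf_digraph "double Q" by (rule wf_double)
interpretation M: supermodule2 M by (rule M_supermodule2)
interpretation T: superalgebra "tensor_alg M" by (rule M.tensor_superalgebra[OF two])
interpretation S: supercommutative_superalgebra "sym_alg M" by (rule M.sym_supercommutative)

abbreviation "S\<^sub>M \<equiv> sym_alg M"

definition cl :: "'v \<Rightarrow> 'e darrow list \<Rightarrow> ('r, ('r, 'v, 'e) cyc) symm" where
  "cl v w = sym_gen M (cc v w)"

lemma cl_grade: "cl v w \<in> grade S\<^sub>M (wpar w)"
  unfolding cl_def by (rule M.sym_gen_grade[OF cc_grade])

lemma cl_S: "cl v w \<in> carrier S\<^sub>M"
  by (rule S.grade_carrier[OF cl_grade])

lemma gen_sg: "x \<in> carrier M \<Longrightarrow> sym_gen M (ksgn M e x) = ksgn S\<^sub>M e (sym_gen M x)"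
  by (rule linear_map_ksgn[OF M.smod_axioms S.smod_axioms M.sym_gen_linear])

lemma cl_rotate: "\<lbrakk>walk u p v; walk v q u\<rbrakk> \<Longrightarrow> cl u (p @ q) = ksgn S\<^sub>M (wpar p * wpar q) (cl v (q @ p))"
  unfolding cl_def by (subst cc_rotate, assumption+, rule gen_sg, rule cc_closed)

lemma cl_contraction: "contraction S\<^sub>M Q cl"
  by (intro contraction.intro cyclic_words.intro cyclic_words_axioms.intro S.supercommutative_superalgebra_axioms wf_double cl_grade cl_rotate)

interpretation W: contraction "sym_alg M" Q cl pl for pl by (rule cl_contraction)

lemma bd_cases: "W.bd True = 1" "W.bd False = 0" "W.al True p q = [p, q]" "W.al False p q = []"
  by (simp_all add: W.bd_def W.al_def)

text \<open>The left side rotates both words to their contracted letters, the right side inserts the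
  second word into the first one in place. The two closed walks differ by one rotation, whose sign
  is part of \<open>eps\<close>.\<close>

lemma gen_br:
  assumes "walk i w i" "walk j w' j"
  shows "sym_gen M (br pl w w') = W.bracket_word pl i w w'"
proof -
  have "sym_gen M (br pl w w') = S.rx w (\<lambda>p a. S.rx w' (\<lambda>q b. sym_gen M (brt pl p a q b)))"
    unfolding br_def by (simp add: M.rx_hom[OF S.smod_axioms M.sym_gen_linear] M.rx_closed)
  also have "\<dots> = S.ew w (\<lambda>u p v. S.ew w' (\<lambda>x q y. ksgn S\<^sub>M (wpar u * (parity p + wpar v) + wpar x * (parity q + wpar y)) (sym_gen M (brt pl p (v @ u) q (y @ x)))))"
    unfolding S.rx_def by (simp add: S.ew_sg[symmetric] S.sg_sg M.gen_closed)
  also have "\<dots> = W.bracket_word pl i w w'"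
    unfolding W.bracket_word_def
  proof (intro S.ew_cong)
    fix u p v x q y assume ww: "w = u @ p # v" "w' = x @ q # y"
    show "ksgn S\<^sub>M (wpar u * (parity p + wpar v) + wpar x * (parity q + wpar y)) (sym_gen M (brt pl p (v @ u) q (y @ x))) =
      (if paired p q then ksgn S\<^sub>M (W.eps pl u p v x q y) (cl i (u @ W.al pl p q @ y @ x @ W.al pl q p @ v)) else \<zero>\<^bsub>S\<^sub>M\<^esub>)"
    proof (cases "paired p q")
      case True
      note e = double_ends[OF True]
      note wp = walk_rotate[OF assms(1)[unfolded ww(1)]] and wq = walk_rotate[OF assms(2)[unfolded ww(2)]]
      have w: "walk i u (tl_of p)" "walk (hd_of p) v i" using assms(1) unfolding ww(1) W.walk_mid by blast+
      show ?thesis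
      proof (cases pl)
        case pl: True
        have R: "walk i (u @ [p] @ [q] @ (y @ x) @ [q]) (tl_of p)"
          by (rule D.awalk_appendI[OF w(1) D.awalk_appendI[of _ "[p]" "hd_of p"]])
            (use wp(1) walk_around[OF wq] e in \<open>simp_all add: D.awalk_Cons_iff D.awalk_Nil_iff del: D.awalk_append_iff\<close>)
        have P: "walk (tl_of p) ([p] @ v) i" using w(2) wp(1) by (simp add: D.awalk_Cons_iff)
        show ?thesis using cl_rotate[OF R P] pl True
          by (simp add: brt_def gen_sg cl_def[symmetric] bd_cases W.eps_def S.sg_sg cl_S paired_parity[OF True] bit_ring)
      next
        case pl: False
        have R: "walk i (u @ y @ x) (hd_of p)"
          by (rule D.awalk_appendI[OF w(1)]) (use wq(2) e in \<open>simp del: D.awalk_append_iff\<close>)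
        show ?thesis using cl_rotate[OF R w(2)] pl True
          by (simp add: brt_def gen_sg cl_def[symmetric] bd_cases W.eps_def S.sg_sg cl_S paired_parity[OF True] bit_ring)
      qed
    qed (simp add: brt_def linear_map_zero[OF M.smod_axioms S.smod_axioms M.sym_gen_linear])
  qed
  finally show ?thesis .
qed

text \<open>The summand of the cobracket in the symmetric algebra, where its two factors may be
  exchanged.\<close>

definition dS :: "bool \<Rightarrow> 'e darrow \<Rightarrow> 'e darrow list \<Rightarrow> 'e darrow \<Rightarrow> 'e darrow list \<Rightarrow> ('r, ('r, 'v, 'e) cyc) symm" where
  "dS pl p x q y = sym_class M (dlt pl p x q y)"

lemma dS_closed [simp]: "dS pl p x q y \<in> carrier S\<^sub>M"
  unfolding dS_def by (rule linear_mapsD(1)[OF M.sym_class_linear dlt_closed])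

lemma dS_eq: "dS pl p x q y = (if paired p q then
     if pl then ksgn S\<^sub>M (wpar x + wpar y * parity p + parity q) (cl (tl_of p) ([p] @ x @ [q]) \<otimes>\<^bsub>S\<^sub>M\<^esub> cl (tl_of q) ([q] @ y @ [p]))
     else ksgn S\<^sub>M (wpar x * parity q) (cl (hd_of p) x \<otimes>\<^bsub>S\<^sub>M\<^esub> cl (hd_of q) y) else \<zero>\<^bsub>S\<^sub>M\<^esub>)"
proof -
  have m: "sym_class M (ksgn T\<^sub>M e (tg a \<otimes>\<^bsub>T\<^sub>M\<^esub> tg b)) = ksgn S\<^sub>M e (sym_gen M a \<otimes>\<^bsub>S\<^sub>M\<^esub> sym_gen M b)"
    if "a \<in> carrier M" "b \<in> carrier M" for e a b
    using that by (simp add: linear_map_ksgn[OF T.smod_axioms S.smod_axioms M.sym_class_linear] M.sym_class_mult tg_closed sym_gen_def)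
  show ?thesis
    by (simp add: dS_def dlt_def m cl_def linear_map_zero[OF T.smod_axioms S.smod_axioms M.sym_class_linear])
qed

lemma dS_swap: "dS pl q y p x = ksgn S\<^sub>M ((parity p + wpar x) * (parity q + wpar y)) (dS pl p x q y)"
proof (cases "paired p q")
  case True
  then have qp: "paired q p" using paired_sym by blast
  show ?thesis
  proof (cases pl)
    case pl: True
    have "cl (tl_of q) ([q] @ y @ [p]) \<otimes>\<^bsub>S\<^sub>M\<^esub> cl (tl_of p) ([p] @ x @ [q]) = ksgn S\<^sub>M ((1 + wpar x) * (1 + wpar y)) (cl (tl_of p) ([p] @ x @ [q]) \<otimes>\<^bsub>S\<^sub>M\<^esub> cl (tl_of q) ([q] @ y @ [p]))"
      using S.supercomm[OF cl_grade cl_grade, of "tl_of q" "[q] @ y @ [p]" "tl_of p" "[p] @ x @ [q]"]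
      by (simp add: paired_parity[OF True] bit_ring)
    then show ?thesis using pl True qp by (simp add: dS_eq S.sg_sg cl_S paired_parity[OF True] bit_ring)
  next
    case pl: False
    have "cl (hd_of q) y \<otimes>\<^bsub>S\<^sub>M\<^esub> cl (hd_of p) x = ksgn S\<^sub>M (wpar x * wpar y) (cl (hd_of p) x \<otimes>\<^bsub>S\<^sub>M\<^esub> cl (hd_of q) y)"
      using S.supercomm[OF cl_grade cl_grade, of "hd_of q" y "hd_of p" x] by (simp add: mult.commute)
    then show ?thesis using pl True qp by (simp add: dS_eq S.sg_sg cl_S paired_parity[OF True] bit_ring)
  qed
qed (simp add: dS_eq paired_sym[of q p])

text \<open>Rotating both pieces into the form used by \<open>Y\<close> turns the rotation sign of u
  and the sign in \<open>dlt\<close> into \<open>eps'\<close>.\<close>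

lemma dS_word:
  assumes "walk i (u @ p # v @ q # y) i" "paired p q"
  shows "ksgn S\<^sub>M (wpar u * (parity p + wpar v + parity q + wpar y)) (dS pl p v q (y @ u)) =
    ksgn S\<^sub>M (W.eps' pl u p v q) (cl (hd_of p) (v @ W.al pl q p) \<otimes>\<^bsub>S\<^sub>M\<^esub> cl i (u @ W.al pl p q @ y))"
proof -
  note e = double_ends[OF assms(2)]
  have w: "walk i u (tl_of p)" "p \<in> arcs (double Q)" "walk (hd_of p) v (tl_of q)" "q \<in> arcs (double Q)" "walk (hd_of q) y i"
    using assms(1) unfolding W.walk_mid by blast+
  show ?thesis
  proof (cases pl)
    case pl: True
    have R: "walk i (u @ [p]) (tl_of q)" by (rule D.awalk_appendI[OF w(1)]) (use w(2) e in \<open>simp add: D.awalk_Cons_iff D.awalk_Nil_iff\<close>)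
    have P: "walk (tl_of q) ([q] @ y) i" using w by (simp add: D.awalk_Cons_iff)
    have c: "cl (tl_of p) ([p] @ v @ [q]) = ksgn S\<^sub>M (parity p * (wpar v + parity q)) (cl (hd_of p) (v @ [q, p]))"
      unfolding cl_def dlt_eq(3)[OF w(2,4,3) assms(2)] by (simp add: gen_sg)
    show ?thesis using cl_rotate[OF R P] c pl assms(2)
      by (simp add: dS_eq bd_cases W.eps'_def S.sg_sg S.sg_mult_left S.sg_mult_right cl_S paired_parity[OF assms(2)] bit_ring)
  next
    case pl: False
    have P: "walk (tl_of p) y i" using w e by simp
    show ?thesis using cl_rotate[OF w(1) P] pl assms(2) e
      by (simp add: dS_eq bd_cases W.eps'_def S.sg_sg S.sg_mult_left S.sg_mult_right cl_S paired_parity[OF assms(2)] bit_ring)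
  qed
qed

text \<open>The sum over rotations runs over ordered pairs, with q after p in the word or before it.
  By \<open>dS_swap\<close> both kinds contribute the same, so the total is twice
  \<open>delta_word\<close>, and the factor \<open>half\<close> cancels the 2.\<close>

lemma class_dl:
  assumes a: "walk i a i"
  shows "sym_class M (dl pl a) = W.delta_word pl i a"
proof -
  let ?c = "\<lambda>u p v q y. ksgn S\<^sub>M (wpar u * (parity p + wpar v + parity q + wpar y)) (dS pl p v q (y @ u))"
  have D: "W.delta_word pl i a = S.ew a (\<lambda>u p z. S.ew z (\<lambda>v q y. ?c u p v q y))"
    unfolding W.delta_word_def
  proof (intro S.ew_cong)
    fix u p z v q y assume "a = u @ p # z" "z = v @ q # y"
    then show "(if paired p q then ksgn S\<^sub>M (W.eps' pl u p v q) (cl (hd_of p) (v @ W.al pl q p) \<otimes>\<^bsub>S\<^sub>M\<^esub> cl i (u @ W.al pl p q @ y)) else \<zero>\<^bsub>S\<^sub>M\<^esub>) = ?c u p v q y"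
      using dS_word[of i u p v q y pl] a by (cases "paired p q") (simp_all add: dS_eq[of pl p v q "y @ u"] del: D.awalk_append_iff)
  qed
  have "sym_class M (dl pl a) = half \<odot>\<^bsub>S\<^sub>M\<^esub> S.rx a (\<lambda>p a'. S.ew a' (dS pl p))"
    unfolding dl_def dS_def[abs_def]
    by (simp add: linear_mapsD(3)[OF M.sym_class_linear] T.rx_closed T.ew_closed
      T.rx_hom[OF S.smod_axioms M.sym_class_linear] T.ew_hom[OF S.smod_axioms M.sym_class_linear])
  also have "S.rx a (\<lambda>p a'. S.ew a' (dS pl p)) =
    S.ew a (\<lambda>u p z. S.ew z (\<lambda>v q y. ksgn S\<^sub>M (wpar u * (parity p + wpar z)) (dS pl p v q (y @ u)))) \<oplus>\<^bsub>S\<^sub>M\<^esub>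
    S.ew a (\<lambda>u p z. S.ew u (\<lambda>x q y. ksgn S\<^sub>M (wpar u * (parity p + wpar z)) (dS pl p (z @ x) q y)))"
    unfolding S.rx_def by (simp add: S.ew_append S.ew_sg S.ew_closed S.sg_add S.ew_add)
  also have "S.ew a (\<lambda>u p z. S.ew z (\<lambda>v q y. ksgn S\<^sub>M (wpar u * (parity p + wpar z)) (dS pl p v q (y @ u)))) = W.delta_word pl i a"
    unfolding D by (intro S.ew_cong) (simp add: add_ac)
  also have "S.ew a (\<lambda>u p z. S.ew u (\<lambda>x q y. ksgn S\<^sub>M (wpar u * (parity p + wpar z)) (dS pl p (z @ x) q y))) =
    S.ew a (\<lambda>u p z. S.ew u (\<lambda>x q y. ksgn S\<^sub>M ((wpar x + parity q + wpar y) * (parity p + wpar z)) (dS pl p (z @ x) q y)))"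
    by (intro S.ew_cong) (simp add: add_ac)
  also have "\<dots> = S.ew a (\<lambda>x q r. S.ew r (\<lambda>y p z. ksgn S\<^sub>M ((wpar x + parity q + wpar y) * (parity p + wpar z)) (dS pl p (z @ x) q y)))"
    by (rule S.ew_nest) simp
  also have "\<dots> = W.delta_word pl i a"
    unfolding D
  proof (intro S.ew_cong)
    fix u p v q y
    show "ksgn S\<^sub>M ((wpar u + parity p + wpar v) * (parity q + wpar y)) (dS pl q (y @ u) p v) = ?c u p v q y"
      unfolding dS_swap[of pl q "y @ u" p v] by (simp add: S.sg_sg bit_ring)
  qed
  finally have "sym_class M (dl pl a) = half \<odot>\<^bsub>S\<^sub>M\<^esub> (W.delta_word pl i a \<oplus>\<^bsub>S\<^sub>M\<^esub> W.delta_word pl i a)" .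
  also have "\<dots> = ((1 + 1) * half) \<odot>\<^bsub>S\<^sub>M\<^esub> W.delta_word pl i a"
    by (simp add: S.sm_ladd S.sm_radd distrib_right)
  \<comment> \<open>\<open>half\<close> is a definite description; it denotes because inverses in a
    commutative ring are unique.\<close>
  also have "(1 + 1) * half = (1 :: 'r)"
  proof -
    obtain h :: 'r where h: "(1 + 1) * h = 1" using two by (metis dvdE)
    have "h' = h" if "(1 + 1) * h' = 1" for h' :: 'r
    proof -
      have "h' = ((1 + 1) * h) * h'" by (simp only: h mult_1)
      also have "\<dots> = ((1 + 1) * h') * h" by (simp only: mult.assoc mult.commute mult.left_commute)
      finally show ?thesis by (simp only: that mult_1)
    qed
    then show ?thesis unfolding half_def by (rule theI[of "\<lambda>h. (1 + 1) * h = 1", OF h])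
  qed
  finally show ?thesis by simp
qed

lemma delta_word_grade: "W.delta_word pl i a \<in> grade S\<^sub>M (1 + wpar a)"
  unfolding W.delta_word_def
proof (intro S.ew_mem[OF S.grade_submodule])
  fix u p z v q y assume a: "a = u @ p # z" "z = v @ q # y"
  show "(if paired p q then ksgn S\<^sub>M (W.eps' pl u p v q) (cl (hd_of p) (v @ W.al pl q p) \<otimes>\<^bsub>S\<^sub>M\<^esub> cl i (u @ W.al pl p q @ y)) else \<zero>\<^bsub>S\<^sub>M\<^esub>) \<in> grade S\<^sub>M (1 + wpar a)"
  proof (cases "paired p q")
    case True
    then have "paired q p" using paired_sym by blast
    then have "wpar (v @ W.al pl q p) + wpar (u @ W.al pl p q @ y) = 1 + wpar a"
      using True by (simp add: W.wpar_al a paired_parity[OF True] add_ac)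
    then show ?thesis using S.grade_mult[OF cl_grade cl_grade, of "hd_of p" "v @ W.al pl q p" i "u @ W.al pl p q @ y"] True by simp
  qed simp
qed

theorem Delta_bv_algebra:
  "bv_algebra S\<^sub>M (\<lambda>z. extend_bracket M (brk pl) z \<oplus>\<^bsub>S\<^sub>M\<^esub> extend_cobracket M (cbk pl) z)"
proof -
  define B where "B = extend_bracket M (brk pl)"
  define C where "C = extend_cobracket M (cbk pl)"
  define \<Delta> where "\<Delta> z = B z \<oplus>\<^bsub>S\<^sub>M\<^esub> C z" for z
  have lin: "(\<lambda>x. sym_class M (cbk pl x)) \<in> linear_maps M S\<^sub>M" by (rule linear_map_comp[OF cbk(1) M.sym_class_linear])
  have gr: "sym_class M (cbk pl x) \<in> grade S\<^sub>M (1 + p)" if "x \<in> grade M p" for x p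
  proof (rule linear_grade[OF S.smod_axioms lin S.grade_submodule that])
    fix c assume c: "c \<in> closed_paths Q" "wpar (snd c) = p"
    then have "walk (fst c) (snd c) (fst c)" by (auto simp: closed_paths_def)
    then show "sym_class M (cbk pl (cyc c)) \<in> grade S\<^sub>M (1 + p)"
      using cbk(2)[of "fst c" "snd c" pl] c class_dl[of "fst c" "snd c" pl] delta_word_grade[of pl "fst c" "snd c"] by simp
  qed
  note EB = M.extend_bracket[OF brk_like[of pl], folded B_def]
  have EC: "C \<in> hom_ends S\<^sub>M 1" "C \<one>\<^bsub>S\<^sub>M\<^esub> = \<zero>\<^bsub>S\<^sub>M\<^esub>" "dop S\<^sub>M 2 1 C"
    "\<lbrakk>x \<in> grade M p; z \<in> carrier S\<^sub>M\<rbrakk> \<Longrightarrow>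
      C (sym_gen M x \<otimes>\<^bsub>S\<^sub>M\<^esub> z) = sym_class M (cbk pl x) \<otimes>\<^bsub>S\<^sub>M\<^esub> z \<oplus>\<^bsub>S\<^sub>M\<^esub> ksgn S\<^sub>M p (sym_gen M x \<otimes>\<^bsub>S\<^sub>M\<^esub> C z)" for x p z
    unfolding C_def by (rule M.extend_cobracket[OF lin gr]; assumption)+
  obtain AD where AD: "\<forall>p. \<forall>x\<in>grade M p. AD p x \<in> hom_ends S\<^sub>M (1 + p) \<and> AD p x \<one>\<^bsub>S\<^sub>M\<^esub> = \<zero>\<^bsub>S\<^sub>M\<^esub> \<and>
      (\<forall>z\<in>carrier S\<^sub>M. B (sym_gen M x \<otimes>\<^bsub>S\<^sub>M\<^esub> z) = AD p x z \<oplus>\<^bsub>S\<^sub>M\<^esub> ksgn S\<^sub>M p (sym_gen M x \<otimes>\<^bsub>S\<^sub>M\<^esub> B z) \<and>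
        (\<forall>q. \<forall>y\<in>grade M q. AD p x (sym_gen M y \<otimes>\<^bsub>S\<^sub>M\<^esub> z) =
          sym_gen M (brk pl (x, y)) \<otimes>\<^bsub>S\<^sub>M\<^esub> z \<oplus>\<^bsub>S\<^sub>M\<^esub> ksgn S\<^sub>M ((1 + p) * q) (sym_gen M y \<otimes>\<^bsub>S\<^sub>M\<^esub> AD p x z)))"
    using EB(4) by (elim exE) (rule that)
  note h = AD[THEN spec, THEN bspec, OF cc_grade]
  note h3 = h[THEN conjunct2, THEN conjunct2, THEN bspec]
  define ad where "ad i w = AD (wpar w) (cc i w)" for i w
  have ad: "ad i w \<in> hom_ends S\<^sub>M (1 + wpar w)" "ad i w \<one>\<^bsub>S\<^sub>M\<^esub> = \<zero>\<^bsub>S\<^sub>M\<^esub>"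
    "z \<in> carrier S\<^sub>M \<Longrightarrow> B (cl i w \<otimes>\<^bsub>S\<^sub>M\<^esub> z) = ad i w z \<oplus>\<^bsub>S\<^sub>M\<^esub> ksgn S\<^sub>M (wpar w) (cl i w \<otimes>\<^bsub>S\<^sub>M\<^esub> B z)"
    "z \<in> carrier S\<^sub>M \<Longrightarrow> ad i w (cl k v \<otimes>\<^bsub>S\<^sub>M\<^esub> z) = sym_gen M (brk pl (cc i w, cc k v)) \<otimes>\<^bsub>S\<^sub>M\<^esub> z \<oplus>\<^bsub>S\<^sub>M\<^esub> ksgn S\<^sub>M ((1 + wpar w) * wpar v) (cl k v \<otimes>\<^bsub>S\<^sub>M\<^esub> ad i w z)"
    for i w k v z
    unfolding ad_def cl_def
    by (rule h[THEN conjunct1], rule h[THEN conjunct2, THEN conjunct1], rule h3[THEN conjunct1], assumption,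
      rule h3[THEN conjunct2, THEN spec, THEN bspec, OF _ cc_grade])
  note Bl = hom_endsD(1)[OF EB(1)] and Cl = hom_endsD(1)[OF EC(1)]
  have \<Delta>l: "\<Delta> \<in> linear_maps S\<^sub>M S\<^sub>M"
    unfolding \<Delta>_def[abs_def] by (rule linear_maps_add[OF S.smod_axioms Bl Cl])
  have clc: "cc i w = cyc (i, w) \<and> (i, w) \<in> closed_paths Q" if "walk i w i" for i w
    using that by (simp add: cc_def closed_paths_def)
  interpret O: bv_operator S\<^sub>M Q cl pl \<Delta> ad
  proof unfold_locales
    show "\<Delta> \<in> linear_maps S\<^sub>M S\<^sub>M" by (rule \<Delta>l)
    show "\<Delta> \<one>\<^bsub>S\<^sub>M\<^esub> = \<zero>\<^bsub>S\<^sub>M\<^esub>" by (simp add: \<Delta>_def EB(2) EC(2))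
    show "ad i w \<in> linear_maps S\<^sub>M S\<^sub>M" for i w by (rule hom_endsD(1)[OF ad(1)])
    show "ad i w \<one>\<^bsub>S\<^sub>M\<^esub> = \<zero>\<^bsub>S\<^sub>M\<^esub>" for i w by (rule ad(2))
    fix i w z assume w: "walk i w i" and z: "z \<in> carrier S\<^sub>M"
    have "C (cl i w \<otimes>\<^bsub>S\<^sub>M\<^esub> z) = W.delta_word pl i w \<otimes>\<^bsub>S\<^sub>M\<^esub> z \<oplus>\<^bsub>S\<^sub>M\<^esub> ksgn S\<^sub>M (wpar w) (cl i w \<otimes>\<^bsub>S\<^sub>M\<^esub> C z)"
      using EC(4)[OF cc_grade z, of i w] clc[OF w] cbk(2)[of i w pl] class_dl[OF w, of pl] by (simp add: cl_def)
    moreover have "B z \<in> carrier S\<^sub>M" "C z \<in> carrier S\<^sub>M" "ad i w z \<in> carrier S\<^sub>M"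
      using linear_mapsD(1)[OF Bl z] linear_mapsD(1)[OF Cl z] linear_mapsD(1)[OF hom_endsD(1)[OF ad(1)] z] by blast+
    ultimately show "\<Delta> (cl i w \<otimes>\<^bsub>S\<^sub>M\<^esub> z) = W.delta_word pl i w \<otimes>\<^bsub>S\<^sub>M\<^esub> z \<oplus>\<^bsub>S\<^sub>M\<^esub> ad i w z \<oplus>\<^bsub>S\<^sub>M\<^esub> ksgn S\<^sub>M (wpar w) (cl i w \<otimes>\<^bsub>S\<^sub>M\<^esub> \<Delta> z)"
      unfolding \<Delta>_def ad(3)[OF z] by (simp add: cl_S z S.r_distr S.sg_add S.a_ac)
    show "ad i w (cl k v \<otimes>\<^bsub>S\<^sub>M\<^esub> z) = W.bracket_word pl i w v \<otimes>\<^bsub>S\<^sub>M\<^esub> z \<oplus>\<^bsub>S\<^sub>M\<^esub> ksgn S\<^sub>M ((1 + wpar w) * wpar v) (cl k v \<otimes>\<^bsub>S\<^sub>M\<^esub> ad i w z)"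
      if v: "walk k v k" for k v
      unfolding ad(4)[OF z] using clc[OF w] clc[OF v] brk(3)[of i w k v pl] gen_br[OF w v, of pl] by simp
  qed
  let ?f = "\<lambda>ws t. foldr (\<lambda>(i, w) z. cl i w \<otimes>\<^bsub>S\<^sub>M\<^esub> z) ws t"
  have fl: "?f ws \<in> linear_maps S\<^sub>M S\<^sub>M" for ws
  proof (induction ws)
    case Nil
    show ?case by (rule linear_mapsI) simp_all
  next
    case (Cons iw ws)
    then show ?case
      using linear_map_comp[OF Cons S.mult_linear_left[OF cl_S[of "fst iw" "snd iw"]]] by (simp add: case_prod_beta)
  qed
  note \<Delta>\<Delta> = linear_map_comp[OF \<Delta>l \<Delta>l]
  \<comment> \<open>The claim is generalised by closed words ws already multiplied on the left. By
    linearity the induction turns the generators of w one after the other into classes of closed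
    paths, until only a product of such classes is left.\<close>
  have z: "\<Delta> (\<Delta> (?f ws (sw M w))) = \<zero>\<^bsub>S\<^sub>M\<^esub>" if "w \<in> lists (carrier M)" "\<forall>(i, w)\<in>set ws. walk i w i" for w ws
    using that
  proof (induction w arbitrary: ws)
    case Nil
    then show ?case using O.Delta_square_cl[OF two] by (simp add: M.sw_Nil)
  next
    case (Cons x w)
    then have w: "w \<in> lists (carrier M)" and x: "x \<in> carrier M" by simp_all
    have "\<Delta> (\<Delta> (?f ws (sym_gen M x \<otimes>\<^bsub>S\<^sub>M\<^esub> sw M w))) = \<zero>\<^bsub>S\<^sub>M\<^esub>"
    proof (rule cyc_ext[OF S.smod_axioms _ linear_maps_zero[OF S.smod_axioms] _ x])
      show "(\<lambda>x. \<Delta> (\<Delta> (?f ws (sym_gen M x \<otimes>\<^bsub>S\<^sub>M\<^esub> sw M w)))) \<in> linear_maps M S\<^sub>M"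
        by (rule linear_map_comp[OF linear_map_comp[OF linear_map_comp[OF M.sym_gen_linear S.mult_linear_right[OF M.sw_closed[OF w]]] fl] \<Delta>\<Delta>])
      fix c assume c: "c \<in> closed_paths Q"
      have cw: "walk (fst c) (snd c) (fst c)" using c by (auto simp: closed_paths_def)
      have "\<Delta> (\<Delta> (?f (ws @ [c]) (sw M w))) = \<zero>\<^bsub>S\<^sub>M\<^esub>"
        by (rule Cons.IH) (use Cons.prems cw w in auto)
      then show "\<Delta> (\<Delta> (?f ws (sym_gen M (cyc c) \<otimes>\<^bsub>S\<^sub>M\<^esub> sw M w))) = \<zero>\<^bsub>S\<^sub>M\<^esub>"
        using clc[OF cw] by (simp add: case_prod_beta cl_def)
    qed
    then show ?case by (simp only: M.sw_Cons[OF x w])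
  qed
  have "\<Delta> (\<Delta> t) = \<zero>\<^bsub>S\<^sub>M\<^esub>" if t: "t \<in> carrier S\<^sub>M" for t
    by (rule M.sym_linear_eqI[OF S.smod_axioms \<Delta>\<Delta> linear_maps_zero[OF S.smod_axioms] _ t]) (use z[of _ "[]"] in simp)
  moreover have "diff_op S\<^sub>M 2 1 \<Delta>"
  proof -
    have n: "Suc 2 = (3 :: nat)" by simp
    show ?thesis
      unfolding S.diff_op_iff_dop n \<Delta>_def[abs_def] by (rule S.dop_add[OF EB(3) S.dop_Suc[OF EC(3), unfolded n]])
  qed
  moreover have "\<Delta> \<one>\<^bsub>S\<^sub>M\<^esub> = \<zero>\<^bsub>S\<^sub>M\<^esub>" by (simp add: \<Delta>_def EB(2) EC(2))
  ultimately have "bv_algebra S\<^sub>M \<Delta>"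
    by (intro bv_algebra.intro bv_algebra_axioms.intro S.supercommutative_superalgebra_axioms)
  then show ?thesis by (simp only: \<Delta>_def[abs_def] B_def C_def)
qed

end

theorem theorem5p7:
  fixes Q :: "('v, 'e) pre_digraph"
  assumes "fin_digraph Q"
    and "(1 + 1 :: 'r :: {comm_ring, comm_monoid_mult}) dvd 1"
  shows "bv_algebra (SN_gr Q :: ('r, ('r, 'v, 'e) scyc) supermod) (Delta_minus Q) \<and>
    bv_algebra (SN_gr Q :: ('r, ('r, 'v, 'e) scyc) supermod) (Delta_plus Q)"
proof -
  interpret quiver Q "N_gr Q :: ('r, ('r, 'v, 'e) cyc) supermod"
    by (rule quiver.intro[OF assms refl])
  show ?thesis using Delta_bv_algebra[of False] Delta_bv_algebra[of True]
    by (simp add: SN_gr_def brk_def cbk_def Delta_minus_def[abs_def] Delta_plus_def[abs_def])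
qed

end
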